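(* Assume that $\sigma^2\,\frac{\ln n}{(\ln\ln n)^2}\to\infty$ as $n\to\infty$. Then for every fixed $\lambda\in\mathbb R$ and every sequence $t=t_\star+\lambda w_\star+o(w_\star)$, $$\max_{i\in V}\left|\mathcal D_i(t)-\frac{1}{\sqrt{2\pi}}\int_\lambda^\infty e^{-u^2/2}\,du\right|\to 0$$ in probability as $n\to\infty$.
   Context: Configuration model: for each $n$, let $(d_i^-)_{1\le i\le n}$ and $(d_i^+)_{1\le i\le n}$ be positive integers with $\sum_i d_i^-=\sum_i d_i^+=m$. Each vertex $i\in V=\{1,\dots,n\}$ carries a set $E_i^+$ of $d_i^+$ tails and a set $E_i^-$ of $d_i^-$ heads. The environment $\omega$ is a uniformly random bijection from $\bigcup_i E_i^+$ to $\bigcup_i E_i^-$; each pair $\omega(e)=f$ is an arc from the vertex of $e$ to the vertex of $f$ (loops and multiple arcs allowed), giving a random directed multigraph $G$. The random walk has transition matrix $P(i,j)=\frac{1}{d_i^+}\,|\{e\in E_i^+:\omega(e)\in E_j^-\}|$. All quantities depend on $n$, limits as $n\to\infty$. Standing assumption: $\delta:=\min_i\min(d_i^+,d_i^-)\ge 2$ and $\Delta:=\max_i\max(d_i^+,d_i^-)$ is bounded uniformly in $n$. With high probability $G$ is strongly connected; $\pi_\star$ denotes the invariant probability measure of $P$ (unique with high probability). Define $\mathcal D_i(t)=\frac12\sum_{j\in V}|P^t(i,j)-\pi_\star(j)|$, $\mu=\frac1m\sum_i d_i^-\ln d_i^+$, $t_\star=\frac{\ln n}{\mu}$, $\sigma^2=\frac1m\sum_i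 d_i^-(\ln d_i^+-\mu)^2$ and $w_\star=\frac{\sigma\sqrt{\ln n}}{\mu^{3/2}}$. *)

theory Defs
  imports "HOL-Probability.Probability"
begin

text \<open>Configuration model on the vertex set V = {0..<n}. A degree sequence is given by
  dp i = d_i^+ (out-degree, number of tails) and dm i = d_i^- (in-degree, number of heads).
  Tail k of vertex i is the pair (i,k) with k < dp i; head k of vertex j is (j,k) with k < dm j.\<close>

definition tails :: "nat \<Rightarrow> (nat \<Rightarrow> nat) \<Rightarrow> (nat \<times> nat) set" where
  "tails n dp = Sigma {..<n} (\<lambda>i. {..<dp i})"

definition heads :: "nat \<Rightarrow> (nat \<Rightarrow> nat) \<Rightarrow> (nat \<times> nat) set" where
  "heads n dm = Sigma {..<n} (\<lambda>i. {..<dm i})"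

definition envs :: "nat \<Rightarrow> (nat \<Rightarrow> nat) \<Rightarrow> (nat \<Rightarrow> nat) \<Rightarrow> ((nat \<times> nat) \<Rightarrow> (nat \<times> nat)) set" where
  "envs n dp dm = {\<omega> \<in> tails n dp \<rightarrow>\<^sub>E heads n dm. bij_betw \<omega> (tails n dp) (heads n dm)}"

definition env_pmf :: "nat \<Rightarrow> (nat \<Rightarrow> nat) \<Rightarrow> (nat \<Rightarrow> nat) \<Rightarrow> ((nat \<times> nat) \<Rightarrow> (nat \<times> nat)) pmf" where
  "env_pmf n dp dm = pmf_of_set (envs n dp dm)"

definition trans :: "(nat \<Rightarrow> nat) \<Rightarrow> ((nat \<times> nat) \<Rightarrow> (nat \<times> nat)) \<Rightarrow> nat \<Rightarrow> nat \<Rightarrow> real" where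
  "trans dp \<omega> i j = real (card {k. k < dp i \<and> fst (\<omega> (i, k)) = j}) / real (dp i)"

fun matpow :: "nat \<Rightarrow> (nat \<Rightarrow> nat \<Rightarrow> real) \<Rightarrow> nat \<Rightarrow> nat \<Rightarrow> nat \<Rightarrow> real" where
  "matpow n Q 0 i j = (if i = j then 1 else 0)"
| "matpow n Q (Suc t) i j = (\<Sum>k<n. matpow n Q t i k * Q k j)"

definition is_invariant :: "nat \<Rightarrow> (nat \<Rightarrow> nat \<Rightarrow> real) \<Rightarrow> (nat \<Rightarrow> real) \<Rightarrow> bool" where
  "is_invariant n Q \<pi> \<longleftrightarrow> (\<forall>j<n. 0 \<le> \<pi> j) \<and> (\<forall>j\<ge>n. \<pi> j = 0) \<and> (\<Sum>j<n. \<pi> j) = 1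
     \<and> (\<forall>j<n. (\<Sum>i<n. \<pi> i * Q i j) = \<pi> j)"

text \<open>pi_star: the invariant probability measure (well defined when unique, which holds w.h.p.).\<close>
definition pi_star :: "nat \<Rightarrow> (nat \<Rightarrow> nat \<Rightarrow> real) \<Rightarrow> nat \<Rightarrow> real" where
  "pi_star n Q = (THE \<pi>. is_invariant n Q \<pi>)"

definition tv_dist :: "nat \<Rightarrow> (nat \<Rightarrow> nat) \<Rightarrow> ((nat \<times> nat) \<Rightarrow> (nat \<times> nat)) \<Rightarrow> nat \<Rightarrow> nat \<Rightarrow> real" where
  "tv_dist n dp \<omega> i t =
     (1/2) * (\<Sum>j<n. \<bar>matpow n (trans dp \<omega>) t i j - pi_star n (trans dp \<omega>) j\<bar>)"

definition num_arcs :: "nat \<Rightarrow> (nat \<Rightarrow> nat) \<Rightarrow> nat" where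
  "num_arcs n dm = (\<Sum>i<n. dm i)"

definition mu :: "nat \<Rightarrow> (nat \<Rightarrow> nat) \<Rightarrow> (nat \<Rightarrow> nat) \<Rightarrow> real" where
  "mu n dp dm = (\<Sum>i<n. real (dm i) * ln (real (dp i))) / real (num_arcs n dm)"

definition sigma2 :: "nat \<Rightarrow> (nat \<Rightarrow> nat) \<Rightarrow> (nat \<Rightarrow> nat) \<Rightarrow> real" where
  "sigma2 n dp dm = (\<Sum>i<n. real (dm i) * (ln (real (dp i)) - mu n dp dm)^2) / real (num_arcs n dm)"

definition t_star :: "nat \<Rightarrow> (nat \<Rightarrow> nat) \<Rightarrow> (nat \<Rightarrow> nat) \<Rightarrow> real" where
  "t_star n dp dm = ln (real n) / mu n dp dm"

definition w_star :: "nat \<Rightarrow> (nat \<Rightarrow> nat) \<Rightarrow> (nat \<Rightarrow> nat) \<Rightarrow> real" where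
  "w_star n dp dm = sqrt (sigma2 n dp dm) * sqrt (ln (real n)) / (mu n dp dm) powr (3/2)"

definition gauss_tail :: "real \<Rightarrow> real" where
  "gauss_tail lam = (LBINT u:{lam..}. exp (- (u^2) / 2)) / sqrt (2 * pi)"

end

theory Submission
  imports Defs "HOL-Real_Asymp.Real_Asymp"
begin

text \<open>Write \<open>q\<close> for the probability that a product of independent degree weights \<open>1 / d\<^sup>+\<close> over about
  \<open>t\<close> uniform heads is at most \<open>\<theta> = 1 / (n L)\<close> with \<open>L\<close> polylogarithmic. A second moment computation
  shows that, from a typical vertex, the walk restricted to light paths (weight at most \<open>\<theta>\<close>) is close to
  \<open>q \<nu>\<close>, where \<open>\<nu>\<close> is the law after a few steps of the walk started from a uniform head. Swapping a set of
  tails with uniformly chosen ones preserves the law of the environment and barely changes the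
  discrepancy, so exceptional vertices are spread out enough that, with high probability, the walk from
  every vertex avoids them after \<open>O(ln ln n)\<close> steps. Large times then give mixing to \<open>\<nu>\<close>, hence a unique
  invariant measure close to \<open>\<nu>\<close>; at time \<open>t\<close> the light paths bound the distance from above by \<open>1 - q\<close>,
  while heavy paths have few endpoints, which bounds it from below by \<open>1 - q\<close>. The central limit theorem
  identifies the limit of \<open>1 - q\<close> with the Gaussian tail.\<close>

text \<open>The second moment bound saves only a power of \<open>ln n\<close>: its diagonal term
  \<open>\<theta>\<close>, multiplied by \<open>n\<close> when passing to an \<open>L1\<close> norm,
  is the inverse of a polylogarithm. Markov's inperfect control of most vertices cannot survive a
  union bound over all \<open>n\<close> starting points, and the swapping argument exists to
  overcome this. Below a vertex whose ball is a tree, a large exceptional mass forces at least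
  \<open>2 ln n\<close> tails of one level to lead to exceptional vertices at once. Half of them
  contribute independent-like factors, each a large negative power of \<open>ln n\<close>; the
  product absorbs both the choice of the tails and the union over \<open>n\<close>.

  Lightness is imposed on the middle \<open>N\<close> heads only. The \<open>h\<close> steps at
  either end are reserved for two trajectories to separate and to merge again, so that the dominant
  meeting pairs have windows that do not share an arc. The two-point sums of the light walk, of the
  comparison law and of the pair of them then involve one constant \<open>CC h\<close>, and the
  square expands to \<open>q^2 - 2 q^2 + q^2\<close> times it, up to errors.\<close>

type_synonym tail = "nat \<times> nat"
type_synonym head = "nat \<times> nat"
type_synonym arc = "tail \<times> head"
type_synonym env = "tail => head"

section \<open>Trajectories as lists of arcs\<close>

fun endv :: "nat => arc list => nat" where
  "endv x [] = x"
| "endv x (ef # a) = endv (fst (snd ef)) a"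

abbreviation verts :: "arc list => nat list" where
  "verts a \<equiv> map (\<lambda>ef. fst (snd ef)) a"

definition simple :: "nat => arc list => bool" where
  "simple x a \<longleftrightarrow> distinct (x # verts a)"

text \<open>Revealed arcs form a set, so an arc shared by two trajectories \<open>a\<close> and
  \<open>b\<close> counts once in \<open>set a \<union> set b\<close>.\<close>

definition ext :: "env => arc set => bool" where
  "ext w g \<longleftrightarrow> (\<forall>ef\<in>g. w (fst ef) = snd ef)"

lemma endv_append [simp]: "endv x (a @ b) = endv (endv x a) b"
  by (induction a arbitrary: x) auto

lemma endv_last: "endv x a = last (x # verts a)"
  by (induction a arbitrary: x) auto

lemma ext_empty [simp]: "ext w {}" by (simp add: ext_def)
lemma ext_insert: "ext w (insert ef g) \<longleftrightarrow> w (fst ef) = snd ef \<and> ext w g" by (auto simp: ext_def)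
lemma ext_Un: "ext w (g \<union> g') \<longleftrightarrow> ext w g \<and> ext w g'" by (auto simp: ext_def)

section \<open>The configuration model with fixed degrees, and its partially revealed
  matchings\<close>

locale config =
  fixes n :: nat and dp dm :: "nat => nat" and D :: nat
  assumes sums: "(\<Sum>i<n. dm i) = (\<Sum>i<n. dp i)"
    and deg2: "\<And>i. i < n ==> 2 <= dp i \<and> 2 <= dm i"
    and degD: "\<And>i. i < n ==> dp i <= D \<and> dm i <= D"
    and npos: "0 < n"
begin

definition T where "T = tails n dp"
definition H where "H = heads n dm"
definition m :: nat where "m = card H"

lemma finT [simp, intro]: "finite T" and finH [simp, intro]: "finite H"
  by (auto simp: T_def H_def tails_def heads_def)

lemma memT: "e \<in> T \<longleftrightarrow> fst e < n \<and> snd e < dp (fst e)"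
  by (cases e) (auto simp: T_def tails_def)

lemma memH: "f \<in> H \<longleftrightarrow> fst f < n \<and> snd f < dm (fst f)"
  by (cases f) (auto simp: H_def heads_def)

lemma cardT: "card T = m"
  by (simp add: T_def m_def H_def tails_def heads_def sums)

lemma m_num: "m = num_arcs n dm"
  by (simp add: m_def H_def heads_def num_arcs_def)

lemma sum_H: "(\<Sum>f\<in>H. \<phi> f) = (\<Sum>v<n. \<Sum>k<dm v. \<phi> (v, k))"
  by (simp add: H_def heads_def sum.Sigma)

lemma sum_T: "(\<Sum>e\<in>T. \<phi> e) = (\<Sum>v<n. \<Sum>k<dp v. \<phi> (v, k))"
  by (simp add: T_def tails_def sum.Sigma)

lemma m_ge: "2 * n <= m"
proof -
  have "(\<Sum>i<n. 2) <= (\<Sum>i<n. dm i)" by (rule sum_mono) (use deg2 in auto)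
  thus ?thesis by (simp add: m_num num_arcs_def)
qed

lemma m_le: "m <= D * n"
proof -
  have "(\<Sum>i<n. dm i) <= (\<Sum>i<n. D)" by (rule sum_mono) (use degD in auto)
  thus ?thesis by (simp add: m_num num_arcs_def mult.commute)
qed

lemma mpos: "0 < m" using m_ge npos by linarith

lemma D2: "2 <= D" using deg2[OF npos] degD[OF npos] by linarith

lemma heads_at: "card {f\<in>H. fst f = v} = (if v < n then dm v else 0)"
proof -
  have "{f\<in>H. fst f = v} = (if v < n then Pair v ` {..<dm v} else {})"
    by (auto simp: memH)
  thus ?thesis by (simp add: card_image inj_on_def)
qed

lemma heads_at_le: "card {f\<in>H. fst f = v} <= D"
  using degD by (auto simp: heads_at)

lemma heads_in_le:
  assumes "finite U" shows "card {f\<in>H. fst f \<in> U} <= D * card U"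
proof -
  have "{f\<in>H. fst f \<in> U} = (\<Union>v\<in>U. {f\<in>H. fst f = v})" by auto
  also have "card \<dots> <= (\<Sum>v\<in>U. card {f\<in>H. fst f = v})" by (rule card_UN_le[OF assms])
  also have "\<dots> <= (\<Sum>v\<in>U. D)" by (rule sum_mono) (rule heads_at_le)
  finally show ?thesis by (simp add: mult.commute)
qed

definition Env where "Env g = {w \<in> envs n dp dm. ext w g}"

lemma finite_envs [simp, intro]: "finite (envs n dp dm)"
proof -
  have "finite (T \<rightarrow>\<^sub>E H)" by (rule finite_PiE) auto
  thus ?thesis by (rule finite_subset[rotated]) (auto simp: envs_def T_def H_def)
qed

lemma finite_Env [simp, intro]: "finite (Env g)" by (simp add: Env_def)

lemma Env_empty [simp]: "Env {} = envs n dp dm" by (simp add: Env_def)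

lemma Env_sub: "w \<in> Env g ==> w \<in> envs n dp dm" by (simp add: Env_def)

lemma Env_ext: "w \<in> Env g ==> ext w g" by (simp add: Env_def)

lemma envs_bij: "w \<in> envs n dp dm ==> bij_betw w T H"
  by (simp add: envs_def T_def H_def)

lemma envs_mem: "w \<in> envs n dp dm ==> e \<in> T ==> w e \<in> H"
  using envs_bij bij_betwE by blast

lemma envs_inj: "w \<in> envs n dp dm ==> e \<in> T ==> e' \<in> T ==> w e = w e' \<longleftrightarrow> e = e'"
  using envs_bij by (metis bij_betw_def inj_on_eq_iff)

lemma envs_fst: "w \<in> envs n dp dm ==> e \<in> T ==> fst (w e) < n"
  using envs_mem memH by blast

lemma envs_undef: "w \<in> envs n dp dm ==> e \<notin> T ==> w e = undefined"
  by (cases e) (auto simp: envs_def T_def PiE_def extensional_def)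

lemma envsI: "bij_betw w T H ==> (\<And>e. e \<notin> T ==> w e = undefined) ==> w \<in> envs n dp dm"
  by (auto simp: envs_def T_def[symmetric] H_def[symmetric] PiE_def extensional_def bij_betw_def)

abbreviation (input) Envs where "Envs \<equiv> envs n dp dm"

lemma envs_ne: "Envs \<noteq> {}"
proof -
  obtain w where w: "bij_betw w T H"
    using finite_same_card_bij[of T H] cardT m_def by auto
  have "bij_betw (\<lambda>e. if e \<in> T then w e else undefined) T H"
    using w by (subst bij_betw_cong[of T _ w]) auto
  hence "(\<lambda>e. if e \<in> T then w e else undefined) \<in> Envs" by (intro envsI) auto
  thus ?thesis by auto
qed

lemma card_envs_pos: "0 < card (Envs)" using envs_ne by (simp add: card_gt_0_iff)

definition pmatch :: "arc set => bool" where
  "pmatch g \<longleftrightarrow> g \<subseteq> T \<times> H \<and> inj_on fst g \<and> inj_on snd g"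

lemma pmatch_empty [simp]: "pmatch {}" by (simp add: pmatch_def)

lemma pmatch_finite: "pmatch g ==> finite g"
  unfolding pmatch_def by (rule finite_subset[of _ "T \<times> H"]) auto

lemma pmatch_sub: "pmatch g ==> g' \<subseteq> g ==> pmatch g'"
  unfolding pmatch_def by (meson inj_on_subset subset_trans)

lemma pmatch_insert:
  "pmatch g ==> e \<in> T ==> f \<in> H ==> e \<notin> fst ` g ==> f \<notin> snd ` g ==> pmatch (insert (e, f) g)"
  unfolding pmatch_def by (auto simp: inj_on_insert image_iff dest!: bspec)

lemma Env_pmatch:
  assumes "Env g \<noteq> {}" "g \<subseteq> T \<times> H" shows "pmatch g"
proof -
  obtain w where w: "w \<in> Envs" "ext w g" using assms(1) by (auto simp: Env_def)
  have "inj_on fst g"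
  proof (rule inj_onI)
    fix x y assume "x \<in> g" "y \<in> g" "fst x = fst y"
    thus "x = y" using w(2) by (metis ext_def prod_eq_iff)
  qed
  moreover have "inj_on snd g"
  proof (rule inj_onI)
    fix x y assume xy: "x \<in> g" "y \<in> g" "snd x = snd y"
    hence "w (fst x) = w (fst y)" "fst x \<in> T" "fst y \<in> T" using w(2) assms(2) by (auto simp: ext_def)
    thus "x = y" using envs_inj[OF w(1)] xy by (metis prod_eq_iff)
  qed
  ultimately show ?thesis using assms(2) by (simp add: pmatch_def)
qed

lemma card_snd_pmatch: "pmatch g ==> card (snd ` g) = card g"
  by (simp add: pmatch_def card_image)
lemma card_fst_pmatch: "pmatch g ==> card (fst ` g) = card g"
  by (simp add: pmatch_def card_image)

text \<open>Composition with the transposition of \<open>f\<close> and \<open>f'\<close> exchanges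
  the two classes. It keeps the arcs of \<open>g\<close>, whose heads are neither \<open>f\<close>
  nor \<open>f'\<close>. Outside \<open>T\<close> the composed map is reset to
  \<open>undefined\<close>, as extensionality of environments demands.\<close>

lemma Env_swap_card:
  assumes "pmatch g" "e \<in> T" "e \<notin> fst ` g" "f \<in> H" "f' \<in> H" "f \<notin> snd ` g" "f' \<notin> snd ` g"
  shows "card (Env (insert (e, f) g)) = card (Env (insert (e, f') g))"
proof -
  have swap: "(\<lambda>x. if x \<in> T then Transposition.transpose f f' (w x) else undefined) \<in> Env (insert (e, f') g)"
    if w: "w \<in> Env (insert (e, f) g)" and f: "f \<in> H" "f' \<in> H" "f \<notin> snd ` g" "f' \<notin> snd ` g" for w f f'
  proof -
    have we: "w \<in> Envs" "w e = f" "ext w g" using w by (auto simp: Env_def ext_insert)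
    have tp: "bij_betw (Transposition.transpose f f') H H"
      by (intro bij_betw_imageI inj_on_subset[OF inj_transpose]) (auto simp: f transpose_image_eq)
    have "bij_betw (\<lambda>x. Transposition.transpose f f' (w x)) T H"
      using bij_betw_trans[OF envs_bij[OF we(1)] tp] by (simp add: o_def)
    hence "bij_betw (\<lambda>x. if x \<in> T then Transposition.transpose f f' (w x) else undefined) T H"
      by (subst bij_betw_cong[of T _ "\<lambda>x. Transposition.transpose f f' (w x)"]) auto
    hence "(\<lambda>x. if x \<in> T then Transposition.transpose f f' (w x) else undefined) \<in> Envs"
      by (intro envsI) auto
    moreover have "ext (\<lambda>x. if x \<in> T then Transposition.transpose f f' (w x) else undefined) (insert (e, f') g)"
    proof -
      have "Transposition.transpose f f' (w (fst ef)) = snd ef" if "ef \<in> g" for ef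
      proof -
        have "w (fst ef) = snd ef" using we(3) that by (auto simp: ext_def)
        moreover have "snd ef \<noteq> f" "snd ef \<noteq> f'" using f that by auto
        ultimately show ?thesis by (simp add: Transposition.transpose_def)
      qed
      moreover have "fst ef \<in> T" if "ef \<in> g" for ef using assms(1) that by (auto simp: pmatch_def)
      ultimately show ?thesis using we assms(2) by (auto simp: ext_def)
    qed
    ultimately show ?thesis by (simp add: Env_def)
  qed
  have inv: "(\<lambda>x. if x \<in> T then Transposition.transpose f' f
        ((\<lambda>x. if x \<in> T then Transposition.transpose f f' (w x) else undefined) x) else undefined) = w"
    if "w \<in> Envs" for w f f'
  proof
    fix x show "(if x \<in> T then Transposition.transpose f' f
        ((\<lambda>x. if x \<in> T then Transposition.transpose f f' (w x) else undefined) x) else undefined) = w x"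
      using envs_undef[OF that, of x] by (auto simp: transpose_commute)
  qed
  show ?thesis
  proof (rule bij_betw_same_card[OF bij_betw_byWitness])
    show "(\<lambda>w x. if x \<in> T then Transposition.transpose f f' (w x) else undefined) ` Env (insert (e, f) g) \<subseteq> Env (insert (e, f') g)"
      by (rule image_subsetI, rule swap) (use assms in auto)
    show "(\<lambda>w x. if x \<in> T then Transposition.transpose f' f (w x) else undefined) ` Env (insert (e, f') g) \<subseteq> Env (insert (e, f) g)"
      by (rule image_subsetI, rule swap) (use assms in auto)
    show "\<forall>w\<in>Env (insert (e, f) g). (\<lambda>w x. if x \<in> T then Transposition.transpose f' f (w x) else undefined)
       ((\<lambda>w x. if x \<in> T then Transposition.transpose f f' (w x) else undefined) w) = w"
    proof
      fix w assume "w \<in> Env (insert (e, f) g)"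
      from inv[OF Env_sub[OF this], of f' f] show "(\<lambda>w x. if x \<in> T then Transposition.transpose f' f (w x) else undefined)
       ((\<lambda>w x. if x \<in> T then Transposition.transpose f f' (w x) else undefined) w) = w" by simp
    qed
    show "\<forall>w\<in>Env (insert (e, f') g). (\<lambda>w x. if x \<in> T then Transposition.transpose f f' (w x) else undefined)
       ((\<lambda>w x. if x \<in> T then Transposition.transpose f' f (w x) else undefined) w) = w"
    proof
      fix w assume "w \<in> Env (insert (e, f') g)"
      from inv[OF Env_sub[OF this], of f f'] show "(\<lambda>w x. if x \<in> T then Transposition.transpose f f' (w x) else undefined)
       ((\<lambda>w x. if x \<in> T then Transposition.transpose f' f (w x) else undefined) w) = w" by simp
    qed
  qed
qed

text \<open>Reveals the head matched with the fresh tail \<open>e\<close>; injectivity of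
  \<open>w\<close> keeps that head off the heads already used by \<open>g\<close>.\<close>

lemma Env_split:
  assumes "pmatch g" "e \<in> T" "e \<notin> fst ` g"
  shows "(\<Sum>w\<in>Env g. \<phi> w) = (\<Sum>f\<in>H - snd ` g. \<Sum>w\<in>Env (insert (e, f) g). \<phi> w)"
proof -
  have "(\<Sum>w\<in>Env g. \<phi> w) = (\<Sum>f\<in>H - snd ` g. \<Sum>w\<in>{w\<in>Env g. w e = f}. \<phi> w)"
  proof (rule sum.group[symmetric])
    show "(\<lambda>w. w e) ` Env g \<subseteq> H - snd ` g"
    proof (clarsimp)
      fix w assume w: "w \<in> Env g"
      have "w e \<in> H" using w assms envs_mem Env_sub by blast
      moreover have "w e \<notin> snd ` g"
      proof
        assume "w e \<in> snd ` g"
        then obtain ef where ef: "ef \<in> g" "w e = snd ef" by auto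
        hence "w e = w (fst ef)" using w by (auto simp: Env_def ext_def)
        moreover have "fst ef \<in> T" using ef assms(1) by (auto simp: pmatch_def)
        ultimately have "e = fst ef" using envs_inj[OF Env_sub[OF w]] assms(2) by blast
        thus False using assms(3) ef by auto
      qed
      ultimately show "w e \<in> H \<and> w e \<notin> snd ` g" by blast
    qed
  qed auto
  also have "\<dots> = (\<Sum>f\<in>H - snd ` g. \<Sum>w\<in>Env (insert (e, f) g). \<phi> w)"
    by (intro sum.cong refl) (auto simp: Env_def ext_insert)
  finally show ?thesis .
qed

lemma Env_tower:
  assumes "pmatch g" "e \<in> T" "e \<notin> fst ` g" "f \<in> H" "f \<notin> snd ` g"
  shows "card (Env (insert (e, f) g)) * (m - card g) = card (Env g)"
proof -
  have "card (Env g) = (\<Sum>f\<in>H - snd ` g. card (Env (insert (e, f) g)))"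
    using Env_split[OF assms(1-3), of "\<lambda>_. 1 :: nat"] by simp
  also have "\<dots> = (\<Sum>f'\<in>H - snd ` g. card (Env (insert (e, f) g)))"
    by (rule sum.cong[OF refl], rule Env_swap_card[OF assms(1-3)]) (use assms in auto)
  also have "\<dots> = card (Env (insert (e, f) g)) * card (H - snd ` g)" by simp
  also have "card (H - snd ` g) = m - card g"
  proof -
    have "snd ` g \<subseteq> H" using assms(1) by (auto simp: pmatch_def)
    thus ?thesis using card_snd_pmatch[OF assms(1)] pmatch_finite[OF assms(1)]
      by (simp add: card_Diff_subset m_def)
  qed
  finally show ?thesis by simp
qed

text \<open>The exact value is the inverse falling factorial of \<open>m\<close>.\<close>
lemma Env_card_bounds:
  assumes "finite g'" "pmatch (g \<union> g')" "fst ` g \<inter> fst ` g' = {}" "card g + card g' <= K" "K < m"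
  shows "real (card (Env g)) / real m ^ card g' <= card (Env (g \<union> g'))"
    and "real (card (Env (g \<union> g'))) <= real (card (Env g)) / (real m - real K) ^ card g'"
  using assms
proof (induction g' rule: finite_induct)
  case empty
  { case 1 show ?case by simp }
  { case 2 show ?case by simp }
next
  case (insert ef g')
  obtain e f where ef: "ef = (e, f)" by (cases ef)
  have pm: "pmatch (insert ef (g \<union> g'))" if "pmatch (g \<union> insert ef g')" using that by simp
  have main: "real (card (Env (g \<union> insert ef g'))) = real (card (Env (g \<union> g'))) / (real m - real (card (g \<union> g')))
      \<and> card (g \<union> g') = card g + card g' \<and> pmatch (g \<union> g')"
    if a: "pmatch (g \<union> insert ef g')" "fst ` g \<inter> fst ` insert ef g' = {}"
      "card g + card (insert ef g') <= K"
  proof -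
    have p: "pmatch (g \<union> g')" by (rule pmatch_sub[OF a(1)]) auto
    have mem: "e \<in> T" "f \<in> H" using a(1) by (auto simp: pmatch_def ef)
    have nin: "ef \<notin> g \<union> g'" using insert.hyps(2) a(2) by auto
    have e: "e \<notin> fst ` (g \<union> g')"
    proof
      assume "e \<in> fst ` (g \<union> g')"
      then obtain x where "x \<in> g \<union> g'" "fst x = fst ef" by (auto simp: ef)
      moreover have "inj_on fst (g \<union> insert ef g')" using a(1) by (simp add: pmatch_def)
      ultimately have "x = ef" by (auto simp: inj_on_def)
      thus False using nin \<open>x \<in> g \<union> g'\<close> by auto
    qed
    have f: "f \<notin> snd ` (g \<union> g')"
    proof
      assume "f \<in> snd ` (g \<union> g')"
      then obtain x where "x \<in> g \<union> g'" "snd x = snd ef" by (auto simp: ef)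
      moreover have "inj_on snd (g \<union> insert ef g')" using a(1) by (simp add: pmatch_def)
      ultimately have "x = ef" by (auto simp: inj_on_def)
      thus False using nin \<open>x \<in> g \<union> g'\<close> by auto
    qed
    have c: "card (g \<union> g') = card g + card g'"
    proof (rule card_Un_disjoint)
      show "finite g" using pmatch_finite[OF p] by simp
      show "g \<inter> g' = {}" using a(2) by auto
    qed (use insert in auto)
    have "card (Env (insert (e, f) (g \<union> g'))) * (m - card (g \<union> g')) = card (Env (g \<union> g'))"
      by (rule Env_tower[OF p mem(1) e mem(2) f])
    hence "real (card (Env (insert (e, f) (g \<union> g')))) * real (m - card (g \<union> g')) = real (card (Env (g \<union> g')))"
      by (metis of_nat_mult)
    moreover have "card (g \<union> g') < m" using a(3) c insert.hyps \<open>K < m\<close> by simp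
    ultimately have "real (card (Env (insert (e, f) (g \<union> g')))) = real (card (Env (g \<union> g'))) / (real m - real (card (g \<union> g')))"
      by (simp add: field_simps of_nat_diff)
    thus ?thesis using c p by (simp add: ef)
  qed
  { case 1
    have IH: "real (card (Env g)) / real m ^ card g' <= card (Env (g \<union> g'))"
      using insert.IH(1) main[OF 1(1,2,3)] 1 insert.hyps by auto
    have lt: "card (g \<union> g') < m" using main[OF 1(1,2,3)] 1 insert.hyps by auto
    have "real (card (Env g)) / real m ^ card (insert ef g') = real (card (Env g)) / real m ^ card g' / m"
      using insert.hyps by simp
    also have "\<dots> <= card (Env (g \<union> g')) / m" by (rule divide_right_mono[OF IH]) simp
    also have "\<dots> <= card (Env (g \<union> g')) / (real m - real (card (g \<union> g')))"
      by (rule divide_left_mono) (use lt in auto)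
    finally show ?case using main[OF 1(1,2,3)] by simp }
  { case 2
    have IH: "real (card (Env (g \<union> g'))) <= real (card (Env g)) / (real m - real K) ^ card g'"
      using insert.IH(2) main[OF 2(1,2,3)] 2 insert.hyps by auto
    have lt: "card (g \<union> g') <= K" using main[OF 2(1,2,3)] 2 insert.hyps by auto
    have "real (card (Env (g \<union> insert ef g'))) = real (card (Env (g \<union> g'))) / (real m - real (card (g \<union> g')))"
      using main[OF 2(1,2,3)] by simp
    also have "\<dots> <= real (card (Env (g \<union> g'))) / (real m - real K)"
      by (rule divide_left_mono) (use lt 2 in \<open>auto intro!: mult_pos_pos\<close>)
    also have "\<dots> <= (real (card (Env g)) / (real m - real K) ^ card g') / (real m - real K)"
      by (rule divide_right_mono[OF IH]) (use 2 in auto)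
    also have "\<dots> = real (card (Env g)) / (real m - real K) ^ card (insert ef g')"
      using insert.hyps by simp
    finally show ?case . }
qed

end

text \<open>Collision count of an exploration whose state consists of the revealed arcs
  \<open>g\<close> and the visited vertices \<open>U\<close>. Tails matched before involve no new
  randomness and are followed without scoring; this is what lets \<open>col_bound\<close> charge one
  factor for each unit of the count.\<close>

fun ncol :: "arc set => nat set => arc list => nat" where
  "ncol g U [] = 0"
| "ncol g U (ef # a) = (if fst ef \<in> fst ` g then ncol g U a
     else of_bool (fst (snd ef) \<in> U) + ncol (insert ef g) (insert (fst (snd ef)) U) a)"

section \<open>Weights of trajectories, quenched and annealed expectations\<close>

context config begin

text \<open>Probability that the walk chooses the tails of \<open>a\<close>, given that the
  environment contains its arcs.\<close>

fun wt :: "arc list => real" where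
  "wt [] = 1"
| "wt (ef # a) = wt a / real (dp (fst (fst ef)))"

fun valid :: "nat => arc list => bool" where
  "valid x [] \<longleftrightarrow> True"
| "valid x (ef # a) \<longleftrightarrow> fst (fst ef) = x \<and> fst ef \<in> T \<and> snd ef \<in> H \<and> valid (fst (snd ef)) a"

definition VL where "VL x t = {a. valid x a \<and> length a = t}"

lemma wt_nonneg [simp]: "0 <= wt a"
  by (induction a) auto

lemma wt_append: "wt (a @ b) = wt a * wt b"
  by (induction a) auto

lemma valid_append: "valid x (a @ b) \<longleftrightarrow> valid x a \<and> valid (endv x a) b"
  by (induction a arbitrary: x) auto

lemma valid_set: "valid x a ==> set a \<subseteq> T \<times> H"
  by (induction a arbitrary: x) auto

lemma valid_endv: "valid x a ==> x < n ==> endv x a < n"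
  by (induction a arbitrary: x) (auto simp: memH)

lemma wt_le: "valid x a ==> wt a <= (1/2) ^ length a"
proof (induction a arbitrary: x)
  case (Cons ef a)
  have "2 <= real (dp (fst (fst ef)))" using Cons.prems deg2[of "fst (fst ef)"] by (auto simp: memT)
  moreover have "wt a <= (1/2) ^ length a" using Cons by auto
  ultimately have "wt a / real (dp (fst (fst ef))) <= (1/2) ^ length a / 2"
    by (intro frac_le) auto
  thus ?case by simp
qed simp

lemma wt_ge: "valid x a ==> (1 / real D) ^ length a <= wt a"
proof (induction a arbitrary: x)
  case (Cons ef a)
  have "real (dp (fst (fst ef))) <= D" "0 < real (dp (fst (fst ef)))"
    using Cons.prems degD[of "fst (fst ef)"] deg2[of "fst (fst ef)"] by (auto simp: memT)
  moreover have "(1 / real D) ^ length a <= wt a" using Cons by auto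
  ultimately have "(1 / real D) ^ length a / D <= wt a / real (dp (fst (fst ef)))"
    by (intro frac_le) auto
  thus ?case by simp
qed simp

lemma VL_0 [simp]: "VL x 0 = {[]}" by (auto simp: VL_def)

lemma VL_Suc:
  assumes "x < n"
  shows "VL x (Suc t) = (\<lambda>(k, f, a). ((x, k), f) # a) ` (SIGMA k:{..<dp x}. SIGMA f:H. VL (fst f) t)"
proof (intro equalityI subsetI)
  fix a assume "a \<in> VL x (Suc t)"
  then obtain ef b where a: "a = ef # b" "valid x (ef # b)" "length b = t"
    by (cases a) (auto simp: VL_def)
  hence "a = (\<lambda>(k, f, a). ((x, k), f) # a) (snd (fst ef), snd ef, b)" by (cases ef) auto
  moreover have "(snd (fst ef), snd ef, b) \<in> (SIGMA k:{..<dp x}. SIGMA f:H. VL (fst f) t)"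
    using a by (auto simp: memT VL_def)
  ultimately show "a \<in> (\<lambda>(k, f, a). ((x, k), f) # a) ` (SIGMA k:{..<dp x}. SIGMA f:H. VL (fst f) t)"
    by (rule image_eqI)
qed (use assms in \<open>auto simp: VL_def memT\<close>)

lemma finite_VL [simp, intro]: "finite (VL x t)"
proof -
  have "finite {a. set a \<subseteq> T \<times> H \<and> length a = t}" by (rule finite_lists_length_eq) auto
  thus ?thesis by (rule finite_subset[rotated]) (use valid_set in \<open>auto simp: VL_def\<close>)
qed

lemma sum_VL_Suc:
  assumes "x < n"
  shows "(\<Sum>a\<in>VL x (Suc t). \<phi> a) = (\<Sum>k<dp x. \<Sum>f\<in>H. \<Sum>a\<in>VL (fst f) t. \<phi> (((x, k), f) # a))"
  by (subst VL_Suc[OF assms], subst sum.reindex)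
     (auto simp: inj_on_def sum.Sigma case_prod_unfold intro!: sum.cong)

text \<open>Quenched expectation over the walk of \<open>t\<close> steps from \<open>x\<close>; a trajectory is a list of arcs.\<close>
definition QE :: "env => nat => nat => (arc list => real) => real" where
  "QE w t x \<phi> = (\<Sum>a\<in>VL x t. wt a * of_bool (ext w (set a)) * \<phi> a)"

lemma QE_0 [simp]: "QE w 0 x \<phi> = \<phi> []" by (simp add: QE_def)

lemma QE_Suc:
  assumes "w \<in> Envs" "x < n"
  shows "QE w (Suc t) x \<phi> = (\<Sum>k<dp x. QE w t (fst (w (x, k))) (\<lambda>a. \<phi> (((x, k), w (x, k)) # a))) / dp x"
proof -
  have "QE w (Suc t) x \<phi> = (\<Sum>k<dp x. \<Sum>f\<in>H. if f = w (x, k) then QE w t (fst f) (\<lambda>a. \<phi> (((x, k), f) # a)) / dp x else 0)"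
    unfolding QE_def sum_VL_Suc[OF assms(2)]
    by (intro sum.cong refl) (auto simp: ext_insert sum_divide_distrib mult_ac intro!: sum.cong)
  also have "\<dots> = (\<Sum>k<dp x. QE w t (fst (w (x, k))) (\<lambda>a. \<phi> (((x, k), w (x, k)) # a)) / dp x)"
    by (intro sum.cong refl) (use envs_mem[OF assms(1)] assms(2) in \<open>auto simp: memT\<close>)
  finally show ?thesis by (simp add: sum_divide_distrib)
qed

lemma QE_mono: "(\<And>a. a \<in> VL x t ==> ext w (set a) ==> \<phi> a <= \<psi> a) ==> QE w t x \<phi> <= QE w t x \<psi>"
  unfolding QE_def by (intro sum_mono) (auto intro!: mult_left_mono)

lemma QE_cong: "(\<And>a. a \<in> VL x t ==> ext w (set a) ==> \<phi> a = \<psi> a) ==> QE w t x \<phi> = QE w t x \<psi>"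
  unfolding QE_def by (intro sum.cong refl) auto

lemma QE_nonneg: "(\<And>a. a \<in> VL x t ==> ext w (set a) ==> 0 <= \<phi> a) ==> 0 <= QE w t x \<phi>"
  using QE_mono[of x t w "\<lambda>_. 0" \<phi>] by (simp add: QE_def)

lemma QE_add: "QE w t x (\<lambda>a. \<phi> a + \<psi> a) = QE w t x \<phi> + QE w t x \<psi>"
  by (simp add: QE_def ring_distribs sum.distrib)

lemma QE_diff: "QE w t x (\<lambda>a. \<phi> a - \<psi> a) = QE w t x \<phi> - QE w t x \<psi>"
  by (simp add: QE_def ring_distribs sum_subtractf)

lemma QE_cmult: "QE w t x (\<lambda>a. c * \<phi> a) = c * QE w t x \<phi>"
  by (simp add: QE_def sum_distrib_left mult.left_commute mult.assoc)

lemma QE_cmult2: "QE w t x (\<lambda>a. \<phi> a * c) = QE w t x \<phi> * c"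
  by (simp add: QE_def sum_distrib_right mult.assoc)

lemma QE_sum: "QE w t x (\<lambda>a. \<Sum>i\<in>I. \<phi> i a) = (\<Sum>i\<in>I. QE w t x (\<phi> i))"
  by (simp add: QE_def sum_distrib_left sum.swap[of _ I])

lemma QE_const:
  assumes "w \<in> Envs" "x < n" shows "QE w t x (\<lambda>_. c) = c"
  using assms(2)
proof (induction t arbitrary: x)
  case (Suc t)
  have "(\<Sum>k<dp x. QE w t (fst (w (x, k))) (\<lambda>_. c)) = (\<Sum>k<dp x. c)"
    using Suc envs_fst[OF assms(1)] by (intro sum.cong refl) (auto simp: memT)
  moreover have "dp x > 0" using deg2[of x] Suc.prems by simp
  ultimately show ?case using QE_Suc[OF assms(1) Suc.prems] by simp
qed simp

lemma QE_le_const: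
  assumes "w \<in> Envs" "x < n" "\<And>a. a \<in> VL x t ==> ext w (set a) ==> \<phi> a <= c"
  shows "QE w t x \<phi> <= c"
  using QE_mono[of x t w \<phi> "\<lambda>_. c"] QE_const[OF assms(1,2)] assms(3) by simp

text \<open>The Markov property at time \<open>t\<close>, for functionals that still see the whole
  trajectory.\<close>

lemma QE_append:
  assumes "w \<in> Envs" "x < n"
  shows "QE w (t + s) x \<phi> = QE w t x (\<lambda>a. QE w s (endv x a) (\<lambda>b. \<phi> (a @ b)))"
  using assms(2)
proof (induction t arbitrary: x \<phi>)
  case (Suc t)
  have "(\<Sum>k<dp x. QE w (t + s) (fst (w (x, k))) (\<lambda>a. \<phi> (((x, k), w (x, k)) # a)))
     = (\<Sum>k<dp x. QE w t (fst (w (x, k))) (\<lambda>a. QE w s (endv (fst (w (x, k))) a) (\<lambda>b. \<phi> (((x, k), w (x, k)) # a @ b))))"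
    using Suc.prems envs_fst[OF assms(1)] by (intro sum.cong refl Suc.IH) (auto simp: memT)
  thus ?case using QE_Suc[OF assms(1) Suc.prems] by simp
qed simp

lemma QE_endv_sum:
  assumes "w \<in> Envs" "x < n"
  shows "QE w t x (\<lambda>a. \<psi> (endv x a)) = (\<Sum>j<n. QE w t x (\<lambda>a. of_bool (endv x a = j)) * \<psi> j)"
proof -
  have "QE w t x (\<lambda>a. \<psi> (endv x a)) = QE w t x (\<lambda>a. \<Sum>j<n. of_bool (endv x a = j) * \<psi> j)"
  proof (rule QE_cong)
    fix a assume "a \<in> VL x t"
    hence "endv x a < n" using valid_endv assms by (auto simp: VL_def)
    thus "\<psi> (endv x a) = (\<Sum>j<n. of_bool (endv x a = j) * \<psi> j)"
      by simp
  qed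
  also have "\<dots> = (\<Sum>j<n. QE w t x (\<lambda>a. of_bool (endv x a = j)) * \<psi> j)"
    unfolding QE_sum QE_cmult2 ..
  finally show ?thesis .
qed

definition PP :: "env => nat => nat => nat => real" where
  "PP w t i j = QE w t i (\<lambda>a. of_bool (endv i a = j))"

lemma PP_nonneg: "0 <= PP w t i j" unfolding PP_def by (rule QE_nonneg) simp

lemma PP_sum: "w \<in> Envs ==> i < n ==> (\<Sum>j<n. PP w t i j) = 1"
  using QE_endv_sum[of w i t "\<lambda>_. 1"] QE_const[of w i t 1] by (simp add: PP_def)

lemma PP_add:
  assumes "w \<in> Envs" "i < n"
  shows "PP w (t + s) i j = (\<Sum>k<n. PP w t i k * PP w s k j)"
proof -
  have "PP w (t + s) i j = QE w t i (\<lambda>a. PP w s (endv i a) j)"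
    unfolding PP_def QE_append[OF assms] by simp
  thus ?thesis using QE_endv_sum[OF assms, of t "\<lambda>k. PP w s k j"] by (simp add: PP_def)
qed

lemma PP_1:
  assumes "w \<in> Envs" "i < n" shows "PP w 1 i j = trans dp w i j"
proof -
  have "{k. k < dp i \<and> fst (w (i, k)) = j} = {..<dp i} \<inter> {k. fst (w (i, k)) = j}" by auto
  thus ?thesis using QE_Suc[OF assms, of 0] by (simp add: PP_def trans_def)
qed

lemma matpow_PP:
  assumes "w \<in> Envs" "i < n" shows "matpow n (trans dp w) t i j = PP w t i j"
proof (induction t arbitrary: j)
  case 0 thus ?case by (simp add: PP_def)
next
  case (Suc t)
  have "matpow n (trans dp w) (Suc t) i j = (\<Sum>k<n. PP w t i k * PP w 1 k j)"
    using PP_1[OF assms(1)] by (simp add: Suc)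
  thus ?case using PP_add[OF assms, of t 1 j] by simp
qed

text \<open>Annealing: exchanging the two sums turns an average over environments into a weighted
  sum over trajectories, in which the environments are only counted. \<open>Env_card_bounds\<close>
  estimates these counts.\<close>

lemma sum_Env_QE:
  "(\<Sum>w\<in>Env g. QE w t x (\<phi> w)) = (\<Sum>a\<in>VL x t. wt a * (\<Sum>w\<in>Env (g \<union> set a). \<phi> w a))"
proof -
  have "(\<Sum>w\<in>Env g. QE w t x (\<phi> w)) = (\<Sum>a\<in>VL x t. \<Sum>w\<in>Env g. wt a * (of_bool (ext w (set a)) * \<phi> w a))"
    unfolding QE_def mult.assoc by (rule sum.swap)
  hence "(\<Sum>w\<in>Env g. QE w t x (\<phi> w)) = (\<Sum>a\<in>VL x t. wt a * (\<Sum>w\<in>Env g. of_bool (ext w (set a)) * \<phi> w a))"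
    unfolding sum_distrib_left .
  moreover have "(\<Sum>w\<in>Env g. of_bool (ext w (set a)) * \<phi> w a) = (\<Sum>w\<in>Env (g \<union> set a). \<phi> w a)" for a
  proof -
    have "Env (g \<union> set a) = Env g \<inter> {w. ext w (set a)}" by (auto simp: Env_def ext_Un)
    hence *: "(\<Sum>w\<in>Env (g \<union> set a). \<phi> w a) = (\<Sum>w\<in>Env g. if w \<in> {w. ext w (set a)} then \<phi> w a else 0)"
      by (simp add: sum.inter_restrict)
    show ?thesis unfolding * by (intro sum.cong refl) auto
  qed
  ultimately show ?thesis by (simp only:)
qed

lemma sum_Env_QE_const:
  "(\<Sum>w\<in>Env g. QE w t x \<phi>) = (\<Sum>a\<in>VL x t. wt a * \<phi> a * card (Env (g \<union> set a)))"
  using sum_Env_QE[where \<phi> = "\<lambda>_. \<phi>"] by (simp add: mult_ac)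

text \<open>Revealing the environment along the walk: each newly revealed head hits the
  already visited set \<open>U\<close> with probability at most \<open>p\<close>.\<close>
lemma col_bound:
  assumes "pmatch g" "finite U" "x < n" "card g + t < m"
    and "real (D * (card U + t)) <= p * (real m - real (card g) - real t)"
  shows "(\<Sum>w\<in>Env g. QE w t x (\<lambda>a. of_bool (j <= ncol g U a))) <= card (Env g) * (real t * p) ^ j"
  using assms
proof (induction t arbitrary: g U x j)
  case 0
  show ?case by (cases j) auto
next
  case (Suc t)
  have mg: "0 < real m - real (card g) - real (Suc t)" using Suc.prems(4) by simp
  have p0: "0 <= p"
  proof (rule ccontr)
    assume "\<not> 0 <= p"
    hence "p * (real m - real (card g) - real (Suc t)) < 0" using mg by (simp add: mult_neg_pos)
    with Suc.prems(5) show False by linarith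
  qed
  have pD: "real (D * (card U + 1 + t)) <= p * (real m - (real (card g) + 1) - real t)"
    using Suc.prems(5) by (simp add: algebra_simps)
  have pD': "real (D * (card U + t)) <= p * (real m - real (card g) - real t)"
  proof -
    have "real (D * (card U + t)) <= real (D * (card U + 1 + t))" by simp
    also have "\<dots> <= p * (real m - (real (card g) + 1) - real t)" by (rule pD)
    also have "\<dots> <= p * (real m - real (card g) - real t)" by (rule mult_left_mono) (use p0 in auto)
    finally show ?thesis .
  qed
  have pU: "real (D * card U) <= p * (real m - real (card g))"
  proof -
    have "real (D * card U) <= real (D * (card U + t))" by (intro of_nat_mono mult_le_mono) auto
    also note pD'
    also have "p * (real m - real (card g) - real t) <= p * (real m - real (card g))"
      by (rule mult_left_mono) (use p0 in auto)
    finally show ?thesis .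
  qed
  define B where "B = (real (Suc t) * p) ^ j"
  have B0: "0 <= B" using p0 by (simp add: B_def)
  have Bt: "(real t * p) ^ j <= B" unfolding B_def using p0 by (intro power_mono mult_right_mono) auto
  have step: "(\<Sum>w\<in>Env g. QE w t (fst (w (x, k))) (\<lambda>a. of_bool (j <= ncol g U (((x, k), w (x, k)) # a))))
     <= card (Env g) * B" if k: "k < dp x" for k
  proof -
    have eT: "(x, k) \<in> T" using k Suc.prems(3) by (simp add: memT)
    show ?thesis
    proof (cases "(x, k) \<in> fst ` g")
      case True
      then obtain f where f: "((x, k), f) \<in> g" by force
      hence fH: "f \<in> H" using Suc.prems(1) by (auto simp: pmatch_def)
      have "(\<Sum>w\<in>Env g. QE w t (fst (w (x, k))) (\<lambda>a. of_bool (j <= ncol g U (((x, k), w (x, k)) # a))))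
         = (\<Sum>w\<in>Env g. QE w t (fst f) (\<lambda>a. of_bool (j <= ncol g U a)))"
      proof (intro sum.cong refl)
        fix w assume "w \<in> Env g"
        hence "w (x, k) = f" using f by (force simp: Env_def ext_def)
        thus "QE w t (fst (w (x, k))) (\<lambda>a. of_bool (j <= ncol g U (((x, k), w (x, k)) # a)))
           = QE w t (fst f) (\<lambda>a. of_bool (j <= ncol g U a))" using True by simp
      qed
      also have "\<dots> <= card (Env g) * (real t * p) ^ j"
        using Suc.IH[OF Suc.prems(1,2), of "fst f" j] fH Suc.prems(4) pD' by (simp add: memH)
      also have "\<dots> <= card (Env g) * B" by (rule mult_left_mono[OF Bt]) simp
      finally show ?thesis .
    next
      case False
      \<comment> \<open>A head on \<open>U\<close> consumes one of the \<open>j\<close> collisions,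
        so the remaining walk owes \<open>j - 1\<close>; any other head leaves the debt
        unchanged.\<close>
      define c where "c f = (if fst f \<in> U then (real t * p) ^ (j - 1) else (real t * p) ^ j)" for f :: head
      have c0: "0 <= c f" for f using p0 by (simp add: c_def)
      have Ef: "real (card (Env (insert ((x, k), f) g))) = card (Env g) / (real m - real (card g))"
        if f: "f \<in> H - snd ` g" for f
      proof -
        have "card (Env (insert ((x, k), f) g)) * (m - card g) = card (Env g)"
          using Env_tower[OF Suc.prems(1) eT False] f by auto
        hence "real (card (Env (insert ((x, k), f) g))) * real (m - card g) = card (Env g)"
          by (metis of_nat_mult)
        thus ?thesis using mg by (simp add: field_simps of_nat_diff)
      qed
      show ?thesis
      proof (cases "j = 0")
        case True
        have "(\<Sum>w\<in>Env g. QE w t (fst (w (x, k))) (\<lambda>a. of_bool (j <= ncol g U (((x, k), w (x, k)) # a))))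
           <= (\<Sum>w\<in>Env g. 1)"
          by (intro sum_mono QE_le_const) (use Env_sub envs_fst eT in auto)
        thus ?thesis using True by (simp add: B_def)
      next
        case j: False
        have "(\<Sum>w\<in>Env g. QE w t (fst (w (x, k))) (\<lambda>a. of_bool (j <= ncol g U (((x, k), w (x, k)) # a))))
          = (\<Sum>f\<in>H - snd ` g. \<Sum>w\<in>Env (insert ((x, k), f) g).
               QE w t (fst f) (\<lambda>a. of_bool (j <= of_bool (fst f \<in> U) + ncol (insert ((x, k), f) g) (insert (fst f) U) a)))"
          unfolding Env_split[OF Suc.prems(1) eT False]
          using False by (intro sum.cong refl) (auto simp: Env_def ext_insert)
        also have "\<dots> <= (\<Sum>f\<in>H - snd ` g. card (Env (insert ((x, k), f) g)) * c f)"
        proof (rule sum_mono)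
          fix f assume f: "f \<in> H - snd ` g"
          let ?g = "insert ((x, k), f) g" and ?U = "insert (fst f) U"
          have pm: "pmatch ?g" using pmatch_insert[OF Suc.prems(1) eT _ False] f by auto
          have cg: "card ?g = card g + 1"
            using False pmatch_finite[OF Suc.prems(1)] by (subst card_insert_disjoint) (auto simp: image_iff)
          have cU: "card ?U <= card U + 1" by (simp add: card_insert_if Suc.prems(2))
          have "real (D * (card ?U + t)) <= real (D * (card U + 1 + t))" using cU by (intro of_nat_mono mult_le_mono) auto
          hence pg: "real (D * (card ?U + t)) <= p * (real m - real (card ?g) - real t)" using pD by (simp only: cg of_nat_add of_nat_1)
          have fn: "fst f < n" using f by (auto simp: memH)
          have IH: "(\<Sum>w\<in>Env ?g. QE w t (fst f) (\<lambda>a. of_bool (i <= ncol ?g ?U a))) <= card (Env ?g) * (real t * p) ^ i" for i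
            by (rule Suc.IH[OF pm _ fn _ pg]) (use Suc.prems cg in auto)
          show "(\<Sum>w\<in>Env ?g. QE w t (fst f) (\<lambda>a. of_bool (j <= of_bool (fst f \<in> U) + ncol ?g ?U a))) <= card (Env ?g) * c f"
          proof (cases "fst f \<in> U")
            case True
            have "j <= of_bool (fst f \<in> U) + ncol ?g ?U a \<longleftrightarrow> j - 1 <= ncol ?g ?U a" for a using True j by auto
            thus ?thesis using IH[of "j - 1"] True by (simp add: c_def)
          next
            case False
            thus ?thesis using IH[of j] by (simp add: c_def)
          qed
        qed
        also have "\<dots> = (card (Env g) / (real m - real (card g))) * (\<Sum>f\<in>H - snd ` g. c f)"
          using Ef by (simp add: sum_distrib_left)
        also have "(\<Sum>f\<in>H - snd ` g. c f) <= real (D * card U) * (real t * p) ^ (j - 1) + (real m - real (card g)) * (real t * p) ^ j"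
        proof -
          have "(\<Sum>f\<in>H - snd ` g. c f) <= (\<Sum>f\<in>H - snd ` g. of_bool (fst f \<in> U) * (real t * p) ^ (j - 1) + (real t * p) ^ j)"
            by (rule sum_mono) (use p0 in \<open>auto simp: c_def\<close>)
          also have "\<dots> = real (card ((H - snd ` g) \<inter> {f. fst f \<in> U})) * (real t * p) ^ (j - 1) + real (card (H - snd ` g)) * (real t * p) ^ j"
            by (simp add: sum.distrib flip: sum_distrib_right)
          also have "real (card (H - snd ` g)) = real m - real (card g)"
          proof -
            have "snd ` g \<subseteq> H" using Suc.prems(1) by (auto simp: pmatch_def)
            thus ?thesis using card_snd_pmatch[OF Suc.prems(1)] pmatch_finite[OF Suc.prems(1)] Suc.prems(4)
              by (simp add: card_Diff_subset m_def of_nat_diff)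
          qed
          also have "card ((H - snd ` g) \<inter> {f. fst f \<in> U}) <= D * card U"
            by (rule order_trans[OF card_mono heads_in_le[OF Suc.prems(2)]]) auto
          finally show ?thesis using p0 by (simp add: mult_right_mono)
        qed
        also have "\<dots> <= p * (real m - real (card g)) * (real t * p) ^ (j - 1) + (real m - real (card g)) * (real t * p) ^ j"
          by (intro add_right_mono mult_right_mono pU) (use p0 in auto)
        also have "\<dots> = (real m - real (card g)) * (p * (real t * p) ^ (j - 1) + (real t * p) ^ j)"
          by (simp add: algebra_simps)
        also have "(card (Env g) / (real m - real (card g))) * \<dots> = card (Env g) * (p * (real t * p) ^ (j - 1) + (real t * p) ^ j)"
          using mg by simp
        \<comment> \<open>The sum is \<open>((t + 1) p) (t p)^(j - 1)\<close>. Absorbing the extra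
          step in this way dictates the shape \<open>(t p)^j\<close> of the bound.\<close>
        also have "p * (real t * p) ^ (j - 1) + (real t * p) ^ j <= B"
        proof -
          obtain i where i: "j = Suc i" using j by (cases j) auto
          have "p * (real t * p) ^ (j - 1) + (real t * p) ^ j = (real (Suc t) * p) * (real t * p) ^ i"
            by (simp add: i algebra_simps)
          also have "\<dots> <= (real (Suc t) * p) * (real (Suc t) * p) ^ i"
            using p0 by (intro mult_left_mono power_mono mult_right_mono) auto
          finally show ?thesis by (simp add: B_def i)
        qed
        finally show ?thesis using mg by (simp add: divide_simps mult_left_mono)
      qed
    qed
  qed
  have "(\<Sum>w\<in>Env g. QE w (Suc t) x (\<lambda>a. of_bool (j <= ncol g U a)))
     = (\<Sum>k<dp x. \<Sum>w\<in>Env g. QE w t (fst (w (x, k))) (\<lambda>a. of_bool (j <= ncol g U (((x, k), w (x, k)) # a)))) / dp x"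
    using QE_Suc[OF Env_sub Suc.prems(3)]
    by (subst sum.swap) (simp flip: sum_divide_distrib)
  also have "\<dots> <= (\<Sum>k<dp x. card (Env g) * B) / dp x"
    by (intro divide_right_mono sum_mono step) auto
  also have "\<dots> = card (Env g) * B" using deg2[OF Suc.prems(3)] by simp
  finally show ?case by (simp add: B_def)
qed

text \<open>The last assumption says that the walk stands at the border of the explored part: every
  revealed tail sits in \<open>U\<close> but not at \<open>x\<close>. Hence the next tail is fresh,
  and a step without collision lands outside \<open>U\<close>, which restores the assumption for the
  enlarged state.\<close>

lemma ncol_0_avoid:
  assumes "valid x a" "ncol g U a = 0" "x \<in> U" "\<forall>e\<in>fst ` g. fst e \<in> U \<and> fst e \<noteq> x"
  shows "distinct (verts a) \<and> set (verts a) \<inter> U = {}"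
  using assms
proof (induction a arbitrary: x g U)
  case (Cons ef a)
  have "fst ef \<notin> fst ` g" using Cons.prems(1,4) by auto
  hence *: "fst (snd ef) \<notin> U" "ncol (insert ef g) (insert (fst (snd ef)) U) a = 0"
    using Cons.prems(2) by auto
  have "distinct (verts a) \<and> set (verts a) \<inter> insert (fst (snd ef)) U = {}"
    by (rule Cons.IH[OF _ *(2)]) (use Cons.prems * in auto)
  thus ?case using * by auto
qed simp

lemma ncol_0_simple: "valid x a ==> ncol {} {x} a = 0 ==> simple x a"
  using ncol_0_avoid[of x a "{}" "{x}"] by (auto simp: simple_def)

text \<open>Distinct tails keep each arc of \<open>b\<close> fresh until its own turn, and
  \<open>U\<close> can only grow, so counting against the initial state is a lower bound.\<close>

lemma ncol_ge_filter:
  assumes "distinct (map fst b)"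
  shows "length (filter (\<lambda>ef. fst ef \<notin> fst ` g \<and> fst (snd ef) \<in> U) b) <= ncol g U b"
  using assms
proof (induction b arbitrary: g U)
  case (Cons ef b)
  have mono: "length (filter (\<lambda>ef. fst ef \<notin> fst ` g \<and> fst (snd ef) \<in> U) b)
     <= length (filter (\<lambda>ef'. fst ef' \<notin> fst ` (insert ef g) \<and> fst (snd ef') \<in> insert (fst (snd ef)) U) b)"
  proof -
    have "filter (\<lambda>ef. fst ef \<notin> fst ` g \<and> fst (snd ef) \<in> U) b =
       filter (\<lambda>ef. fst ef \<notin> fst ` g \<and> fst (snd ef) \<in> U) (filter (\<lambda>ef'. fst ef' \<notin> fst ` (insert ef g) \<and> fst (snd ef') \<in> insert (fst (snd ef)) U) b)"
      unfolding filter_filter using Cons.prems by (intro filter_cong refl) (auto simp: image_iff)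
    from ord_eq_le_trans[OF arg_cong[OF this, of length] length_filter_le] show ?thesis .
  qed
  show ?case
  proof (cases "fst ef \<in> fst ` g")
    case True thus ?thesis using Cons by simp
  next
    case False
    have "length (filter (\<lambda>ef'. fst ef' \<notin> fst ` (insert ef g) \<and> fst (snd ef') \<in> insert (fst (snd ef)) U) b)
      <= ncol (insert ef g) (insert (fst (snd ef)) U) b" by (rule Cons.IH) (use Cons.prems in simp)
    thus ?thesis using mono False by auto
  qed
qed simp

lemma simple_tails:
  assumes "valid x a" "simple x a" shows "distinct (map fst a)"
proof -
  have "map (\<lambda>ef. fst (fst ef)) a = butlast (x # verts a)" if "valid x a" for x a
    using that
  proof (induction a arbitrary: x)
    case (Cons ef a)
    hence "map (\<lambda>ef. fst (fst ef)) a = butlast (verts (ef # a))" and "fst (fst ef) = x" by simp_all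
    thus ?case by simp
  qed simp
  hence "distinct (map (\<lambda>ef. fst (fst ef)) a)"
    using assms distinct_butlast[of "x # verts a"] by (simp add: simple_def)
  hence "distinct (map fst (map fst a))" by (simp add: o_def)
  thus ?thesis by (simp only: distinct_map)
qed

end

lemma common_suffix:
  "\<exists>a0 b0 s. a = a0 @ s \<and> b = b0 @ s \<and> (a0 = [] \<or> b0 = [] \<or> last a0 \<noteq> last b0)"
proof (induction a arbitrary: b rule: rev_induct)
  case (snoc z a)
  show ?case
  proof (cases "b \<noteq> [] \<and> last b = z")
    case True
    obtain a0 b0 s where "a = a0 @ s" "butlast b = b0 @ s" "a0 = [] \<or> b0 = [] \<or> last a0 \<noteq> last b0"
      using snoc[of "butlast b"] by blast
    moreover from this have "b = b0 @ s @ [z]" using True by (metis append.assoc append_butlast_last_id)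
    ultimately show ?thesis by (metis append.assoc)
  next
    case False
    thus ?thesis by (intro exI[of _ "a @ [z]"] exI[of _ b] exI[of _ "[]"]) auto
  qed
qed auto

text \<open>Used in \<open>merge_classify\<close> to find the place where a trajectory, fresh at
  first, steps onto tails of another one.\<close>

lemma list_switch:
  assumes "c \<noteq> []" "\<not> Q (hd c)" "\<exists>z\<in>set c. Q z"
  shows "\<exists>c1 z1 z2 c2. c = c1 @ z1 # z2 # c2 \<and> \<not> Q z1 \<and> Q z2"
  using assms
proof (induction c rule: list_nonempty_induct)
  case (cons z c)
  show ?case
  proof (cases "Q (hd c)")
    case True
    thus ?thesis using cons by (intro exI[of _ "[]"] exI[of _ z] exI[of _ "hd c"] exI[of _ "tl c"]) auto
  next
    case False
    then obtain c1 z1 z2 c2 where "c = c1 @ z1 # z2 # c2 \<and> \<not> Q z1 \<and> Q z2" using cons by auto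
    thus ?thesis by (intro exI[of _ "z # c1"]) auto
  qed
qed auto

context config begin

subsection \<open>Averages over independent heads\<close>

definition HL where "HL t = {fs. set fs \<subseteq> H \<and> length fs = t}"

definition iE :: "nat => (head list => real) => real" where
  "iE t \<phi> = (\<Sum>fs\<in>HL t. \<phi> fs) / real m ^ t"

text \<open>A uniform head sits at vertex \<open>v\<close> with probability \<open>dm v / m\<close>;
  this is the mean under the in-degree law, the law of the vertex reached through a fresh
  tail.\<close>

definition avgH :: "(nat => real) => real" where
  "avgH \<phi> = (\<Sum>f\<in>H. \<phi> (fst f)) / real m"

lemma finite_HL [simp, intro]: "finite (HL t)"
  unfolding HL_def by (rule finite_lists_length_eq) auto

lemma HL_0 [simp]: "HL 0 = {[]}" by (auto simp: HL_def)

lemma iE_0 [simp]: "iE 0 \<phi> = \<phi> []" by (simp add: iE_def)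

lemma iE_Suc: "iE (Suc t) \<phi> = (\<Sum>f\<in>H. iE t (\<lambda>fs. \<phi> (f # fs))) / m"
proof -
  have "HL (Suc t) = (\<lambda>(f, fs). f # fs) ` (H \<times> HL t)"
    by (auto simp: HL_def length_Suc_conv image_iff)
  hence "(\<Sum>fs\<in>HL (Suc t). \<phi> fs) = (\<Sum>p\<in>H \<times> HL t. \<phi> (fst p # snd p))"
    by (simp only:, subst sum.reindex) (auto simp: inj_on_def case_prod_unfold)
  also have "\<dots> = (\<Sum>f\<in>H. \<Sum>fs\<in>HL t. \<phi> (f # fs))" by (simp add: sum.cartesian_product case_prod_unfold)
  finally show ?thesis by (simp add: iE_def sum_divide_distrib mult_ac)
qed

lemma iE_mono: "(\<And>fs. fs \<in> HL t ==> \<phi> fs <= \<psi> fs) ==> iE t \<phi> <= iE t \<psi>"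
  unfolding iE_def by (intro divide_right_mono sum_mono) auto

lemma iE_cong: "(\<And>fs. fs \<in> HL t ==> \<phi> fs = \<psi> fs) ==> iE t \<phi> = iE t \<psi>"
  unfolding iE_def by (intro arg_cong2[of _ _ _ _ "(/)"] sum.cong refl) auto

lemma iE_const [simp]: "iE t (\<lambda>_. c) = c"
  by (induction t) (use mpos in \<open>auto simp: iE_Suc simp flip: m_def\<close>)

lemma iE_nonneg: "(\<And>fs. fs \<in> HL t ==> 0 <= \<phi> fs) ==> 0 <= iE t \<phi>"
  using iE_mono[of t "\<lambda>_. 0" \<phi>] by simp

lemma iE_cmult: "iE t (\<lambda>fs. c * \<phi> fs) = c * iE t \<phi>"
  by (simp add: iE_def sum_distrib_left)

lemma iE_cmult2: "iE t (\<lambda>fs. \<phi> fs * c) = iE t \<phi> * c"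
  by (simp add: iE_def sum_distrib_right)

lemma iE_plus: "iE t (\<lambda>fs. \<phi> fs + \<psi> fs) = iE t \<phi> + iE t \<psi>"
  by (simp add: iE_def sum.distrib add_divide_distrib)

lemma iE_add: "iE (s + t) \<phi> = iE s (\<lambda>fs. iE t (\<lambda>gs. \<phi> (fs @ gs)))"
  by (induction s arbitrary: \<phi>) (simp_all add: iE_Suc)

lemma iE_mid: "iE (s + N + t) (\<lambda>fs. \<phi> (take N (drop s fs))) = iE N \<phi>"
proof -
  have "iE (s + N + t) (\<lambda>fs. \<phi> (take N (drop s fs)))
    = iE s (\<lambda>fs. iE N (\<lambda>gs. iE t (\<lambda>hs. \<phi> (take N (drop s (fs @ gs @ hs))))))"
    by (simp only: iE_add append.assoc)
  also have "\<dots> = iE s (\<lambda>fs. iE N (\<lambda>gs. iE t (\<lambda>hs. \<phi> gs)))"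
    by (intro iE_cong) (auto simp: HL_def)
  finally show ?thesis by simp
qed

lemma avgH_mono: "(\<And>x. x < n ==> \<phi> x <= \<psi> x) ==> avgH \<phi> <= avgH \<psi>"
  unfolding avgH_def by (intro divide_right_mono sum_mono) (auto simp: memH)

lemma avgH_cong: "(\<And>x. x < n ==> \<phi> x = \<psi> x) ==> avgH \<phi> = avgH \<psi>"
  unfolding avgH_def by (intro arg_cong2[of _ _ _ _ "(/)"] sum.cong refl) (auto simp: memH)

lemma avgH_const [simp]: "avgH (\<lambda>_. c) = c" using mpos by (simp add: avgH_def flip: m_def)

lemma avgH_nonneg: "(\<And>x. x < n ==> 0 <= \<phi> x) ==> 0 <= avgH \<phi>"
  using avgH_mono[of "\<lambda>_. 0" \<phi>] by simp

lemma avgH_add: "avgH (\<lambda>x. \<phi> x + \<psi> x) = avgH \<phi> + avgH \<psi>"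
  by (simp add: avgH_def sum.distrib add_divide_distrib)

lemma avgH_diff: "avgH (\<lambda>x. \<phi> x - \<psi> x) = avgH \<phi> - avgH \<psi>"
  by (simp add: avgH_def sum_subtractf diff_divide_distrib)

lemma avgH_cmult: "avgH (\<lambda>x. c * \<phi> x) = c * avgH \<phi>"
  by (simp add: avgH_def sum_distrib_left)

lemma avgH_cmult2: "avgH (\<lambda>x. \<phi> x * c) = avgH \<phi> * c"
  by (simp add: avgH_def sum_distrib_right)

lemma avgH_sum: "avgH (\<lambda>x. \<Sum>i\<in>I. \<phi> i x) = (\<Sum>i\<in>I. avgH (\<phi> i))"
  unfolding avgH_def by (subst sum.swap) (simp add: sum_divide_distrib)

lemma avgH_mem: "finite U ==> avgH (\<lambda>x. of_bool (x \<in> U)) <= real (D * card U) / m"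
  unfolding avgH_def using heads_in_le[of U] by (intro divide_right_mono) (auto simp: Int_def simp del: of_nat_mult)

text \<open>A starting vertex drawn from the in-degree law acts as one more independent head. This
  turns the averages over \<open>x\<close> and \<open>y\<close> in \<open>XN_lb\<close> into a
  birthday problem.\<close>

lemma iE_Suc_avg: "avgH (\<lambda>x. iE t (\<lambda>fs. \<phi> (x # map fst fs))) = iE (Suc t) (\<lambda>fs. \<phi> (map fst fs))"
  by (simp add: avgH_def iE_Suc)

text \<open>A vertex carries at most \<open>D\<close> of the \<open>m\<close> heads, so a new head
  repeats one of \<open>k\<close> vertices with probability at most \<open>D k / m\<close>; then
  \<open>k + k^2 <= (k + 1)^2\<close>.\<close>

lemma iE_birthday: "iE k (\<lambda>fs. of_bool (\<not> distinct (map fst fs))) <= real k ^ 2 * real D / m"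
proof (induction k)
  case (Suc k)
  have "iE (Suc k) (\<lambda>fs. of_bool (\<not> distinct (map fst fs)))
    <= iE (Suc k) (\<lambda>fs. of_bool (fst (hd fs) \<in> fst ` set (tl fs)) + of_bool (\<not> distinct (map fst (tl fs))))"
    by (rule iE_mono) (auto simp: HL_def length_Suc_conv)
  also have "\<dots> = (\<Sum>f\<in>H. iE k (\<lambda>fs. of_bool (fst f \<in> fst ` set fs))) / m + iE k (\<lambda>fs. of_bool (\<not> distinct (map fst fs)))"
    using mpos by (simp add: iE_plus iE_Suc flip: m_def)
  also have "(\<Sum>f\<in>H. iE k (\<lambda>fs. of_bool (fst f \<in> fst ` set fs))) / m = iE k (\<lambda>fs. avgH (\<lambda>x. of_bool (x \<in> fst ` set fs)))"
    unfolding iE_def avgH_def sum_divide_distrib[symmetric] by (subst sum.swap) (simp add: mult_ac)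
  also have "\<dots> <= iE k (\<lambda>_. real (D * k) / m)"
  proof (rule iE_mono)
    fix fs assume fs: "fs \<in> HL k"
    have "card (fst ` set fs) <= k" using fs card_image_le[of "set fs" fst] card_length[of fs] by (auto simp: HL_def)
    hence "real (D * card (fst ` set fs)) <= real (D * k)" by (intro of_nat_mono mult_le_mono) auto
    thus "avgH (\<lambda>x. of_bool (x \<in> fst ` set fs)) <= real (D * k) / m"
      using avgH_mem[of "fst ` set fs"] by (meson List.finite_set divide_right_mono finite_imageI of_nat_0_le_iff order_trans)
  qed
  finally have "iE (Suc k) (\<lambda>fs. of_bool (\<not> distinct (map fst fs))) <= real (D * k) / m + real k ^ 2 * real D / m"
    using Suc by simp
  also have "\<dots> = (real k + real k ^ 2) * (real D / m)" by (simp add: algebra_simps add_divide_distrib)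
  also have "\<dots> <= real (Suc k) ^ 2 * (real D / m)" by (intro mult_right_mono) (auto simp: power2_eq_square algebra_simps)
  finally show ?case by simp
qed simp

text \<open>Idealised walk in which every step reveals an independent uniform head.\<close>
definition isum :: "nat => nat => (arc list => real) => real" where
  "isum x t \<phi> = (\<Sum>a\<in>VL x t. wt a * \<phi> a) / real m ^ t"

lemma isum_0 [simp]: "isum x 0 \<phi> = \<phi> []" by (simp add: isum_def)

lemma isum_Suc:
  assumes "x < n"
  shows "isum x (Suc t) \<phi> = (\<Sum>k<dp x. \<Sum>f\<in>H. isum (fst f) t (\<lambda>a. \<phi> (((x, k), f) # a))) / (dp x * m)"
  unfolding isum_def sum_VL_Suc[OF assms] by (simp add: sum_divide_distrib mult_ac)

lemma isum_mono: "(\<And>a. a \<in> VL x t ==> \<phi> a <= \<psi> a) ==> isum x t \<phi> <= isum x t \<psi>"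
  unfolding isum_def by (intro divide_right_mono sum_mono mult_left_mono) auto

text \<open>In the idealised walk the heads do not depend on the chosen tails, so their joint law is
  the same from every starting vertex.\<close>

lemma isum_heads:
  assumes "x < n" shows "isum x t (\<lambda>a. \<phi> (map snd a)) = iE t \<phi>"
  using assms
proof (induction t arbitrary: x \<phi>)
  case (Suc t)
  have "isum x (Suc t) (\<lambda>a. \<phi> (map snd a)) = (\<Sum>k<dp x. \<Sum>f\<in>H. iE t (\<lambda>fs. \<phi> (f # fs))) / (dp x * m)"
    unfolding isum_Suc[OF Suc.prems]
    by (intro arg_cong2[of _ _ _ _ "(/)"] sum.cong refl) (use Suc.IH in \<open>auto simp: memH\<close>)
  moreover have "0 < dp x" using deg2[OF Suc.prems] by simp
  ultimately show ?case by (simp add: iE_Suc)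
qed simp

lemma isum_const [simp]: "x < n ==> isum x t (\<lambda>_. c) = c"
  using isum_heads[of x t "\<lambda>_. c"] by simp

text \<open>Excluding one of the \<open>dp x\<close> first tails is independent of the heads. The
  factor \<open>1 - 1 / dp x\<close> is kept exactly because it telescopes in
  \<open>XX_inner\<close>.\<close>

lemma isum_heads_first:
  assumes "x < n" "k0 < dp x"
  shows "isum x (Suc t) (\<lambda>a. of_bool (fst (hd a) \<noteq> (x, k0)) * \<phi> (map snd a)) = (1 - 1 / dp x) * iE (Suc t) \<phi>"
proof -
  have "(\<Sum>k<dp x. \<Sum>f\<in>H. isum (fst f) t (\<lambda>a. of_bool (k \<noteq> k0) * \<phi> (f # map snd a)))
     = (\<Sum>k<dp x. of_bool (k \<noteq> k0) * (\<Sum>f\<in>H. iE t (\<lambda>fs. \<phi> (f # fs))))"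
    unfolding sum_distrib_left
  proof (intro sum.cong refl)
    fix k f assume "f \<in> H"
    thus "isum (fst f) t (\<lambda>a. of_bool (k \<noteq> k0) * \<phi> (f # map snd a)) = of_bool (k \<noteq> k0) * iE t (\<lambda>fs. \<phi> (f # fs))"
      using isum_heads[of "fst f" t "\<lambda>fs. of_bool (k \<noteq> k0) * \<phi> (f # fs)"] by (simp add: memH iE_cmult)
  qed
  also have "\<dots> = (real (dp x) - 1) * (\<Sum>f\<in>H. iE t (\<lambda>fs. \<phi> (f # fs)))"
  proof -
    have "(\<Sum>k<dp x. of_bool (k \<noteq> k0)) = (\<Sum>k\<in>{..<dp x} - {k0}. 1 :: real)"
      by (intro sum.mono_neutral_cong_right) auto
    also have "\<dots> = real (dp x) - 1" using assms by (simp add: of_nat_diff)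
    finally show ?thesis by (simp flip: sum_distrib_right)
  qed
  finally show ?thesis using deg2[OF assms(1)]
    by (simp add: isum_Suc[OF assms(1)] iE_Suc field_simps)
qed

definition hw :: "head list => real" where
  "hw fs = (\<Prod>f\<leftarrow>fs. 1 / real (dp (fst f)))"

lemma hw_simps [simp]: "hw [] = 1" "hw (f # fs) = hw fs / dp (fst f)"
  by (simp_all add: hw_def)

lemma hw_append: "hw (fs @ gs) = hw fs * hw gs" by (simp add: hw_def)

lemma hw_nonneg [simp]: "0 <= hw fs" by (induction fs) auto

lemma hw_le: "set fs \<subseteq> H ==> hw fs <= (1/2) ^ length fs"
proof (induction fs)
  case (Cons f fs)
  have "2 <= real (dp (fst f))" using Cons.prems deg2[of "fst f"] by (auto simp: memH)
  hence "hw fs / real (dp (fst f)) <= (1/2) ^ length fs / 2" using Cons by (intro frac_le) auto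
  thus ?case by simp
qed simp

text \<open>Every tail after the first sits at the vertex of the preceding head. Apart from the
  factor of the first tail, a weight is therefore a product over heads, in which the last head does
  not take part. This is the bridge from the walk to independent heads.\<close>

lemma wt_tl: "valid x (z # a) ==> wt a = hw (butlast (map snd (z # a)))"
  by (induction a arbitrary: x z) auto

lemma hw_drop_le1: "hw fs <= 1"
proof (induction fs)
  case (Cons f fs)
  show ?case
  proof (cases "dp (fst f) = 0")
    case False
    hence "1 <= real (dp (fst f))" by simp
    hence "hw fs / real (dp (fst f)) <= 1 / 1" using Cons by (intro frac_le) auto
    thus ?thesis by simp
  qed simp
qed simp

text \<open>The two trajectories merge with \<open>r\<close> steps left: \<open>gg\<close> of the last \<open>r + 1\<close> heads is the
  conditional probability of merging exactly there and of never separating again.\<close>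
definition gg :: "head list => real" where
  "gg fs = (real (dm (fst (hd fs))) - 1) / m * hw (butlast fs)"

text \<open>Given the heads of a first trajectory, this is to leading order the chance that a second
  one merges with fewer than \<open>h\<close> steps left and then stays with it.\<close>

definition GG :: "nat => head list => real" where
  "GG h fs = (\<Sum>r<h. gg (drop (length fs - Suc r) fs))"

lemma gg_bounds:
  assumes "set fs \<subseteq> H" "fs \<noteq> []"
  shows "0 <= gg fs" "gg fs <= D / m * (1/2) ^ (length fs - 1)"
proof -
  have hd: "hd fs \<in> H" using assms by auto
  have d: "2 <= dm (fst (hd fs))" "dm (fst (hd fs)) <= D"
    using hd deg2 degD by (auto simp: memH)
  show "0 <= gg fs" using d by (simp add: gg_def)
  have sub: "set (butlast fs) \<subseteq> H" using assms by (meson in_set_butlastD subset_iff)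
  have "gg fs <= (D / m) * (1/2) ^ length (butlast fs)"
    unfolding gg_def using d hw_le[OF sub] by (intro mult_mono divide_right_mono) auto
  thus "gg fs <= D / m * (1/2) ^ (length fs - 1)" by simp
qed

lemma sum_half: "(\<Sum>r<h. (1/2 :: real) ^ r) <= 2"
  by (simp add: sum_gp_strict)

lemma GG_bounds:
  assumes "set fs \<subseteq> H" "h <= length fs"
  shows "0 <= GG h fs" "GG h fs <= 2 * D / m"
proof -
  have mem: "set (drop (length fs - Suc r) fs) \<subseteq> H" "drop (length fs - Suc r) fs \<noteq> []" "length (drop (length fs - Suc r) fs) = Suc r"
    if "r < h" for r using assms that set_drop_subset[of "length fs - Suc r" fs] by auto
  show "0 <= GG h fs" unfolding GG_def using gg_bounds(1) mem by (intro sum_nonneg) auto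
  have "GG h fs <= (\<Sum>r<h. D / m * (1/2) ^ r)" unfolding GG_def
    using gg_bounds(2) mem by (intro sum_mono) fastforce
  also have "\<dots> = D / m * (\<Sum>r<h. (1/2) ^ r)" by (simp add: sum_distrib_left)
  also have "\<dots> <= D / m * 2" using sum_half by (intro mult_left_mono) auto
  finally show "GG h fs <= 2 * D / m" by (simp add: mult.commute)
qed

text \<open>The common constant of the three second moments compared in \<open>star\<close>.\<close>

definition CC where "CC h = iE h (GG h)"

lemma CC_bounds: "0 <= CC h" "CC h <= 2 * D / m"
  unfolding CC_def using GG_bounds by (auto intro!: iE_nonneg simp: HL_def)
   (rule order_trans[OF iE_mono[of h _ "\<lambda>_. 2 * D / m"]], auto simp: HL_def)

lemma GG_append: "length gs = h ==> GG h (fs @ gs) = GG h gs"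
  unfolding GG_def by (intro sum.cong refl) auto

subsection \<open>Combinatorics of two merging trajectories\<close>

lemma verts_inj:
  assumes "distinct (verts a)" "z \<in> set a" "z' \<in> set a" "fst (snd z) = fst (snd z')"
  shows "z = z'"
  using assms by (auto simp: distinct_map inj_on_def)

lemma tails_verts: "valid x a ==> e \<in> fst ` set a ==> fst e \<in> set (x # verts a)"
  by (induction a arbitrary: x) auto

lemma valid_ext_T: "valid x a ==> ef \<in> set a ==> fst ef \<in> T \<and> snd ef \<in> H"
  using valid_set by fastforce

text \<open>Besides the shape of \<open>b\<close>, the definition records that the arcs up to the
  merging point have fresh and distinct tails, as \<open>Env_path_ub\<close> asks. The merging arc
  enters the vertex through a different head, since every head is matched once.\<close>

definition Mg :: "arc list => nat => arc list => bool" where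
  "Mg a r b \<longleftrightarrow> (\<exists>c e f. b = c @ (e, f) # drop (length a - r) a \<and> distinct (map fst (c @ [(e, f)]))
     \<and> fst ` set (c @ [(e, f)]) \<inter> fst ` set a = {} \<and> f \<noteq> snd (a ! (length a - Suc r))
     \<and> fst f = fst (snd (a ! (length a - Suc r))))"

text \<open>Once the common suffix is removed, the two last arcs enter the same vertex. Equal tails
  or equal heads would make them the same arc of \<open>w\<close>. A tail of \<open>a\<close> that
  enters this vertex must be that of \<open>last a0\<close>, because the vertices of
  \<open>a\<close> are distinct.\<close>

lemma suffix_facts:
  assumes "w \<in> Envs" "ext w (set a)" "ext w (set b)" "valid x a" "simple x a" "valid y b"
    and "endv y b = endv x a" "a = a0 @ s" "b = b0 @ s" "a0 \<noteq> []" "b0 \<noteq> []" "last a0 \<noteq> last b0"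
  shows "fst (snd (last b0)) = fst (snd (last a0))" "snd (last b0) \<noteq> snd (last a0)" "fst (last b0) \<notin> fst ` set a"
proof -
  have va: "valid (endv x a0) s" and vb: "valid (endv y b0) s" using assms(4,6,8,9) by (auto simp: valid_append)
  have eq: "endv x a0 = endv y b0"
  proof (cases s)
    case Nil thus ?thesis using assms(7-9) by simp
  next
    case (Cons z s') thus ?thesis using va vb by simp
  qed
  have mem: "last a0 \<in> set a" "last b0 \<in> set b" using assms(8-11) by auto
  show v: "fst (snd (last b0)) = fst (snd (last a0))"
    using eq assms(10,11) by (simp add: endv_last last_map)
  have wl: "w (fst (last a0)) = snd (last a0)" "w (fst (last b0)) = snd (last b0)"
    using assms(2,3) mem by (auto simp: ext_def)
  have ne: "fst (last a0) \<noteq> fst (last b0)" using assms(12) wl by (metis prod_eq_iff)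
  show "snd (last b0) \<noteq> snd (last a0)"
    using ne wl envs_inj[OF assms(1)] valid_ext_T[OF assms(4) mem(1)] valid_ext_T[OF assms(6) mem(2)] by metis
  show "fst (last b0) \<notin> fst ` set a"
  proof
    assume "fst (last b0) \<in> fst ` set a"
    then obtain z where z: "z \<in> set a" "fst z = fst (last b0)" by auto
    hence "snd z = snd (last b0)" using assms(2) wl by (auto simp: ext_def)
    hence "fst (snd z) = fst (snd (last a0))" using v by simp
    hence "z = last a0" using verts_inj[OF _ z(1) mem(1)] assms(5) by (simp add: simple_def)
    thus False using ne z by simp
  qed
qed

text \<open>Strip the longest common suffix; the arc of \<open>b\<close> entering it is one
  collision. If some earlier tail of \<open>b\<close> lies on \<open>a\<close>, then
  \<open>b\<close> has stepped from a fresh tail onto \<open>a\<close> before, and that step is a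
  second collision. Otherwise \<open>b\<close> has the form \<open>Mg\<close>.\<close>

lemma merge_classify:
  assumes "w \<in> Envs" "ext w (set a)" "ext w (set b)" "valid x a" "simple x a" "valid y b" "simple y b"
    and "length b <= length a" "b \<noteq> []" "fst (hd b) \<notin> fst ` set a" "endv y b = endv x a"
    and U: "set (x # verts a) \<subseteq> U"
  shows "(\<exists>r<length b. Mg a r b) \<or> 2 <= ncol (set a) U b"
proof -
  obtain a0 b0 s where s: "a = a0 @ s" "b = b0 @ s" "a0 = [] \<or> b0 = [] \<or> last a0 \<noteq> last b0"
    using common_suffix[of a b] by blast
  have b0: "b0 \<noteq> []"
  proof
    assume "b0 = []"
    hence "hd b \<in> set a" using s assms(9) by simp
    thus False using assms(10) by simp
  qed
  have "length b0 <= length a0" using assms(8) s by simp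
  hence a0: "a0 \<noteq> []" using b0 by auto
  have ne: "last a0 \<noteq> last b0" using s a0 b0 by auto
  note sf = suffix_facts[OF assms(1-6,11) s(1,2) a0 b0 ne]
  define c where "c = butlast b0"
  obtain e f where ef: "last b0 = (e, f)" by (cases "last b0")
  have b0c: "b0 = c @ [(e, f)]" using b0 ef by (metis c_def append_butlast_last_id)
  have dt: "distinct (map fst b)" using simple_tails assms by blast
  have lst: "a ! (length a - Suc (length s)) = last a0" using s a0 by (simp add: nth_append last_conv_nth)
  show ?thesis
  proof (cases "\<exists>z\<in>set c. fst z \<in> fst ` set a")
    case False
    hence disj: "fst ` set c \<inter> fst ` set a = {}" by blast
    have "Mg a (length s) b" unfolding Mg_def
    proof (intro exI conjI)
      show "b = c @ (e, f) # drop (length a - length s) a" using s b0c by simp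
      show "distinct (map fst (c @ [(e, f)]))" using dt s b0c by simp
      show "fst ` set (c @ [(e, f)]) \<inter> fst ` set a = {}" using disj sf(3) ef by simp
    qed (use sf lst ef in auto)
    moreover have "length s < length b" using b0 s by auto
    ultimately show ?thesis by blast
  next
    case True
    hence cne: "c \<noteq> []" by auto
    hence "hd c = hd b" using s b0c by simp
    hence hc: "\<not> fst (hd c) \<in> fst ` set a" using assms(10) by simp
    then obtain c1 z1 z2 c2 where c: "c = c1 @ z1 # z2 # c2" "fst z1 \<notin> fst ` set a" "fst z2 \<in> fst ` set a"
      using list_switch[OF cne hc True] by blast
    have beq: "b = c1 @ z1 # z2 # c2 @ (e, f) # s" using s b0c c by simp
    have "fst (fst z2) = fst (snd z1)" using assms(6) by (simp add: beq valid_append)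
    hence z1U: "fst (snd z1) \<in> U" using tails_verts[OF assms(4) c(3)] U by auto
    have "last a0 \<in> set a" using s a0 by simp
    hence fU: "fst f \<in> U" using sf(1) ef U by force
    have "2 <= length (filter (\<lambda>ef. fst ef \<notin> fst ` set a \<and> fst (snd ef) \<in> U) b)"
      using c(2) z1U fU sf(3) ef by (simp add: beq)
    thus ?thesis using ncol_ge_filter[OF dt, of "set a" U] by linarith
  qed
qed

text \<open>If all tails of \<open>b\<close> lie on \<open>a\<close>, an arc entering the common
  suffix would contradict \<open>suffix_facts\<close>; so \<open>b\<close> is a suffix of
  \<open>a\<close>, and equal lengths give \<open>b = a\<close>. Otherwise the last fresh arc of
  \<open>b\<close> leads to a vertex of \<open>a\<close>, which is a collision.\<close>

lemma follow_classify:
  assumes "w \<in> Envs" "ext w (set a)" "ext w (set b)" "valid x a" "simple x a" "valid y b" "simple y b"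
    and "length b = length a" "b \<noteq> []" "fst (hd b) \<in> fst ` set a" "endv y b = endv x a"
    and U: "set (x # verts a) \<subseteq> U"
  shows "(y = x \<and> b = a) \<or> (y \<in> set (x # verts a) \<and> 1 <= ncol (set a) U b)"
proof -
  have y: "y = fst (fst (hd b))" using assms(6,9) by (cases b) auto
  show ?thesis
  proof (cases "\<exists>z\<in>set b. fst z \<notin> fst ` set a")
    case False
    obtain a0 b0 s where s: "a = a0 @ s" "b = b0 @ s" "a0 = [] \<or> b0 = [] \<or> last a0 \<noteq> last b0"
      using common_suffix[of a b] by blast
    have len: "length a0 = length b0" using assms(8) s by simp
    have "b0 = []"
    proof (rule ccontr)
      assume b0: "b0 \<noteq> []"
      hence a0: "a0 \<noteq> []" using len by auto
      have "fst (last b0) \<notin> fst ` set a"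
        using suffix_facts(3)[OF assms(1-6,11) s(1,2) a0 b0] s a0 b0 by auto
      thus False using False s b0 by auto
    qed
    hence "a = b" using s len by simp
    moreover have "x = y" using assms(4) y \<open>a = b\<close> assms(9) by (cases a) auto
    ultimately show ?thesis by simp
  next
    case True
    then obtain b1 z b2 where b: "b = b1 @ z # b2" "fst z \<notin> fst ` set a" "\<forall>z\<in>set b2. fst z \<in> fst ` set a"
      using split_list_last_prop[of b "\<lambda>z. fst z \<notin> fst ` set a"] by auto
    have ane: "a \<noteq> []" using assms(8,9) by auto
    have "fst (snd z) \<in> set (x # verts a)"
    proof (cases b2)
      case Nil
      hence "fst (snd z) = endv x a" using b assms(11) by (simp add: endv_last)
      thus ?thesis using ane by (simp add: endv_last) (metis last_in_set list.set_map map_is_Nil_conv)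
    next
      case (Cons z2 b3)
      hence "fst (fst z2) = fst (snd z)" using assms(6) b by (simp add: valid_append)
      thus ?thesis using tails_verts[OF assms(4), of "fst z2"] b(3) Cons by auto
    qed
    hence "1 <= length (filter (\<lambda>ef. fst ef \<notin> fst ` set a \<and> fst (snd ef) \<in> U) b)"
      using b(1,2) U by auto
    moreover have "distinct (map fst b)" using simple_tails assms by blast
    ultimately have "1 <= ncol (set a) U b" using ncol_ge_filter[of b "set a" U] by linarith
    moreover have "y \<in> set (x # verts a)" using tails_verts[OF assms(4,10)] y by simp
    ultimately show ?thesis by blast
  qed
qed

text \<open>Splits by the number \<open>l\<close> of initial arcs shared with \<open>a\<close>; the
  indicator expresses that the tail of \<open>a ! l\<close> is not the next one taken.\<close>

lemma QE_prefix:
  assumes "w \<in> Envs" "ext w (set a)" "valid x a" "x < n"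
  shows "QE w (length a) x \<phi> = wt a * \<phi> a + (\<Sum>l<length a. wt (take l a) *
     QE w (length a - l) (endv x (take l a)) (\<lambda>b. of_bool (fst (hd b) \<noteq> fst (a ! l)) * \<phi> (take l a @ b)))"
  using assms(2-)
proof (induction a arbitrary: x \<phi>)
  case (Cons ef a)
  obtain k0 f where ef: "ef = ((x, k0), f)" using Cons.prems by (cases ef) auto
  have k0: "k0 < dp x" using Cons.prems by (auto simp: ef memT)
  have wf: "w (x, k0) = f" using Cons.prems by (auto simp: ef ext_def)
  have IH: "QE w (length a) (fst f) (\<lambda>b. \<phi> (ef # b)) = wt a * \<phi> (ef # a) + (\<Sum>l<length a. wt (take l a) *
     QE w (length a - l) (endv (fst f) (take l a)) (\<lambda>b. of_bool (fst (hd b) \<noteq> fst (a ! l)) * \<phi> (ef # take l a @ b)))"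
    by (rule Cons.IH) (use Cons.prems in \<open>auto simp: ef ext_insert memH\<close>)
  let ?S = "\<lambda>k. QE w (length a) (fst (w (x, k))) (\<lambda>b. \<phi> (((x, k), w (x, k)) # b))"
  have "QE w (length (ef # a)) x \<phi> = (\<Sum>k<dp x. ?S k) / dp x"
    using QE_Suc[OF assms(1) Cons.prems(3), of "length a" \<phi>] by simp
  also have "(\<Sum>k<dp x. ?S k) = ?S k0 + (\<Sum>k\<in>{..<dp x} - {k0}. ?S k)"
    by (rule sum.remove) (use k0 in auto)
  also have "(\<Sum>k\<in>{..<dp x} - {k0}. ?S k) = (\<Sum>k<dp x. of_bool (k \<noteq> k0) * ?S k)"
    by (rule sum.mono_neutral_cong_left) auto
  also have "\<dots> / dp x = QE w (Suc (length a)) x (\<lambda>b. of_bool (fst (hd b) \<noteq> (x, k0)) * \<phi> b)"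
    unfolding QE_Suc[OF assms(1) Cons.prems(3)] by (simp add: QE_cmult)
  hence "(?S k0 + (\<Sum>k<dp x. of_bool (k \<noteq> k0) * ?S k)) / dp x
     = ?S k0 / dp x + QE w (Suc (length a)) x (\<lambda>b. of_bool (fst (hd b) \<noteq> (x, k0)) * \<phi> b)"
    by (simp add: add_divide_distrib)
  also have "?S k0 = QE w (length a) (fst f) (\<lambda>b. \<phi> (ef # b))" by (simp add: wf ef)
  also note IH
  finally show ?case
    by (simp add: sum.lessThan_Suc_shift ef add_divide_distrib sum_divide_distrib del: sum.lessThan_Suc)
qed simp

end

section \<open>Counting pairs of trajectories that merge\<close>

context config begin

text \<open>Any environment containing all the arcs certifies that they form a matching; when there
  is none, the left side vanishes.\<close>

lemma Env_path_ub:
  assumes "valid y b" "distinct (map fst b)" "fst ` g \<inter> fst ` set b = {}" "g \<subseteq> T \<times> H"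
    and "card g + length b <= K" "K < m"
  shows "real (card (Env (g \<union> set b))) <= card (Env g) / (real m - real K) ^ length b"
proof (cases "Env (g \<union> set b) = {}")
  case True
  thus ?thesis using assms(6) by simp
next
  case False
  have "pmatch (g \<union> set b)" by (rule Env_pmatch[OF False]) (use assms valid_set in auto)
  moreover have "card (set b) = length b" using assms(2) by (simp add: distinct_card distinct_map)
  ultimately show ?thesis using Env_card_bounds(2)[of "set b" g K] assms by simp
qed

lemma heads_H: "valid x a ==> set (map snd a) \<subseteq> H"
  by (induction a arbitrary: x) auto

lemma gg_wt:
  assumes "valid x a" "Suc r <= length a"
  shows "gg (drop (length a - Suc r) (map snd a))
     = (real (dm (fst (snd (a ! (length a - Suc r))))) - 1) / m * wt (drop (length a - r) a)"
proof -
  let ?i = "length a - Suc r"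
  have i: "?i < length a" "Suc ?i = length a - r" using assms by auto
  have d: "drop ?i a = a ! ?i # drop (length a - r) a" using Cons_nth_drop_Suc[OF i(1)] i(2) by simp
  have "valid (endv x (take ?i a)) (drop ?i a)"
    using assms(1) valid_append[of x "take ?i a" "drop ?i a"] by simp
  hence "wt (drop (length a - r) a) = hw (butlast (map snd (drop ?i a)))"
    using wt_tl d by metis
  thus ?thesis unfolding gg_def drop_map by (simp add: d)
qed

lemma heads_others: "f \<in> H ==> real (card {f'\<in>H. fst f' = fst f \<and> f' \<noteq> f}) = real (dm (fst f)) - 1"
proof -
  assume f: "f \<in> H"
  have "{f'\<in>H. fst f' = fst f \<and> f' \<noteq> f} = {f'\<in>H. fst f' = fst f} - {f}" by auto
  moreover have "card ({f'\<in>H. fst f' = fst f} - {f}) = card {f'\<in>H. fst f' = fst f} - 1"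
    using f by (intro card_Diff_singleton) auto
  moreover have "card {f'\<in>H. fst f' = fst f} = dm (fst f)" "1 <= dm (fst f)"
    using heads_at[of "fst f"] f deg2[of "fst f"] by (auto simp: memH)
  ultimately show ?thesis by (simp add: of_nat_diff)
qed

text \<open>A merging trajectory is determined by its part \<open>c\<close> before the merging arc,
  a tail index \<open>k\<close> at the end of \<open>c\<close>, and one of the \<open>dm - 1\<close>
  other heads at the merging vertex; the rest copies \<open>a\<close>. Thus \<open>t' - r\<close>
  fresh arcs are revealed. Summing over \<open>k\<close> cancels the factor \<open>1 / dp\<close>.
  The \<open>1 / m\<close> of one fresh arc, the number \<open>dm - 1\<close> and the weight of the
  copied part combine into \<open>gg\<close>.\<close>

lemma merge_ub:
  assumes "valid x a" "Suc r <= length a" "r < t'" "y < n" "length a + t' <= K" "K < m"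
    and "\<And>c. 0 <= \<Psi> c"
  shows "(\<Sum>w\<in>Env (set a). QE w t' y (\<lambda>b. of_bool (Mg a r b) * \<Psi> (take (t' - Suc r) b)))
    <= card (Env (set a)) * ((real m / (real m - real K)) ^ (t' - r)
       * (gg (drop (length a - Suc r) (map snd a)) * isum y (t' - Suc r) \<Psi>))"
proof -
  define z where "z = a ! (length a - Suc r)"
  define dr where "dr = drop (length a - r) a"
  define FS where "FS = {f\<in>H. fst f = fst (snd z) \<and> f \<noteq> snd z}"
  define S where "S = (SIGMA c:VL y (t' - Suc r). {..<dp (endv y c)} \<times> FS)"
  define G where "G = (\<lambda>(c, k, f). c @ ((endv y c, k), f) # dr)"
  define F where "F b = wt b * (of_bool (Mg a r b) * \<Psi> (take (t' - Suc r) b)) * card (Env (set a \<union> set b))" for b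
  define Q where "Q = card (Env (set a)) / (real m - real K) ^ (t' - r)"
  have F0: "0 <= F b" for b using assms(7) by (simp add: F_def)
  have Q0: "0 <= Q" using assms(6) by (simp add: Q_def)
  have zH: "snd z \<in> H" using valid_ext_T[OF assms(1), of z] assms(2) by (simp add: z_def)
  have FSc: "real (card FS) = real (dm (fst (snd z))) - 1" unfolding FS_def by (rule heads_others[OF zH])
  have finFS: "finite FS" by (simp add: FS_def)
  have finS: "finite S" unfolding S_def using finFS by auto
  have sub: "{b\<in>VL y t'. Mg a r b} \<subseteq> G ` S"
  proof
    fix b assume "b \<in> {b\<in>VL y t'. Mg a r b}"
    then obtain c e f where b: "valid y b" "length b = t'" "b = c @ (e, f) # dr" "f \<noteq> snd z" "fst f = fst (snd z)"
      unfolding Mg_def VL_def dr_def[symmetric] z_def[symmetric] by auto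
    have ldr: "length dr = r" using assms(2) by (simp add: dr_def)
    have v: "valid y c" "fst e = endv y c" "e \<in> T" "f \<in> H" using b by (auto simp: valid_append)
    have "(c, snd e, f) \<in> S" using v b ldr by (auto simp: S_def VL_def FS_def memT)
    moreover have "b = G (c, snd e, f)" using b v by (cases e) (auto simp: G_def)
    ultimately show "b \<in> G ` S" by blast
  qed
  have Fb: "F (G s) <= (case s of (c, k, f) => wt c / dp (endv y c) * wt dr * \<Psi> c * Q)" if "s \<in> S" for s
  proof -
    obtain c k f where s: "s = (c, k, f)" by (cases s)
    have c: "c \<in> VL y (t' - Suc r)" "k < dp (endv y c)" "f \<in> FS" using that by (auto simp: S_def s)
    have wtG: "wt (G s) = wt c / dp (endv y c) * wt dr" by (simp add: s G_def wt_append)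
    have tk: "take (t' - Suc r) (G s) = c" using c by (simp add: s G_def VL_def)
    show ?thesis
    proof (cases "Mg a r (G s)")
      case False
      thus ?thesis using Q0 assms(7)[of c] by (simp add: F_def s)
    next
      case True
      let ?c = "c @ [((endv y c, k), f)]"
      have M: "distinct (map fst ?c)" "fst ` set ?c \<inter> fst ` set a = {}"
      proof -
        obtain c' e' f' where b: "G s = c' @ (e', f') # dr"
          "distinct (map fst (c' @ [(e', f')])) \<and> fst ` set (c' @ [(e', f')]) \<inter> fst ` set a = {}"
          using True unfolding Mg_def dr_def[symmetric] by blast
        have "?c = c' @ [(e', f')]" using b(1) by (auto simp: s G_def)
        with b(2) show "distinct (map fst ?c)" "fst ` set ?c \<inter> fst ` set a = {}" by metis+
      qed
      have vc: "valid y ?c" using c valid_endv[of y c] assms(4) by (auto simp: VL_def valid_append memT FS_def)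
      have "set a \<union> set (G s) = set a \<union> set ?c" using set_drop_subset[of "length a - r" a] by (auto simp: s G_def dr_def)
      moreover have "real (card (Env (set a \<union> set ?c))) <= card (Env (set a)) / (real m - real K) ^ length ?c"
      proof (rule Env_path_ub[OF vc M(1) _ valid_set[OF assms(1)] _ assms(6)])
        show "fst ` set a \<inter> fst ` set ?c = {}" using M(2) by blast
        show "card (set a) + length ?c <= K" using c assms(3,5) card_length[of a] by (simp add: VL_def)
      qed
      moreover have "length ?c = t' - r" using c assms(3) by (simp add: VL_def)
      ultimately have E: "real (card (Env (set a \<union> set (G s)))) <= Q" unfolding Q_def by metis
      have "F (G s) = wt c / dp (endv y c) * wt dr * \<Psi> c * card (Env (set a \<union> set (G s)))"
        using True by (simp add: F_def wtG tk)
      also have "\<dots> <= wt c / dp (endv y c) * wt dr * \<Psi> c * Q"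
        by (rule mult_left_mono[OF E]) (use assms(7) in auto)
      finally show ?thesis by (simp add: s)
    qed
  qed
  have "(\<Sum>w\<in>Env (set a). QE w t' y (\<lambda>b. of_bool (Mg a r b) * \<Psi> (take (t' - Suc r) b))) = (\<Sum>b\<in>VL y t'. F b)"
    unfolding sum_Env_QE_const F_def ..
  also have "\<dots> = (\<Sum>b\<in>{b\<in>VL y t'. Mg a r b}. F b)"
    by (rule sum.mono_neutral_right) (auto simp: F_def)
  also have "\<dots> <= (\<Sum>b\<in>G ` S. F b)" by (rule sum_mono2) (use sub F0 finS in auto)
  also have "\<dots> <= (\<Sum>s\<in>S. F (G s))" using sum_image_le[OF finS, of F G] F0 by (simp add: o_def)
  also have "\<dots> <= (\<Sum>s\<in>S. case s of (c, k, f) => wt c / dp (endv y c) * wt dr * \<Psi> c * Q)" by (rule sum_mono[OF Fb])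
  also have "\<dots> = (\<Sum>c\<in>VL y (t' - Suc r). \<Sum>(k, f)\<in>{..<dp (endv y c)} \<times> FS. wt c / dp (endv y c) * wt dr * \<Psi> c * Q)"
    unfolding S_def using finFS by (subst sum.Sigma) (auto simp: case_prod_unfold)
  also have "\<dots> = (\<Sum>c\<in>VL y (t' - Suc r). wt c * \<Psi> c * (card FS * wt dr * Q))"
  proof (rule sum.cong[OF refl])
    fix c assume "c \<in> VL y (t' - Suc r)"
    hence "endv y c < n" using valid_endv assms(4) by (auto simp: VL_def)
    hence "dp (endv y c) \<noteq> 0" using deg2 by force
    thus "(\<Sum>(k, f)\<in>{..<dp (endv y c)} \<times> FS. wt c / dp (endv y c) * wt dr * \<Psi> c * Q) = wt c * \<Psi> c * (card FS * wt dr * Q)"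
      by (simp add: case_prod_unfold card_cartesian_product)
  qed
  also have "\<dots> = card (Env (set a)) * ((real m / (real m - real K)) ^ (t' - r)
       * (gg (drop (length a - Suc r) (map snd a)) * isum y (t' - Suc r) \<Psi>))"
  proof -
    have mm: "real m ^ (t' - r) = real m * real m ^ (t' - Suc r)"
      using assms(3) by (metis Suc_diff_Suc power_Suc)
    have alg: "J * ((d - 1) * v * (E / x)) = E * (M * M' / x * ((d - 1) / M * v * (J / M')))"
      if "M \<noteq> 0" "M' \<noteq> 0" "x \<noteq> 0" for J d v E x M M' :: real using that by (simp add: field_simps)
    show ?thesis unfolding gg_wt[OF assms(1,2)] isum_def Q_def z_def[symmetric] dr_def[symmetric] FSc power_divide mm
      sum_distrib_right[symmetric] by (rule alg) (use mpos assms(6) in auto)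
  qed
  finally show ?thesis .
qed

text \<open>The window skips the first \<open>h\<close> heads and, for length
  \<open>2 * h + 1 + N\<close>, the last \<open>h + 1\<close>. How two trajectories separate near
  the start and merge near the end then does not affect lightness.\<close>

definition low :: "nat => nat => real => arc list => bool" where
  "low h N \<theta> a \<longleftrightarrow> hw (take N (drop h (map snd a))) <= \<theta>"

definition qq :: "nat => real => real" where
  "qq N \<theta> = iE N (\<lambda>fs. of_bool (hw fs <= \<theta>))"

lemma qq_bounds: "0 <= qq N \<theta>" "qq N \<theta> <= 1"
  unfolding qq_def using iE_mono[of N _ "\<lambda>_. 1"] by (auto intro!: iE_nonneg)

lemma QE_single: "QE w t x (\<lambda>b. of_bool (b = a)) <= (1/2) ^ t"
proof -
  have "QE w t x (\<lambda>b. of_bool (b = a)) = (\<Sum>b\<in>VL x t. if b = a then wt a * of_bool (ext w (set a)) else 0)"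
    unfolding QE_def by (intro sum.cong refl) auto
  also have "\<dots> <= (1/2) ^ t"
    by (subst sum.delta[OF finite_VL]) (use wt_le[of x a] in \<open>auto simp: VL_def\<close>)
  finally show ?thesis .
qed

lemma tail_verts: "valid x a ==> map (\<lambda>ef. fst (fst ef)) a = butlast (x # verts a)"
proof (induction a arbitrary: x)
  case (Cons ef a)
  hence "map (\<lambda>ef. fst (fst ef)) a = butlast (verts (ef # a))" and "fst (fst ef) = x" by simp_all
  thus ?case by simp
qed simp

lemma wt_take_Suc:
  assumes "valid x a" "l < length a"
  shows "wt (take (Suc l) a) = wt (take l a) / dp (endv x (take l a))"
    and "fst (fst (a ! l)) = endv x (take l a)" "snd (fst (a ! l)) < dp (endv x (take l a))"
proof -
  have "a = take l a @ a ! l # drop (Suc l) a" using assms(2) by (simp add: id_take_nth_drop)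
  hence v: "valid x (take l a @ a ! l # drop (Suc l) a)" using assms(1) by metis
  show *: "fst (fst (a ! l)) = endv x (take l a)" "snd (fst (a ! l)) < dp (endv x (take l a))"
    using v by (auto simp: valid_append memT)
  show "wt (take (Suc l) a) = wt (take l a) / dp (endv x (take l a))"
    using assms(2) by (simp add: take_Suc_conv_app_nth wt_append * )
qed

end

section \<open>The second moment of the light walk\<close>

locale walk_config = config +
  fixes t h N K :: nat and p \<theta> :: real
  assumes teq: "t = 2 * h + 1 + N" and h1: "1 <= h" and Kdef: "K = 2 * t" and Km: "K < m"
    and pD: "real (D * (2 * t + 2)) <= p * (real m - real K)" and th0: "0 <= \<theta>"
begin

text \<open>Price for treating up to \<open>t\<close> fresh arcs as drawn with replacement while at
  most \<open>K\<close> arcs are revealed.\<close>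

definition RR where "RR = (real m / (real m - real K)) ^ t"

lemma base1: "1 <= real m / (real m - real K)" using Km by (simp add: field_simps)

lemma RR1: "1 <= RR" unfolding RR_def using base1 by (rule one_le_power)

lemma RR_pow: "j <= t ==> (real m / (real m - real K)) ^ j <= RR"
  unfolding RR_def by (rule power_increasing) (use base1 in auto)

lemma p0: "0 <= p"
proof (rule ccontr)
  assume "\<not> 0 <= p"
  hence "p * (real m - real K) < 0" using Km by (simp add: mult_neg_pos)
  moreover have "0 <= real (D * (2 * t + 2))" by simp
  ultimately show False using pD by linarith
qed

text \<open>Two trajectories of length at most \<open>t\<close> reveal at most
  \<open>2 * t = K\<close> arcs and visit at most \<open>2 * t + 2\<close> vertices, which carry at
  most \<open>D * (2 * t + 2)\<close> heads. The assumption \<open>pD\<close> on \<open>p\<close> is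
  made for this count.\<close>

lemma col_path:
  assumes "valid x a" "length a <= t" "y < n" "t' <= t"
  shows "(\<Sum>w\<in>Env (set a). QE w t' y (\<lambda>b. of_bool (j <= ncol (set a) (set (y # x # verts a)) b)))
     <= card (Env (set a)) * (real t * p) ^ j"
proof (cases "Env (set a) = {}")
  case False
  have pm: "pmatch (set a)" by (rule Env_pmatch[OF False valid_set[OF assms(1)]])
  have ca: "card (set a) <= t" using card_length[of a] assms(2) by linarith
  have "card (set (y # x # verts a)) <= length (y # x # verts a)" by (rule card_length)
  hence "card (set (y # x # verts a)) + t' <= 2 * t + 2" using assms by simp
  hence "real (D * (card (set (y # x # verts a)) + t')) <= real (D * (2 * t + 2))"
    by (intro of_nat_mono mult_le_mono) auto
  also have "\<dots> <= p * (real m - real K)" by (rule pD)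
  also have "\<dots> <= p * (real m - real (card (set a)) - real t')"
    by (rule mult_left_mono) (use p0 ca assms Kdef in auto)
  finally have "(\<Sum>w\<in>Env (set a). QE w t' y (\<lambda>b. of_bool (j <= ncol (set a) (set (y # x # verts a)) b)))
     <= card (Env (set a)) * (real t' * p) ^ j"
    by (intro col_bound[OF pm _ assms(3)]) (use ca assms Km Kdef in auto)
  also have "\<dots> <= card (Env (set a)) * (real t * p) ^ j"
    by (intro mult_left_mono power_mono mult_right_mono) (use p0 assms in auto)
  finally show ?thesis .
qed simp

lemma Env_simple_ub:
  assumes "valid x a" "simple x a" "length a <= t"
  shows "real (card (Env (set a))) <= card (Envs) * RR / real m ^ length a"
proof -
  have "real (card (Env (set a))) <= card (Envs) / (real m - real K) ^ length a"
    using Env_path_ub[OF assms(1) simple_tails[OF assms(1,2)], of "{}" K] assms(3) Km Kdef by simp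
  also have "\<dots> = card (Envs) * (real m / (real m - real K)) ^ length a / real m ^ length a"
    using mpos by (simp add: power_divide)
  also have "\<dots> <= card (Envs) * RR / real m ^ length a"
    by (intro divide_right_mono mult_left_mono RR_pow assms) auto
  finally show ?thesis .
qed

lemma gg_r_bounds:
  assumes "valid x a" "r < length a"
  shows "0 <= gg (drop (length a - Suc r) (map snd a))"
    "gg (drop (length a - Suc r) (map snd a)) <= D / m * (1/2) ^ r"
proof -
  have s: "set (drop (length a - Suc r) (map snd a)) \<subseteq> H"
  proof -
    have "snd ` set a \<subseteq> H" using valid_set[OF assms(1)] by auto
    thus ?thesis using set_drop_subset[of "length a - Suc r" "map snd a"] by simp
  qed
  have ne: "drop (length a - Suc r) (map snd a) \<noteq> []" using assms by simp
  have le: "length (drop (length a - Suc r) (map snd a)) - 1 = r" using assms by simp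
  show "0 <= gg (drop (length a - Suc r) (map snd a))" using gg_bounds(1)[OF s ne] .
  show "gg (drop (length a - Suc r) (map snd a)) <= D / m * (1/2) ^ r" using gg_bounds(2)[OF s ne] le by simp
qed

lemma GG_heads: "length a = l ==> GG h (map snd a) = (\<Sum>r<h. gg (drop (l - Suc r) (map snd a)))"
  by (simp add: GG_def)

lemma geo_tail: "(\<Sum>r\<in>{h..<k}. (1/2 :: real) ^ r) <= 2 * (1/2) ^ h"
proof (cases "h <= k")
  case True
  have "(\<Sum>r\<in>{h..<k}. (1/2 :: real) ^ r) = (\<Sum>r\<in>{0..<k - h}. (1/2) ^ (r + h))"
    using True sum.shift_bounds_nat_ivl[of "\<lambda>r. (1/2 :: real) ^ r" 0 h "k - h"] by simp
  also have "\<dots> = (1/2) ^ h * (\<Sum>r<k - h. (1/2) ^ r)"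
    by (simp add: power_add sum_distrib_left mult.commute atLeast0LessThan)
  also have "\<dots> <= (1/2) ^ h * 2" by (intro mult_left_mono sum_half) auto
  finally show ?thesis by simp
qed simp

text \<open>For a fixed first trajectory \<open>a\<close>, the second one equals \<open>a\<close>,
  or leaves it after \<open>l\<close> arcs and merges with \<open>r\<close> steps left, or has two
  collisions. If \<open>l <= h\<close> and \<open>r < h\<close>, its window lies in its fresh part,
  which yields a factor \<open>qq N \<theta>\<close> next to \<open>gg\<close>. The remaining pairs
  \<open>(l, r)\<close> are summed geometrically and cost \<open>2^-h\<close>.\<close>

lemma XX_inner:
  assumes a: "valid x a" "simple x a" "length a = t" and x: "x < n"
  shows "(\<Sum>w\<in>Env (set a). QE w t x (\<lambda>b. of_bool (simple x b \<and> low h N \<theta> b \<and> endv x b = endv x a)))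
     <= card (Env (set a)) * (wt a + 2 * (real t * p)^2 + RR * (qq N \<theta> * GG h (map snd a) + 6 * D / m * (1/2)^h))"
proof -
  define v where "v l = endv x (take l a)" for l
  define g where "g r = gg (drop (t - Suc r) (map snd a))" for r
  define \<phi> where "\<phi> b = (of_bool (simple x b \<and> low h N \<theta> b \<and> endv x b = endv x a) :: real)" for b
  \<comment> \<open>Condition inherited by the part between departure and merging. Outside
    \<open>l <= h\<close>, \<open>r < h\<close> the window may overlap arcs shared with
    \<open>a\<close>, and the default \<open>1\<close> drops the condition. An empty part cannot
    violate the condition on its first tail.\<close>
  define \<Psi> where "\<Psi> l r c = (if l <= h \<and> r < h then of_bool (c \<noteq> [] \<longrightarrow> fst (hd c) \<noteq> fst (a ! l)) *
      of_bool (hw (take N (drop (h - l) (map snd c))) <= \<theta>) else (1 :: real))" for l r and c :: "arc list"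
  have \<Psi>0: "0 <= \<Psi> l r c" for l r c by (simp add: \<Psi>_def)
  have vn: "v l < n" for l unfolding v_def
    using valid_endv[of x "take l a"] valid_append[of x "take l a" "drop l a"] a x by simp
  have point: "of_bool (fst (hd b) \<noteq> fst (a ! l)) * \<phi> (take l a @ b)
     <= (\<Sum>r<t - l. of_bool (Mg a r b) * \<Psi> l r (take (t - l - Suc r) b))
        + of_bool (2 <= ncol (set a) (set (v l # x # verts a)) b)"
    if w: "w \<in> Env (set a)" and l: "l < t" and b: "b \<in> VL (v l) (t - l)" "ext w (set b)" for w l b
  proof (cases "fst (hd b) \<noteq> fst (a ! l) \<and> simple x (take l a @ b) \<and> low h N \<theta> (take l a @ b) \<and> endv x (take l a @ b) = endv x a")
    case False
    thus ?thesis using \<Psi>0 by (auto simp: \<phi>_def intro!: add_nonneg_nonneg sum_nonneg)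
  next
    case True
    have bv: "valid (v l) b" "length b = t - l" "b \<noteq> []" using b l by (auto simp: VL_def)
    have sb: "simple (v l) b"
    proof -
      have "distinct (x # verts (take l a) @ verts b)" using True by (simp add: simple_def)
      moreover have "v l \<in> set (x # verts (take l a))" unfolding v_def endv_last using last_in_set by blast
      ultimately show ?thesis by (auto simp: simple_def)
    qed
    have hd: "fst (hd b) \<notin> fst ` set a"
    proof
      assume "fst (hd b) \<in> fst ` set a"
      then obtain z where z: "z \<in> set a" "fst (hd b) = fst z" by auto
      hence "fst (fst z) = v l" using bv by (cases b) auto
      also have "v l = fst (fst (a ! l))" using wt_take_Suc(2)[OF a(1)] l a(3) by (simp add: v_def)
      finally have e: "fst (fst z) = fst (fst (a ! l))" .
      have "distinct (map (\<lambda>ef. fst (fst ef)) a)"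
        unfolding tail_verts[OF a(1)] using a(2) distinct_butlast unfolding simple_def by blast
      hence "z = a ! l" using e z(1) l a(3) by (simp add: distinct_map inj_on_def)
      thus False using True z by simp
    qed
    have endb: "endv (v l) b = endv x a" using True by (simp add: v_def)
    have "(\<exists>r<length b. Mg a r b) \<or> 2 <= ncol (set a) (set (v l # x # verts a)) b"
      by (rule merge_classify[OF Env_sub[OF w] Env_ext[OF w] b(2) a(1,2) bv(1) sb _ bv(3) hd endb]) (use a l bv in auto)
    thus ?thesis
    proof
      assume "\<exists>r<length b. Mg a r b"
      then obtain r where r: "r < t - l" "Mg a r b" using bv by auto
      then obtain c e f where c: "b = c @ (e, f) # drop (t - r) a" using a(3) unfolding Mg_def by blast
      have lc: "length c = t - l - Suc r" using bv(2) r a(3) by (simp add: c)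
      have tk: "take (t - l - Suc r) b = c" using lc by (simp add: c)
      have "\<Psi> l r c = 1"
      proof (cases "l <= h \<and> r < h")
        case lr: True
        \<comment> \<open>The part \<open>c\<close> has \<open>(h - l) + N + (h - r)\<close> arcs,
          so the window of the full trajectory begins \<open>h - l\<close> arcs after the departure
          and ends before the merging arc.\<close>
        have "take N (drop h (map snd (take l a @ b))) = take N (drop (h - l) (map snd c))"
          using lr l a(3) lc teq by (simp add: c)
        moreover have "c \<noteq> [] \<longrightarrow> fst (hd c) \<noteq> fst (a ! l)" using True by (auto simp: c)
        ultimately show ?thesis using True lr by (simp add: \<Psi>_def low_def)
      next
        case lr: False
        show ?thesis unfolding \<Psi>_def if_not_P[OF lr] ..
      qed
      hence "1 <= of_bool (Mg a r b) * \<Psi> l r (take (t - l - Suc r) b)" using r tk by simp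
      also have "\<dots> <= (\<Sum>r<t - l. of_bool (Mg a r b) * \<Psi> l r (take (t - l - Suc r) b))"
        by (rule member_le_sum[of r]) (use r \<Psi>0 in auto)
      finally show ?thesis by (simp add: \<phi>_def)
    next
      assume "2 <= ncol (set a) (set (v l # x # verts a)) b"
      hence "of_bool (2 <= ncol (set a) (set (v l # x # verts a)) b) = (1 :: real)" by simp
      moreover have "0 <= (\<Sum>r<t - l. of_bool (Mg a r b) * \<Psi> l r (take (t - l - Suc r) b))"
        by (intro sum_nonneg) (simp add: \<Psi>0)
      moreover have "of_bool (fst (hd b) \<noteq> fst (a ! l)) * \<phi> (take l a @ b) <= 1" by (simp add: \<phi>_def)
      ultimately show ?thesis by linarith
    qed
  qed
  have iota: "isum (v l) (t - l - Suc r) (\<Psi> l r) <= (if l <= h \<and> r < h then (1 - 1 / dp (v l)) * qq N \<theta> else 1)"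
    if l: "l < t" "r < t - l" for l r
  proof (cases "l <= h \<and> r < h")
    case True
    define j where "j = t - l - Suc (Suc r)"
    have j: "t - l - Suc r = Suc j" "Suc j = (h - l) + N + (h - r)" using True teq by (auto simp: j_def)
    have al: "fst (a ! l) = (v l, snd (fst (a ! l)))" "snd (fst (a ! l)) < dp (v l)"
      using wt_take_Suc(2,3)[OF a(1)] l a(3) by (auto simp: v_def prod_eq_iff)
    have "isum (v l) (Suc j) (\<Psi> l r) <= isum (v l) (Suc j) (\<lambda>c. of_bool (fst (hd c) \<noteq> (v l, snd (fst (a ! l)))) *
        of_bool (hw (take N (drop (h - l) (map snd c))) <= \<theta>))"
      by (rule isum_mono) (use True al in \<open>auto simp: \<Psi>_def VL_def\<close>)
    also have "\<dots> = (1 - 1 / dp (v l)) * iE (Suc j) (\<lambda>fs. of_bool (hw (take N (drop (h - l) fs)) <= \<theta>))"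
      by (rule isum_heads_first[OF vn al(2), where \<phi> = "\<lambda>fs. of_bool (hw (take N (drop (h - l) fs)) <= \<theta>)"])
    also have "iE (Suc j) (\<lambda>fs. of_bool (hw (take N (drop (h - l) fs)) <= \<theta>)) = qq N \<theta>"
      unfolding j(2) qq_def by (rule iE_mid)
    finally show ?thesis using True j by simp
  next
    case False
    thus ?thesis using isum_const[OF vn, of l _ 1] by (auto simp: \<Psi>_def[abs_def] if_P)
  qed
  have g0: "0 <= g r" "g r <= D / m * (1/2) ^ r" if "r < t" for r
    using gg_r_bounds[OF a(1)] that a(3) by (auto simp: g_def)
  have wl: "wt (take l a) <= (1/2) ^ l" if "l < t" for l
    using wt_le[of x "take l a"] valid_append[of x "take l a" "drop l a"] a that by simp
  \<comment> \<open>The factors \<open>1 - 1 / dp (v l)\<close> turn the weights into differences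
    \<open>wt (take l a) - wt (take (Suc l) a)\<close>, whose sum telescopes to at most
    \<open>1\<close>. The constant \<open>6\<close> is \<open>2 * 2\<close> from pairs with
    \<open>l <= h\<close> and \<open>r >= h\<close>, plus \<open>2\<close> from
    \<open>l > h\<close>.\<close>
  have dbl: "(\<Sum>l<t. wt (take l a) * (\<Sum>r<t - l. g r * (if l <= h \<and> r < h then (1 - 1 / dp (v l)) * qq N \<theta> else 1)))
     <= qq N \<theta> * GG h (map snd a) + 6 * D / m * (1/2)^h"
  proof -
    have each: "wt (take l a) * (\<Sum>r<t - l. g r * (if l <= h \<and> r < h then (1 - 1 / dp (v l)) * qq N \<theta> else 1))
      <= of_bool (l <= h) * (wt (take l a) - wt (take (Suc l) a)) * (qq N \<theta> * GG h (map snd a))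
        + (D / m * 2 * (1/2)^h * (1/2)^l + of_bool (h < l) * (D / m * 2) * (1/2)^l)" (is "?L <= ?A + ?B") if l: "l < t" for l
    proof (cases "l <= h")
      case True
      have d: "1 <= real (dp (v l))" using deg2[OF vn, of l] by simp
      have c0: "0 <= (1 - 1 / dp (v l)) * qq N \<theta>" using d qq_bounds(1) by (intro mult_nonneg_nonneg) auto
      have "(\<Sum>r<t - l. g r * (if l <= h \<and> r < h then (1 - 1 / dp (v l)) * qq N \<theta> else 1))
         = (\<Sum>r<t - l. g r * (if r < h then (1 - 1 / dp (v l)) * qq N \<theta> else 1))"
        using True by simp
      also have "\<dots> <= (\<Sum>r<t. g r * (if r < h then (1 - 1 / dp (v l)) * qq N \<theta> else 1))"
      proof (rule sum_mono2)
        fix r assume "r \<in> {..<t} - {..<t - l}"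
        thus "0 <= g r * (if r < h then (1 - 1 / dp (v l)) * qq N \<theta> else 1)"
          using c0 g0(1)[of r] by (intro mult_nonneg_nonneg) auto
      qed auto
      also have "\<dots> = (\<Sum>r<h. g r * ((1 - 1 / dp (v l)) * qq N \<theta>)) + (\<Sum>r\<in>{h..<t}. g r)"
      proof -
        have *: "{..<t} = {..<h} \<union> {h..<t}" using teq by auto
        show ?thesis unfolding * by (subst sum.union_disjoint) auto
      qed
      also have "(\<Sum>r<h. g r * ((1 - 1 / dp (v l)) * qq N \<theta>)) = (1 - 1 / dp (v l)) * (qq N \<theta> * GG h (map snd a))"
        unfolding GG_heads[OF a(3)] by (simp add: g_def sum_distrib_left mult_ac)
      also have "(\<Sum>r\<in>{h..<t}. g r) <= D / m * (2 * (1/2)^h)"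
      proof -
        have "(\<Sum>r\<in>{h..<t}. g r) <= (\<Sum>r\<in>{h..<t}. D / m * (1/2)^r)" by (intro sum_mono g0) auto
        also have "\<dots> = D / m * (\<Sum>r\<in>{h..<t}. (1/2)^r)" by (simp add: sum_distrib_left)
        also have "\<dots> <= D / m * (2 * (1/2)^h)" by (intro mult_left_mono geo_tail) auto
        finally show ?thesis .
      qed
      finally have "?L <= wt (take l a) * ((1 - 1 / dp (v l)) * (qq N \<theta> * GG h (map snd a)) + D / m * (2 * (1/2)^h))"
        by (intro mult_left_mono) auto
      also have "\<dots> = (wt (take l a) - wt (take (Suc l) a)) * (qq N \<theta> * GG h (map snd a)) + wt (take l a) * (D / m * (2 * (1/2)^h))"
        using wt_take_Suc(1)[OF a(1), of l] l a(3) by (simp add: v_def algebra_simps)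
      also have "wt (take l a) * (D / m * (2 * (1/2)^h)) <= (1/2)^l * (D / m * (2 * (1/2)^h))"
        by (rule mult_right_mono[OF wl[OF l]]) simp
      finally show ?thesis using True by (simp add: mult_ac)
    next
      case False
      have "(\<Sum>r<t - l. g r) <= (\<Sum>r<t - l. D / m * (1/2)^r)" by (intro sum_mono g0) auto
      also have "\<dots> = D / m * (\<Sum>r<t - l. (1/2)^r)" by (simp add: sum_distrib_left)
      also have "\<dots> <= D / m * 2" by (intro mult_left_mono sum_half) auto
      finally have "?L <= (1/2)^l * (D / m * 2)" using False g0
        by (simp only: if_False simp_thms mult_1_right) (intro mult_mono wl[OF l], auto intro!: sum_nonneg)
      also have "\<dots> <= ?A + ?B" using False by (simp add: mult.commute[of "(1/2) ^ l"])
      finally show ?thesis .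
    qed
    have "(\<Sum>l<t. wt (take l a) * (\<Sum>r<t - l. g r * (if l <= h \<and> r < h then (1 - 1 / dp (v l)) * qq N \<theta> else 1)))
      <= (\<Sum>l<t. of_bool (l <= h) * (wt (take l a) - wt (take (Suc l) a)) * (qq N \<theta> * GG h (map snd a))
        + (D / m * 2 * (1/2)^h * (1/2)^l + of_bool (h < l) * (D / m * 2) * (1/2)^l))"
      by (rule sum_mono) (use each in auto)
    also have "\<dots> = (\<Sum>l<t. of_bool (l <= h) * (wt (take l a) - wt (take (Suc l) a))) * (qq N \<theta> * GG h (map snd a))
        + (D / m * 2 * (1/2)^h * (\<Sum>l<t. (1/2)^l) + D / m * 2 * (\<Sum>l<t. of_bool (h < l) * (1/2)^l))"
      by (simp only: sum.distrib sum_distrib_left sum_distrib_right mult_ac)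
    also have "(\<Sum>l<t. of_bool (l <= h) * (wt (take l a) - wt (take (Suc l) a))) = (\<Sum>l<Suc h. wt (take l a) - wt (take (Suc l) a))"
      by (rule sum.mono_neutral_cong_right) (use teq in auto)
    also have "\<dots> = 1 - wt (take (Suc h) a)" by (subst sum_lessThan_telescope') simp
    also have "(\<Sum>l<t. of_bool (h < l) * (1/2 :: real)^l) = (\<Sum>l\<in>{Suc h..<t}. (1/2)^l)"
      by (rule sum.mono_neutral_cong_right) auto
    also have "(\<Sum>l\<in>{Suc h..<t}. (1/2 :: real)^l) = (\<Sum>l\<in>{h..<t - 1}. (1/2)^(Suc l))"
      using sum.shift_bounds_Suc_ivl[of "\<lambda>l. (1/2 :: real)^l" h "t - 1"] teq by simp
    also have "\<dots> = 1/2 * (\<Sum>l\<in>{h..<t - 1}. (1/2)^l)" by (simp add: sum_distrib_left)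
    finally have 1: "(\<Sum>l<t. wt (take l a) * (\<Sum>r<t - l. g r * (if l <= h \<and> r < h then (1 - 1 / dp (v l)) * qq N \<theta> else 1)))
      <= (1 - wt (take (Suc h) a)) * (qq N \<theta> * GG h (map snd a)) + (D / m * 2 * (1/2)^h * (\<Sum>l<t. (1/2)^l) + D / m * 2 * (1/2 * (\<Sum>l\<in>{h..<t - 1}. (1/2)^l)))" .
    have qg: "0 <= qq N \<theta> * GG h (map snd a)"
      using qq_bounds(1) GG_bounds(1)[OF heads_H[OF a(1)], of h] a(3) teq by (intro mult_nonneg_nonneg) auto
    have a1: "(1 - wt (take (Suc h) a)) * (qq N \<theta> * GG h (map snd a)) <= 1 * (qq N \<theta> * GG h (map snd a))"
      by (rule mult_right_mono[OF _ qg]) simp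
    have a2: "D / m * 2 * (1/2)^h * (\<Sum>l<t. (1/2)^l) <= D / m * 2 * (1/2)^h * 2"
      by (intro mult_left_mono sum_half) auto
    have a3: "D / m * 2 * (1/2 * (\<Sum>l\<in>{h..<t - 1}. (1/2)^l)) <= D / m * 2 * (1/2 * (2 * (1/2)^h))"
      by (intro mult_left_mono geo_tail) auto
    have e: "6 * D / m * (1/2)^h = D / m * 2 * (1/2)^h * 2 + D / m * 2 * (1/2 * (2 * (1/2 :: real)^h))"
      by (simp add: algebra_simps)
    show ?thesis using order_trans[OF 1 add_mono[OF a1 add_mono[OF a2 a3]]] by (simp only: e mult_1_left)
  qed
  have "(\<Sum>w\<in>Env (set a). QE w t x \<phi>) <= (\<Sum>w\<in>Env (set a). wt a + (\<Sum>l<t. wt (take l a) *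
      ((\<Sum>r<t - l. QE w (t - l) (v l) (\<lambda>b. of_bool (Mg a r b) * \<Psi> l r (take (t - l - Suc r) b)))
       + QE w (t - l) (v l) (\<lambda>b. of_bool (2 <= ncol (set a) (set (v l # x # verts a)) b)))))"
  proof (rule sum_mono)
    fix w assume w: "w \<in> Env (set a)"
    have "QE w t x \<phi> = wt a * \<phi> a + (\<Sum>l<t. wt (take l a) *
       QE w (t - l) (v l) (\<lambda>b. of_bool (fst (hd b) \<noteq> fst (a ! l)) * \<phi> (take l a @ b)))"
      using QE_prefix[OF Env_sub[OF w] Env_ext[OF w] a(1) x, of \<phi>] a(3) by (simp add: v_def)
    also have "\<dots> <= wt a * 1 + (\<Sum>l<t. wt (take l a) *
       QE w (t - l) (v l) (\<lambda>b. (\<Sum>r<t - l. of_bool (Mg a r b) * \<Psi> l r (take (t - l - Suc r) b))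
        + of_bool (2 <= ncol (set a) (set (v l # x # verts a)) b)))"
      by (intro add_mono mult_left_mono sum_mono QE_mono point[OF w]) (auto simp: \<phi>_def)
    finally show "QE w t x \<phi> <= wt a + (\<Sum>l<t. wt (take l a) *
      ((\<Sum>r<t - l. QE w (t - l) (v l) (\<lambda>b. of_bool (Mg a r b) * \<Psi> l r (take (t - l - Suc r) b)))
       + QE w (t - l) (v l) (\<lambda>b. of_bool (2 <= ncol (set a) (set (v l # x # verts a)) b))))"
      unfolding QE_add QE_sum mult_1_right .
  qed
  also have "\<dots> = card (Env (set a)) * wt a + (\<Sum>l<t. wt (take l a) *
      ((\<Sum>r<t - l. \<Sum>w\<in>Env (set a). QE w (t - l) (v l) (\<lambda>b. of_bool (Mg a r b) * \<Psi> l r (take (t - l - Suc r) b)))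
       + (\<Sum>w\<in>Env (set a). QE w (t - l) (v l) (\<lambda>b. of_bool (2 <= ncol (set a) (set (v l # x # verts a)) b)))))"
    unfolding sum.distrib sum.swap[of _ _ "Env (set a)"] sum_distrib_left[symmetric]
    by (simp add: sum.swap[of _ _ "Env (set a)"] sum.distrib)
  also have "\<dots> <= card (Env (set a)) * wt a + (\<Sum>l<t. wt (take l a) *
      ((\<Sum>r<t - l. card (Env (set a)) * (RR * (g r * (if l <= h \<and> r < h then (1 - 1 / dp (v l)) * qq N \<theta> else 1))))
       + card (Env (set a)) * (real t * p)^2))"
  proof (intro add_left_mono sum_mono mult_left_mono add_mono)
    fix l r assume l: "l \<in> {..<t}" and r: "r \<in> {..<t - l}"
    have "(\<Sum>w\<in>Env (set a). QE w (t - l) (v l) (\<lambda>b. of_bool (Mg a r b) * \<Psi> l r (take (t - l - Suc r) b)))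
      <= card (Env (set a)) * ((real m / (real m - real K)) ^ (t - l - r)
       * (gg (drop (length a - Suc r) (map snd a)) * isum (v l) (t - l - Suc r) (\<Psi> l r)))"
      by (rule merge_ub[OF a(1) _ _ vn _ Km]) (use l r a(3) Kdef \<Psi>0 in auto)
    also have "\<dots> <= card (Env (set a)) * (RR * (g r * (if l <= h \<and> r < h then (1 - 1 / dp (v l)) * qq N \<theta> else 1)))"
    proof (rule mult_left_mono[OF mult_mono])
      show "gg (drop (length a - Suc r) (map snd a)) * isum (v l) (t - l - Suc r) (\<Psi> l r)
         <= g r * (if l <= h \<and> r < h then (1 - 1 / dp (v l)) * qq N \<theta> else 1)"
        unfolding g_def a(3) by (rule mult_left_mono[OF iota]) (use g0[of r] l r in \<open>auto simp: g_def\<close>)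
      show "0 <= gg (drop (length a - Suc r) (map snd a)) * isum (v l) (t - l - Suc r) (\<Psi> l r)"
        using g0[of r] l r a(3) \<Psi>0 unfolding isum_def
        by (intro mult_nonneg_nonneg divide_nonneg_nonneg sum_nonneg) (auto simp: g_def)
    qed (use RR_pow RR1 in auto)
    finally show "(\<Sum>w\<in>Env (set a). QE w (t - l) (v l) (\<lambda>b. of_bool (Mg a r b) * \<Psi> l r (take (t - l - Suc r) b)))
      <= card (Env (set a)) * (RR * (g r * (if l <= h \<and> r < h then (1 - 1 / dp (v l)) * qq N \<theta> else 1)))" .
  next
    fix l assume "l \<in> {..<t}"
    show "(\<Sum>w\<in>Env (set a). QE w (t - l) (v l) (\<lambda>b. of_bool (2 <= ncol (set a) (set (v l # x # verts a)) b)))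
      <= card (Env (set a)) * (real t * p)^2"
      by (rule col_path[OF a(1) _ vn]) (use a in auto)
  qed auto
  also have "\<dots> = card (Env (set a)) * (wt a + (\<Sum>l<t. wt (take l a)) * (real t * p)^2 + RR *
      (\<Sum>l<t. wt (take l a) * (\<Sum>r<t - l. g r * (if l <= h \<and> r < h then (1 - 1 / dp (v l)) * qq N \<theta> else 1))))"
    by (simp only: ring_distribs sum.distrib sum_distrib_left sum_distrib_right mult_ac add_ac)
  also have "\<dots> <= card (Env (set a)) * (wt a + 2 * (real t * p)^2 + RR * (qq N \<theta> * GG h (map snd a) + 6 * D / m * (1/2)^h))"
  proof (intro mult_left_mono add_mono order_refl mult_right_mono dbl)
    have "(\<Sum>l<t. wt (take l a)) <= (\<Sum>l<t. (1/2)^l)" by (rule sum_mono) (use wl in auto)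
    thus "(\<Sum>l<t. wt (take l a)) <= 2" using sum_half[of t] by linarith
  qed (use RR1 in auto)
  finally show ?thesis unfolding \<phi>_def[abs_def] .
qed

end

lemma of_bool_le3:
  fixes A B C :: real
  assumes "0 <= A" "0 <= B" "0 <= C" "P ==> 1 <= A \<or> 1 <= B \<or> 1 <= C"
  shows "of_bool P <= A + B + C"
  using assms by (cases P) auto

context config begin

lemma sum_wt_Env: "x < n ==> (\<Sum>a\<in>VL x l. wt a * card (Env (set a))) = card (Envs)"
  using sum_Env_QE_const[where g = "{}" and t = l and x = x and \<phi> = "\<lambda>_. 1"] QE_const by simp

lemma sum_envs_QE:
  "(\<Sum>w\<in>Envs. QE w t x (\<lambda>a. c a * \<psi> w a)) = (\<Sum>a\<in>VL x t. wt a * (c a * (\<Sum>w\<in>Env (set a). \<psi> w a)))"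
  using sum_Env_QE[where g = "{}" and t = t and x = x and \<phi> = "\<lambda>w a. c a * \<psi> w a"]
  by (simp add: sum_distrib_left)

text \<open>An inner product of two endpoint laws is the mass of pairs of trajectories that meet;
  the second moments enter in this form.\<close>

lemma QE_meet:
  assumes "x < n"
  shows "(\<Sum>j<n. QE w t x (\<lambda>a. \<phi> a * of_bool (endv x a = j)) * QE w s y (\<lambda>b. \<psi> b * of_bool (endv y b = j)))
    = QE w t x (\<lambda>a. \<phi> a * QE w s y (\<lambda>b. \<psi> b * of_bool (endv y b = endv x a)))"
proof -
  have "(\<Sum>j<n. QE w t x (\<lambda>a. \<phi> a * of_bool (endv x a = j)) * QE w s y (\<lambda>b. \<psi> b * of_bool (endv y b = j)))
    = QE w t x (\<lambda>a. \<Sum>j<n. \<phi> a * of_bool (endv x a = j) * QE w s y (\<lambda>b. \<psi> b * of_bool (endv y b = j)))"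
    unfolding QE_sum QE_cmult2 ..
  also have "\<dots> = QE w t x (\<lambda>a. \<phi> a * QE w s y (\<lambda>b. \<psi> b * of_bool (endv y b = endv x a)))"
  proof (rule QE_cong)
    fix a assume "a \<in> VL x t"
    hence e: "endv x a < n" using valid_endv assms by (auto simp: VL_def)
    have "(\<Sum>j<n. \<phi> a * of_bool (endv x a = j) * QE w s y (\<lambda>b. \<psi> b * of_bool (endv y b = j)))
      = (\<Sum>j<n. if j = endv x a then \<phi> a * QE w s y (\<lambda>b. \<psi> b * of_bool (endv y b = endv x a)) else 0)"
      by (intro sum.cong refl) auto
    thus "(\<Sum>j<n. \<phi> a * of_bool (endv x a = j) * QE w s y (\<lambda>b. \<psi> b * of_bool (endv y b = j)))
      = \<phi> a * QE w s y (\<lambda>b. \<psi> b * of_bool (endv y b = endv x a))" using e by simp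
  qed
  finally show ?thesis .
qed

end

context walk_config begin

text \<open>All factors outside the window are at most \<open>1\<close>, and the last head, which
  contributes no factor, lies outside it. This bounds the diagonal term of the second moment by
  \<open>\<theta>\<close>.\<close>

lemma wt_le_mid:
  assumes "valid x a" "length a = t" shows "wt a <= hw (take N (drop h (map snd a)))"
proof -
  obtain z b where zb: "a = z # b" using assms(2) teq by (cases a) auto
  have d: "1 <= real (dp (fst (fst z)))" using assms(1) deg2[of "fst (fst z)"] by (auto simp: zb memT)
  have "wt a = wt b / dp (fst (fst z))" by (simp add: zb)
  also have "\<dots> <= wt b / 1" using d by (intro divide_left_mono) auto
  also have "wt b = hw (butlast (map snd a))" using wt_tl[of x z b] assms(1) by (simp only: zb)
  also have "butlast (map snd a) = take h (map snd a) @ take N (drop h (map snd a)) @ drop (h + N) (butlast (map snd a))"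
  proof -
    have "take (h + N) (butlast (map snd a)) = take (h + N) (map snd a)"
      by (rule take_butlast) (use assms(2) teq in simp)
    also have "\<dots> = take h (map snd a) @ take N (drop h (map snd a))" by (rule take_add)
    finally show ?thesis by (metis append.assoc append_take_drop_id)
  qed
  also have "hw \<dots> = hw (take N (drop h (map snd a))) * (hw (take h (map snd a)) * hw (drop (h + N) (butlast (map snd a))))"
    by (simp add: hw_append mult_ac)
  also have "\<dots> <= hw (take N (drop h (map snd a))) * 1"
    by (intro mult_left_mono mult_le_one hw_drop_le1) auto
  finally show ?thesis by simp
qed

text \<open>The window lies within the first \<open>h + N + 1\<close> heads and \<open>GG h\<close>
  looks at the last \<open>h\<close> ones, so the two factors are independent.\<close>

lemma isum_low_GG:
  assumes "x < n"
  shows "isum x t (\<lambda>a. of_bool (low h N \<theta> a) * GG h (map snd a)) = qq N \<theta> * CC h"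
proof -
  have tt: "t = (h + N + 1) + h" using teq by simp
  have "isum x t (\<lambda>a. of_bool (low h N \<theta> a) * GG h (map snd a))
    = iE t (\<lambda>fs. of_bool (hw (take N (drop h fs)) <= \<theta>) * GG h fs)"
    unfolding low_def by (rule isum_heads[OF assms, where \<phi> = "\<lambda>fs. of_bool (hw (take N (drop h fs)) <= \<theta>) * GG h fs"])
  also have "\<dots> = iE (h + N + 1) (\<lambda>fs. iE h (\<lambda>gs. of_bool (hw (take N (drop h fs)) <= \<theta>) * GG h gs))"
    unfolding tt iE_add by (intro iE_cong) (auto simp: HL_def GG_append simp del: append_assoc)
  also have "\<dots> = iE (h + N + 1) (\<lambda>fs. of_bool (hw (take N (drop h fs)) <= \<theta>)) * CC h"
    by (simp add: iE_cmult iE_cmult2 CC_def)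
  also have "iE (h + N + 1) (\<lambda>fs. of_bool (hw (take N (drop h fs)) <= \<theta>)) = qq N \<theta>"
    unfolding qq_def by (rule iE_mid)
  finally show ?thesis .
qed

text \<open>Sums \<open>XX_inner\<close> over \<open>a\<close>. The error terms keep the exact
  number of environments, whose weighted sum is known. In the main term that number is replaced by
  its bound of order \<open>m^-t\<close>, which produces the second \<open>RR\<close> and lets
  \<open>isum_low_GG\<close> apply.\<close>

lemma XX_ub:
  assumes x: "x < n"
  shows "(\<Sum>w\<in>Envs. QE w t x (\<lambda>a. of_bool (simple x a \<and> low h N \<theta> a) *
       QE w t x (\<lambda>b. of_bool (simple x b \<and> low h N \<theta> b \<and> endv x b = endv x a))))
    <= card (Envs) * (\<theta> + 2 * (real t * p)^2 + RR * (6 * D / m * (1/2)^h) + RR * RR * (qq N \<theta> * (qq N \<theta> * CC h)))"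
proof -
  let ?E = "real (card (Envs))"
  let ?e = "2 * (real t * p)^2 + RR * (6 * D / m * (1/2)^h)"
  have "(\<Sum>w\<in>Envs. QE w t x (\<lambda>a. of_bool (simple x a \<and> low h N \<theta> a) *
       QE w t x (\<lambda>b. of_bool (simple x b \<and> low h N \<theta> b \<and> endv x b = endv x a))))
    = (\<Sum>a\<in>VL x t. wt a * (of_bool (simple x a \<and> low h N \<theta> a) *
        (\<Sum>w\<in>Env (set a). QE w t x (\<lambda>b. of_bool (simple x b \<and> low h N \<theta> b \<and> endv x b = endv x a)))))"
    by (rule sum_envs_QE)
  also have "\<dots> <= (\<Sum>a\<in>VL x t. (\<theta> + ?e) * (wt a * card (Env (set a)))
     + ?E * RR * RR * qq N \<theta> * (wt a * (of_bool (low h N \<theta> a) * GG h (map snd a)) / real m ^ t))"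
  proof (rule sum_mono)
    fix a assume aV: "a \<in> VL x t"
    hence a: "valid x a" "length a = t" by (auto simp: VL_def)
    have e0: "0 <= ?e" using RR1 by simp
    have GG0: "0 <= GG h (map snd a)" using GG_bounds(1)[OF heads_H[OF a(1)], of h] a(2) teq by simp
    have R0: "0 <= ?E * RR * RR * qq N \<theta> * (wt a * (of_bool (low h N \<theta> a) * GG h (map snd a)) / real m ^ t)"
      using RR1 qq_bounds(1)[of N \<theta>] GG0 by (intro mult_nonneg_nonneg divide_nonneg_nonneg) auto
    show "wt a * (of_bool (simple x a \<and> low h N \<theta> a) *
        (\<Sum>w\<in>Env (set a). QE w t x (\<lambda>b. of_bool (simple x b \<and> low h N \<theta> b \<and> endv x b = endv x a))))
      <= (\<theta> + ?e) * (wt a * card (Env (set a)))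
       + ?E * RR * RR * qq N \<theta> * (wt a * (of_bool (low h N \<theta> a) * GG h (map snd a)) / real m ^ t)"
    proof (cases "simple x a \<and> low h N \<theta> a")
      case False
      have n0: "0 <= (\<theta> + ?e) * (wt a * card (Env (set a)))" using e0 th0 by (intro mult_nonneg_nonneg) auto
      have z: "of_bool (simple x a \<and> low h N \<theta> a) = (0 :: real)" using False by (simp only: of_bool_eq)
      show ?thesis unfolding z mult_zero_left mult_zero_right by (rule add_nonneg_nonneg[OF n0 R0])
    next
      case True
      have w\<theta>: "wt a <= \<theta>" using wt_le_mid[OF a] True by (simp add: low_def)
      have "(\<Sum>w\<in>Env (set a). QE w t x (\<lambda>b. of_bool (simple x b \<and> low h N \<theta> b \<and> endv x b = endv x a)))
        <= card (Env (set a)) * (wt a + 2 * (real t * p)^2 + RR * (qq N \<theta> * GG h (map snd a) + 6 * D / m * (1/2)^h))"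
        by (rule XX_inner[OF a(1) _ a(2) x]) (use True in simp)
      also have "\<dots> = card (Env (set a)) * (wt a + ?e) + card (Env (set a)) * (RR * qq N \<theta> * GG h (map snd a))"
        by (simp add: algebra_simps)
      also have "\<dots> <= card (Env (set a)) * (\<theta> + ?e) + (?E * RR / real m ^ t) * (RR * qq N \<theta> * GG h (map snd a))"
        using Env_simple_ub[OF a(1)] a(2) True w\<theta> GG0 RR1 qq_bounds(1)[of N \<theta>]
        by (intro add_mono mult_left_mono mult_right_mono mult_nonneg_nonneg) auto
      finally have "wt a * (\<Sum>w\<in>Env (set a). QE w t x (\<lambda>b. of_bool (simple x b \<and> low h N \<theta> b \<and> endv x b = endv x a)))
        <= wt a * (card (Env (set a)) * (\<theta> + ?e) + (?E * RR / real m ^ t) * (RR * qq N \<theta> * GG h (map snd a)))"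
        by (rule mult_left_mono) simp
      thus ?thesis using True by (simp add: algebra_simps)
    qed
  qed
  also have "\<dots> = (\<theta> + ?e) * ?E + ?E * RR * RR * qq N \<theta> * isum x t (\<lambda>a. of_bool (low h N \<theta> a) * GG h (map snd a))"
    unfolding sum.distrib sum_distrib_left[symmetric] sum_wt_Env[OF x] isum_def sum_divide_distrib ..
  also have "\<dots> = ?E * (\<theta> + 2 * (real t * p)^2 + RR * (6 * D / m * (1/2)^h) + RR * RR * (qq N \<theta> * (qq N \<theta> * CC h)))"
    unfolding isum_low_GG[OF x] by (simp add: algebra_simps)
  finally show ?thesis .
qed

abbreviation (input) meets :: "nat => arc list => nat => arc list => real" where
  "meets y b x a \<equiv> of_bool (simple y b \<and> endv y b = endv x a)"

text \<open>Here the second walk starts from a uniform head. It begins on a tail of \<open>a\<close>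
  only if \<open>y\<close> is a vertex of \<open>a\<close>, which has probability at most
  \<open>D (h + 1) / m\<close>; then it collides once more, unless it coincides with
  \<open>a\<close>. Otherwise it merges as in \<open>Mg\<close> or collides twice.\<close>

lemma NN_inner:
  assumes a: "valid x a" "simple x a" "length a = h" and x: "x < n"
  shows "avgH (\<lambda>y. \<Sum>w\<in>Env (set a). QE w h y (\<lambda>b. meets y b x a))
    <= card (Env (set a)) * (RR * GG h (map snd a) + ((real t * p)^2 + real (D * (h + 1)) / m * (real t * p) + real D / m * (1/2)^h))"
proof -
  let ?c = "real (card (Env (set a)))"
  have ht: "h <= t" using teq by simp
  have each: "(\<Sum>w\<in>Env (set a). QE w h y (\<lambda>b. meets y b x a))
     <= ?c * (RR * GG h (map snd a)) + ?c * (real t * p)^2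
        + (of_bool (y \<in> set (x # verts a)) * (?c * (real t * p)) + of_bool (y \<in> {x}) * (?c * (1/2)^h))" if y: "y < n" for y
  proof -
    let ?U = "set (y # x # verts a)"
    have "(\<Sum>w\<in>Env (set a). QE w h y (\<lambda>b. meets y b x a))
      <= (\<Sum>w\<in>Env (set a). QE w h y (\<lambda>b. (\<Sum>r<h. of_bool (Mg a r b) * 1) + of_bool (2 <= ncol (set a) ?U b)
          + (of_bool (y \<in> set (x # verts a)) * of_bool (1 <= ncol (set a) ?U b) + of_bool (y \<in> {x}) * of_bool (b = a))))"
    proof (intro sum_mono QE_mono)
      fix w b assume w: "w \<in> Env (set a)" and b: "b \<in> VL y h" "ext w (set b)"
      show "meets y b x a <= (\<Sum>r<h. of_bool (Mg a r b) * 1) + of_bool (2 <= ncol (set a) ?U b)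
          + (of_bool (y \<in> set (x # verts a)) * of_bool (1 <= ncol (set a) ?U b) + of_bool (y \<in> {x}) * (of_bool (b = a) :: real))"
        (is "_ <= ?A + ?B + ?C")
      proof (rule of_bool_le3)
        show "0 <= ?A" "0 <= ?B" "0 <= ?C" by (auto intro: sum_nonneg)
        assume True: "simple y b \<and> endv y b = endv x a"
        have bv: "valid y b" "length b = h" "b \<noteq> []" using b h1 by (auto simp: VL_def)
        show "1 <= ?A \<or> 1 <= ?B \<or> 1 <= ?C"
        proof (cases "fst (hd b) \<in> fst ` set a")
          case hd: True
          have "(y = x \<and> b = a) \<or> (y \<in> set (x # verts a) \<and> 1 <= ncol (set a) ?U b)"
            by (rule follow_classify[OF Env_sub[OF w] Env_ext[OF w] b(2) a(1,2) bv(1) _ _ bv(3) hd]) (use True a bv in auto)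
          thus ?thesis by auto
        next
          case hd: False
          have "(\<exists>r<length b. Mg a r b) \<or> 2 <= ncol (set a) ?U b"
            by (rule merge_classify[OF Env_sub[OF w] Env_ext[OF w] b(2) a(1,2) bv(1) _ _ bv(3) hd]) (use True a bv in auto)
          thus ?thesis
          proof
            assume "\<exists>r<length b. Mg a r b"
            then obtain r where r: "r < h" "Mg a r b" using bv by auto
            have "of_bool (Mg a r b) * (1 :: real) <= ?A" by (rule member_le_sum) (use r in auto)
            thus ?thesis using r by auto
          qed simp
        qed
      qed
    qed
    also have "\<dots> = (\<Sum>r<h. \<Sum>w\<in>Env (set a). QE w h y (\<lambda>b. of_bool (Mg a r b) * 1))
       + (\<Sum>w\<in>Env (set a). QE w h y (\<lambda>b. of_bool (2 <= ncol (set a) ?U b)))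
       + (of_bool (y \<in> set (x # verts a)) * (\<Sum>w\<in>Env (set a). QE w h y (\<lambda>b. of_bool (1 <= ncol (set a) ?U b)))
          + of_bool (y \<in> {x}) * (\<Sum>w\<in>Env (set a). QE w h y (\<lambda>b. of_bool (b = a))))"
      unfolding QE_add QE_sum QE_cmult sum.distrib sum_distrib_left sum.swap[of _ "Env (set a)" "{..<h}"] ..
    also have "\<dots> <= (\<Sum>r<h. ?c * (RR * gg (drop (h - Suc r) (map snd a)))) + ?c * (real t * p)^2
       + (of_bool (y \<in> set (x # verts a)) * (?c * (real t * p)^1) + of_bool (y \<in> {x}) * (?c * (1/2)^h))"
    proof (intro add_mono sum_mono mult_left_mono)
      fix r assume r: "r \<in> {..<h}"
      have "(\<Sum>w\<in>Env (set a). QE w h y (\<lambda>b. of_bool (Mg a r b) * 1))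
        <= ?c * ((real m / (real m - real K)) ^ (h - r) * (gg (drop (length a - Suc r) (map snd a)) * isum y (h - Suc r) (\<lambda>_. 1)))"
        by (rule merge_ub[OF a(1) _ _ y _ Km]) (use r a teq Kdef in auto)
      also have "\<dots> <= ?c * (RR * gg (drop (h - Suc r) (map snd a)))"
        unfolding isum_const[OF y] mult_1_right a(3)
        by (intro mult_left_mono mult_right_mono RR_pow) (use gg_r_bounds(1)[OF a(1), of r] r a(3) ht in auto)
      finally show "(\<Sum>w\<in>Env (set a). QE w h y (\<lambda>b. of_bool (Mg a r b) * 1)) <= ?c * (RR * gg (drop (h - Suc r) (map snd a)))" .
    next
      show "(\<Sum>w\<in>Env (set a). QE w h y (\<lambda>b. of_bool (2 <= ncol (set a) ?U b))) <= ?c * (real t * p)^2"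
        by (rule col_path[OF a(1) _ y ht]) (use a ht in simp)
      show "(\<Sum>w\<in>Env (set a). QE w h y (\<lambda>b. of_bool (1 <= ncol (set a) ?U b))) <= ?c * (real t * p)^1"
        by (rule col_path[OF a(1) _ y ht]) (use a ht in simp)
      have "(\<Sum>w\<in>Env (set a). QE w h y (\<lambda>b. of_bool (b = a))) <= (\<Sum>w\<in>Env (set a). (1/2)^h)"
        by (intro sum_mono QE_single)
      thus "(\<Sum>w\<in>Env (set a). QE w h y (\<lambda>b. of_bool (b = a))) <= ?c * (1/2)^h" by simp
    qed auto
    finally show ?thesis unfolding GG_heads[OF a(3)] by (simp add: sum_distrib_left)
  qed
  have "avgH (\<lambda>y. \<Sum>w\<in>Env (set a). QE w h y (\<lambda>b. meets y b x a))
    <= avgH (\<lambda>y. ?c * (RR * GG h (map snd a)) + ?c * (real t * p)^2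
        + (of_bool (y \<in> set (x # verts a)) * (?c * (real t * p)) + of_bool (y \<in> {x}) * (?c * (1/2)^h)))"
    by (rule avgH_mono[OF each])
  also have "\<dots> = ?c * (RR * GG h (map snd a)) + ?c * (real t * p)^2
        + (avgH (\<lambda>y. of_bool (y \<in> set (x # verts a))) * (?c * (real t * p)) + avgH (\<lambda>y. of_bool (y \<in> {x})) * (?c * (1/2)^h))"
    by (simp only: avgH_add avgH_cmult2 avgH_const)
  also have "\<dots> <= ?c * (RR * GG h (map snd a)) + ?c * (real t * p)^2
        + (real (D * (h + 1)) / m * (?c * (real t * p)) + real D / m * (?c * (1/2)^h))"
  proof (intro add_left_mono add_mono mult_right_mono)
    have "card (set (x # verts a)) <= h + 1" using card_length[of "x # verts a"] a by simp
    hence "real (D * card (set (x # verts a))) <= real (D * (h + 1))" by (intro of_nat_mono mult_le_mono) auto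
    thus "avgH (\<lambda>y. of_bool (y \<in> set (x # verts a))) <= real (D * (h + 1)) / m"
      using avgH_mem[of "set (x # verts a)"] by (meson List.finite_set divide_right_mono of_nat_0_le_iff order_trans)
    show "avgH (\<lambda>y. of_bool (y \<in> {x})) <= real D / m" using avgH_mem[of "{x}"] by simp
  qed (use p0 in auto)
  also have "\<dots> = ?c * (RR * GG h (map snd a) + ((real t * p)^2 + real (D * (h + 1)) / m * (real t * p) + real D / m * (1/2)^h))"
    by (simp add: algebra_simps)
  finally show ?thesis .
qed

lemma NN_ub:
  "avgH (\<lambda>x. avgH (\<lambda>y. \<Sum>w\<in>Envs. QE w h x (\<lambda>a. of_bool (simple x a) *
       QE w h y (\<lambda>b. meets y b x a))))
    <= card (Envs) * (RR * RR * CC h + ((real t * p)^2 + real (D * (h + 1)) / m * (real t * p) + real D / m * (1/2)^h))"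
proof -
  let ?E = "real (card (Envs))"
  let ?e = "(real t * p)^2 + real (D * (h + 1)) / m * (real t * p) + real D / m * (1/2)^h"
  have e0: "0 <= ?e" using p0 by simp
  have each: "avgH (\<lambda>y. \<Sum>w\<in>Envs. QE w h x (\<lambda>a. of_bool (simple x a) *
       QE w h y (\<lambda>b. meets y b x a))) <= ?E * (RR * RR * CC h + ?e)" if x: "x < n" for x
  proof -
    have "avgH (\<lambda>y. \<Sum>w\<in>Envs. QE w h x (\<lambda>a. of_bool (simple x a) *
       QE w h y (\<lambda>b. meets y b x a)))
      = (\<Sum>a\<in>VL x h. wt a * (of_bool (simple x a) * avgH (\<lambda>y. \<Sum>w\<in>Env (set a). QE w h y (\<lambda>b. meets y b x a))))"
      unfolding sum_envs_QE avgH_sum avgH_cmult ..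
    also have "\<dots> <= (\<Sum>a\<in>VL x h. ?e * (wt a * card (Env (set a))) + ?E * RR * RR * (wt a * GG h (map snd a) / real m ^ h))"
    proof (rule sum_mono)
      fix a assume "a \<in> VL x h"
      hence a: "valid x a" "length a = h" by (auto simp: VL_def)
      have GG0: "0 <= GG h (map snd a)" using GG_bounds(1)[OF heads_H[OF a(1)], of h] a(2) by simp
      show "wt a * (of_bool (simple x a) * avgH (\<lambda>y. \<Sum>w\<in>Env (set a). QE w h y (\<lambda>b. meets y b x a)))
        <= ?e * (wt a * card (Env (set a))) + ?E * RR * RR * (wt a * GG h (map snd a) / real m ^ h)"
      proof (cases "simple x a")
        case False
        thus ?thesis using e0 GG0 RR1 by (auto intro!: add_nonneg_nonneg mult_nonneg_nonneg)
      next
        case True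
        have "avgH (\<lambda>y. \<Sum>w\<in>Env (set a). QE w h y (\<lambda>b. meets y b x a))
          <= card (Env (set a)) * (RR * GG h (map snd a) + ?e)" by (rule NN_inner[OF a(1) True a(2) x])
        also have "\<dots> = card (Env (set a)) * ?e + card (Env (set a)) * (RR * GG h (map snd a))" by (simp add: algebra_simps)
        also have "\<dots> <= card (Env (set a)) * ?e + (?E * RR / real m ^ h) * (RR * GG h (map snd a))"
          using Env_simple_ub[OF a(1) True] a(2) GG0 RR1 teq by (intro add_left_mono mult_right_mono) auto
        finally have "wt a * avgH (\<lambda>y. \<Sum>w\<in>Env (set a). QE w h y (\<lambda>b. meets y b x a))
          <= wt a * (card (Env (set a)) * ?e + (?E * RR / real m ^ h) * (RR * GG h (map snd a)))"
          by (rule mult_left_mono) simp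
        thus ?thesis using True by (simp add: algebra_simps)
      qed
    qed
    also have "\<dots> = ?e * ?E + ?E * RR * RR * isum x h (\<lambda>a. GG h (map snd a))"
      unfolding sum.distrib sum_distrib_left[symmetric] sum_wt_Env[OF x] isum_def sum_divide_distrib ..
    also have "isum x h (\<lambda>a. GG h (map snd a)) = CC h" unfolding CC_def by (rule isum_heads[OF x])
    finally show ?thesis by (simp add: algebra_simps)
  qed
  show ?thesis using avgH_mono[OF each] by simp
qed

end

section \<open>Lower bound for the correlation with the comparison law\<close>

context walk_config begin

definition FS :: "arc list => nat => head set" where
  "FS a r = {f\<in>H. fst f = fst (snd (a ! (t - Suc r))) \<and> f \<noteq> snd (a ! (t - Suc r))}"

text \<open>Inverse of the parametrisation behind \<open>merge_ub\<close>. A lower bound has to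
  exhibit merging trajectories, and distinct parameters must yield distinct trajectories.\<close>

definition branch :: "nat => arc list => nat \<times> arc list \<times> nat \<times> head => arc list" where
  "branch y a = (\<lambda>(r, c, k, f). c @ ((endv y c, k), f) # drop (t - r) a)"

definition branches :: "nat => nat => arc list => (nat \<times> arc list \<times> nat \<times> head) set" where
  "branches x y a = (SIGMA r:{..<h}. SIGMA c:{c\<in>VL y (h - Suc r). distinct (x # y # verts a @ verts c)}.
      {..<dp (endv y c)} \<times> FS a r)"

text \<open>The last two facts recover \<open>r\<close> from the trajectory:
  \<open>h - Suc r\<close> is the last position whose tail lies off the vertices of
  \<open>a\<close>. Injectivity of \<open>branch\<close> rests on this.\<close>

lemma branch_facts:
  assumes a: "valid x a" "length a = t" and x: "x < n" "y < n"
    and s: "(r, c, k, f) \<in> branches x y a"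
  defines "b \<equiv> branch y a (r, c, k, f)"
  shows "valid y b" "length b = h" "simple y b" "endv y b = endv x a" "simple x a"
    and "wt b = wt c / dp (endv y c) * wt (drop (t - r) a)"
    and "pmatch (set a \<union> set b)" "card (set a \<union> set b) = t + (h - r)"
    and "fst (fst (b ! (h - Suc r))) \<notin> set (x # verts a)"
    and "\<And>i. h - Suc r < i ==> i < h ==> fst (fst (b ! i)) \<in> set (x # verts a)"
proof -
  have s': "r < h" "valid y c" "length c = h - Suc r" "distinct (x # y # verts a @ verts c)" "k < dp (endv y c)" "f \<in> FS a r"
    using s by (auto simp: branches_def VL_def)
  have ht: "h <= t" "r < t" using s'(1) teq by auto
  define z where "z = a ! (t - Suc r)"
  have za: "z \<in> set a" using ht a(2) by (simp add: z_def)
  have f: "f \<in> H" "fst f = fst (snd z)" "f \<noteq> snd z" using s'(6) by (auto simp: FS_def z_def)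
  have dra: "drop (t - Suc r) a = z # drop (t - r) a"
    using Cons_nth_drop_Suc[of "t - Suc r" a] ht a(2) by (simp add: z_def Suc_diff_Suc)
  hence aeq: "a = take (t - Suc r) a @ z # drop (t - r) a" by (metis append_take_drop_id)
  have dsub: "set (drop (t - r) a) \<subseteq> set a" by (rule set_drop_subset)
  have b: "b = c @ ((endv y c, k), f) # drop (t - r) a" by (simp add: b_def branch_def)
  have vdr: "valid (fst f) (drop (t - r) a)"
  proof -
    have "valid x (take (t - Suc r) a @ z # drop (t - r) a)" using a(1) aeq by metis
    thus ?thesis by (simp add: valid_append f)
  qed
  have ec: "endv y c < n" by (rule valid_endv[OF s'(2) x(2)])
  show vb: "valid y b" using s'(2,5) vdr ec f by (simp add: b valid_append memT)
  show lb: "length b = h" using s'(1,3) ht a(2) by (simp add: b)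
  have dvz: "distinct (verts (z # drop (t - r) a))" "set (verts (z # drop (t - r) a)) \<subseteq> set (verts a)"
  proof -
    have "verts a = verts (take (t - Suc r) a) @ verts (z # drop (t - r) a)" using aeq by (metis map_append)
    thus "distinct (verts (z # drop (t - r) a))" "set (verts (z # drop (t - r) a)) \<subseteq> set (verts a)"
      using s'(4) by (auto simp del: list.map)
  qed
  show "simple y b"
  proof -
    have "verts b = verts c @ verts (z # drop (t - r) a)" by (simp add: b f)
    moreover have "distinct (y # verts c)" "set (y # verts c) \<inter> set (verts a) = {}" using s'(4) by auto
    ultimately have "distinct ((y # verts c) @ verts (z # drop (t - r) a))"
      using dvz unfolding distinct_append by blast
    thus ?thesis using \<open>verts b = _\<close> unfolding simple_def by (simp only: append_Cons)
  qed
  show sa: "simple x a" using s'(4) by (auto simp: simple_def)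
  show "endv y b = endv x a"
  proof -
    have "endv x a = endv x (take (t - Suc r) a @ z # drop (t - r) a)" using aeq by simp
    thus ?thesis by (simp add: b f)
  qed
  show "wt b = wt c / dp (endv y c) * wt (drop (t - r) a)" by (simp add: b wt_append)
  define L where "L = a @ c @ [((endv y c, k), f)]"
  have setL: "set a \<union> set b = set L" using dsub by (auto simp: L_def b)
  have endc: "map (\<lambda>ef. fst (fst ef)) c @ [endv y c] = y # verts c"
    unfolding tail_verts[OF s'(2)] endv_last by (rule append_butlast_last_id) simp
  have "map fst (map fst L) = butlast (x # verts a) @ y # verts c"
  proof -
    have "map fst (map fst L) = map (\<lambda>ef. fst (fst ef)) a @ map (\<lambda>ef. fst (fst ef)) c @ [endv y c]"
      by (simp add: L_def)
    thus ?thesis unfolding endc tail_verts[OF a(1)] .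
  qed
  moreover have "distinct (butlast (x # verts a) @ y # verts c)"
  proof -
    have "distinct (x # verts a)" "distinct (y # verts c)" "set (x # verts a) \<inter> set (y # verts c) = {}"
      using s'(4) by auto
    thus ?thesis using distinct_butlast[of "x # verts a"] in_set_butlastD[of _ "x # verts a"]
      unfolding distinct_append by (meson disjoint_iff)
  qed
  ultimately have d1: "distinct (map fst L)" using distinct_map by metis
  have d2: "distinct (map snd L)"
  proof -
    have "distinct (map fst (map snd (a @ c)))"
      using s'(4) by (simp add: o_def)
    hence "distinct (map snd (a @ c))" using distinct_map by blast
    moreover have "f \<notin> snd ` set (a @ c)"
    proof
      assume "f \<in> snd ` set (a @ c)"
      then obtain z' where z': "z' \<in> set a \<or> z' \<in> set c" "f = snd z'" by auto
      have zv: "fst f \<in> set (verts a)" using za f by auto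
      show False using z'(1)
      proof
        assume "z' \<in> set a"
        hence "z' = z" using verts_inj[of a z' z] za f z' s'(4) by auto
        thus False using f z' by simp
      next
        assume "z' \<in> set c"
        hence "fst f \<in> set (verts c)" using z' by auto
        thus False using zv s'(4) by auto
      qed
    qed
    ultimately show ?thesis by (auto simp: L_def)
  qed
  have "set L \<subseteq> T \<times> H" using valid_set[OF a(1)] valid_set[OF vb] setL by blast
  thus "pmatch (set a \<union> set b)" using d1 d2 unfolding setL pmatch_def distinct_map by blast
  have "length L = t + (h - r)" using s'(1,3) a(2) by (simp add: L_def)
  moreover have "distinct L" using d1 by (simp add: distinct_map)
  ultimately show "card (set a \<union> set b) = t + (h - r)" unfolding setL by (simp add: distinct_card)
  have "endv y c \<in> set (y # verts c)" unfolding endv_last by (rule last_in_set) simp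
  moreover have "fst (fst (b ! (h - Suc r))) = endv y c" using s'(3) by (simp add: b nth_append)
  moreover have "set (y # verts c) \<inter> set (x # verts a) = {}" using s'(4) by auto
  hence "z \<notin> set (x # verts a)" if "z \<in> set (y # verts c)" for z using that by blast
  ultimately show "fst (fst (b ! (h - Suc r))) \<notin> set (x # verts a)" by (simp only: not_False_eq_True)
  fix i assume i: "h - Suc r < i" "i < h"
  have "b ! i \<in> set (drop (t - r) a)"
  proof -
    define j where "j = i - Suc (length c)"
    have j: "i = Suc (length c + j)" using i s'(3) by (simp add: j_def)
    have "j < length (drop (t - r) a)" using i lb j by (simp add: b)
    thus ?thesis using j by (simp add: b nth_append del: drop_drop nth_drop)
  qed
  hence "fst (b ! i) \<in> fst ` set a" using dsub by blast
  thus "fst (fst (b ! i)) \<in> set (x # verts a)" by (rule tails_verts[OF a(1)])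
qed

text \<open>Together with \<open>a\<close>, a branch reveals \<open>t + (h - r)\<close> arcs, so the
  lower half of \<open>Env_card_bounds\<close> applies. Compared with \<open>merge_ub\<close>, what
  is given up is recorded by the distinctness indicator.\<close>

lemma XN_inner:
  assumes a: "valid x a" "length a = t" and x: "x < n" "y < n"
  shows "card (Envs) / real m ^ t * (\<Sum>r<h. gg (drop (t - Suc r) (map snd a)) *
        isum y (h - Suc r) (\<lambda>c. of_bool (distinct (x # y # verts a @ verts c))))
    <= of_bool (simple x a) * (\<Sum>w\<in>Env (set a). QE w h y (\<lambda>b. meets y b x a))"
proof -
  let ?E = "real (card (Envs))"
  let ?S = "branches x y a" and ?G = "branch y a"
  define F where "F b = wt b * meets y b x a * real (card (Env (set a \<union> set b)))" for b
  note bf = branch_facts[OF a x]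
  have finS: "finite ?S" unfolding branches_def FS_def by (intro finite_SigmaI finite_cartesian_product) auto
  have inj: "inj_on ?G ?S"
  proof (rule inj_onI)
    fix s s' assume s: "s \<in> ?S" "s' \<in> ?S" "?G s = ?G s'"
    obtain r c k f where e: "s = (r, c, k, f)" by (cases s)
    obtain r' c' k' f' where e': "s' = (r', c', k', f')" by (cases s')
    have rh: "r < h" "r' < h" "length c = h - Suc r" "length c' = h - Suc r'" using s by (auto simp: branches_def e e' VL_def)
    have "\<not> r < r'"
    proof
      assume "r < r'"
      hence i: "h - Suc r' < h - Suc r" "h - Suc r < h" using rh by auto
      show False using bf(10)[OF s(2)[unfolded e'] i] bf(9)[OF s(1)[unfolded e]] s(3) e e' by simp
    qed
    moreover have "\<not> r' < r"
    proof
      assume "r' < r"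
      hence i: "h - Suc r < h - Suc r'" "h - Suc r' < h" using rh by auto
      show False using bf(10)[OF s(1)[unfolded e] i] bf(9)[OF s(2)[unfolded e']] s(3) e e' by simp
    qed
    ultimately have "r = r'" by simp
    thus "s = s'" using s(3) rh by (auto simp: e e' branch_def)
  qed
  show ?thesis
  proof (cases "simple x a")
    case False
    have "isum y (h - Suc r) (\<lambda>c. of_bool (distinct (x # y # verts a @ verts c))) = 0" for r
    proof -
      have "\<not> distinct (x # y # verts a @ verts c)" for c :: "arc list" using False by (auto simp: simple_def)
      thus ?thesis by (simp only: isum_def of_bool_eq mult_zero_right sum.neutral_const div_0)
    qed
    thus ?thesis using False by (simp only: of_bool_eq mult_zero_right mult_zero_left sum.neutral_const order_refl)
  next
    case sa: True
    have FG: "F (?G (r, c, k, f)) \<ge> wt c / dp (endv y c) * wt (drop (t - r) a) * (?E / real m ^ (t + (h - r)))"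
      if "(r, c, k, f) \<in> ?S" for r c k f
    proof -
      let ?b = "?G (r, c, k, f)"
      have rh: "r < h" using that by (simp add: branches_def)
      have "?E / real m ^ card (set a \<union> set ?b) <= card (Env ({} \<union> (set a \<union> set ?b)))"
        unfolding Env_empty[symmetric]
        by (rule Env_card_bounds(1)[where K = K]) (use bf(7,8)[OF that] Km Kdef teq rh in auto)
      hence "?E / real m ^ (t + (h - r)) <= card (Env (set a \<union> set ?b))" using bf(8)[OF that] by simp
      hence "wt ?b * (?E / real m ^ (t + (h - r))) <= wt ?b * card (Env (set a \<union> set ?b))"
        by (rule mult_left_mono) simp
      thus ?thesis unfolding F_def using bf(3,4)[OF that] unfolding bf(6)[OF that] by simp
    qed
    have "(\<Sum>w\<in>Env (set a). QE w h y (\<lambda>b. meets y b x a)) = (\<Sum>b\<in>VL y h. F b)"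
      unfolding sum_Env_QE_const F_def ..
    also have "\<dots> \<ge> (\<Sum>b\<in>?G ` ?S. F b)"
    proof (rule sum_mono2)
      show "?G ` ?S \<subseteq> VL y h"
      proof
        fix b assume "b \<in> ?G ` ?S"
        then obtain s where s: "s \<in> ?S" "b = ?G s" by blast
        obtain r c k f where e: "s = (r, c, k, f)" by (cases s)
        show "b \<in> VL y h" using bf(1,2)[OF s(1)[unfolded e]] by (simp add: VL_def s(2) e)
      qed
      show "0 <= F b" for b by (simp add: F_def)
    qed simp
    also have "(\<Sum>b\<in>?G ` ?S. F b) = (\<Sum>s\<in>?S. F (?G s))" by (subst sum.reindex[OF inj]) simp
    also have "\<dots> \<ge> (\<Sum>s\<in>?S. case s of (r, c, k, f) => wt c / dp (endv y c) * wt (drop (t - r) a) * (?E / real m ^ (t + (h - r))))"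
      by (rule sum_mono) (use FG in auto)
    also have "(\<Sum>s\<in>?S. case s of (r, c, k, f) => wt c / dp (endv y c) * wt (drop (t - r) a) * (?E / real m ^ (t + (h - r))))
      = (\<Sum>r<h. \<Sum>c\<in>{c\<in>VL y (h - Suc r). distinct (x # y # verts a @ verts c)}. \<Sum>(k, f)\<in>{..<dp (endv y c)} \<times> FS a r.
            wt c / dp (endv y c) * wt (drop (t - r) a) * (?E / real m ^ (t + (h - r))))"
    proof -
      have fin1: "finite ({..<dp (endv y c)} \<times> FS a r)" for c r by (simp add: FS_def)
      have fin2: "finite (SIGMA c:{c\<in>VL y (h - Suc r). distinct (x # y # verts a @ verts c)}. {..<dp (endv y c)} \<times> FS a r)" for r
        using fin1 by auto
      show ?thesis unfolding branches_def
        by (subst sum.Sigma, simp, use fin1 in simp, subst sum.Sigma, simp, use fin2 in simp, simp add: case_prod_unfold)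
    qed
    also have "\<dots> = (\<Sum>r<h. ?E / real m ^ t * (gg (drop (t - Suc r) (map snd a)) *
        isum y (h - Suc r) (\<lambda>c. of_bool (distinct (x # y # verts a @ verts c)))))"
    proof (intro sum.cong refl)
      fix r assume r: "r \<in> {..<h}"
      let ?z = "a ! (t - Suc r)"
      let ?C = "{c\<in>VL y (h - Suc r). distinct (x # y # verts a @ verts c)}"
      have zH: "snd ?z \<in> H" using valid_ext_T[OF a(1), of ?z] a(2) teq r by simp
      have FSc: "real (card (FS a r)) = real (dm (fst (snd ?z))) - 1" unfolding FS_def by (rule heads_others[OF zH])
      have "(\<Sum>c\<in>?C. \<Sum>(k, f)\<in>{..<dp (endv y c)} \<times> FS a r. wt c / dp (endv y c) * wt (drop (t - r) a) * (?E / real m ^ (t + (h - r))))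
        = (\<Sum>c\<in>?C. wt c * (card (FS a r) * wt (drop (t - r) a) * (?E / real m ^ (t + (h - r)))))"
      proof (rule sum.cong[OF refl])
        fix c assume "c \<in> ?C"
        hence "endv y c < n" using valid_endv x by (auto simp: VL_def)
        hence "dp (endv y c) \<noteq> 0" using deg2 by force
        thus "(\<Sum>(k, f)\<in>{..<dp (endv y c)} \<times> FS a r. wt c / dp (endv y c) * wt (drop (t - r) a) * (?E / real m ^ (t + (h - r))))
          = wt c * (card (FS a r) * wt (drop (t - r) a) * (?E / real m ^ (t + (h - r))))"
          by (simp add: case_prod_unfold card_cartesian_product)
      qed
      also have "\<dots> = (\<Sum>c\<in>?C. wt c) * (card (FS a r) * wt (drop (t - r) a) * (?E / real m ^ (t + (h - r))))"
        by (simp only: sum_distrib_right)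
      also have "(\<Sum>c\<in>?C. wt c) = (\<Sum>c\<in>VL y (h - Suc r). wt c * of_bool (distinct (x # y # verts a @ verts c)))"
        by (rule sum.mono_neutral_cong_left) auto
      also have "(\<Sum>c\<in>VL y (h - Suc r). wt c * of_bool (distinct (x # y # verts a @ verts c)))
           * (card (FS a r) * wt (drop (t - r) a) * (?E / real m ^ (t + (h - r))))
         = ?E / real m ^ t * (gg (drop (t - Suc r) (map snd a)) * isum y (h - Suc r) (\<lambda>c. of_bool (distinct (x # y # verts a @ verts c))))"
      proof -
        have g: "gg (drop (t - Suc r) (map snd a)) = (real (dm (fst (snd ?z))) - 1) / m * wt (drop (t - r) a)"
          using gg_wt[OF a(1), of r] a(2) r teq by simp
        have mm: "real m ^ (t + (h - r)) = real m ^ t * (real m * real m ^ (h - Suc r))"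
          using r by (metis Suc_diff_Suc lessThan_iff power_Suc power_add)
        have alg: "J * ((d - 1) * v * (E / (Mt * (M * M')))) = E / Mt * ((d - 1) / M * v * (J / M'))"
          for J d v E Mt M M' :: real by (simp add: divide_simps)
        show ?thesis unfolding g FSc mm isum_def by (rule alg)
      qed
      finally show "(\<Sum>c\<in>?C. \<Sum>(k, f)\<in>{..<dp (endv y c)} \<times> FS a r. wt c / dp (endv y c) * wt (drop (t - r) a) * (?E / real m ^ (t + (h - r))))
         = ?E / real m ^ t * (gg (drop (t - Suc r) (map snd a)) * isum y (h - Suc r) (\<lambda>c. of_bool (distinct (x # y # verts a @ verts c))))" .
    qed
    finally show ?thesis using sa by (simp add: sum_distrib_left)
  qed
qed

text \<open>For a pair such as \<open>x = y\<close> there is no branch at all; the loss is small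
  only after averaging over both starting vertices. These and at most \<open>t + h\<close> further
  heads then form a birthday problem, which costs \<open>D / m\<close>. The bound on
  \<open>gg\<close> supplies another \<open>D / m\<close>, and the geometric sum over
  \<open>r\<close> the constant \<open>2\<close>.\<close>

lemma XN_lb:
  "card (Envs) * (qq N \<theta> * CC h - 2 * (real D / m)^2 * real (t + h + 2)^2)
    <= avgH (\<lambda>x. avgH (\<lambda>y. \<Sum>w\<in>Envs. QE w t x (\<lambda>a. of_bool (simple x a \<and> low h N \<theta> a) *
       QE w h y (\<lambda>b. meets y b x a))))"
proof -
  let ?E = "real (card (Envs))"
  define nd where "nd r x y a = isum y (h - Suc r) (\<lambda>c. of_bool (\<not> distinct (x # y # verts a @ verts c)))" for r x y and a :: "arc list"
  have each: "?E * (qq N \<theta> * CC h - (\<Sum>r<h. real D / m * (1/2)^r * isum x t (nd r x y)))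
     <= (\<Sum>w\<in>Envs. QE w t x (\<lambda>a. of_bool (simple x a \<and> low h N \<theta> a) *
       QE w h y (\<lambda>b. meets y b x a)))" if x: "x < n" "y < n" for x y
  proof -
    have "(\<Sum>w\<in>Envs. QE w t x (\<lambda>a. of_bool (simple x a \<and> low h N \<theta> a) *
       QE w h y (\<lambda>b. meets y b x a)))
      = (\<Sum>a\<in>VL x t. wt a * (of_bool (low h N \<theta> a) * (of_bool (simple x a) *
          (\<Sum>w\<in>Env (set a). QE w h y (\<lambda>b. meets y b x a)))))"
      unfolding sum_envs_QE by (simp only: of_bool_conj mult_ac)
    also have "\<dots> \<ge> (\<Sum>a\<in>VL x t. wt a * (?E / real m ^ t * (of_bool (low h N \<theta> a) * GG h (map snd a)
         - (\<Sum>r<h. real D / m * (1/2)^r * nd r x y a))))"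
    proof (intro sum_mono mult_left_mono)
      fix a assume "a \<in> VL x t"
      hence a: "valid x a" "length a = t" by (auto simp: VL_def)
      have nd: "nd r x y a = 1 - isum y (h - Suc r) (\<lambda>c. of_bool (distinct (x # y # verts a @ verts c)))" for r
      proof -
        have "nd r x y a = isum y (h - Suc r) (\<lambda>c. 1 - of_bool (distinct (x # y # verts a @ verts c)))"
          unfolding nd_def by (simp only: of_bool_not_iff)
        also have "\<dots> = isum y (h - Suc r) (\<lambda>_. 1) - isum y (h - Suc r) (\<lambda>c. of_bool (distinct (x # y # verts a @ verts c)))"
          by (simp only: isum_def right_diff_distrib sum_subtractf diff_divide_distrib)
        finally show ?thesis by (simp only: isum_const[OF x(2)])
      qed
      have nd0: "0 <= nd r x y a" for r unfolding nd_def isum_def by (intro divide_nonneg_nonneg sum_nonneg) auto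
      have g: "gg (drop (t - Suc r) (map snd a)) <= real D / m * (1/2)^r" if "r < h" for r
        using gg_r_bounds(2)[OF a(1), of r] a(2) that teq by simp
      have nn: "0 <= (\<Sum>r<h. real D / m * (1/2)^r * nd r x y a)" using nd0 by (intro sum_nonneg) auto
      show "?E / real m ^ t * (of_bool (low h N \<theta> a) * GG h (map snd a) - (\<Sum>r<h. real D / m * (1/2)^r * nd r x y a))
        <= of_bool (low h N \<theta> a) * (of_bool (simple x a) *
          (\<Sum>w\<in>Env (set a). QE w h y (\<lambda>b. meets y b x a)))"
      proof (cases "low h N \<theta> a")
        case False
        have "?E / real m ^ t * (0 - (\<Sum>r<h. real D / m * (1/2)^r * nd r x y a)) <= 0"
          using nn by (intro mult_nonneg_nonpos) auto
        thus ?thesis using False by (simp only: of_bool_eq mult_zero_left)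
      next
        case True
        have "GG h (map snd a) - (\<Sum>r<h. real D / m * (1/2)^r * nd r x y a)
           <= (\<Sum>r<h. gg (drop (t - Suc r) (map snd a)) - gg (drop (t - Suc r) (map snd a)) * nd r x y a)"
          unfolding GG_heads[OF a(2)] sum_subtractf
          using g nd0 by (intro diff_left_mono sum_mono mult_right_mono) auto
        also have "\<dots> = (\<Sum>r<h. gg (drop (t - Suc r) (map snd a)) *
            isum y (h - Suc r) (\<lambda>c. of_bool (distinct (x # y # verts a @ verts c))))"
          by (intro sum.cong refl) (simp only: nd right_diff_distrib mult_1_right diff_diff_eq2 add_diff_cancel_left')
        finally have "?E / real m ^ t * (GG h (map snd a) - (\<Sum>r<h. real D / m * (1/2)^r * nd r x y a))
          <= ?E / real m ^ t * (\<Sum>r<h. gg (drop (t - Suc r) (map snd a)) *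
            isum y (h - Suc r) (\<lambda>c. of_bool (distinct (x # y # verts a @ verts c))))"
          by (rule mult_left_mono) simp
        also note XN_inner[OF a x]
        finally show ?thesis using True by (simp only: of_bool_eq mult_1_left)
      qed
    qed simp
    also have "(\<Sum>a\<in>VL x t. wt a * (?E / real m ^ t * (of_bool (low h N \<theta> a) * GG h (map snd a)
         - (\<Sum>r<h. real D / m * (1/2)^r * nd r x y a))))
      = ?E * (isum x t (\<lambda>a. of_bool (low h N \<theta> a) * GG h (map snd a)) - (\<Sum>r<h. real D / m * (1/2)^r * isum x t (nd r x y)))"
    proof -
      have "(\<Sum>r<h. real D / m * (1/2)^r * isum x t (nd r x y)) = isum x t (\<lambda>a. \<Sum>r<h. real D / m * (1/2)^r * nd r x y a)"
        unfolding isum_def sum_distrib_left sum_divide_distrib by (subst sum.swap) (simp add: mult_ac)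
      hence "?E * (isum x t (\<lambda>a. of_bool (low h N \<theta> a) * GG h (map snd a)) - (\<Sum>r<h. real D / m * (1/2)^r * isum x t (nd r x y)))
        = ?E * isum x t (\<lambda>a. of_bool (low h N \<theta> a) * GG h (map snd a) - (\<Sum>r<h. real D / m * (1/2)^r * nd r x y a))"
        by (simp only: isum_def right_diff_distrib sum_subtractf diff_divide_distrib)
      thus ?thesis unfolding isum_def sum_distrib_left sum_divide_distrib by (simp only: mult_ac times_divide_eq_right times_divide_eq_left)
    qed
    finally show ?thesis unfolding isum_low_GG[OF x(1)] .
  qed
  have avgnd: "avgH (\<lambda>x. avgH (\<lambda>y. isum x t (nd r x y))) <= real D / m * real (t + h + 2)^2" if r: "r < h" for r
  proof -
    have "avgH (\<lambda>x. avgH (\<lambda>y. isum x t (nd r x y)))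
      = avgH (\<lambda>x. avgH (\<lambda>y. iE t (\<lambda>fs. iE (h - Suc r) (\<lambda>gs. of_bool (\<not> distinct (x # y # map fst (fs @ gs)))))))"
    proof (intro avgH_cong)
      fix x y assume x: "x < n" "y < n"
      have "nd r x y a = iE (h - Suc r) (\<lambda>gs. of_bool (\<not> distinct (x # y # map fst (map snd a @ gs))))" for a
        unfolding nd_def using isum_heads[OF x(2), of "h - Suc r" "\<lambda>gs. of_bool (\<not> distinct (x # y # map fst (map snd a @ gs)))"]
        unfolding map_append map_map o_def .
      hence "nd r x y = (\<lambda>a. iE (h - Suc r) (\<lambda>gs. of_bool (\<not> distinct (x # y # map fst (map snd a @ gs)))))" by blast
      thus "isum x t (nd r x y) = iE t (\<lambda>fs. iE (h - Suc r) (\<lambda>gs. of_bool (\<not> distinct (x # y # map fst (fs @ gs)))))"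
        using isum_heads[OF x(1), of t "\<lambda>fs. iE (h - Suc r) (\<lambda>gs. of_bool (\<not> distinct (x # y # map fst (fs @ gs))))"]
        by (simp only:)
    qed
    also have "\<dots> = avgH (\<lambda>x. avgH (\<lambda>y. iE (t + (h - Suc r)) (\<lambda>fs. of_bool (\<not> distinct (x # y # map fst fs)))))"
      by (simp only: iE_add)
    also have "\<dots> = iE (Suc (Suc (t + (h - Suc r)))) (\<lambda>fs. of_bool (\<not> distinct (map fst fs)))"
      by (simp only: iE_Suc_avg[where \<phi> = "\<lambda>ys. of_bool (\<not> distinct (_ # ys))"] iE_Suc_avg[where \<phi> = "\<lambda>ys. of_bool (\<not> distinct ys)"])
    also have "\<dots> <= real (Suc (Suc (t + (h - Suc r))))^2 * real D / m" by (rule iE_birthday)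
    also have "\<dots> = real D / m * real (Suc (Suc (t + (h - Suc r))))^2" by simp
    also have "\<dots> <= real D / m * real (t + h + 2)^2" by (intro mult_left_mono power_mono of_nat_mono) auto
    finally show ?thesis .
  qed
  have "(\<Sum>r<h. real D / m * (1/2)^r * avgH (\<lambda>x. avgH (\<lambda>y. isum x t (nd r x y))))
     <= (\<Sum>r<h. real D / m * (1/2)^r * (real D / m * real (t + h + 2)^2))"
    by (intro sum_mono mult_left_mono avgnd) auto
  also have "\<dots> = (\<Sum>r<h. (1/2)^r) * ((real D / m)^2 * real (t + h + 2)^2)"
    unfolding sum_distrib_right by (intro sum.cong refl) (simp add: power2_eq_square)
  also have "\<dots> <= 2 * ((real D / m)^2 * real (t + h + 2)^2)" by (intro mult_right_mono sum_half) auto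
  finally have "?E * (qq N \<theta> * CC h - 2 * (real D / m)^2 * real (t + h + 2)^2)
    <= ?E * (qq N \<theta> * CC h - (\<Sum>r<h. real D / m * (1/2)^r * avgH (\<lambda>x. avgH (\<lambda>y. isum x t (nd r x y)))))"
    by (intro mult_left_mono) auto
  also have "\<dots> = avgH (\<lambda>x. avgH (\<lambda>y. ?E * (qq N \<theta> * CC h - (\<Sum>r<h. real D / m * (1/2)^r * isum x t (nd r x y)))))"
    by (simp only: avgH_cmult avgH_diff avgH_sum avgH_const)
  also have "\<dots> <= avgH (\<lambda>x. avgH (\<lambda>y. \<Sum>w\<in>Envs. QE w t x (\<lambda>a. of_bool (simple x a \<and> low h N \<theta> a) *
       QE w h y (\<lambda>b. meets y b x a))))"
    by (intro avgH_mono each)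
  finally show ?thesis .
qed

text \<open>Truncation to simple trajectories is what the merging analysis can handle;
  \<open>FF_le\<close> adds the discarded mass back.\<close>

definition Xs where "Xs w x j = QE w t x (\<lambda>a. of_bool (simple x a \<and> low h N \<theta> a) * of_bool (endv x a = j))"
definition Ns where "Ns w j = avgH (\<lambda>y. QE w h y (\<lambda>b. of_bool (simple y b) * of_bool (endv y b = j)))"

definition Err where "Err = 3 * (real t * p)^2 + 7 * RR * (real D / m) * (1/2)^h + 2 * (RR * RR - 1) * (2 * real D / m)
   + real (D * (h + 1)) / m * (real t * p) + 4 * (real D / m)^2 * real (t + h + 2)^2"

text \<open>Expanding the square, the leading terms are \<open>q^2 CC\<close> twice, with factors
  \<open>RR * RR\<close>, and \<open>- 2 q^2 CC\<close>. They cancel up to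
  \<open>2 * (RR * RR - 1)\<close> times \<open>CC h <= 2 * D / m\<close>. The diagonal
  \<open>\<theta>\<close> survives as the main contribution.\<close>

lemma star:
  "(\<Sum>w\<in>Envs. avgH (\<lambda>x. \<Sum>j<n. (Xs w x j - qq N \<theta> * Ns w j)^2)) <= card (Envs) * (\<theta> + Err)"
proof -
  let ?E = "real (card (Envs))" and ?q = "qq N \<theta>"
  let ?sl = "\<lambda>x a. of_bool (simple x a \<and> low h N \<theta> a) :: real"
  define XX where "XX w = avgH (\<lambda>x. QE w t x (\<lambda>a. ?sl x a * QE w t x (\<lambda>b. of_bool (simple x b \<and> low h N \<theta> b \<and> endv x b = endv x a))))" for w
  define XN where "XN w = avgH (\<lambda>x. avgH (\<lambda>y. QE w t x (\<lambda>a. ?sl x a * QE w h y (\<lambda>b. meets y b x a))))" for w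
  define NN where "NN w = avgH (\<lambda>x. avgH (\<lambda>y. QE w h x (\<lambda>a. of_bool (simple x a) * QE w h y (\<lambda>b. meets y b x a))))" for w
  have 1: "avgH (\<lambda>x. \<Sum>j<n. Xs w x j * Xs w x j) = XX w" for w
    unfolding XX_def
  proof (rule avgH_cong)
    fix x assume "x < n"
    thus "(\<Sum>j<n. Xs w x j * Xs w x j) = QE w t x (\<lambda>a. ?sl x a * QE w t x (\<lambda>b. of_bool (simple x b \<and> low h N \<theta> b \<and> endv x b = endv x a)))"
      unfolding Xs_def by (subst QE_meet) (simp_all only: of_bool_conj mult.assoc)
  qed
  have 2: "avgH (\<lambda>x. \<Sum>j<n. Xs w x j * Ns w j) = XN w" for w
    unfolding XN_def
  proof (rule avgH_cong)
    fix x assume x: "x < n"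
    have "(\<Sum>j<n. Xs w x j * Ns w j) = avgH (\<lambda>y. \<Sum>j<n. Xs w x j * QE w h y (\<lambda>b. of_bool (simple y b) * of_bool (endv y b = j)))"
      by (simp only: Ns_def avgH_cmult avgH_sum)
    also have "\<dots> = avgH (\<lambda>y. QE w t x (\<lambda>a. ?sl x a * QE w h y (\<lambda>b. meets y b x a)))"
      unfolding Xs_def by (subst QE_meet[OF x]) (simp only: of_bool_conj mult.assoc)
    finally show "(\<Sum>j<n. Xs w x j * Ns w j) = avgH (\<lambda>y. QE w t x (\<lambda>a. ?sl x a * QE w h y (\<lambda>b. meets y b x a)))" .
  qed
  have 3: "(\<Sum>j<n. Ns w j * Ns w j) = NN w" for w
  proof -
    have "(\<Sum>j<n. Ns w j * Ns w j) = avgH (\<lambda>x. avgH (\<lambda>y. \<Sum>j<n. QE w h x (\<lambda>b. of_bool (simple x b) * of_bool (endv x b = j))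
         * QE w h y (\<lambda>b. of_bool (simple y b) * of_bool (endv y b = j))))"
      by (simp only: Ns_def avgH_cmult avgH_cmult2 avgH_sum)
    also have "\<dots> = NN w" unfolding NN_def
    proof (rule avgH_cong)
      fix x assume "x < n"
      thus "avgH (\<lambda>y. \<Sum>j<n. QE w h x (\<lambda>b. of_bool (simple x b) * of_bool (endv x b = j)) * QE w h y (\<lambda>b. of_bool (simple y b) * of_bool (endv y b = j)))
         = avgH (\<lambda>y. QE w h x (\<lambda>a. of_bool (simple x a) * QE w h y (\<lambda>b. meets y b x a)))"
        by (subst QE_meet) (simp_all only: of_bool_conj mult.assoc)
    qed
    finally show ?thesis .
  qed
  have sq: "avgH (\<lambda>x. \<Sum>j<n. (Xs w x j - ?q * Ns w j)^2) = XX w + ?q * ?q * NN w - 2 * ?q * XN w" for w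
  proof -
    have "(\<Sum>j<n. (Xs w x j - ?q * Ns w j)^2) = (\<Sum>j<n. Xs w x j * Xs w x j) + ?q * ?q * (\<Sum>j<n. Ns w j * Ns w j) - 2 * ?q * (\<Sum>j<n. Xs w x j * Ns w j)" for x
      by (simp add: power2_eq_square algebra_simps sum.distrib sum_subtractf sum_distrib_left)
    thus ?thesis by (simp only: avgH_diff avgH_add avgH_cmult avgH_const 1 2 3)
  qed
  have A: "(\<Sum>w\<in>Envs. XX w) <= ?E * (\<theta> + 2 * (real t * p)^2 + RR * (6 * D / m * (1/2)^h) + RR * RR * (?q * (?q * CC h)))"
    unfolding XX_def avgH_sum[symmetric] using avgH_mono[OF XX_ub] by simp
  have B: "(\<Sum>w\<in>Envs. NN w) <= ?E * (RR * RR * CC h + ((real t * p)^2 + real (D * (h + 1)) / m * (real t * p) + real D / m * (1/2)^h))"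
    unfolding NN_def avgH_sum[symmetric] by (rule NN_ub)
  have C: "?E * (?q * CC h - 2 * (real D / m)^2 * real (t + h + 2)^2) <= (\<Sum>w\<in>Envs. XN w)"
    unfolding XN_def avgH_sum[symmetric] by (rule XN_lb)
  have q: "0 <= ?q" "?q <= 1" "?q * ?q <= 1" using qq_bounds[of N \<theta>] by (auto intro: mult_le_one)
  define e where "e = (real t * p)^2 + real (D * (h + 1)) / m * (real t * p) + real D / m * (1/2)^h"
  define k where "k = 2 * (real D / m)^2 * real (t + h + 2)^2"
  have e0: "0 <= e" using p0 by (simp add: e_def)
  have k0: "0 <= k" by (simp add: k_def)
  have "(\<Sum>w\<in>Envs. avgH (\<lambda>x. \<Sum>j<n. (Xs w x j - ?q * Ns w j)^2))
    = (\<Sum>w\<in>Envs. XX w) + ?q * ?q * (\<Sum>w\<in>Envs. NN w) - 2 * ?q * (\<Sum>w\<in>Envs. XN w)"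
    unfolding sq by (simp only: sum.distrib sum_subtractf sum_distrib_left)
  also have "\<dots> <= ?E * (\<theta> + 2 * (real t * p)^2 + RR * (6 * D / m * (1/2)^h) + RR * RR * (?q * (?q * CC h)))
     + ?q * ?q * (?E * (RR * RR * CC h + e)) - 2 * ?q * (?E * (?q * CC h - k))"
    by (intro diff_mono add_mono mult_left_mono A B[folded e_def] C[folded k_def]) (use q in auto)
  also have "\<dots> = ?E * (\<theta> + 2 * (real t * p)^2 + RR * (6 * D / m * (1/2)^h) + (?q * ?q) * (2 * (RR * RR - 1) * CC h) + (?q * ?q) * e + ?q * (2 * k))"
    by (simp add: algebra_simps)
  also have "\<dots> <= ?E * (\<theta> + 2 * (real t * p)^2 + RR * (6 * D / m * (1/2)^h) + 1 * (2 * (RR * RR - 1) * (2 * real D / m)) + 1 * e + 1 * (2 * k))"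
  proof -
    have RR2: "0 <= 2 * (RR * RR - 1)" using RR1 mult_mono[of 1 RR 1 RR] by simp
    have c: "(?q * ?q) * (2 * (RR * RR - 1) * CC h) <= 1 * (2 * (RR * RR - 1) * (2 * real D / m))"
      using RR2 CC_bounds(1)[of h] CC_bounds(2)[of h] by (intro mult_mono[OF q(3)] mult_left_mono) auto
    show ?thesis by (intro mult_left_mono add_mono order_refl c mult_right_mono q) (use e0 k0 in auto)
  qed
  also have "\<dots> <= ?E * (\<theta> + Err)"
  proof (rule mult_left_mono)
    have "1 * (real D / m * (1/2)^h) <= RR * (real D / m * (1/2)^h)" by (rule mult_right_mono[OF RR1]) simp
    thus "\<theta> + 2 * (real t * p)^2 + RR * (6 * D / m * (1/2)^h) + 1 * (2 * (RR * RR - 1) * (2 * real D / m)) + 1 * e + 1 * (2 * k) <= \<theta> + Err"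
    proof -
      have 1: "RR * (6 * D / m * (1/2)^h) = 6 * (RR * (real D / m * (1/2)^h))"
        "7 * RR * (real D / m) * (1/2)^h = 7 * (RR * (real D / m * (1/2)^h))" by simp_all
      have alg: "\<theta> + 2 * s + 6 * X + 1 * G + 1 * (s + d + c) + 1 * (2 * (2 * u * v)) <= \<theta> + (3 * s + 7 * X + G + d + 4 * u * v)"
        if "1 * c <= X" for s X G d c u v :: real using that by simp
      show ?thesis unfolding Err_def e_def k_def 1
        by (rule alg) (rule \<open>1 * (real D / m * (1/2)^h) <= RR * (real D / m * (1/2)^h)\<close>)
    qed
  qed simp
  finally show ?thesis .
qed

end

text \<open>A linearised Cauchy-Schwarz inequality. \<open>FF_le\<close> applies it with
  \<open>c * n\<close> to pass from squares to an \<open>L1\<close> norm over \<open>n\<close>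
  vertices; \<open>c\<close> is tuned when the scales are fixed.\<close>

lemma abs_le_weighted_square: "0 < c ==> \<bar>z\<bar> <= c / 2 * z^2 + 1 / (2 * c)" for c z :: real
proof -
  assume c: "0 < c"
  have "0 <= (c * \<bar>z\<bar> - 1)^2" by simp
  hence "2 * c * \<bar>z\<bar> <= c^2 * z^2 + 1" by (simp add: power2_eq_square algebra_simps)
  thus ?thesis using c by (simp add: field_simps power2_eq_square)
qed

section \<open>The discrepancy between the light walk and its target\<close>

context config begin

definition hit :: "env => nat => nat => tail set => real" where
  "hit w s x S = QE w s x (\<lambda>a. of_bool (fst ` set a \<inter> S \<noteq> {}))"

definition nu :: "env => nat => nat => real" where
  "nu w s j = avgH (\<lambda>y. PP w s y j)"

definition XX :: "nat => nat => nat => real => env => nat => nat => real" where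
  "XX t h N \<theta> w x j = QE w t x (\<lambda>a. of_bool (low h N \<theta> a) * of_bool (endv x a = j))"

text \<open>The vertices \<open>x\<close> at which this \<open>L1\<close> distance is large are the
  exceptional ones.\<close>

definition FF :: "nat => nat => nat => real => env => nat => real" where
  "FF t h N \<theta> w x = (\<Sum>j<n. \<bar>XX t h N \<theta> w x j - qq N \<theta> * nu w h j\<bar>)"

lemma nu_nonneg: "0 <= nu w s j" unfolding nu_def by (intro avgH_nonneg PP_nonneg)

lemma nu_sum: "w \<in> Envs ==> (\<Sum>j<n. nu w s j) = 1"
  unfolding nu_def avgH_sum[symmetric] using avgH_cong[of "\<lambda>x. \<Sum>j<n. PP w s x j" "\<lambda>_. 1"] PP_sum by simp

end

context walk_config begin

text \<open>A trajectory that is not simple has a collision with its own past. The range up to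
  \<open>t + 1\<close> serves \<open>return_expect\<close>, where a cycle is closed after one extra
  step.\<close>

lemma nonsimple_bound:
  assumes "x < n" "s <= t + 1"
  shows "(\<Sum>w\<in>Envs. QE w s x (\<lambda>a. of_bool (\<not> simple x a))) <= card (Envs) * ((real t + 1) * p)"
proof -
  have st: "s + 1 <= 2 * t" using assms(2) teq h1 by simp
  have "(\<Sum>w\<in>Envs. QE w s x (\<lambda>a. of_bool (\<not> simple x a)))
    <= (\<Sum>w\<in>Env {}. QE w s x (\<lambda>a. of_bool (1 <= ncol {} {x} a)))"
  proof (simp only: Env_empty, intro sum_mono QE_mono)
    fix w a assume "a \<in> VL x s"
    hence "valid x a" by (simp add: VL_def)
    hence "simple x a \<or> 0 < ncol {} {x} a" using ncol_0_simple by blast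
    thus "(of_bool (\<not> simple x a) :: real) <= of_bool (1 <= ncol {} {x} a)" by (auto simp: Suc_le_eq)
  qed
  also have "\<dots> <= card (Env {}) * (real s * p)^1"
  proof (rule col_bound)
    have "real (D * (card {x} + s)) <= real (D * (2 * t + 2))" by (intro of_nat_mono mult_le_mono) (use st in auto)
    also have "\<dots> <= p * (real m - real K)" by (rule pD)
    also have "\<dots> <= p * (real m - real (card ({} :: arc set)) - real s)"
      by (rule mult_left_mono) (use st Kdef p0 in auto)
    finally show "real (D * (card {x} + s)) <= p * (real m - real (card ({} :: arc set)) - real s)" .
  qed (use assms st Kdef Km in auto)
  also have "\<dots> <= card (Envs) * ((real t + 1) * p)"
    using p0 assms(2) by (simp add: mult_left_mono mult_right_mono)
  finally show ?thesis .
qed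

lemma FF_le:
  fixes c :: real
  assumes w: "w \<in> Envs" and x: "x < n" and c: "0 < c"
  shows "FF t h N \<theta> w x <= c * n / 2 * (\<Sum>j<n. (Xs w x j - qq N \<theta> * Ns w j)^2) + 1 / (2 * c)
     + QE w t x (\<lambda>a. of_bool (\<not> simple x a)) + avgH (\<lambda>y. QE w h y (\<lambda>b. of_bool (\<not> simple y b)))"
proof -
  have cn: "0 < c * n" using c npos by simp
  define d1 where "d1 j = QE w t x (\<lambda>a. of_bool (\<not> simple x a) * of_bool (endv x a = j))" for j
  define d2 where "d2 j = avgH (\<lambda>y. QE w h y (\<lambda>b. of_bool (\<not> simple y b) * of_bool (endv y b = j)))" for j
  have X: "\<bar>XX t h N \<theta> w x j - Xs w x j\<bar> <= d1 j" for j
  proof -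
    have "Xs w x j <= XX t h N \<theta> w x j" unfolding Xs_def XX_def by (rule QE_mono) auto
    moreover have "XX t h N \<theta> w x j <= Xs w x j + d1 j" unfolding Xs_def XX_def d1_def QE_add[symmetric]
      by (rule QE_mono) auto
    ultimately show ?thesis by linarith
  qed
  have Nu: "\<bar>nu w h j - Ns w j\<bar> <= d2 j" for j
  proof -
    have "Ns w j <= nu w h j" unfolding Ns_def nu_def PP_def by (intro avgH_mono QE_mono) auto
    moreover have "nu w h j <= Ns w j + d2 j" unfolding Ns_def nu_def PP_def d2_def avgH_add[symmetric] QE_add[symmetric]
      by (intro avgH_mono QE_mono) auto
    ultimately show ?thesis by linarith
  qed
  have "FF t h N \<theta> w x <= (\<Sum>j<n. \<bar>Xs w x j - qq N \<theta> * Ns w j\<bar> + d1 j + d2 j)"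
    unfolding FF_def
  proof (rule sum_mono)
    fix j
    have "\<bar>qq N \<theta> * (nu w h j - Ns w j)\<bar> <= 1 * d2 j"
      unfolding abs_mult using Nu qq_bounds[of N \<theta>] by (intro mult_mono) auto
    hence "\<bar>qq N \<theta> * nu w h j - qq N \<theta> * Ns w j\<bar> <= d2 j" by (simp add: right_diff_distrib)
    thus "\<bar>XX t h N \<theta> w x j - qq N \<theta> * nu w h j\<bar> <= \<bar>Xs w x j - qq N \<theta> * Ns w j\<bar> + d1 j + d2 j"
      using X[of j] by linarith
  qed
  also have "\<dots> <= (\<Sum>j<n. (c * n / 2 * (Xs w x j - qq N \<theta> * Ns w j)^2 + 1 / (2 * (c * n))) + d1 j + d2 j)"
    by (intro sum_mono add_right_mono abs_le_weighted_square[OF cn])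
  also have "\<dots> = c * n / 2 * (\<Sum>j<n. (Xs w x j - qq N \<theta> * Ns w j)^2) + real n * (1 / (2 * (c * n))) + (\<Sum>j<n. d1 j) + (\<Sum>j<n. d2 j)"
    by (simp add: sum.distrib sum_distrib_left)
  also have "real n * (1 / (2 * (c * n))) = 1 / (2 * c)" using npos by simp
  also have "(\<Sum>j<n. d1 j) = QE w t x (\<lambda>a. of_bool (\<not> simple x a))"
    unfolding d1_def QE_sum[symmetric]
  proof (rule QE_cong)
    fix a assume "a \<in> VL x t"
    hence "endv x a < n" using valid_endv x by (auto simp: VL_def)
    thus "(\<Sum>j<n. of_bool (\<not> simple x a) * of_bool (endv x a = j)) = (of_bool (\<not> simple x a) :: real)"
      unfolding sum_distrib_left[symmetric] by simp
  qed
  also have "(\<Sum>j<n. d2 j) = avgH (\<lambda>y. QE w h y (\<lambda>b. of_bool (\<not> simple y b)))"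
    unfolding d2_def avgH_sum[symmetric] QE_sum[symmetric]
  proof (intro avgH_cong QE_cong)
    fix y a assume "y < n" "a \<in> VL y h"
    hence "endv y a < n" using valid_endv by (auto simp: VL_def)
    thus "(\<Sum>j<n. of_bool (\<not> simple y a) * of_bool (endv y a = j)) = (of_bool (\<not> simple y a) :: real)"
      unfolding sum_distrib_left[symmetric] by simp
  qed
  finally show ?thesis .
qed

lemma FF_expect:
  fixes c :: real
  assumes c: "0 < c"
  shows "(\<Sum>w\<in>Envs. avgH (FF t h N \<theta> w))
     <= card (Envs) * (c * n / 2 * (\<theta> + Err) + 1 / (2 * c) + 2 * ((real t + 1) * p))"
proof -
  let ?E = "real (card (Envs))"
  let ?n1 = "\<lambda>w x. QE w t x (\<lambda>a. of_bool (\<not> simple x a))" and ?n2 = "\<lambda>w x. QE w h x (\<lambda>a. of_bool (\<not> simple x a))"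
  have "(\<Sum>w\<in>Envs. avgH (FF t h N \<theta> w)) <= (\<Sum>w\<in>Envs. avgH (\<lambda>x.
      c * n / 2 * (\<Sum>j<n. (Xs w x j - qq N \<theta> * Ns w j)^2) + 1 / (2 * c) + ?n1 w x + avgH (?n2 w)))"
    by (intro sum_mono avgH_mono FF_le[OF _ _ c])
  also have "\<dots> = c * n / 2 * (\<Sum>w\<in>Envs. avgH (\<lambda>x. \<Sum>j<n. (Xs w x j - qq N \<theta> * Ns w j)^2)) + ?E * (1 / (2 * c))
      + avgH (\<lambda>x. \<Sum>w\<in>Envs. ?n1 w x) + avgH (\<lambda>x. \<Sum>w\<in>Envs. ?n2 w x)"
    by (simp only: avgH_add avgH_cmult avgH_const sum.distrib sum_constant avgH_sum sum_distrib_left)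
  also have "\<dots> <= c * n / 2 * (?E * (\<theta> + Err)) + ?E * (1 / (2 * c)) + avgH (\<lambda>x. ?E * ((real t + 1) * p)) + avgH (\<lambda>x. ?E * ((real t + 1) * p))"
    by (intro add_mono mult_left_mono star avgH_mono nonsimple_bound order_refl) (use c teq in auto)
  finally show ?thesis by (simp add: algebra_simps)
qed

text \<open>The square sum is the chance that two walks in the same environment, started from
  independent uniform heads, end at the same vertex. Then the second start lies on the first
  trajectory or a collision occurs. The bound controls columns of \<open>hit\<close> and later the
  target mass of small sets.\<close>

lemma nu2_expect:
  assumes s: "s <= t"
  shows "(\<Sum>w\<in>Envs. \<Sum>j<n. (nu w s j)^2) <= card (Envs) * (real (D * (t + 1)) / m + real t * p)"
proof -
  let ?E = "real (card (Envs))"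
  have inner: "avgH (\<lambda>y. \<Sum>w\<in>Env (set a). QE w s y (\<lambda>b. of_bool (endv y b = endv x a)))
    <= card (Env (set a)) * (real (D * (t + 1)) / m + real t * p)" if a: "valid x a" "length a = s" and x: "x < n" for x a
  proof -
    let ?c = "real (card (Env (set a)))"
    have "(\<Sum>w\<in>Env (set a). QE w s y (\<lambda>b. of_bool (endv y b = endv x a)))
      <= of_bool (y \<in> set (x # verts a)) * ?c + ?c * (real t * p)^1" if y: "y < n" for y
    proof (cases "y \<in> set (x # verts a)")
      case True
      have "(\<Sum>w\<in>Env (set a). QE w s y (\<lambda>b. of_bool (endv y b = endv x a))) <= (\<Sum>w\<in>Env (set a). 1)"
        by (intro sum_mono QE_le_const) (use y Env_sub in auto)
      moreover have "0 <= ?c * (real t * p)^1" using p0 by simp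
      ultimately show ?thesis using True by (simp only: of_bool_eq mult_1_left sum_constant mult_1_right)
    next
      case False
      have "(\<Sum>w\<in>Env (set a). QE w s y (\<lambda>b. of_bool (endv y b = endv x a)))
        <= (\<Sum>w\<in>Env (set a). QE w s y (\<lambda>b. of_bool (1 <= ncol (set a) (set (y # x # verts a)) b)))"
      proof (intro sum_mono QE_mono)
        fix w b assume b: "b \<in> VL y s"
        have "1 <= ncol (set a) (set (y # x # verts a)) b" if e: "endv y b = endv x a"
        proof (rule ccontr)
          assume "\<not> 1 <= ncol (set a) (set (y # x # verts a)) b"
          hence "ncol (set a) (set (y # x # verts a)) b = 0" by simp
          moreover have "\<forall>e\<in>fst ` set a. fst e \<in> set (y # x # verts a) \<and> fst e \<noteq> y"
          proof
            fix e assume "e \<in> fst ` set a"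
            from tails_verts[OF a(1) this] show "fst e \<in> set (y # x # verts a) \<and> fst e \<noteq> y" using False by auto
          qed
          ultimately have d: "set (verts b) \<inter> set (y # x # verts a) = {}"
            using ncol_0_avoid[of y b "set a" "set (y # x # verts a)"] b by (auto simp: VL_def)
          have "endv x a \<in> set (x # verts a)" unfolding endv_last by (rule last_in_set) simp
          moreover have "endv y b \<in> set (y # verts b)" unfolding endv_last by (rule last_in_set) simp
          moreover have "set (y # verts b) \<inter> set (x # verts a) = {}" using d False by auto
          ultimately show False using e by (metis disjoint_iff)
        qed
        thus "(of_bool (endv y b = endv x a) :: real) <= of_bool (1 <= ncol (set a) (set (y # x # verts a)) b)" by auto
      qed
      also have "\<dots> <= ?c * (real t * p)^1" by (rule col_path[OF a(1) _ y s]) (use a s in simp)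
      finally show ?thesis by (simp only: False of_bool_eq mult_zero_left add_0_left)
    qed
    hence "avgH (\<lambda>y. \<Sum>w\<in>Env (set a). QE w s y (\<lambda>b. of_bool (endv y b = endv x a)))
      <= avgH (\<lambda>y. of_bool (y \<in> set (x # verts a)) * ?c + ?c * (real t * p)^1)" by (rule avgH_mono)
    also have "\<dots> = avgH (\<lambda>y. of_bool (y \<in> set (x # verts a))) * ?c + ?c * (real t * p)"
      by (simp only: avgH_add avgH_cmult2 avgH_const power_one_right)
    also have "\<dots> <= real (D * (t + 1)) / m * ?c + ?c * (real t * p)"
    proof (intro add_right_mono mult_right_mono)
      have "card (set (x # verts a)) <= t + 1" using card_length[of "x # verts a"] a s by simp
      hence "real (D * card (set (x # verts a))) <= real (D * (t + 1))" by (intro of_nat_mono mult_le_mono) auto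
      thus "avgH (\<lambda>y. of_bool (y \<in> set (x # verts a))) <= real (D * (t + 1)) / m"
        using avgH_mem[of "set (x # verts a)"] by (meson List.finite_set divide_right_mono of_nat_0_le_iff order_trans)
    qed simp
    finally show ?thesis by (simp add: algebra_simps)
  qed
  have each: "avgH (\<lambda>y. \<Sum>w\<in>Envs. QE w s x (\<lambda>a. 1 * QE w s y (\<lambda>b. of_bool (endv y b = endv x a))))
    <= ?E * (real (D * (t + 1)) / m + real t * p)" if x: "x < n" for x
  proof -
    have "avgH (\<lambda>y. \<Sum>w\<in>Envs. QE w s x (\<lambda>a. 1 * QE w s y (\<lambda>b. of_bool (endv y b = endv x a))))
      = (\<Sum>a\<in>VL x s. wt a * (1 * avgH (\<lambda>y. \<Sum>w\<in>Env (set a). QE w s y (\<lambda>b. of_bool (endv y b = endv x a)))))"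
      unfolding sum_envs_QE avgH_sum avgH_cmult ..
    also have "\<dots> <= (\<Sum>a\<in>VL x s. wt a * (1 * (card (Env (set a)) * (real (D * (t + 1)) / m + real t * p))))"
      by (intro sum_mono mult_left_mono inner x) (auto simp: VL_def)
    also have "\<dots> = (\<Sum>a\<in>VL x s. wt a * card (Env (set a))) * (real (D * (t + 1)) / m + real t * p)"
      by (simp only: sum_distrib_right mult_1_left mult.assoc)
    finally show ?thesis unfolding sum_wt_Env[OF x] .
  qed
  have "(\<Sum>j<n. (nu w s j)^2) = avgH (\<lambda>x. avgH (\<lambda>y. QE w s x (\<lambda>a. 1 * QE w s y (\<lambda>b. of_bool (endv y b = endv x a)))))" for w
  proof -
    have "(\<Sum>j<n. (nu w s j)^2) = avgH (\<lambda>x. avgH (\<lambda>y. \<Sum>j<n. QE w s x (\<lambda>b. 1 * of_bool (endv x b = j)) * QE w s y (\<lambda>b. 1 * of_bool (endv y b = j))))"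
      by (simp only: nu_def PP_def power2_eq_square avgH_cmult avgH_cmult2 avgH_sum mult_1_left)
    also have "\<dots> = avgH (\<lambda>x. avgH (\<lambda>y. QE w s x (\<lambda>a. 1 * QE w s y (\<lambda>b. 1 * of_bool (endv y b = endv x a)))))"
      by (intro avgH_cong QE_meet)
    finally show ?thesis by (simp only: mult_1_left)
  qed
  hence "(\<Sum>w\<in>Envs. \<Sum>j<n. (nu w s j)^2)
    = avgH (\<lambda>x. avgH (\<lambda>y. \<Sum>w\<in>Envs. QE w s x (\<lambda>a. 1 * QE w s y (\<lambda>b. of_bool (endv y b = endv x a)))))"
    by (simp only: avgH_sum)
  also have "\<dots> <= avgH (\<lambda>x. ?E * (real (D * (t + 1)) / m + real t * p))" by (rule avgH_mono[OF each])
  finally show ?thesis by simp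
qed

text \<open>If traversing \<open>e\<close> is counted as the first step, a return to
  \<open>e\<close> repeats a tail within \<open>t + 1\<close> steps, so the trajectory is not
  simple. Summing over the tails at \<open>x\<close> gives \<open>dp x\<close> times a walk
  probability.\<close>

lemma return_expect:
  "(\<Sum>w\<in>Envs. \<Sum>e\<in>T. hit w t (fst (w e)) {e}) <= card (Envs) * (real m * ((real t + 1) * p))"
proof -
  let ?E = "real (card (Envs))"
  have "(\<Sum>e\<in>T. hit w t (fst (w e)) {e}) <= (\<Sum>x<n. dp x * QE w (t + 1) x (\<lambda>a. of_bool (\<not> simple x a)))"
    if w: "w \<in> Envs" for w
    unfolding sum_T
  proof (rule sum_mono)
    fix x assume "x \<in> {..<n}"
    hence x: "x < n" by simp
    have dpx: "0 < dp x" using deg2[OF x] by simp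
    have "(\<Sum>k<dp x. hit w t (fst (w (x, k))) {(x, k)}) = dp x * QE w (Suc t) x (\<lambda>a. of_bool (fst (hd a) \<in> fst ` set (tl a)))"
      using dpx unfolding QE_Suc[OF w x] hit_def by simp
    also have "\<dots> <= dp x * QE w (Suc t) x (\<lambda>a. of_bool (\<not> simple x a))"
    proof (intro mult_left_mono QE_mono)
      fix a assume "a \<in> VL x (Suc t)"
      hence a: "valid x a" "a \<noteq> []" by (auto simp: VL_def)
      have "\<not> simple x a" if "fst (hd a) \<in> fst ` set (tl a)"
        using simple_tails[OF a(1)] that a(2) by (cases a) auto
      thus "(of_bool (fst (hd a) \<in> fst ` set (tl a)) :: real) <= of_bool (\<not> simple x a)" by auto
    qed simp
    finally show "(\<Sum>k<dp x. hit w t (fst (w (x, k))) {(x, k)}) <= dp x * QE w (t + 1) x (\<lambda>a. of_bool (\<not> simple x a))" by simp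
  qed
  hence "(\<Sum>w\<in>Envs. \<Sum>e\<in>T. hit w t (fst (w e)) {e})
    <= (\<Sum>w\<in>Envs. \<Sum>x<n. dp x * QE w (t + 1) x (\<lambda>a. of_bool (\<not> simple x a)))" by (rule sum_mono)
  also have "\<dots> = (\<Sum>x<n. dp x * (\<Sum>w\<in>Envs. QE w (t + 1) x (\<lambda>a. of_bool (\<not> simple x a))))"
    by (subst sum.swap) (simp only: sum_distrib_left)
  also have "\<dots> <= (\<Sum>x<n. dp x * (?E * ((real t + 1) * p)))"
    by (intro sum_mono mult_left_mono nonsimple_bound) auto
  also have "\<dots> = ?E * (real m * ((real t + 1) * p))"
    using m_num sums by (simp add: num_arcs_def flip: sum_distrib_right of_nat_sum)
  finally show ?thesis .
qed

end

text \<open>Chain rule for a uniform list: given its predecessors, an entry at a position of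
  \<open>I\<close> satisfies \<open>Q\<close> with conditional probability at most
  \<open>d\<close>.\<close>

lemma card_sequential:
  fixes Q :: "'a list => 'a => bool" and d :: real
  assumes "finite S" "0 <= d" "I \<subseteq> {..<M}"
    and "\<And>p. set p \<subseteq> S ==> length p < M ==> real (card {g\<in>S. Q p g}) <= d * card S"
  shows "real (card {gs. set gs \<subseteq> S \<and> length gs = M \<and> (\<forall>r\<in>I. Q (take r gs) (gs ! r))}) <= d ^ card I * real (card S) ^ M"
  using assms(3,4)
proof (induction M arbitrary: I)
  case 0
  hence "I = {}" by auto
  moreover have "{gs. set gs \<subseteq> S \<and> length gs = 0 \<and> (\<forall>r\<in>{}. Q (take r gs) (gs ! r))} = {[]}" by auto
  ultimately show ?case by simp
next
  case (Suc M)
  define I' where "I' = I \<inter> {..<M}"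
  define A where "A = {gs. set gs \<subseteq> S \<and> length gs = M \<and> (\<forall>r\<in>I'. Q (take r gs) (gs ! r))}"
  have A: "real (card A) <= d ^ card I' * real (card S) ^ M"
    unfolding A_def by (rule Suc.IH) (use Suc.prems in \<open>auto simp: I'_def\<close>)
  have finA: "finite A" unfolding A_def
    by (rule finite_subset[OF _ finite_lists_length_eq[OF assms(1), of M]]) auto
  have finI: "finite I" using Suc.prems(1) finite_subset by blast
  define B where "B gs = (if M \<in> I then {g\<in>S. Q gs g} else S)" for gs
  define c where "c = (if M \<in> I then d * card S else real (card S))"
  have "{gs. set gs \<subseteq> S \<and> length gs = Suc M \<and> (\<forall>r\<in>I. Q (take r gs) (gs ! r))} \<subseteq> (\<lambda>(gs, g). gs @ [g]) ` (SIGMA gs:A. B gs)"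
  proof
    fix hs assume hs: "hs \<in> {gs. set gs \<subseteq> S \<and> length gs = Suc M \<and> (\<forall>r\<in>I. Q (take r gs) (gs ! r))}"
    then obtain gs g where gs: "hs = gs @ [g]" "length gs = M" by (auto simp: length_Suc_conv_rev)
    have set: "set gs \<subseteq> S" "g \<in> S" using hs gs by auto
    have Q: "Q (take r hs) (hs ! r)" if "r \<in> I" for r using hs that by simp
    have "gs \<in> A" unfolding A_def mem_Collect_eq
    proof (intro conjI ballI set gs(2))
      fix r assume "r \<in> I'"
      hence "r \<in> I" "r < M" by (auto simp: I'_def)
      thus "Q (take r gs) (gs ! r)" using Q[of r] gs by (simp add: nth_append)
    qed
    moreover have "g \<in> B gs" using set Q[of M] gs(1) by (simp add: B_def flip: gs(2))
    ultimately show "hs \<in> (\<lambda>(gs, g). gs @ [g]) ` (SIGMA gs:A. B gs)"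
      using gs by (intro image_eqI[of _ _ "(gs, g)"]) auto
  qed
  note sub = this
  have finAB: "finite (SIGMA gs:A. B gs)" using finA assms(1) by (auto simp: B_def)
  have "card {gs. set gs \<subseteq> S \<and> length gs = Suc M \<and> (\<forall>r\<in>I. Q (take r gs) (gs ! r))} <= card (SIGMA gs:A. B gs)"
    by (rule order_trans[OF card_mono[OF finite_imageI[OF finAB] sub] card_image_le[OF finAB]])
  also have "card (SIGMA gs:A. B gs) = (\<Sum>gs\<in>A. card (B gs))" using finA assms(1) by (simp add: card_SigmaI B_def)
  finally have "real (card {gs. set gs \<subseteq> S \<and> length gs = Suc M \<and> (\<forall>r\<in>I. Q (take r gs) (gs ! r))}) <= (\<Sum>gs\<in>A. real (card (B gs)))"
    by (simp only: of_nat_sum[symmetric] of_nat_le_iff)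
  also have "\<dots> <= (\<Sum>gs\<in>A. c)"
    by (rule sum_mono) (use Suc.prems(2) in \<open>auto simp: B_def c_def A_def\<close>)
  also have "\<dots> = card A * c" by simp
  also have "\<dots> <= (d ^ card I' * real (card S) ^ M) * c"
    by (rule mult_right_mono[OF A]) (use assms(2) in \<open>simp add: c_def\<close>)
  also have "\<dots> = d ^ card I * real (card S) ^ Suc M"
  proof (cases "M \<in> I")
    case True
    have "I = insert M I'" using True Suc.prems(1) by (auto simp: I'_def less_Suc_eq)
    moreover have "M \<notin> I'" "finite I'" using finI by (auto simp: I'_def)
    ultimately have "card I = Suc (card I')" by simp
    thus ?thesis using True by (simp add: c_def)
  next
    case False
    have "I = I'" using False Suc.prems(1) by (auto simp: I'_def less_Suc_eq)
    thus ?thesis using False by (simp add: c_def)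
  qed
  finally show ?case .
qed

section \<open>Swapping tails\<close>

fun swp :: "tail list => tail list => env => env" where
  "swp (e # es) (g # gs) w = swp es gs (\<lambda>x. w (Transposition.transpose e g x))"
| "swp _ _ w = w"

lemma swp_other: "x \<notin> set es \<union> set gs ==> swp es gs w x = w x"
  by (induction es gs w rule: swp.induct) (auto simp: transpose_apply_other)

text \<open>Swaps are carried out from left to right. The value at \<open>gs ! r\<close> is still
  the original one when its turn comes, provided this tail did not occur earlier in
  \<open>gs\<close>; later swaps leave \<open>es ! r\<close> alone, since \<open>es\<close> is
  distinct and disjoint from \<open>gs\<close>.\<close>

lemma swp_nth:
  assumes "length es = length gs" "distinct es" "set es \<inter> set gs = {}" "r < length gs" "gs ! r \<notin> set (take r gs)"
  shows "swp es gs w (es ! r) = w (gs ! r)"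
  using assms
proof (induction es gs w arbitrary: r rule: swp.induct)
  case (1 e es g gs w)
  show ?case
  proof (cases r)
    case 0
    have "e \<notin> set es \<union> set gs" using 1 by auto
    thus ?thesis using 0 swp_other[of e es gs "\<lambda>x. w (Transposition.transpose e g x)"] by simp
  next
    case (Suc r')
    have "swp es gs (\<lambda>x. w (Transposition.transpose e g x)) (es ! r') = w (Transposition.transpose e g (gs ! r'))"
      by (rule "1.IH") (use "1.prems" Suc in auto)
    moreover have "gs ! r' \<noteq> e" "gs ! r' \<noteq> g" using "1.prems" Suc by auto
    ultimately show ?thesis using Suc by (simp add: transpose_apply_other)
  qed
qed auto

context config begin

lemma trans_env:
  assumes "w \<in> Envs" "e \<in> T" "g \<in> T"
  shows "(\<lambda>x. w (Transposition.transpose e g x)) \<in> Envs"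
proof (rule envsI)
  have "bij_betw (Transposition.transpose e g) T T"
    by (intro bij_betw_imageI inj_on_subset[OF inj_transpose]) (auto simp: assms transpose_image_eq)
  from bij_betw_trans[OF this envs_bij[OF assms(1)]]
  show "bij_betw (\<lambda>x. w (Transposition.transpose e g x)) T H" by (simp add: o_def)
  fix x assume "x \<notin> T"
  thus "w (Transposition.transpose e g x) = undefined"
    using assms envs_undef[OF assms(1), of x] by (metis transpose_apply_other)
qed

text \<open>Transposing two tails outside \<open>A\<close> is an involution of the environments with
  prescribed values on \<open>A\<close>, so the uniform law conditioned on those values is
  invariant.\<close>

lemma sum_swp:
  fixes w0 :: env
  assumes "set es \<subseteq> T - A" "set gs \<subseteq> T - A"
  defines "W \<equiv> {w \<in> Envs. \<forall>e\<in>A. w e = w0 e}"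
  shows "(\<Sum>w\<in>W. \<phi> (swp es gs w)) = (\<Sum>w\<in>W. \<phi> w)" "\<And>w. w \<in> W ==> swp es gs w \<in> W"
proof -
  have tr: "(\<lambda>x. w (Transposition.transpose e g x)) \<in> W" if "w \<in> W" "e \<in> T - A" "g \<in> T - A" for w e g
  proof -
    have "Transposition.transpose e g x = x" if "x \<in> A" for x
      using that \<open>e \<in> T - A\<close> \<open>g \<in> T - A\<close> by (intro transpose_apply_other) auto
    thus ?thesis using that trans_env unfolding W_def by auto
  qed
  have one: "(\<Sum>w\<in>W. \<psi> (\<lambda>x. w (Transposition.transpose e g x))) = (\<Sum>w\<in>W. \<psi> w)" if "e \<in> T - A" "g \<in> T - A" for e g \<psi>
    by (rule sum.reindex_bij_witness[where i = "\<lambda>w x. w (Transposition.transpose e g x)" and j = "\<lambda>w x. w (Transposition.transpose e g x)"])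
       (use tr that in auto)
  show "(\<Sum>w\<in>W. \<phi> (swp es gs w)) = (\<Sum>w\<in>W. \<phi> w)" using assms(1,2)
  proof (induction es arbitrary: gs)
    case (Cons e es)
    show ?case
    proof (cases gs)
      case (Cons g gs')
      have "(\<Sum>w\<in>W. \<phi> (swp (e # es) gs w)) = (\<Sum>w\<in>W. (\<lambda>w. \<phi> (swp es gs' w)) (\<lambda>x. w (Transposition.transpose e g x)))"
        by (simp add: Cons)
      also have "\<dots> = (\<Sum>w\<in>W. \<phi> (swp es gs' w))" by (rule one) (use Cons.prems Cons in auto)
      also have "\<dots> = (\<Sum>w\<in>W. \<phi> w)" by (rule Cons.IH) (use Cons.prems Cons in auto)
      finally show ?thesis .
    qed simp
  qed simp
  show "swp es gs w \<in> W" if "w \<in> W" for w using assms(1,2) that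
  proof (induction es gs w rule: swp.induct)
    case (1 e es g gs w)
    have "(\<lambda>x. w (Transposition.transpose e g x)) \<in> W" by (rule tr) (use 1 in auto)
    thus ?case using 1 by simp
  qed auto
qed

subsection \<open>Stability of walk functionals under local modifications\<close>

lemma hit_nonneg: "0 <= hit w s x S" unfolding hit_def by (rule QE_nonneg) simp

lemma hit_subset: "S \<subseteq> S' ==> hit w s x S <= hit w s x S'"
  unfolding hit_def by (rule QE_mono) auto

lemma hit_sum:
  assumes "finite S" shows "hit w s x S <= (\<Sum>e\<in>S. hit w s x {e})"
  unfolding hit_def QE_sum[symmetric]
proof (rule QE_mono)
  fix a
  show "(of_bool (fst ` set a \<inter> S \<noteq> {}) :: real) <= (\<Sum>e\<in>S. of_bool (fst ` set a \<inter> {e} \<noteq> {}))"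
  proof (cases "fst ` set a \<inter> S = {}")
    case False
    then obtain e where e: "e \<in> S" "fst ` set a \<inter> {e} \<noteq> {}" by blast
    have "(of_bool (fst ` set a \<inter> {e} \<noteq> {}) :: real) <= (\<Sum>e\<in>S. of_bool (fst ` set a \<inter> {e} \<noteq> {}))"
      by (rule member_le_sum[OF e(1) _ assms]) simp
    moreover have "(of_bool (fst ` set a \<inter> {e} \<noteq> {}) :: real) = 1" using e(2) by (simp only: of_bool_eq(2) not_False_eq_True)
    moreover have "(of_bool (fst ` set a \<inter> S \<noteq> {}) :: real) <= 1" by simp
    ultimately show ?thesis by linarith
  qed (auto intro: sum_nonneg)
qed

lemma hit_Un: "hit w s x (S \<union> S') <= hit w s x S + hit w s x S'"
  unfolding hit_def QE_add[symmetric] by (rule QE_mono) auto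

lemma hit_mono_time:
  assumes "w \<in> Envs" "x < n" "s <= t" shows "hit w s x S <= hit w t x S"
proof -
  have "hit w t x S = QE w (s + (t - s)) x (\<lambda>a. of_bool (fst ` set a \<inter> S \<noteq> {}))" using assms(3) by (simp add: hit_def)
  also have "\<dots> = QE w s x (\<lambda>a. QE w (t - s) (endv x a) (\<lambda>b. of_bool (fst ` set (a @ b) \<inter> S \<noteq> {})))"
    by (rule QE_append[OF assms(1,2)])
  also have "\<dots> \<ge> QE w s x (\<lambda>a. QE w (t - s) (endv x a) (\<lambda>b. of_bool (fst ` set a \<inter> S \<noteq> {})))"
    by (intro QE_mono) auto
  also have "QE w s x (\<lambda>a. QE w (t - s) (endv x a) (\<lambda>b. of_bool (fst ` set a \<inter> S \<noteq> {}))) = hit w s x S"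
    unfolding hit_def by (rule QE_cong) (use QE_const[OF assms(1)] valid_endv assms(2) in \<open>auto simp: VL_def\<close>)
  finally show ?thesis .
qed

lemma QE_avoid_eq:
  assumes "\<And>e. e \<notin> S ==> w e = w' e"
  shows "QE w s x (\<lambda>a. of_bool (fst ` set a \<inter> S = {}) * \<phi> a) = QE w' s x (\<lambda>a. of_bool (fst ` set a \<inter> S = {}) * \<phi> a)"
  unfolding QE_def
proof (intro sum.cong refl)
  fix a
  have "ext w (set a) = ext w' (set a)" if "fst ` set a \<inter> S = {}"
    unfolding ext_def using that assms by (intro ball_cong refl) (metis disjoint_iff imageI)
  thus "wt a * of_bool (ext w (set a)) * (of_bool (fst ` set a \<inter> S = {}) * \<phi> a)
     = wt a * of_bool (ext w' (set a)) * (of_bool (fst ` set a \<inter> S = {}) * \<phi> a)" by (cases "fst ` set a \<inter> S = {}") simp_all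
qed

text \<open>The complementary event, avoiding \<open>S'\<close>, depends only on values where the
  two environments agree.\<close>

lemma hit_eq:
  assumes "w \<in> Envs" "w' \<in> Envs" "x < n" "\<And>e. e \<notin> S ==> w e = w' e" "S \<subseteq> S'"
  shows "hit w s x S' = hit w' s x S'"
proof -
  have *: "hit w s x S' = 1 - QE w s x (\<lambda>a. of_bool (fst ` set a \<inter> S' = {}) * 1)" if "w \<in> Envs" for w
  proof -
    have "hit w s x S' = QE w s x (\<lambda>a. 1 - of_bool (fst ` set a \<inter> S' = {}) * 1)"
      unfolding hit_def by (rule QE_cong) simp
    thus ?thesis by (simp only: QE_diff QE_const[OF that assms(3)])
  qed
  show ?thesis unfolding *[OF assms(1)] *[OF assms(2)]
    by (subst QE_avoid_eq[of S' w w']) (use assms in auto)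
qed

text \<open>Trajectories avoiding \<open>S\<close> contribute equally in both environments. The
  others have mass \<open>hit\<close> in each, the same number by \<open>hit_eq\<close>, whence the
  factor \<open>2\<close>.\<close>

lemma QE_endv_change:
  assumes "w \<in> Envs" "w' \<in> Envs" "x < n" "\<And>e. e \<notin> S ==> w e = w' e" "\<And>a. 0 <= c a \<and> c a <= 1"
  shows "(\<Sum>j<n. \<bar>QE w s x (\<lambda>a. c a * of_bool (endv x a = j)) - QE w' s x (\<lambda>a. c a * of_bool (endv x a = j))\<bar>) <= 2 * hit w s x S"
proof -
  define A where "A w j = QE w s x (\<lambda>a. of_bool (fst ` set a \<inter> S \<noteq> {}) * of_bool (endv x a = j))" for w j
  have dec: "QE w s x (\<lambda>a. c a * of_bool (endv x a = j)) = QE w s x (\<lambda>a. of_bool (fst ` set a \<inter> S = {}) * (c a * of_bool (endv x a = j)))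
      + QE w s x (\<lambda>a. of_bool (fst ` set a \<inter> S \<noteq> {}) * (c a * of_bool (endv x a = j)))" for w j
    unfolding QE_add[symmetric] by (rule QE_cong) simp
  have b: "0 <= QE w s x (\<lambda>a. of_bool (fst ` set a \<inter> S \<noteq> {}) * (c a * of_bool (endv x a = j)))"
     "QE w s x (\<lambda>a. of_bool (fst ` set a \<inter> S \<noteq> {}) * (c a * of_bool (endv x a = j))) <= A w j" for w j
    unfolding A_def using assms(5) by (auto intro!: QE_nonneg QE_mono mult_left_mono)
  have "\<bar>QE w s x (\<lambda>a. c a * of_bool (endv x a = j)) - QE w' s x (\<lambda>a. c a * of_bool (endv x a = j))\<bar> <= A w j + A w' j" for j
  proof -
    have "QE w s x (\<lambda>a. of_bool (fst ` set a \<inter> S = {}) * (c a * of_bool (endv x a = j)))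
       = QE w' s x (\<lambda>a. of_bool (fst ` set a \<inter> S = {}) * (c a * of_bool (endv x a = j)))"
      by (rule QE_avoid_eq) (rule assms(4))
    thus ?thesis using b[of w j] b[of w' j] dec[of w j] dec[of w' j] by linarith
  qed
  hence le: "(\<Sum>j<n. \<bar>QE w s x (\<lambda>a. c a * of_bool (endv x a = j)) - QE w' s x (\<lambda>a. c a * of_bool (endv x a = j))\<bar>)
    <= (\<Sum>j<n. A w j) + (\<Sum>j<n. A w' j)" by (subst sum.distrib[symmetric]) (rule sum_mono)
  have hA: "(\<Sum>j<n. A w j) = hit w s x S" for w
    unfolding A_def hit_def QE_sum[symmetric]
  proof (rule QE_cong)
    fix a assume "a \<in> VL x s"
    hence "endv x a < n" using valid_endv assms(3) by (auto simp: VL_def)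
    thus "(\<Sum>j<n. of_bool (fst ` set a \<inter> S \<noteq> {}) * of_bool (endv x a = j)) = (of_bool (fst ` set a \<inter> S \<noteq> {}) :: real)"
      unfolding sum_distrib_left[symmetric] by simp
  qed
  have "hit w s x S = hit w' s x S"
    by (rule hit_eq[OF assms(1-3), of S]) (use assms(4) in auto)
  thus ?thesis using le unfolding hA by simp
qed

lemma FF_change:
  assumes "w \<in> Envs" "w' \<in> Envs" "x < n" "\<And>e. e \<notin> S ==> w e = w' e" "h <= t"
  shows "FF t h N \<theta> w' x <= FF t h N \<theta> w x + 2 * hit w t x S + 2 * avgH (\<lambda>y. hit w t y S)"
proof -
  have X: "(\<Sum>j<n. \<bar>XX t h N \<theta> w x j - XX t h N \<theta> w' x j\<bar>) <= 2 * hit w t x S"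
    unfolding XX_def by (rule QE_endv_change[OF assms(1-4)]) auto
  have Nu: "(\<Sum>j<n. \<bar>nu w h j - nu w' h j\<bar>) <= 2 * avgH (\<lambda>y. hit w t y S)"
  proof -
    have "(\<Sum>j<n. \<bar>nu w h j - nu w' h j\<bar>) <= (\<Sum>j<n. avgH (\<lambda>y. \<bar>PP w h y j - PP w' h y j\<bar>))"
    proof (rule sum_mono)
      fix j
      have "nu w h j - nu w' h j <= avgH (\<lambda>y. \<bar>PP w h y j - PP w' h y j\<bar>)"
        unfolding nu_def avgH_diff[symmetric] by (rule avgH_mono) simp
      moreover have "nu w' h j - nu w h j <= avgH (\<lambda>y. \<bar>PP w h y j - PP w' h y j\<bar>)"
        unfolding nu_def avgH_diff[symmetric] by (rule avgH_mono) simp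
      ultimately show "\<bar>nu w h j - nu w' h j\<bar> <= avgH (\<lambda>y. \<bar>PP w h y j - PP w' h y j\<bar>)" by linarith
    qed
    also have "\<dots> <= avgH (\<lambda>y. 2 * hit w h y S)"
      unfolding avgH_sum[symmetric] PP_def
    proof (rule avgH_mono)
      fix y assume y: "y < n"
      show "(\<Sum>j<n. \<bar>QE w h y (\<lambda>a. of_bool (endv y a = j)) - QE w' h y (\<lambda>a. of_bool (endv y a = j))\<bar>) <= 2 * hit w h y S"
        using QE_endv_change[OF assms(1,2) y assms(4), where c = "\<lambda>_. 1" and s = h] by simp
    qed
    also have "\<dots> <= avgH (\<lambda>y. 2 * hit w t y S)"
      by (intro avgH_mono mult_left_mono hit_mono_time[OF assms(1) _ assms(5)]) auto
    finally show ?thesis by (simp add: avgH_cmult)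
  qed
  have "FF t h N \<theta> w' x <= (\<Sum>j<n. \<bar>XX t h N \<theta> w x j - qq N \<theta> * nu w h j\<bar> + \<bar>XX t h N \<theta> w x j - XX t h N \<theta> w' x j\<bar> + \<bar>nu w h j - nu w' h j\<bar>)"
    unfolding FF_def
  proof (rule sum_mono)
    fix j
    have "\<bar>qq N \<theta> * (nu w h j - nu w' h j)\<bar> <= 1 * \<bar>nu w h j - nu w' h j\<bar>"
      unfolding abs_mult using qq_bounds[of N \<theta>] by (intro mult_right_mono) auto
    hence "\<bar>qq N \<theta> * nu w h j - qq N \<theta> * nu w' h j\<bar> <= \<bar>nu w h j - nu w' h j\<bar>" by (simp add: right_diff_distrib)
    thus "\<bar>XX t h N \<theta> w' x j - qq N \<theta> * nu w' h j\<bar> <= \<bar>XX t h N \<theta> w x j - qq N \<theta> * nu w h j\<bar>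
       + \<bar>XX t h N \<theta> w x j - XX t h N \<theta> w' x j\<bar> + \<bar>nu w h j - nu w' h j\<bar>" by linarith
  qed
  thus ?thesis using X Nu by (simp add: sum.distrib FF_def)
qed

text \<open>Using \<open>e\<close> at step \<open>s\<close> means standing at its vertex at time
  \<open>s\<close>. Averaged over the start, this converts second moments of \<open>nu\<close> into
  a bound on how often a single tail is hit.\<close>

lemma hit_column:
  assumes "w \<in> Envs"
  shows "avgH (\<lambda>x. hit w t x {e}) <= (\<Sum>s<t. nu w s (fst e))"
proof -
  have "hit w t x {e} <= (\<Sum>s<t. PP w s x (fst e))" if x: "x < n" for x
  proof -
    have "hit w t x {e} <= QE w t x (\<lambda>a. \<Sum>s<t. of_bool (endv x (take s a) = fst e))"
      unfolding hit_def
    proof (rule QE_mono)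
      fix a assume "a \<in> VL x t"
      hence a: "valid x a" "length a = t" by (auto simp: VL_def)
      show "of_bool (fst ` set a \<inter> {e} \<noteq> {}) <= (\<Sum>s<t. of_bool (endv x (take s a) = fst e) :: real)"
      proof (cases "e \<in> fst ` set a")
        case True
        then obtain s where s: "s < t" "fst (a ! s) = e" using a(2) by (auto simp: in_set_conv_nth image_iff)
        have "endv x (take s a) = fst e" using wt_take_Suc(2)[OF a(1), of s] s a(2) by simp
        hence "1 = (of_bool (endv x (take s a) = fst e) :: real)" by simp
        also have "\<dots> <= (\<Sum>s<t. of_bool (endv x (take s a) = fst e))" by (rule member_le_sum) (use s in auto)
        finally show ?thesis by (rule order_trans[rotated]) simp
      next
        case False
        hence "fst ` set a \<inter> {e} = {}" by blast
        thus ?thesis by (simp only: of_bool_eq simp_thms) (simp add: sum_nonneg)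
      qed
    qed
    also have "\<dots> = (\<Sum>s<t. PP w s x (fst e))" unfolding QE_sum
    proof (intro sum.cong refl)
      fix s assume "s \<in> {..<t}"
      hence st: "t = s + (t - s)" by simp
      have "QE w t x (\<lambda>a. of_bool (endv x (take s a) = fst e))
        = QE w s x (\<lambda>a. QE w (t - s) (endv x a) (\<lambda>b. of_bool (endv x (take s (a @ b)) = fst e)))"
        by (subst st) (rule QE_append[OF assms x])
      also have "\<dots> = PP w s x (fst e)" unfolding PP_def
      proof (rule QE_cong)
        fix a assume "a \<in> VL x s"
        hence "length a = s" "endv x a < n" using valid_endv x by (auto simp: VL_def)
        thus "QE w (t - s) (endv x a) (\<lambda>b. of_bool (endv x (take s (a @ b)) = fst e)) = of_bool (endv x a = fst e)"
          using QE_const[OF assms] by simp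
      qed
      finally show "QE w t x (\<lambda>a. of_bool (endv x (take s a) = fst e)) = PP w s x (fst e)" .
    qed
    finally show ?thesis .
  qed
  hence "avgH (\<lambda>x. hit w t x {e}) <= avgH (\<lambda>x. \<Sum>s<t. PP w s x (fst e))" by (rule avgH_mono)
  thus ?thesis by (simp only: nu_def avgH_sum)
qed

lemma hit_row_sum:
  assumes "w \<in> Envs" "x < n" shows "(\<Sum>e\<in>T. hit w t x {e}) <= t"
proof -
  have "(\<Sum>e\<in>T. hit w t x {e}) = QE w t x (\<lambda>a. \<Sum>e\<in>T. of_bool (fst ` set a \<inter> {e} \<noteq> {}))"
    unfolding hit_def QE_sum ..
  also have "\<dots> <= t"
  proof (rule QE_le_const[OF assms])
    fix a assume "a \<in> VL x t"
    have "(\<Sum>e\<in>T. of_bool (fst ` set a \<inter> {e} \<noteq> {})) = (\<Sum>e\<in>T \<inter> fst ` set a. 1 :: real)"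
      by (rule sum.mono_neutral_cong_right) auto
    also have "\<dots> = card (T \<inter> fst ` set a)" by simp
    also have "card (T \<inter> fst ` set a) <= card (set (map fst a))" by (intro card_mono) auto
    also have "card (set (map fst a)) <= length (map fst a)" by (rule card_length)
    finally show "(\<Sum>e\<in>T. of_bool (fst ` set a \<inter> {e} \<noteq> {})) <= real t" using \<open>a \<in> VL x t\<close> by (simp add: VL_def)
  qed
  finally show ?thesis .
qed

lemma card_gt_le_sum:
  fixes \<phi> :: "'b => real"
  assumes "finite A" "0 < k" "\<And>a. a \<in> A ==> 0 <= \<phi> a"
  shows "real (card {a\<in>A. k < \<phi> a}) <= (\<Sum>a\<in>A. \<phi> a) / k"
proof -
  have "real (card {a\<in>A. k < \<phi> a}) * k = (\<Sum>a\<in>{a\<in>A. k < \<phi> a}. k)" by simp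
  also have "\<dots> <= (\<Sum>a\<in>{a\<in>A. k < \<phi> a}. \<phi> a)" by (rule sum_mono) auto
  also have "\<dots> <= (\<Sum>a\<in>A. \<phi> a)" by (rule sum_mono2) (use assms in auto)
  finally show ?thesis using assms(2) by (simp add: field_simps)
qed

lemma sum_T_env: "w \<in> Envs ==> (\<Sum>e\<in>T. \<phi> (fst (w e))) = real m * avgH \<phi>"
  using sum.reindex_bij_betw[OF envs_bij, of w "\<lambda>f. \<phi> (fst f)"] mpos by (simp add: avgH_def)

lemma card_T_env_gt:
  assumes "w \<in> Envs" "0 < k" "\<And>x. x < n ==> 0 <= \<phi> x"
  shows "real (card {e\<in>T. k < \<phi> (fst (w e))}) <= real m * avgH \<phi> / k"
  using card_gt_le_sum[of T k "\<lambda>e. \<phi> (fst (w e))"] assms sum_T_env[OF assms(1), of \<phi>] envs_fst[OF assms(1)] by simp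

end

section \<open>Exceptional vertices under random swaps\<close>

context config begin

text \<open>Three properties that make swaps harmless: few exceptional vertices, no tail hit often
  from a random start, few tails likely to be reused soon after they are traversed. The thresholds
  \<open>\<eta> / 4\<close> and \<open>\<kappa> / 2\<close> leave room for the perturbations in
  \<open>switch_pointwise\<close>, where they grow to \<open>\<eta> / 2\<close> and
  \<open>\<kappa>\<close>.\<close>

definition Good :: "nat => nat => nat => real => real => real => real => real => real => env => bool" where
  "Good t h N \<theta> \<eta> \<delta> cH cJ \<kappa> w \<longleftrightarrow> avgH (\<lambda>x. of_bool (\<eta> / 4 < FF t h N \<theta> w x)) <= \<delta>
     \<and> (\<forall>e\<in>T. avgH (\<lambda>x. hit w t x {e}) <= cH)
     \<and> real (card {e\<in>T. \<kappa> / 2 < hit w t (fst (w e)) {e}}) <= cJ * m"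

lemma swp_env: "w \<in> Envs ==> set es \<subseteq> T ==> set gs \<subseteq> T ==> swp es gs w \<in> Envs"
  using sum_swp(2)[of es "{}" gs w] by simp

lemma avgH_hit_set:
  fixes c :: real
  assumes "\<forall>e\<in>T. avgH (\<lambda>x. hit w t x {e}) <= c" "X \<subseteq> T" "finite X"
  shows "avgH (\<lambda>x. hit w t x X) <= card X * c"
proof -
  have "avgH (\<lambda>x. hit w t x X) <= avgH (\<lambda>x. \<Sum>e\<in>X. hit w t x {e})" by (intro avgH_mono hit_sum assms)
  also have "\<dots> = (\<Sum>e\<in>X. avgH (\<lambda>x. hit w t x {e}))" by (rule avgH_sum)
  also have "\<dots> <= (\<Sum>e\<in>X. c)" by (rule sum_mono) (use assms in auto)
  finally show ?thesis by simp
qed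

text \<open>The environment \<open>w\<close> inherits weakened good properties from one good swap
  \<open>g0\<close>, as they differ in at most \<open>2 M\<close> tails. After swapping with
  \<open>gs\<close>, the tail \<open>es ! r\<close> leads where \<open>gs ! r\<close> led in
  \<open>w\<close>. If no swapped tail is likely to be hit from there, the discrepancy stays at most
  \<open>\<eta>\<close>. Hence an exceptional \<open>es ! r\<close> means that \<open>gs ! r\<close>
  has a defect of its own or conflicts with another entry.

  Every position is thus bad relative to its predecessors or, in the reversed list, relative to its
  successors. In one of the two orders at least \<open>M'\<close> of the \<open>2 * M'\<close>
  positions are bad, and \<open>card_sequential\<close> applies. The two orders account for the
  factor \<open>2\<close>, the \<open>2^M = 4^M'\<close> sets of positions for the factor
  \<open>4\<close>.\<close>

lemma switch_pointwise:
  fixes \<kappa> cH cJ \<delta> \<delta>' \<eta> :: real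
  assumes w: "w \<in> Envs" and ht: "h <= t" and k0: "0 < \<kappa>" and cH0: "0 <= cH" and d0: "0 <= \<delta>'" "\<delta>' <= 1"
    and es: "distinct es" "set es \<subseteq> T - A" "length es = M" and M: "M = 2 * M'" "1 <= M'"
    and S: "S = T - A - set es"
    and n1: "4 * real M * \<kappa> + 4 * real M * (2 * real M + 1) * cH <= \<eta> / 2"
    and n2: "2 * \<kappa> + 4 * real M * cH <= \<eta> / 4"
    and n3: "real m * (\<delta> + cJ + 12 * real M ^ 2 * cH / \<kappa>) + 3 * real M + real M * real t / \<kappa> <= \<delta>' * card S"
    and g0: "set g0 \<subseteq> S" "length g0 = M" "Good t h N \<theta> \<eta> \<delta> cH cJ \<kappa> (swp es g0 w)"
  shows "real (card {gs. set gs \<subseteq> S \<and> length gs = M \<and> (\<forall>e\<in>set es. \<eta> < FF t h N \<theta> (swp es gs w) (fst (swp es gs w e)))})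
    <= 2 * (4 * \<delta>') ^ M' * real (card S) ^ M"
proof -
  let ?F = "FF t h N \<theta>"
  define w0 where "w0 = swp es g0 w"
  define R where "R = set es \<union> set g0"
  have M1: "1 <= real M" using M by simp
  have subT: "set es \<subseteq> T" "S \<subseteq> T" using es S by auto
  have w0: "w0 \<in> Envs" unfolding w0_def using w subT g0 by (intro swp_env) auto
  have RT: "R \<subseteq> T" "finite R" using subT g0 by (auto simp: R_def)
  have cR: "real (card R) <= 2 * M"
  proof -
    have "card R <= card (set es) + card (set g0)" unfolding R_def by (rule card_Un_le)
    also have "\<dots> <= length es + length g0" by (intro add_mono card_length)
    finally show ?thesis using es g0 by simp
  qed
  have agree: "w e = w0 e" if "e \<notin> R" for e using swp_other that by (simp add: w0_def R_def)
  have G: "avgH (\<lambda>x. of_bool (\<eta> / 4 < ?F w0 x)) <= \<delta>" "\<forall>e\<in>T. avgH (\<lambda>x. hit w0 t x {e}) <= cH"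
    "real (card {e\<in>T. \<kappa> / 2 < hit w0 t (fst (w0 e)) {e}}) <= cJ * m"
    using g0(3) by (auto simp: Good_def w0_def)
  have aR: "avgH (\<lambda>x. hit w0 t x R) <= 2 * M * cH"
    by (rule order_trans[OF avgH_hit_set[OF G(2) RT] mult_right_mono[OF cR cH0]])
  \<comment> \<open>Enlarging the target by \<open>R\<close>, the set where \<open>w\<close> and
    \<open>w0\<close> differ, makes the hitting probability equal in both environments.\<close>
  have col: "avgH (\<lambda>x. hit w t x {e}) <= (2 * real M + 1) * cH" if e: "e \<in> T" for e
  proof -
    have "avgH (\<lambda>x. hit w t x {e}) <= avgH (\<lambda>x. hit w t x (insert e R))" by (intro avgH_mono hit_subset) auto
    also have "\<dots> = avgH (\<lambda>x. hit w0 t x (insert e R))"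
      by (rule avgH_cong, rule hit_eq[OF w w0, of _ R]) (use agree in auto)
    also have "\<dots> <= card (insert e R) * cH" by (rule avgH_hit_set[OF G(2)]) (use RT e in auto)
    also have "\<dots> <= (2 * real M + 1) * cH"
      using cR RT(2) by (intro mult_right_mono cH0) (simp add: card_insert_if)
    finally show ?thesis .
  qed
  \<comment> \<open>\<open>sg\<close> collects the defects of a single tail, \<open>cf\<close> the
    conflicts between two. \<open>cf\<close> is symmetric, so a list may be read in either
    direction.\<close>
  define sg where "sg g \<longleftrightarrow> \<eta> / 2 < ?F w (fst (w g)) \<or> \<kappa> < hit w t (fst (w g)) {g} \<or> (\<exists>e\<in>set es. \<kappa> < hit w t (fst (w g)) {e})" for g
  define cf where "cf g g' \<longleftrightarrow> g = g' \<or> \<kappa> < hit w t (fst (w g)) {g'} \<or> \<kappa> < hit w t (fst (w g')) {g}" for g g'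
  define Q where "Q p g \<longleftrightarrow> sg g \<or> (\<exists>g'\<in>set p. cf g' g)" for p g
  define B1 where "B1 = {g\<in>T. \<eta> / 2 < ?F w (fst (w g))}"
  define B2 where "B2 = {g\<in>T. \<kappa> < hit w t (fst (w g)) {g}}"
  define B3 where "B3 e = {g\<in>T. \<kappa> < hit w t (fst (w g)) {e}}" for e
  define B4 where "B4 g' = {g\<in>T. \<kappa> < hit w t (fst (w g')) {g}}" for g'
  have c1: "real (card B1) <= m * (\<delta> + 2 * M * cH / \<kappa>)"
  proof -
    have "real (card B1) = (\<Sum>g\<in>T. of_bool (\<eta> / 2 < ?F w (fst (w g))))"
      unfolding B1_def by (simp add: Int_def)
    also have "\<dots> = m * avgH (\<lambda>x. of_bool (\<eta> / 2 < ?F w x))" by (rule sum_T_env[OF w])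
    finally have e1: "real (card B1) = m * avgH (\<lambda>x. of_bool (\<eta> / 2 < ?F w x))" .
    have e2: "avgH (\<lambda>x. of_bool (\<eta> / 2 < ?F w x)) <= avgH (\<lambda>x. of_bool (\<eta> / 4 < ?F w0 x) + hit w0 t x R / \<kappa>)"
    proof (rule avgH_mono)
      fix x assume x: "x < n"
      have ch: "?F w x <= ?F w0 x + 2 * hit w0 t x R + 2 * avgH (\<lambda>y. hit w0 t y R)"
        by (rule FF_change[OF w0 w x _ ht]) (use agree in auto)
      show "of_bool (\<eta> / 2 < ?F w x) <= of_bool (\<eta> / 4 < ?F w0 x) + hit w0 t x R / \<kappa>"
      proof (cases "\<eta> / 2 < ?F w x \<and> \<not> \<eta> / 4 < ?F w0 x")
        case True
        hence "\<kappa> <= hit w0 t x R" using ch aR n2 by linarith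
        hence "1 <= hit w0 t x R / \<kappa>" using k0 by simp
        thus ?thesis using True by simp
      next
        case False
        have "0 <= hit w0 t x R / \<kappa>" using hit_nonneg k0 by simp
        thus ?thesis using False by auto
      qed
    qed
    have e3: "avgH (\<lambda>x. of_bool (\<eta> / 4 < ?F w0 x) + hit w0 t x R / \<kappa>) = avgH (\<lambda>x. of_bool (\<eta> / 4 < ?F w0 x)) + avgH (\<lambda>x. hit w0 t x R) / \<kappa>"
      using avgH_cmult2[of "\<lambda>x. hit w0 t x R" "1 / \<kappa>"] by (simp add: avgH_add)
    have e4: "avgH (\<lambda>x. of_bool (\<eta> / 4 < ?F w0 x)) + avgH (\<lambda>x. hit w0 t x R) / \<kappa> <= \<delta> + 2 * M * cH / \<kappa>"
      using G(1) aR k0 by (intro add_mono divide_right_mono) auto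
    show ?thesis unfolding e1 by (rule mult_left_mono[OF order_trans[OF e2 e4[folded e3]]]) simp
  qed
  have c2: "real (card B2) <= cJ * m + m * (2 * M * cH) / (\<kappa> / 2) + 2 * M"
  proof -
    have "B2 \<subseteq> {e\<in>T. \<kappa> / 2 < hit w0 t (fst (w0 e)) {e}} \<union> {e\<in>T. \<kappa> / 2 < hit w0 t (fst (w0 e)) R} \<union> R"
    proof
      fix g assume g: "g \<in> B2"
      hence gT: "g \<in> T" "\<kappa> < hit w t (fst (w g)) {g}" by (auto simp: B2_def)
      show "g \<in> {e\<in>T. \<kappa> / 2 < hit w0 t (fst (w0 e)) {e}} \<union> {e\<in>T. \<kappa> / 2 < hit w0 t (fst (w0 e)) R} \<union> R"
      proof (cases "g \<in> R")
        case False
        have wg: "w g = w0 g" by (rule agree[OF False])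
        have "hit w t (fst (w g)) {g} <= hit w t (fst (w g)) ({g} \<union> R)" by (rule hit_subset) auto
        also have "\<dots> = hit w0 t (fst (w g)) ({g} \<union> R)"
          by (rule hit_eq[OF w w0 envs_fst[OF w gT(1)], of R]) (use agree in auto)
        also have "\<dots> <= hit w0 t (fst (w g)) {g} + hit w0 t (fst (w g)) R" by (rule hit_Un)
        finally have "\<kappa> / 2 < hit w0 t (fst (w0 g)) {g} \<or> \<kappa> / 2 < hit w0 t (fst (w0 g)) R" using gT(2) wg by auto
        thus ?thesis using gT by auto
      qed simp
    qed
    hence "card B2 <= card ({e\<in>T. \<kappa> / 2 < hit w0 t (fst (w0 e)) {e}} \<union> {e\<in>T. \<kappa> / 2 < hit w0 t (fst (w0 e)) R} \<union> R)"
      by (intro card_mono) (use RT in auto)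
    also have "\<dots> <= card {e\<in>T. \<kappa> / 2 < hit w0 t (fst (w0 e)) {e}} + card {e\<in>T. \<kappa> / 2 < hit w0 t (fst (w0 e)) R} + card R"
      by (meson add_mono card_Un_le order_refl order_trans)
    finally have "real (card B2) <= real (card {e\<in>T. \<kappa> / 2 < hit w0 t (fst (w0 e)) {e}}) + real (card {e\<in>T. \<kappa> / 2 < hit w0 t (fst (w0 e)) R}) + real (card R)"
      by linarith
    also have "\<dots> <= cJ * m + m * (2 * M * cH) / (\<kappa> / 2) + 2 * M"
    proof (intro add_mono G(3) cR)
      have "real (card {e\<in>T. \<kappa> / 2 < hit w0 t (fst (w0 e)) R}) <= m * avgH (\<lambda>x. hit w0 t x R) / (\<kappa> / 2)"
        by (rule card_T_env_gt[OF w0]) (use k0 hit_nonneg in auto)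
      also have "\<dots> <= m * (2 * M * cH) / (\<kappa> / 2)" using aR k0 by (intro divide_right_mono mult_left_mono) auto
      finally show "real (card {e\<in>T. \<kappa> / 2 < hit w0 t (fst (w0 e)) R}) <= m * (2 * M * cH) / (\<kappa> / 2)" .
    qed
    finally show ?thesis .
  qed
  have c3: "real (card (B3 e)) <= m * ((2 * real M + 1) * cH) / \<kappa>" if e: "e \<in> T" for e
  proof -
    have "real (card (B3 e)) <= m * avgH (\<lambda>x. hit w t x {e}) / \<kappa>" unfolding B3_def
      by (rule card_T_env_gt[OF w k0]) (rule hit_nonneg)
    also have "\<dots> <= m * ((2 * real M + 1) * cH) / \<kappa>" using col[OF e] k0 by (intro divide_right_mono mult_left_mono) auto
    finally show ?thesis .
  qed
  have c4: "real (card (B4 g')) <= t / \<kappa>" if "g' \<in> T" for g'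
  proof -
    have "real (card (B4 g')) <= (\<Sum>e\<in>T. hit w t (fst (w g')) {e}) / \<kappa>" unfolding B4_def
      by (rule card_gt_le_sum) (use k0 hit_nonneg in auto)
    also have "\<dots> <= t / \<kappa>" using hit_row_sum[OF w envs_fst[OF w that]] k0 by (intro divide_right_mono) auto
    finally show ?thesis .
  qed
  have cQ: "real (card {g\<in>S. Q p g}) <= \<delta>' * card S" if p: "set p \<subseteq> S" "length p < M" for p
  proof -
    have cp: "card (set p) <= M" using card_length[of p] p by linarith
    have ces: "card (set es) <= M" using card_length[of es] es by linarith
    have "{g\<in>S. Q p g} \<subseteq> B1 \<union> B2 \<union> (\<Union>e\<in>set es. B3 e) \<union> (\<Union>g'\<in>set p. insert g' (B3 g' \<union> B4 g'))"
      using subT by (auto simp: Q_def sg_def cf_def B1_def B2_def B3_def B4_def)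
    hence "card {g\<in>S. Q p g} <= card (B1 \<union> B2 \<union> (\<Union>e\<in>set es. B3 e) \<union> (\<Union>g'\<in>set p. insert g' (B3 g' \<union> B4 g')))"
      by (intro card_mono) (auto simp: B1_def B2_def B3_def B4_def)
    also have "\<dots> <= card B1 + card B2 + card (\<Union>e\<in>set es. B3 e) + card (\<Union>g'\<in>set p. insert g' (B3 g' \<union> B4 g'))"
      by (meson add_mono card_Un_le order_refl order_trans)
    also have "\<dots> <= card B1 + card B2 + (\<Sum>e\<in>set es. card (B3 e)) + (\<Sum>g'\<in>set p. card (insert g' (B3 g' \<union> B4 g')))"
      by (intro add_mono card_UN_le order_refl) auto
    also have "\<dots> <= card B1 + card B2 + (\<Sum>e\<in>set es. card (B3 e)) + (\<Sum>g'\<in>set p. 1 + (card (B3 g') + card (B4 g')))"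
    proof (intro add_mono order_refl sum_mono)
      fix g'
      have "card (insert g' (B3 g' \<union> B4 g')) <= 1 + card (B3 g' \<union> B4 g')"
        using card_Un_le[of "{g'}" "B3 g' \<union> B4 g'"] by simp
      also have "\<dots> <= 1 + (card (B3 g') + card (B4 g'))" by (intro add_mono card_Un_le order_refl)
      finally show "card (insert g' (B3 g' \<union> B4 g')) <= 1 + (card (B3 g') + card (B4 g'))" .
    qed
    finally have "real (card {g\<in>S. Q p g}) <= real (card B1 + card B2 + (\<Sum>e\<in>set es. card (B3 e)) + (\<Sum>g'\<in>set p. 1 + (card (B3 g') + card (B4 g'))))"
      by (rule of_nat_mono)
    also have "\<dots> = real (card B1) + real (card B2) + (\<Sum>e\<in>set es. real (card (B3 e))) + (\<Sum>g'\<in>set p. 1 + (real (card (B3 g')) + real (card (B4 g'))))"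
      by simp
    also have "\<dots> <= m * (\<delta> + 2 * M * cH / \<kappa>) + (cJ * m + m * (2 * M * cH) / (\<kappa> / 2) + 2 * M)
       + (\<Sum>e\<in>set es. m * ((2 * real M + 1) * cH) / \<kappa>) + (\<Sum>g'\<in>set p. 1 + (m * ((2 * real M + 1) * cH) / \<kappa> + t / \<kappa>))"
      by (intro add_mono c1 c2 sum_mono c3 c4 order_refl) (use subT p in auto)
    also have "\<dots> = m * (\<delta> + 2 * M * cH / \<kappa>) + (cJ * m + m * (2 * M * cH) / (\<kappa> / 2) + 2 * M)
       + card (set es) * (m * ((2 * real M + 1) * cH) / \<kappa>) + card (set p) * (1 + (m * ((2 * real M + 1) * cH) / \<kappa> + t / \<kappa>))"
      by simp
    also have "\<dots> <= m * (\<delta> + 2 * M * cH / \<kappa>) + (cJ * m + m * (2 * M * cH) / (\<kappa> / 2) + 2 * M)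
       + M * (m * ((2 * real M + 1) * cH) / \<kappa>) + M * (1 + (m * ((2 * real M + 1) * cH) / \<kappa> + t / \<kappa>))"
      using cp ces k0 cH0 by (intro add_mono mult_right_mono order_refl of_nat_mono) auto
    also have "\<dots> = m * (\<delta> + cJ + (8 * M + 4 * M ^ 2) * (cH / \<kappa>)) + 3 * M + M * t / \<kappa>"
      using k0 by (simp add: field_simps power2_eq_square)
    also have "\<dots> <= m * (\<delta> + cJ + (12 * real M ^ 2) * (cH / \<kappa>)) + 3 * M + M * t / \<kappa>"
    proof (intro add_mono mult_left_mono mult_right_mono order_refl)
      have "real M * 1 <= real M * real M" using M1 by (intro mult_left_mono) auto
      thus "real (8 * M + 4 * M ^ 2) <= 12 * real M ^ 2" by (simp add: power2_eq_square)
    qed (use k0 cH0 in auto)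
    also have "\<dots> <= \<delta>' * card S" using n3 by simp
    finally show ?thesis .
  qed
  \<comment> \<open>With neither defect nor conflict, each of the at most \<open>2 M\<close> swapped
    tails is hit with probability at most \<open>\<kappa>\<close> from the vertex behind
    \<open>gs ! r\<close>. Then \<open>FF_change\<close> and \<open>n1\<close> keep the discrepancy
    at that vertex at most \<open>\<eta>\<close>.\<close>
  have key: "Q (take r gs) (gs ! r) \<or> Q (take (M - Suc r) (rev gs)) (gs ! r)"
    if gs: "set gs \<subseteq> S" "length gs = M" "\<forall>e\<in>set es. \<eta> < ?F (swp es gs w) (fst (swp es gs w e))" and r: "r < M" for gs r
  proof (rule ccontr)
    assume neg: "\<not> (Q (take r gs) (gs ! r) \<or> Q (take (M - Suc r) (rev gs)) (gs ! r))"
    let ?g = "gs ! r" and ?w = "swp es gs w"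
    have gT: "?g \<in> T" using gs(1,2) r subT(2) nth_mem[of r gs] by blast
    have nsg: "\<not> sg ?g" using neg by (auto simp: Q_def)
    have ncf: "\<not> cf (gs ! i) ?g" if "i < M" "i \<noteq> r" for i
    proof (cases "i < r")
      case True
      have "take r gs ! i \<in> set (take r gs)" by (rule nth_mem) (use True r gs(2) in simp)
      hence "gs ! i \<in> set (take r gs)" using True by simp
      thus ?thesis using neg by (auto simp: Q_def)
    next
      case False
      have "drop (Suc r) gs ! (i - Suc r) \<in> set (drop (Suc r) gs)" by (rule nth_mem) (use False that gs(2) in simp)
      hence "gs ! i \<in> set (drop (Suc r) gs)" using False that gs(2) by simp
      moreover have "take (M - Suc r) (rev gs) = rev (drop (Suc r) gs)" using gs(2) r by (simp add: take_rev)
      ultimately show ?thesis using neg by (auto simp: Q_def)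
    qed
    have "?w (es ! r) = w ?g"
    proof (rule swp_nth[OF _ es(1)])
      show "?g \<notin> set (take r gs)"
      proof
        assume "?g \<in> set (take r gs)"
        then obtain i where "i < r" "gs ! i = ?g" using r gs(2) by (auto simp: in_set_conv_nth)
        thus False using ncf[of i] r by (auto simp: cf_def)
      qed
    qed (use es gs r S in auto)
    moreover have "es ! r \<in> set es" using r es by simp
    ultimately have big: "\<eta> < ?F ?w (fst (w ?g))" using gs(3) by metis
    have hR: "hit w t (fst (w ?g)) {e} <= \<kappa>" if "e \<in> set es \<union> set gs" for e
    proof (cases "e \<in> set es")
      case True thus ?thesis using nsg by (auto simp: sg_def not_less)
    next
      case False
      hence "e \<in> set gs" using that by simp
      then obtain i where i: "i < M" "e = gs ! i" using gs(2) by (metis in_set_conv_nth)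
      show ?thesis
      proof (cases "i = r")
        case True thus ?thesis using nsg i by (auto simp: sg_def not_less)
      next
        case False thus ?thesis using ncf[OF i(1) False] i by (auto simp: cf_def not_less)
      qed
    qed
    have cE: "real (card (set es \<union> set gs)) <= 2 * M"
    proof -
      have "card (set es \<union> set gs) <= card (set es) + card (set gs)" by (rule card_Un_le)
      also have "\<dots> <= length es + length gs" by (intro add_mono card_length)
      finally show ?thesis using es gs by simp
    qed
    have "hit w t (fst (w ?g)) (set es \<union> set gs) <= (\<Sum>e\<in>set es \<union> set gs. hit w t (fst (w ?g)) {e})" by (rule hit_sum) simp
    also have "\<dots> <= (\<Sum>e\<in>set es \<union> set gs. \<kappa>)" by (rule sum_mono[OF hR])
    also have "\<dots> = card (set es \<union> set gs) * \<kappa>" by simp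
    also have "\<dots> <= 2 * M * \<kappa>" using k0 by (intro mult_right_mono cE) auto
    finally have h1: "hit w t (fst (w ?g)) (set es \<union> set gs) <= 2 * M * \<kappa>" .
    have "avgH (\<lambda>y. hit w t y (set es \<union> set gs)) <= card (set es \<union> set gs) * ((2 * real M + 1) * cH)"
      by (rule avgH_hit_set) (use col subT gs in auto)
    also have "\<dots> <= 2 * M * ((2 * real M + 1) * cH)" using cH0 by (intro mult_right_mono cE) auto
    finally have h2: "avgH (\<lambda>y. hit w t y (set es \<union> set gs)) <= 2 * M * ((2 * real M + 1) * cH)" .
    have "?F ?w (fst (w ?g)) <= ?F w (fst (w ?g)) + 2 * hit w t (fst (w ?g)) (set es \<union> set gs) + 2 * avgH (\<lambda>y. hit w t y (set es \<union> set gs))"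
    proof (rule FF_change[OF w _ envs_fst[OF w gT] _ ht])
      show "?w \<in> Envs" by (rule swp_env[OF w]) (use subT gs in auto)
      show "\<And>e. e \<notin> set es \<union> set gs ==> w e = ?w e" using swp_other by simp
    qed
    also have "\<dots> <= \<eta> / 2 + 2 * (2 * M * \<kappa>) + 2 * (2 * M * ((2 * real M + 1) * cH))"
      using nsg h1 h2 by (intro add_mono mult_left_mono) (auto simp: sg_def not_less)
    also have "\<dots> <= \<eta>" using n1 by (simp add: algebra_simps)
    finally show False using big by simp
  qed
  define Fw where "Fw I = {gs. set gs \<subseteq> S \<and> length gs = M \<and> (\<forall>r\<in>I. Q (take r gs) (gs ! r))}" for I
  have finS: "finite S" using subT finite_subset by blast
  have finL: "finite {gs. set gs \<subseteq> S \<and> length gs = M}" by (rule finite_lists_length_eq[OF finS])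
  have finFw: "finite (Fw I)" for I by (rule finite_subset[OF _ finL]) (auto simp: Fw_def)
  define II where "II = {I. I \<subseteq> {..<M} \<and> M' <= card I}"
  have finII: "finite II" by (rule finite_subset[of _ "Pow {..<M}"]) (auto simp: II_def)
  have cII: "real (card II) <= 4 ^ M'"
  proof -
    have "card II <= card (Pow {..<M})" by (rule card_mono) (auto simp: II_def)
    also have "\<dots> = 2 ^ M" by (simp add: card_Pow)
    also have "\<dots> = 4 ^ M'" using M by (simp add: power_mult)
    finally show ?thesis by (metis of_nat_le_iff of_nat_numeral of_nat_power)
  qed
  have cFw: "real (card (Fw I)) <= \<delta>' ^ M' * real (card S) ^ M" if "I \<in> II" for I
  proof -
    have "real (card (Fw I)) <= \<delta>' ^ card I * real (card S) ^ M"
      unfolding Fw_def by (rule card_sequential[OF finS d0(1) _ cQ]) (use that in \<open>auto simp: II_def\<close>)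
    also have "\<dots> <= \<delta>' ^ M' * real (card S) ^ M"
      by (intro mult_right_mono power_decreasing) (use that d0 in \<open>auto simp: II_def\<close>)
    finally show ?thesis .
  qed
  have "{gs. set gs \<subseteq> S \<and> length gs = M \<and> (\<forall>e\<in>set es. \<eta> < ?F (swp es gs w) (fst (swp es gs w e)))}
     \<subseteq> (\<Union>I\<in>II. Fw I) \<union> rev ` (\<Union>I\<in>II. Fw I)"
  proof
    fix gs assume "gs \<in> {gs. set gs \<subseteq> S \<and> length gs = M \<and> (\<forall>e\<in>set es. \<eta> < ?F (swp es gs w) (fst (swp es gs w e)))}"
    hence gs: "set gs \<subseteq> S" "length gs = M" "\<forall>e\<in>set es. \<eta> < ?F (swp es gs w) (fst (swp es gs w e))" by auto
    define I where "I = {r. r < M \<and> Q (take r gs) (gs ! r)}"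
    define J where "J = {r. r < M \<and> \<not> Q (take r gs) (gs ! r)}"
    have "I \<union> J = {..<M}" "I \<inter> J = {}" "finite I" "finite J" by (auto simp: I_def J_def)
    hence "card I + card J = M" by (metis card_Un_disjoint card_lessThan)
    hence "M' <= card I \<or> M' <= card J" using M by linarith
    thus "gs \<in> (\<Union>I\<in>II. Fw I) \<union> rev ` (\<Union>I\<in>II. Fw I)"
    proof
      assume "M' <= card I"
      hence "I \<in> II" by (auto simp: II_def I_def)
      moreover have "gs \<in> Fw I" using gs by (auto simp: Fw_def I_def)
      ultimately show ?thesis by blast
    next
      assume cJ: "M' <= card J"
      define J' where "J' = (\<lambda>r. M - Suc r) ` J"
      have "inj_on (\<lambda>r. M - Suc r) J" by (rule inj_onI) (auto simp: J_def)
      hence "card J' = card J" by (simp add: J'_def card_image)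
      hence "J' \<in> II" using cJ by (auto simp: II_def J'_def J_def)
      moreover have "rev gs \<in> Fw J'" unfolding Fw_def mem_Collect_eq
      proof (intro conjI ballI)
        fix r' assume "r' \<in> J'"
        then obtain r where r: "r < M" "r' = M - Suc r" "\<not> Q (take r gs) (gs ! r)" by (auto simp: J'_def J_def)
        have "Q (take (M - Suc r) (rev gs)) (gs ! r)" using key[OF gs r(1)] r(3) by blast
        moreover have "rev gs ! r' = gs ! r" using r gs(2) by (simp add: rev_nth)
        ultimately show "Q (take r' (rev gs)) (rev gs ! r')" using r(2) by simp
      qed (use gs in auto)
      ultimately have "rev (rev gs) \<in> rev ` (\<Union>I\<in>II. Fw I)" by blast
      thus ?thesis by simp
    qed
  qed
  hence "card {gs. set gs \<subseteq> S \<and> length gs = M \<and> (\<forall>e\<in>set es. \<eta> < ?F (swp es gs w) (fst (swp es gs w e)))}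
    <= card ((\<Union>I\<in>II. Fw I) \<union> rev ` (\<Union>I\<in>II. Fw I))"
    by (intro card_mono) (use finII finFw in auto)
  also have "\<dots> <= card (\<Union>I\<in>II. Fw I) + card (rev ` (\<Union>I\<in>II. Fw I))" by (rule card_Un_le)
  also have "\<dots> <= card (\<Union>I\<in>II. Fw I) + card (\<Union>I\<in>II. Fw I)"
    by (intro add_left_mono card_image_le) (use finII finFw in auto)
  also have "\<dots> <= (\<Sum>I\<in>II. card (Fw I)) + (\<Sum>I\<in>II. card (Fw I))" by (intro add_mono card_UN_le finII)
  finally have "real (card {gs. set gs \<subseteq> S \<and> length gs = M \<and> (\<forall>e\<in>set es. \<eta> < ?F (swp es gs w) (fst (swp es gs w e)))})
    <= 2 * (\<Sum>I\<in>II. real (card (Fw I)))" by (simp flip: of_nat_sum)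
  also have "\<dots> <= 2 * (\<Sum>I\<in>II. \<delta>' ^ M' * real (card S) ^ M)" by (intro mult_left_mono sum_mono cFw) auto
  also have "\<dots> = 2 * (card II * (\<delta>' ^ M' * real (card S) ^ M))" by simp
  also have "\<dots> <= 2 * (4 ^ M' * (\<delta>' ^ M' * real (card S) ^ M))"
    using d0 by (intro mult_left_mono mult_right_mono cII) auto
  finally show ?thesis by (simp add: power_mult_distrib mult_ac)
qed

text \<open>Double counting of pairs of a swap list and an environment. As swaps preserve the
  uniform law given \<open>A\<close>, the environment may be replaced by its swapped version, and
  for a fixed environment \<open>switch_pointwise\<close> counts the lists. If no list produces a
  good environment there is nothing to count, which justifies the reference list \<open>g0\<close>
  there.\<close>

lemma switch:
  fixes \<kappa> cH cJ \<delta> \<delta>' \<eta> :: real and w0 :: env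
  assumes ht: "h <= t" and k0: "0 < \<kappa>" and cH0: "0 <= cH" and d0: "0 <= \<delta>'" "\<delta>' <= 1"
    and es: "distinct es" "set es \<subseteq> T - A" "length es = M" and M: "M = 2 * M'" "1 <= M'"
    and S: "S = T - A - set es" "S \<noteq> {}"
    and n1: "4 * real M * \<kappa> + 4 * real M * (2 * real M + 1) * cH <= \<eta> / 2"
    and n2: "2 * \<kappa> + 4 * real M * cH <= \<eta> / 4"
    and n3: "real m * (\<delta> + cJ + 12 * real M ^ 2 * cH / \<kappa>) + 3 * real M + real M * real t / \<kappa> <= \<delta>' * card S"
  defines "W \<equiv> {w \<in> Envs. \<forall>e\<in>A. w e = w0 e}"
  shows "real (card {w\<in>W. Good t h N \<theta> \<eta> \<delta> cH cJ \<kappa> w \<and> (\<forall>e\<in>set es. \<eta> < FF t h N \<theta> w (fst (w e)))})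
    <= 2 * (4 * \<delta>') ^ M' * card W"
proof -
  define P where "P w \<longleftrightarrow> Good t h N \<theta> \<eta> \<delta> cH cJ \<kappa> w \<and> (\<forall>e\<in>set es. \<eta> < FF t h N \<theta> w (fst (w e)))" for w
  define L where "L = {gs. set gs \<subseteq> S \<and> length gs = M}"
  have ST: "S \<subseteq> T" using S by auto
  have finS: "finite S" using ST finite_subset by blast
  have finW: "finite W" by (simp add: W_def)
  have finL: "finite L" unfolding L_def by (rule finite_lists_length_eq[OF finS])
  have cL: "card L = card S ^ M" unfolding L_def by (rule card_lists_length_eq[OF finS])
  have "real (card L) * real (card {w\<in>W. P w}) = (\<Sum>gs\<in>L. \<Sum>w\<in>W. of_bool (P w))"
    using finW by (simp add: Int_def)
  also have "\<dots> = (\<Sum>gs\<in>L. \<Sum>w\<in>W. of_bool (P (swp es gs w)))"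
  proof (rule sum.cong[OF refl])
    fix gs assume "gs \<in> L"
    hence gs: "set gs \<subseteq> T - A" using S by (auto simp: L_def)
    show "(\<Sum>w\<in>W. of_bool (P w)) = (\<Sum>w\<in>W. of_bool (P (swp es gs w)) :: real)"
      unfolding W_def by (rule sum_swp(1)[OF es(2) gs, symmetric])
  qed
  also have "\<dots> = (\<Sum>w\<in>W. \<Sum>gs\<in>L. of_bool (P (swp es gs w)))" by (rule sum.swap)
  also have "\<dots> <= (\<Sum>w\<in>W. 2 * (4 * \<delta>') ^ M' * real (card S) ^ M)"
  proof (rule sum_mono)
    fix w assume "w \<in> W"
    hence w: "w \<in> Envs" by (simp add: W_def)
    have eq: "(\<Sum>gs\<in>L. of_bool (P (swp es gs w)) :: real) = card {gs\<in>L. P (swp es gs w)}"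
      using finL by (simp add: Int_def)
    show "(\<Sum>gs\<in>L. of_bool (P (swp es gs w))) <= 2 * (4 * \<delta>') ^ M' * real (card S) ^ M"
    proof (cases "\<exists>gs\<in>L. P (swp es gs w)")
      case True
      then obtain g0 where g0: "set g0 \<subseteq> S" "length g0 = M" "Good t h N \<theta> \<eta> \<delta> cH cJ \<kappa> (swp es g0 w)"
        by (auto simp: L_def P_def)
      have "card {gs\<in>L. P (swp es gs w)} <= card {gs. set gs \<subseteq> S \<and> length gs = M \<and> (\<forall>e\<in>set es. \<eta> < FF t h N \<theta> (swp es gs w) (fst (swp es gs w e)))}"
      proof (rule card_mono)
        show "finite {gs. set gs \<subseteq> S \<and> length gs = M \<and> (\<forall>e\<in>set es. \<eta> < FF t h N \<theta> (swp es gs w) (fst (swp es gs w e)))}"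
          by (rule finite_subset[OF _ finL]) (auto simp: L_def)
      qed (auto simp: L_def P_def)
      hence "real (card {gs\<in>L. P (swp es gs w)}) <= 2 * (4 * \<delta>') ^ M' * real (card S) ^ M"
        using switch_pointwise[OF w ht k0 cH0 d0 es M S(1) n1 n2 n3 g0] by linarith
      thus ?thesis using eq by simp
    next
      case False
      hence "{gs\<in>L. P (swp es gs w)} = {}" by blast
      thus ?thesis using eq d0 by simp
    qed
  qed
  also have "\<dots> = real (card L) * (2 * (4 * \<delta>') ^ M' * card W)" by (simp add: cL)
  finally have "real (card L) * real (card {w\<in>W. P w}) <= real (card L) * (2 * (4 * \<delta>') ^ M' * card W)" .
  moreover have "0 < real (card L)" using S(2) finS by (simp add: cL card_gt_0_iff)
  ultimately show ?thesis by (simp add: P_def)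
qed

end

context config begin

subsection \<open>Local structure: no small vertex set spans more arcs than vertices\<close>

definition sparse :: "nat => env => bool" where
  "sparse k w \<longleftrightarrow> (\<forall>U A. U \<subseteq> {..<n} \<and> card U <= k \<and> A \<subseteq> T \<and> (\<forall>e\<in>A. fst e \<in> U \<and> fst (w e) \<in> U) \<longrightarrow> card A <= card U)"

lemma tails_in_le:
  assumes "U \<subseteq> {..<n}" shows "card {e\<in>T. fst e \<in> U} <= D * card U"
proof -
  have fin: "finite U" using assms finite_subset by blast
  have "{e\<in>T. fst e \<in> U} \<subseteq> (SIGMA v:U. {..<dp v})" by (auto simp: memT)
  hence "card {e\<in>T. fst e \<in> U} <= card (SIGMA v:U. {..<dp v})" by (rule card_mono[rotated]) (use fin in auto)
  also have "\<dots> = (\<Sum>v\<in>U. dp v)" using fin by (simp add: card_SigmaI)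
  also have "\<dots> <= (\<Sum>v\<in>U. D)" by (rule sum_mono) (use degD assms in auto)
  finally show ?thesis by (simp add: mult.commute)
qed

text \<open>Union bound over sets of \<open>u\<close> vertices and \<open>u + 1\<close> arcs inside
  them: \<open>n^u\<close> choices against a probability \<open>n^-(u + 1)\<close> leave
  \<open>1 / n\<close>. The remaining factors are crude in \<open>k\<close>, which is harmless for
  \<open>k\<close> of order \<open>ln ln n\<close>.\<close>

lemma not_sparse_bound:
  assumes "1 <= k" "k + 1 <= n"
  shows "real (card {w\<in>Envs. \<not> sparse k w}) <= card (Envs) * (real k * real (D * k) ^ (2 * k + 2) / n)"
proof -
  define TU where "TU U = {e\<in>T. fst e \<in> U}" for U
  define HU where "HU U = {f\<in>H. fst f \<in> U}" for U
  define Us where "Us u = {U. U \<subseteq> {..<n} \<and> card U = u}" for u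
  define Gs where "Gs U = {g. g \<subseteq> TU U \<times> HU U \<and> card g = card U + 1}" for U
  let ?E = "real (card (Envs))"
  have finUs: "finite (Us u)" for u unfolding Us_def by (rule finite_subset[of _ "Pow {..<n}"]) auto
  have finTH: "finite (TU U \<times> HU U)" for U by (auto simp: TU_def HU_def)
  have finGs: "finite (Gs U)" for U unfolding Gs_def by (rule finite_subset[of _ "Pow (TU U \<times> HU U)"]) (use finTH in auto)
  have sub: "{w\<in>Envs. \<not> sparse k w} \<subseteq> (\<Union>u\<in>{1..k}. \<Union>U\<in>Us u. \<Union>g\<in>Gs U. Env g)"
  proof
    fix w assume "w \<in> {w\<in>Envs. \<not> sparse k w}"
    hence w: "w \<in> Envs" and "\<not> sparse k w" by auto
    then obtain U A where UA: "U \<subseteq> {..<n}" "card U <= k" "A \<subseteq> T" "\<forall>e\<in>A. fst e \<in> U \<and> fst (w e) \<in> U" "card U < card A"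
      unfolding sparse_def by (auto simp: not_le)
    have finA: "finite A" using UA(3) finite_subset by blast
    have finU: "finite U" using UA(1) finite_subset by blast
    have "A \<noteq> {}" using UA(5) by auto
    hence "card U \<noteq> 0" using UA(4) finU by auto
    obtain B where B: "B \<subseteq> A" "card B = card U + 1"
      using UA(5) obtain_subset_with_card_n[of "card U + 1" A] by auto
    define g where "g = (\<lambda>e. (e, w e)) ` B"
    have "card g = card U + 1" unfolding g_def using B by (subst card_image) (auto simp: inj_on_def)
    moreover have "g \<subseteq> TU U \<times> HU U"
    proof
      fix z assume "z \<in> g"
      then obtain e where e: "e \<in> B" "z = (e, w e)" unfolding g_def by blast
      hence "e \<in> A" using B by blast
      thus "z \<in> TU U \<times> HU U" using UA(3,4) envs_mem[OF w, of e] e by (auto simp: TU_def HU_def)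
    qed
    ultimately have "g \<in> Gs U" by (simp add: Gs_def)
    moreover have "w \<in> Env g" using w by (auto simp: Env_def ext_def g_def)
    moreover have "U \<in> Us (card U)" "card U \<in> {1..k}" using UA \<open>card U \<noteq> 0\<close> by (auto simp: Us_def)
    ultimately show "w \<in> (\<Union>u\<in>{1..k}. \<Union>U\<in>Us u. \<Union>g\<in>Gs U. Env g)" by blast
  qed
  have nk: "real n <= real m - real (k + 1)"
  proof -
    have "n + (k + 1) <= m" using m_ge assms by linarith
    thus ?thesis by linarith
  qed
  have cE: "real (card (Env g)) <= ?E / real n ^ (card U + 1)" if g: "g \<in> Gs U" and U: "U \<in> Us u" "u <= k" for g U u
  proof (cases "Env g = {}")
    case False
    have gTH: "g \<subseteq> T \<times> H" using g by (auto simp: Gs_def TU_def HU_def)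
    have fing: "finite g" using g finTH finite_subset by (auto simp: Gs_def)
    have cg: "card g = card U + 1" "card U <= k" using g U by (auto simp: Gs_def Us_def)
    have "real (card (Env ({} \<union> g))) <= real (card (Env {})) / (real m - real (k + 1)) ^ card g"
      by (rule Env_card_bounds(2)) (use Env_pmatch[OF False gTH] fing cg assms m_ge in auto)
    also have "\<dots> <= ?E / real n ^ card g"
      using nk npos by (auto intro!: divide_left_mono power_mono mult_pos_pos zero_less_power)
    finally show ?thesis using cg by simp
  qed simp
  have cG: "real (card (Gs U)) <= real (D * k) ^ (2 * (card U + 1))" if U: "U \<in> Us u" "u <= k" for U u
  proof -
    have fU: "finite U" "card U <= k" using U finite_subset by (auto simp: Us_def)
    have a: "card (TU U) <= D * k" using tails_in_le[of U] U fU unfolding TU_def Us_def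
      by (auto intro: order_trans[OF _ mult_le_mono2])
    have b: "card (HU U) <= D * k" using heads_in_le[OF fU(1)] fU unfolding HU_def
      by (auto intro: order_trans[OF _ mult_le_mono2])
    have "card (Gs U) = card (TU U \<times> HU U) choose (card U + 1)" unfolding Gs_def by (rule n_subsets[OF finTH])
    also have "\<dots> <= card (TU U \<times> HU U) ^ (card U + 1)"
    proof (cases "card U + 1 <= card (TU U \<times> HU U)")
      case True thus ?thesis by (rule binomial_le_pow)
    next
      case False thus ?thesis by (simp add: binomial_eq_0)
    qed
    also have "\<dots> <= (D * k * (D * k)) ^ (card U + 1)"
      unfolding card_cartesian_product by (intro power_mono mult_le_mono a b) auto
    finally have "card (Gs U) <= (D * k) ^ (2 * (card U + 1))" by (simp only: power_mult power2_eq_square)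
    thus ?thesis by (metis of_nat_le_iff of_nat_power)
  qed
  have Dk: "1 <= real (D * k)" using D2 assms by (metis Suc_leI mult_pos_pos of_nat_1 of_nat_le_iff One_nat_def less_le_trans pos2 zero_less_one)
  have each: "(\<Sum>U\<in>Us u. \<Sum>g\<in>Gs U. real (card (Env g))) <= ?E * (real (D * k) ^ (2 * k + 2) / n)" if u: "u \<in> {1..k}" for u
  proof -
    have "(\<Sum>U\<in>Us u. \<Sum>g\<in>Gs U. real (card (Env g))) <= (\<Sum>U\<in>Us u. \<Sum>g\<in>Gs U. ?E / real n ^ (u + 1))"
      by (intro sum_mono order_trans[OF cE]) (use u in \<open>auto simp: Us_def\<close>)
    also have "\<dots> = (\<Sum>U\<in>Us u. real (card (Gs U)) * (?E / real n ^ (u + 1)))" by simp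
    also have "\<dots> <= (\<Sum>U\<in>Us u. real (D * k) ^ (2 * k + 2) * (?E / real n ^ (u + 1)))"
    proof (intro sum_mono mult_right_mono)
      fix U assume U: "U \<in> Us u"
      have "real (card (Gs U)) <= real (D * k) ^ (2 * (card U + 1))" using cG[OF U] u by auto
      also have "\<dots> <= real (D * k) ^ (2 * k + 2)" by (rule power_increasing[OF _ Dk]) (use U u in \<open>auto simp: Us_def\<close>)
      finally show "real (card (Gs U)) <= real (D * k) ^ (2 * k + 2)" .
    qed simp
    also have "\<dots> = real (card (Us u)) * (real (D * k) ^ (2 * k + 2) * (?E / real n ^ (u + 1)))" by simp
    also have "\<dots> <= real n ^ u * (real (D * k) ^ (2 * k + 2) * (?E / real n ^ (u + 1)))"
    proof (rule mult_right_mono)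
      have "card (Us u) = n choose u" unfolding Us_def using n_subsets[of "{..<n}" u] by simp
      also have "\<dots> <= n ^ u" by (rule binomial_le_pow) (use u assms in auto)
      finally show "real (card (Us u)) <= real n ^ u" by (metis of_nat_le_iff of_nat_power)
    qed simp
    also have "\<dots> = ?E * (real (D * k) ^ (2 * k + 2) / n)" using npos by simp
    finally show ?thesis .
  qed
  have "card {w\<in>Envs. \<not> sparse k w} <= card (\<Union>u\<in>{1..k}. \<Union>U\<in>Us u. \<Union>g\<in>Gs U. Env g)"
    by (rule card_mono[OF _ sub]) (use finUs finGs in auto)
  also have "\<dots> <= (\<Sum>u\<in>{1..k}. \<Sum>U\<in>Us u. \<Sum>g\<in>Gs U. card (Env g))"
    by (intro order_trans[OF card_UN_le] sum_mono finUs finGs) (auto intro: order_refl)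
  finally have "real (card {w\<in>Envs. \<not> sparse k w}) <= (\<Sum>u\<in>{1..k}. \<Sum>U\<in>Us u. \<Sum>g\<in>Gs U. real (card (Env g)))"
    by (simp flip: of_nat_sum)
  also have "\<dots> <= (\<Sum>u\<in>{1..k}. ?E * (real (D * k) ^ (2 * k + 2) / n))" by (rule sum_mono[OF each])
  finally show ?thesis by (simp add: mult_ac)
qed

definition wpath :: "env => nat => arc list => bool" where
  "wpath w x a \<longleftrightarrow> valid x a \<and> ext w (set a)"

lemma wpath_append: "wpath w x (a @ b) \<longleftrightarrow> wpath w x a \<and> wpath w (endv x a) b"
  by (auto simp: wpath_def valid_append ext_Un)

lemma wpath_Nil [simp]: "wpath w x []" by (simp add: wpath_def)

lemma wpath_Cons: "w \<in> Envs ==> wpath w x (ef # a) \<longleftrightarrow> fst ef \<in> T \<and> fst (fst ef) = x \<and> snd ef = w (fst ef) \<and> wpath w (fst (snd ef)) a"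
  using envs_mem[of w "fst ef"] by (auto simp: wpath_def ext_insert)

text \<open>The out-ball of radius \<open>R\<close> around \<open>x\<close> is a tree.\<close>
definition TL :: "nat => env => nat => bool" where
  "TL R w x \<longleftrightarrow> (\<forall>p p'. wpath w x p \<and> wpath w x p' \<and> length p <= R \<and> length p' <= R \<and> endv x p = endv x p' \<longrightarrow> p = p')"

lemma TL_suffix:
  assumes "TL R w x" "wpath w x a" "length a + r <= R" shows "TL r w (endv x a)"
  unfolding TL_def
proof (intro allI impI, elim conjE)
  fix p p' assume p: "wpath w (endv x a) p" "wpath w (endv x a) p'" "length p <= r" "length p' <= r" "endv (endv x a) p = endv (endv x a) p'"
  have "a @ p = a @ p'"
    using assms(1)[unfolded TL_def, rule_format, of "a @ p" "a @ p'"] p assms by (simp add: wpath_append)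
  thus "p = p'" by simp
qed

text \<open>A breadth-first tree from \<open>x\<close> leaves at most one arc over, and every cycle uses it; hence its
  source would be a descendant of both children of \<open>x\<close>.\<close>
lemma sparse_two_bad_children:
  assumes w: "w \<in> Envs" and sp: "sparse k w" and k: "4 * R + 3 <= k"
    and e: "e \<in> T" "e' \<in> T" "fst e = x" "fst e' = x" "e \<noteq> e'"
    and bad: "\<not> TL R w (fst (w e))" "\<not> TL R w (fst (w e'))"
  shows False
proof -
  have x: "x < n" using e by (auto simp: memT)
  let ?y = "fst (w e)" and ?y' = "fst (w e')"
  obtain p1 p2 where p12: "wpath w ?y p1" "wpath w ?y p2" "length p1 <= R" "length p2 <= R" "endv ?y p1 = endv ?y p2" "p1 \<noteq> p2"
    using bad(1) unfolding TL_def by blast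
  obtain p3 p4 where p34: "wpath w ?y' p3" "wpath w ?y' p4" "length p3 <= R" "length p4 <= R" "endv ?y' p3 = endv ?y' p4" "p3 \<noteq> p4"
    using bad(2) unfolding TL_def by blast
  \<comment> \<open>The tails of the four paths that witness the two failures, with the two arcs at
    \<open>x\<close>. Their vertices are listed by \<open>L\<close>, which has at most
    \<open>4 * R + 3\<close> entries.\<close>
  define A where "A = {e, e'} \<union> fst ` set (p1 @ p2 @ p3 @ p4)"
  define L where "L = x # ?y # ?y' # verts (p1 @ p2 @ p3 @ p4)"
  define U where "U = set L"
  have cU: "card U <= k" using card_length[of L] p12 p34 k unfolding U_def by (simp add: L_def)
  have AT: "A \<subseteq> T" using e p12(1,2) p34(1,2) valid_ext_T unfolding A_def wpath_def by fastforce
  have vsub: "fst ` set p \<subseteq> A ==> wpath w z p ==> ef \<in> set p ==> snd ef = w (fst ef)" for p z ef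
    by (auto simp: wpath_def ext_def)
  have tailU: "fst t \<in> U \<and> fst (w t) \<in> U" if "t \<in> A" for t
  proof -
    have *: "fst t \<in> set (z # verts p) \<and> fst (w t) \<in> set (verts p)" if "wpath w z p" "t \<in> fst ` set p" for z p
    proof
      show "fst t \<in> set (z # verts p)" using tails_verts[of z p t] that by (auto simp: wpath_def)
      from that(2) obtain ef where "ef \<in> set p" "t = fst ef" by blast
      moreover from this have "snd ef = w t" using that by (auto simp: wpath_def ext_def)
      ultimately show "fst (w t) \<in> set (verts p)" by force
    qed
    have "t = e \<or> t = e' \<or> t \<in> fst ` set p1 \<or> t \<in> fst ` set p2 \<or> t \<in> fst ` set p3 \<or> t \<in> fst ` set p4"
      using that by (auto simp: A_def)
    thus ?thesis
    proof (elim disjE)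
      assume "t \<in> fst ` set p1" from *[OF p12(1) this] show ?thesis by (auto simp: U_def L_def)
    next
      assume "t \<in> fst ` set p2" from *[OF p12(2) this] show ?thesis by (auto simp: U_def L_def)
    next
      assume "t \<in> fst ` set p3" from *[OF p34(1) this] show ?thesis by (auto simp: U_def L_def)
    next
      assume "t \<in> fst ` set p4" from *[OF p34(2) this] show ?thesis by (auto simp: U_def L_def)
    qed (use e in \<open>auto simp: U_def L_def\<close>)
  qed
  have Un: "U \<subseteq> {..<n}"
  proof -
    have "set (verts p) \<subseteq> {..<n}" if "wpath w z p" for z p
      using valid_set[of z p] that by (auto simp: wpath_def memH)
    thus ?thesis using p12 p34 x envs_fst[OF w e(1)] envs_fst[OF w e(2)] unfolding U_def L_def by auto
  qed
  have finU: "finite U" by (simp add: U_def)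
  have finA: "finite A" using AT finite_subset by blast
  have cA: "card A <= card U" using sp Un cU AT tailU unfolding sparse_def by blast
  define RP where "RP u a \<longleftrightarrow> wpath w x a \<and> fst ` set a \<subseteq> A \<and> endv x a = u" for u a
  have reach: "\<exists>a. RP u a" if "u \<in> U" for u
  proof -
    have step: "\<exists>a. RP u a" if r: "RP z a0" and p: "wpath w z p" "fst ` set p \<subseteq> A" "u \<in> set (verts p)" for z a0 p
    proof -
      obtain ef where ef: "ef \<in> set p" "u = fst (snd ef)" using p(3) by auto
      then obtain q1 q2 where q: "p = (q1 @ [ef]) @ q2" by (metis append.assoc append_Cons append_Nil split_list)
      have "wpath w z (q1 @ [ef])" using p(1) unfolding q by (simp only: wpath_append)
      moreover have "fst ` set (q1 @ [ef]) \<subseteq> A" using p(2) by (auto simp: q)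
      ultimately have "RP u (a0 @ q1 @ [ef])" using r ef by (auto simp: RP_def wpath_append)
      thus ?thesis by blast
    qed
    have rx: "RP x []" by (simp add: RP_def)
    have ry: "RP ?y [(e, w e)]" "RP ?y' [(e', w e')]" using e w by (auto simp: RP_def A_def wpath_Cons)
    have sub: "fst ` set p1 \<subseteq> A" "fst ` set p2 \<subseteq> A" "fst ` set p3 \<subseteq> A" "fst ` set p4 \<subseteq> A" by (auto simp: A_def)
    have "u = x \<or> u = ?y \<or> u = ?y' \<or> u \<in> set (verts p1) \<or> u \<in> set (verts p2) \<or> u \<in> set (verts p3) \<or> u \<in> set (verts p4)"
      using that by (auto simp: U_def L_def)
    thus ?thesis
      using rx ry step[OF ry(1) p12(1) sub(1)] step[OF ry(1) p12(2) sub(2)] step[OF ry(2) p34(1) sub(3)] step[OF ry(2) p34(2) sub(4)] by blast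
  qed
  define d where "d u = (LEAST l. \<exists>a. RP u a \<and> length a = l)" for u
  have dex: "\<exists>a. RP u a \<and> length a = d u" if "u \<in> U" for u
    unfolding d_def by (rule LeastI_ex) (use reach[OF that] in blast)
  have dle: "d u <= length a" if "RP u a" for u a
    unfolding d_def by (rule Least_le) (use that in blast)
  have dx: "d x = 0" using dle[of x "[]"] by (simp add: RP_def)
  have par_ex: "\<exists>t\<in>A. fst (w t) = u \<and> d u = Suc (d (fst t))" if u: "u \<in> U" "u \<noteq> x" for u
  proof -
    obtain a where a: "RP u a" "length a = d u" using dex[OF u(1)] by blast
    hence "a \<noteq> []" using u(2) by (auto simp: RP_def)
    then obtain a' z where az: "a = a' @ [z]" by (metis append_butlast_last_id)
    have z: "fst z \<in> A" "snd z = w (fst z)" "fst (fst z) = endv x a'" "fst (snd z) = u" "RP (endv x a') a'"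
      using a(1) unfolding az RP_def wpath_append by (auto simp: wpath_Cons[OF w])
    have 1: "d (fst (fst z)) <= length a'" using dle[OF z(5)] z(3) by simp
    have "fst (fst z) \<in> U" using tailU[OF z(1)] by simp
    then obtain b where b: "RP (fst (fst z)) b" "length b = d (fst (fst z))" using dex by blast
    have "RP u (b @ [z])" using b(1) z AT unfolding RP_def wpath_append by (auto simp: wpath_Cons[OF w])
    hence "d u <= Suc (d (fst (fst z)))" using dle[of u "b @ [z]"] b(2) by simp
    hence "d u = Suc (d (fst (fst z)))" using 1 a(2) az by simp
    thus ?thesis using z by (intro bexI[of _ "fst z"]) auto
  qed
  then obtain par where par: "\<And>u. u \<in> U ==> u \<noteq> x ==> par u \<in> A \<and> fst (w (par u)) = u \<and> d u = Suc (d (fst (par u)))"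
    by metis
  define Tr where "Tr = par ` (U - {x})"
  have inj: "inj_on par (U - {x})" using par by (metis (no_types, lifting) DiffE inj_onI insertCI)
  have xU: "x \<in> U" by (simp add: U_def L_def)
  have "card Tr = card U - 1" unfolding Tr_def card_image[OF inj] using xU by (rule card_Diff_singleton)
  moreover have "Tr \<subseteq> A" unfolding Tr_def using par by blast
  moreover have "card U \<noteq> 0" using finU xU by auto
  ultimately have "card (A - Tr) <= 1" using cA finA by (simp add: card_Diff_subset finite_subset)
  hence one: "t = t'" if "t \<in> A - Tr" "t' \<in> A - Tr" for t t'
    using that finA card_le_Suc0_iff_eq[of "A - Tr"] by auto
  have trd: "d (fst (w t)) = Suc (d (fst t)) \<and> t = par (fst (w t))" if "t \<in> Tr" for t
  proof -
    obtain u where "u \<in> U" "u \<noteq> x" "t = par u" using \<open>t \<in> Tr\<close> unfolding Tr_def by blast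
    thus ?thesis using par[of u] by simp
  qed
  \<comment> \<open>In the tree \<open>Tr\<close> every vertex has at most one incoming arc, so tree
    paths of equal length with the same end agree arc by arc backwards, and so do their starting
    points.\<close>
  have backdet: "q = q' \<and> z = z'"
    if "wpath w z q" "wpath w z' q'" "fst ` set q \<subseteq> Tr" "fst ` set q' \<subseteq> Tr" "endv z q = endv z' q'" "length q = length q'" for q q' z z'
    using that
  proof (induction q arbitrary: q' rule: rev_induct)
    case (snoc a q)
    then obtain b r where q': "q' = r @ [b]" by (metis append_butlast_last_id length_0_conv snoc_eq_iff_butlast)
    have ab: "snd a = w (fst a)" "snd b = w (fst b)" "fst (fst a) = endv z q" "fst (fst b) = endv z' r" "fst a \<in> Tr" "fst b \<in> Tr" "fst (snd a) = fst (snd b)"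
      using snoc.prems unfolding q' wpath_append by (auto simp: wpath_Cons[OF w])
    have fab: "fst a = fst b" using trd[OF ab(5)] trd[OF ab(6)] ab(1,2,7) by metis
    have "a = b" by (rule prod_eqI[OF fab]) (simp only: ab(1,2) fab)
    moreover have "q = r \<and> z = z'"
      by (rule snoc.IH) (use snoc.prems ab \<open>a = b\<close> in \<open>auto simp: q' wpath_append\<close>)
    ultimately show ?case by (simp add: q')
  qed simp
  have dlen: "d (endv z q) = d z + length q" if "wpath w z q" "fst ` set q \<subseteq> Tr" for z q
    using that
  proof (induction q rule: rev_induct)
    case (snoc a q)
    have "snd a = w (fst a)" "fst (fst a) = endv z q" "fst a \<in> Tr"
      using snoc.prems unfolding wpath_append by (auto simp: wpath_Cons[OF w])
    thus ?case using snoc trd[of "fst a"] by (simp add: wpath_append)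
  qed simp
  \<comment> \<open>Two different paths with common ends cannot both stay in the tree: depth forces
    equal lengths, and then \<open>backdet\<close> forces equality. One of them takes an arc outside
    the tree, and its initial piece is a tree path to the source of that arc.\<close>
  have toextra: "\<exists>t q. t \<in> A - Tr \<and> wpath w z q \<and> fst ` set q \<subseteq> Tr \<and> endv z q = fst t"
    if pp: "wpath w z p" "wpath w z p'" "endv z p = endv z p'" "p \<noteq> p'" "fst ` set p \<subseteq> A" "fst ` set p' \<subseteq> A" for z p p'
  proof -
    have one_path: "\<exists>t q. t \<in> A - Tr \<and> wpath w z q \<and> fst ` set q \<subseteq> Tr \<and> endv z q = fst t"
      if p: "wpath w z p" "fst ` set p \<subseteq> A" "\<not> fst ` set p \<subseteq> Tr" for p
    proof -
      have "\<exists>ef\<in>set p. fst ef \<notin> Tr" using p(3) by blast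
      then obtain q ef r where q: "p = q @ ef # r" "fst ef \<notin> Tr" "\<forall>z\<in>set q. \<not> fst z \<notin> Tr"
        using split_list_first_prop[of p "\<lambda>ef. fst ef \<notin> Tr"] by blast
      have "wpath w z q" "endv z q = fst (fst ef)" using p(1) unfolding q(1) wpath_append by (auto simp: wpath_Cons[OF w])
      moreover have "fst ef \<in> A - Tr" using p(2) q by auto
      moreover have "fst ` set q \<subseteq> Tr" using q(3) by blast
      ultimately show ?thesis by blast
    qed
    have "\<not> (fst ` set p \<subseteq> Tr \<and> fst ` set p' \<subseteq> Tr)"
    proof
      assume tr: "fst ` set p \<subseteq> Tr \<and> fst ` set p' \<subseteq> Tr"
      hence "length p = length p'" using dlen[OF pp(1)] dlen[OF pp(2)] pp(3) by simp
      thus False using backdet[OF pp(1,2)] tr pp(3,4) by blast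
    qed
    thus ?thesis using one_path[OF pp(1,5)] one_path[OF pp(2,6)] by blast
  qed
  have sub: "fst ` set p1 \<subseteq> A" "fst ` set p2 \<subseteq> A" "fst ` set p3 \<subseteq> A" "fst ` set p4 \<subseteq> A" by (auto simp: A_def)
  obtain t q where t: "t \<in> A - Tr" "wpath w ?y q" "fst ` set q \<subseteq> Tr" "endv ?y q = fst t"
    using toextra[OF p12(1,2,5,6) sub(1,2)] by blast
  obtain t' q' where t': "t' \<in> A - Tr" "wpath w ?y' q'" "fst ` set q' \<subseteq> Tr" "endv ?y' q' = fst t'"
    using toextra[OF p34(1,2,5,6) sub(3,4)] by blast
  have tt: "t' = t" using one t t' by blast
  have eA: "e \<in> A" "e' \<in> A" by (auto simp: A_def)
  have dq: "d (fst t) = d ?y + length q" "d (fst t) = d ?y' + length q'"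
    using dlen[OF t(2,3)] dlen[OF t'(2,3)] t(4) t'(4) tt by simp_all
  have eTr: "e \<in> Tr"
  proof (rule ccontr)
    assume "e \<notin> Tr"
    hence "e = t" using one eA t by blast
    hence "d ?y' = 0" using dq(2) dx e by simp
    moreover have "e' \<in> Tr" using one[of e' t] eA t(1) \<open>e = t\<close> e(5) by blast
    ultimately show False using trd by simp
  qed
  have e'Tr: "e' \<in> Tr"
  proof (rule ccontr)
    assume "e' \<notin> Tr"
    hence "e' = t" using one eA t by blast
    hence "d ?y = 0" using dq(1) dx e by simp
    thus False using trd[OF eTr] by simp
  qed
  \<comment> \<open>Both children have depth \<open>1\<close>, so their tree paths to the source of
    the single extra arc have equal length; read backwards they must start at the same
    child.\<close>
  have "d ?y = Suc 0" "d ?y' = Suc 0" using trd[OF eTr] trd[OF e'Tr] e dx by simp_all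
  hence "length q = length q'" using dq by simp
  hence "?y = ?y'" using backdet[OF t(2) t'(2) t(3) t'(3)] t(4) t'(4) tt by simp
  hence "e = e'" using trd[OF eTr] trd[OF e'Tr] by metis
  thus False using e(5) by simp
qed

text \<open>Among the at least two arcs leaving a vertex, at most one leads to a vertex whose ball
  of radius \<open>2 * s\<close> is not a tree, so avoiding tree-like vertices costs a factor
  \<open>1/2\<close> per step. Once such a vertex is met within the first \<open>s\<close> steps,
  the position at time \<open>s\<close> still has a tree of depth \<open>s\<close> below it. The
  assumption on \<open>k\<close> is \<open>4 * R + 3\<close> for \<open>R = 2 * s\<close>.\<close>

lemma escape_to_TL:
  assumes w: "w \<in> Envs" and sp: "sparse k w" and k: "8 * s + 3 <= k" and i: "i < n"
  shows "QE w s i (\<lambda>a. of_bool (\<not> TL s w (endv i a))) <= (1/2) ^ s"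
proof -
  define B where "B v a = (\<forall>l\<in>{1..length a}. \<not> TL (2 * s) w (endv v (take l a)))" for v and a :: "arc list"
  have "QE w r x (\<lambda>a. of_bool (B x a)) <= (1/2) ^ r" if "x < n" for r x
    using that
  proof (induction r arbitrary: x)
    case (Suc r)
    let ?b = "\<lambda>k. \<not> TL (2 * s) w (fst (w (x, k)))"
    have Bc: "B x (ef # a) \<longleftrightarrow> \<not> TL (2 * s) w (fst (snd ef)) \<and> B (fst (snd ef)) a" for ef a
    proof
      assume b: "B x (ef # a)"
      have "\<not> TL (2 * s) w (endv x (take (Suc l) (ef # a)))" if "l <= length a" for l
        using b that unfolding B_def by (simp del: take_Suc_Cons)
      from this[of 0] this show "\<not> TL (2 * s) w (fst (snd ef)) \<and> B (fst (snd ef)) a" unfolding B_def by auto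
    next
      assume b: "\<not> TL (2 * s) w (fst (snd ef)) \<and> B (fst (snd ef)) a"
      show "B x (ef # a)" unfolding B_def
      proof
        fix l assume l: "l \<in> {1..length (ef # a)}"
        then obtain l' where "l = Suc l'" by (cases l) auto
        thus "\<not> TL (2 * s) w (endv x (take l (ef # a)))" using b l unfolding B_def by (cases "l' = 0") auto
      qed
    qed
    have dpx: "2 <= real (dp x)" using deg2[OF Suc.prems] by simp
    have "QE w (Suc r) x (\<lambda>a. of_bool (B x a)) = (\<Sum>k<dp x. QE w r (fst (w (x, k))) (\<lambda>a. of_bool (?b k) * of_bool (B (fst (w (x, k))) a))) / dp x"
      unfolding QE_Suc[OF w Suc.prems] Bc of_bool_conj by simp
    also have "\<dots> <= (\<Sum>k<dp x. of_bool (?b k) * (1/2) ^ r) / dp x"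
      unfolding QE_cmult by (intro divide_right_mono sum_mono mult_left_mono Suc.IH)
        (use envs_fst[OF w] Suc.prems in \<open>auto simp: memT\<close>)
    also have "(\<Sum>k<dp x. of_bool (?b k) * (1/2) ^ r) = (\<Sum>k<dp x. of_bool (?b k)) * (1/2 :: real) ^ r"
      by (simp only: sum_distrib_right)
    also have "(\<Sum>k<dp x. of_bool (?b k)) <= (1 :: real)"
    proof -
      have "card {k\<in>{..<dp x}. ?b k} <= Suc 0"
      proof (subst card_le_Suc0_iff_eq, simp, intro ballI)
        fix k1 k2 assume "k1 \<in> {k\<in>{..<dp x}. ?b k}" "k2 \<in> {k\<in>{..<dp x}. ?b k}"
        thus "k1 = k2" using sparse_two_bad_children[OF w sp, of "2 * s" "(x, k1)" "(x, k2)" x] k Suc.prems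
          by (auto simp: memT)
      qed
      thus ?thesis by (simp add: Int_def)
    qed
    hence "(\<Sum>k<dp x. of_bool (?b k)) * (1/2 :: real) ^ r / dp x <= 1 * (1/2) ^ r / 2"
      using dpx by (intro frac_le mult_right_mono) auto
    finally show ?case by simp
  qed (simp add: B_def)
  note Bb = this[OF i, of s]
  have "QE w s i (\<lambda>a. of_bool (\<not> TL s w (endv i a))) <= QE w s i (\<lambda>a. of_bool (B i a))"
  proof (rule QE_mono)
    fix a assume a: "a \<in> VL i s" "ext w (set a)"
    have "B i a" if "\<not> TL s w (endv i a)" unfolding B_def
    proof
      fix l assume l: "l \<in> {1..length a}"
      show "\<not> TL (2 * s) w (endv i (take l a))"
      proof
        assume "TL (2 * s) w (endv i (take l a))"
        moreover have "wpath w i (take l a @ drop l a)" using a by (simp add: wpath_def VL_def)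
        hence "wpath w (endv i (take l a)) (drop l a)" unfolding wpath_append by blast
        ultimately have "TL s w (endv (endv i (take l a)) (drop l a))"
          by (rule TL_suffix) (use l a in \<open>auto simp: VL_def\<close>)
        thus False using that endv_append[of i "take l a" "drop l a"] by simp
      qed
    qed
    thus "(of_bool (\<not> TL s w (endv i a)) :: real) <= of_bool (B i a)" by auto
  qed
  thus ?thesis using Bb by linarith
qed

end

section \<open>Conditioning on the ball around a vertex\<close>

context config begin

definition At :: "env => nat => nat => tail set" where
  "At w x r = {e\<in>T. \<exists>a. wpath w x a \<and> length a = r \<and> endv x a = fst e}"

definition ball_tails :: "env => nat => nat => tail set" where
  "ball_tails w x s = (\<Union>r<s. At w x r)"

lemma card_wpath:
  assumes "w \<in> Envs" "x < n"
  shows "card {a\<in>VL x r. ext w (set a)} <= D ^ r"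
proof -
  have "real (card {a\<in>VL x r. ext w (set a)}) * (1 / real D) ^ r = (\<Sum>a\<in>{a\<in>VL x r. ext w (set a)}. (1 / real D) ^ r)" by simp
  also have "\<dots> <= (\<Sum>a\<in>{a\<in>VL x r. ext w (set a)}. wt a)"
    by (rule sum_mono) (use wt_ge in \<open>auto simp: VL_def\<close>)
  also have "\<dots> = QE w r x (\<lambda>_. 1)" unfolding QE_def by (rule sum.mono_neutral_cong_left) auto
  also have "\<dots> = 1" by (rule QE_const[OF assms])
  finally have "real (card {a\<in>VL x r. ext w (set a)}) <= real D ^ r" using D2 by (simp add: field_simps)
  thus ?thesis by (simp only: of_nat_power[symmetric] of_nat_le_iff)
qed

lemma card_At:
  assumes "w \<in> Envs" "x < n" shows "card (At w x r) <= D ^ Suc r"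
proof -
  let ?P = "{a\<in>VL x r. ext w (set a)}"
  have "At w x r \<subseteq> (\<Union>a\<in>?P. {e\<in>T. fst e \<in> {endv x a}})" by (auto simp: At_def wpath_def VL_def)
  hence "card (At w x r) <= card (\<Union>a\<in>?P. {e\<in>T. fst e \<in> {endv x a}})" by (rule card_mono[rotated]) auto
  also have "\<dots> <= (\<Sum>a\<in>?P. card {e\<in>T. fst e \<in> {endv x a}})" by (rule card_UN_le) auto
  also have "\<dots> <= (\<Sum>a\<in>?P. D)"
  proof (rule sum_mono)
    fix a assume "a \<in> ?P"
    hence "endv x a < n" using valid_endv assms by (auto simp: VL_def)
    thus "card {e\<in>T. fst e \<in> {endv x a}} <= D" using tails_in_le[of "{endv x a}"] by simp
  qed
  also have "\<dots> <= D ^ r * D" using card_wpath[OF assms, of r] by simp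
  finally show ?thesis by (simp add: mult.commute)
qed

lemma card_ball_tails:
  assumes "w \<in> Envs" "x < n" shows "card (ball_tails w x s) <= D ^ Suc s"
proof -
  have "card (ball_tails w x s) <= (\<Sum>r<s. card (At w x r))" unfolding ball_tails_def by (rule card_UN_le) simp
  also have "\<dots> <= (\<Sum>r<s. D ^ Suc r)" by (intro sum_mono card_At assms)
  also have "\<dots> <= D ^ Suc s"
  proof (induction s)
    case (Suc s)
    have "(\<Sum>r<Suc s. D ^ Suc r) <= D ^ Suc s + D ^ Suc s" using Suc by simp
    also have "\<dots> <= D * D ^ Suc s" using D2 by (simp add: mult_le_mono1[of 2 D "D ^ Suc s", simplified mult_2] del: power_Suc)
    finally show ?case by simp
  qed simp
  finally show ?thesis .
qed

text \<open>A ball is explored only through its own tails, so agreement on the tails met by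
  \<open>w0\<close> forces the same short paths in \<open>w\<close>.\<close>

lemma ball_agree:
  assumes w: "w \<in> Envs" "w0 \<in> Envs" and ag: "\<forall>e\<in>ball_tails w0 x s. w e = w0 e" and "length a <= s"
  shows "wpath w x a \<longleftrightarrow> wpath w0 x a"
  using assms(4)
proof (induction a rule: rev_induct)
  case (snoc z a)
  have IH: "wpath w x a = wpath w0 x a" using snoc by simp
  have "w (fst z) = w0 (fst z)" if "wpath w0 x a" "fst z \<in> T" "fst (fst z) = endv x a"
  proof -
    have "fst z \<in> At w0 x (length a)" using that by (auto simp: At_def)
    moreover have "length a < s" using snoc.prems by simp
    ultimately show ?thesis using ag by (auto simp: ball_tails_def)
  qed
  thus ?case unfolding wpath_append IH wpath_Cons[OF w(1)] wpath_Cons[OF w(2)] by auto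
qed simp

lemma ball_agree_At:
  assumes "w \<in> Envs" "w0 \<in> Envs" "\<forall>e\<in>ball_tails w0 x s. w e = w0 e" "r <= s"
  shows "At w x r = At w0 x r"
  unfolding At_def using ball_agree[OF assms(1-3)] assms(4) by blast

text \<open>In a tree every vertex of level \<open>s\<close> is reached by one path, whose weight is
  at most \<open>2^-s\<close>. Dropping the factor \<open>1 / dp v\<close> of the last step turns
  the mass of bad endpoints into a number of bad tails.\<close>

lemma level_bad_mass:
  assumes w: "w \<in> Envs" and x: "x < n" and tl: "TL s w x"
  shows "QE w (Suc s) x (\<lambda>a. of_bool (P (endv x a))) <= (1/2) ^ s * card {e\<in>At w x s. P (fst (w e))}"
proof -
  define g where "g v = (\<Sum>k<dp v. of_bool (P (fst (w (v, k)))) :: real) / dp v" for v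
  have "QE w (s + 1) x (\<lambda>a. of_bool (P (endv x a))) = QE w s x (\<lambda>a. QE w 1 (endv x a) (\<lambda>b. of_bool (P (endv (endv x a) b))))"
    by (subst QE_append[OF w x]) simp
  also have "\<dots> = QE w s x (\<lambda>a. g (endv x a))"
  proof (rule QE_cong)
    fix a assume "a \<in> VL x s"
    hence v: "endv x a < n" using valid_endv x by (auto simp: VL_def)
    show "QE w 1 (endv x a) (\<lambda>b. of_bool (P (endv (endv x a) b))) = g (endv x a)"
      using QE_Suc[OF w v, of 0] by (simp add: g_def)
  qed
  also have "\<dots> = (\<Sum>v<n. PP w s x v * g v)" using QE_endv_sum[OF w x, of s g] by (simp add: PP_def)
  also have "\<dots> <= (\<Sum>v<n. \<Sum>k<dp v. (1/2) ^ s * of_bool ((v, k) \<in> {e\<in>At w x s. P (fst (w e))}))"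
  proof (rule sum_mono)
    fix v assume "v \<in> {..<n}"
    hence v: "v < n" by simp
    have dpv: "1 <= real (dp v)" using deg2[OF v] by simp
    show "PP w s x v * g v <= (\<Sum>k<dp v. (1/2) ^ s * of_bool ((v, k) \<in> {e\<in>At w x s. P (fst (w e))}))"
    proof (cases "\<exists>a. wpath w x a \<and> length a = s \<and> endv x a = v")
      case True
      then obtain a where a: "wpath w x a" "length a = s" "endv x a = v" by blast
      have "PP w s x v <= QE w s x (\<lambda>b. of_bool (b = a))" unfolding PP_def
      proof (rule QE_mono)
        fix b assume "b \<in> VL x s" "ext w (set b)"
        hence "endv x b = v \<longrightarrow> b = a" using tl a unfolding TL_def wpath_def VL_def by auto
        thus "(of_bool (endv x b = v) :: real) <= of_bool (b = a)" by simp
      qed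
      also have "\<dots> <= (1/2) ^ s" by (rule QE_single)
      finally have P: "PP w s x v <= (1/2) ^ s" .
      have "g v <= (\<Sum>k<dp v. of_bool (P (fst (w (v, k)))) :: real) / 1"
        unfolding g_def using dpv by (intro divide_left_mono) (auto intro: sum_nonneg)
      hence "PP w s x v * g v <= (1/2) ^ s * (\<Sum>k<dp v. of_bool (P (fst (w (v, k)))))"
        using P PP_nonneg by (intro mult_mono) (auto simp: g_def intro!: sum_nonneg divide_nonneg_nonneg)
      also have "\<dots> = (\<Sum>k<dp v. (1/2) ^ s * of_bool (P (fst (w (v, k)))))" by (simp only: sum_distrib_left)
      also have "\<dots> = (\<Sum>k<dp v. (1/2) ^ s * of_bool ((v, k) \<in> {e\<in>At w x s. P (fst (w e))}))"
        by (intro sum.cong refl) (use a v in \<open>auto simp: At_def memT\<close>)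
      finally show ?thesis .
    next
      case False
      have "PP w s x v = QE w s x (\<lambda>_. 0)" unfolding PP_def
        by (rule QE_cong) (use False in \<open>auto simp: wpath_def VL_def\<close>)
      hence "PP w s x v = 0" by (simp add: QE_const[OF w x])
      moreover have "0 <= (\<Sum>k<dp v. (1/2) ^ s * of_bool ((v, k) \<in> {e\<in>At w x s. P (fst (w e))}) :: real)"
        by (intro sum_nonneg) simp
      ultimately show ?thesis by simp
    qed
  qed
  also have "\<dots> = (1/2) ^ s * (\<Sum>e\<in>T. of_bool (e \<in> {e\<in>At w x s. P (fst (w e))}))"
    unfolding sum_T sum_distrib_left ..
  also have "(\<Sum>e\<in>T. of_bool (e \<in> {e\<in>At w x s. P (fst (w e))})) = (\<Sum>e\<in>{e\<in>At w x s. P (fst (w e))}. 1 :: real)"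
    by (rule sum.mono_neutral_cong_right) (auto simp: At_def)
  finally show ?thesis by simp
qed

text \<open>Condition on the environment on the tails of levels below \<open>s\<close>. An
  exceptional mass above \<open>\<epsilon>\<close> after \<open>s + 1\<close> steps forces at least
  \<open>M\<close> tails of level \<open>s\<close> to lead to exceptional vertices. In a tree these
  tails do not occur at lower levels, hence they are still free and \<open>switch\<close> applies
  with \<open>A\<close> the revealed tails. The factor \<open>(D^(s + 1))^M\<close> counts the
  choices of the \<open>M\<close> tails.\<close>

lemma tree_vertex_bad:
  fixes \<kappa> cH cJ \<delta> \<delta>' \<eta> \<epsilon> :: real
  assumes x: "x < n" and ht: "h <= t" and k0: "0 < \<kappa>" and cH0: "0 <= cH" and d0: "0 <= \<delta>'" "\<delta>' <= 1"
    and M: "M = 2 * M'" "1 <= M'" and Me: "real M <= \<epsilon> * 2 ^ s" and big: "2 * (D ^ Suc s + M) < m"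
    and n1: "4 * real M * \<kappa> + 4 * real M * (2 * real M + 1) * cH <= \<eta> / 2"
    and n2: "2 * \<kappa> + 4 * real M * cH <= \<eta> / 4"
    and n3: "real m * (\<delta> + cJ + 12 * real M ^ 2 * cH / \<kappa>) + 3 * real M + real M * real t / \<kappa> <= \<delta>' * (real m / 2)"
  shows "real (card {w\<in>Envs. TL s w x \<and> Good t h N \<theta> \<eta> \<delta> cH cJ \<kappa> w \<and> \<epsilon> < QE w (Suc s) x (\<lambda>a. of_bool (\<eta> < FF t h N \<theta> w (endv x a)))})
    <= (real D ^ Suc s) ^ M * (2 * (4 * \<delta>') ^ M') * card (Envs)"
proof -
  define P where "P w \<longleftrightarrow> TL s w x \<and> Good t h N \<theta> \<eta> \<delta> cH cJ \<kappa> w \<and> \<epsilon> < QE w (Suc s) x (\<lambda>a. of_bool (\<eta> < FF t h N \<theta> w (endv x a)))" for w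
  \<comment> \<open>The revealed ball as a partial function. The value \<open>None\<close> outside
    makes equality of two such functions include equality of the sets of revealed tails, so the
    fibres of \<open>bm\<close> are exactly the classes conditioned on.\<close>
  define bm where "bm w = (\<lambda>e. if e \<in> ball_tails w x s then Some (w e) else None)" for w :: env
  define C where "C = (real D ^ Suc s) ^ M * (2 * (4 * \<delta>') ^ M')"
  have C0: "0 <= C" using d0 by (simp add: C_def)
  have fib: "{w\<in>Envs. bm w = bm w0} = {w\<in>Envs. \<forall>e\<in>ball_tails w0 x s. w e = w0 e}" if w0: "w0 \<in> Envs" for w0
  proof (intro equalityI subsetI)
    fix w assume "w \<in> {w\<in>Envs. bm w = bm w0}"
    hence w: "w \<in> Envs" "bm w = bm w0" by auto
    have "w e = w0 e" if "e \<in> ball_tails w0 x s" for e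
      using fun_cong[OF w(2), of e] that by (auto simp: bm_def split: if_splits)
    thus "w \<in> {w\<in>Envs. \<forall>e\<in>ball_tails w0 x s. w e = w0 e}" using w by auto
  next
    fix w assume "w \<in> {w\<in>Envs. \<forall>e\<in>ball_tails w0 x s. w e = w0 e}"
    hence w: "w \<in> Envs" "\<forall>e\<in>ball_tails w0 x s. w e = w0 e" by auto
    have "ball_tails w x s = ball_tails w0 x s" unfolding ball_tails_def
      using ball_agree_At[OF w(1) w0 w(2)] by (intro SUP_cong) auto
    thus "w \<in> {w\<in>Envs. bm w = bm w0}" using w by (auto simp: bm_def)
  qed
  have each: "real (card {w\<in>Envs. bm w = b \<and> P w}) <= C * card {w\<in>Envs. bm w = b}" for b
  proof (cases "\<exists>w0\<in>Envs. bm w0 = b \<and> P w0")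
    case False
    hence e: "{w\<in>Envs. bm w = b \<and> P w} = {}" by blast
    show ?thesis unfolding e using C0 by simp
  next
    case True
    then obtain w0 where w0: "w0 \<in> Envs" "bm w0 = b" "P w0" by blast
    define A where "A = ball_tails w0 x s"
    define Dl where "Dl = At w0 x s"
    define W where "W = {w\<in>Envs. \<forall>e\<in>A. w e = w0 e}"
    have Wb: "{w\<in>Envs. bm w = b} = W" using fib[OF w0(1)] w0(2) by (simp add: W_def A_def)
    have tl0: "TL s w0 x" using w0(3) by (simp add: P_def)
    have DlT: "Dl \<subseteq> T" "A \<subseteq> T" by (auto simp: Dl_def A_def At_def ball_tails_def)
    have finDl: "finite Dl" using DlT finite_subset by blast
    have disj: "Dl \<inter> A = {}"
    proof (rule ccontr)
      assume "Dl \<inter> A \<noteq> {}"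
      then obtain e r where e: "e \<in> At w0 x s" "e \<in> At w0 x r" "r < s" by (auto simp: Dl_def A_def ball_tails_def)
      then obtain a a' where "wpath w0 x a" "length a = s" "endv x a = fst e" "wpath w0 x a'" "length a' = r" "endv x a' = fst e"
        by (auto simp: At_def)
      hence "a = a'" using tl0 e(3) unfolding TL_def by (metis less_imp_le order_refl)
      thus False using e(3) \<open>length a = s\<close> \<open>length a' = r\<close> by simp
    qed
    define LS where "LS = {es. set es \<subseteq> Dl \<and> length es = M \<and> distinct es}"
    have finLS: "finite LS" by (rule finite_subset[OF _ finite_lists_length_eq[OF finDl, of M]]) (auto simp: LS_def)
    have cLS: "real (card LS) <= (real D ^ Suc s) ^ M"
    proof -
      have "card LS <= card {es. set es \<subseteq> Dl \<and> length es = M}"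
        by (rule card_mono[OF finite_lists_length_eq[OF finDl]]) (auto simp: LS_def)
      also have "\<dots> = card Dl ^ M" by (rule card_lists_length_eq[OF finDl])
      also have "\<dots> <= (D ^ Suc s) ^ M" unfolding Dl_def by (intro power_mono card_At w0 x) simp
      finally show ?thesis by (simp only: of_nat_power[symmetric] of_nat_le_iff)
    qed
    have sub: "{w\<in>Envs. bm w = b \<and> P w} \<subseteq> (\<Union>es\<in>LS. {w\<in>W. Good t h N \<theta> \<eta> \<delta> cH cJ \<kappa> w \<and> (\<forall>e\<in>set es. \<eta> < FF t h N \<theta> w (fst (w e)))})"
    proof
      fix w assume "w \<in> {w\<in>Envs. bm w = b \<and> P w}"
      hence w: "w \<in> Envs" "w \<in> W" "P w" using Wb by auto
      have "At w x s = Dl" unfolding Dl_def by (rule ball_agree_At[OF w(1) w0(1)]) (use w(2) in \<open>auto simp: W_def A_def\<close>)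
      define Bd where "Bd = {e\<in>Dl. \<eta> < FF t h N \<theta> w (fst (w e))}"
      have "\<epsilon> < QE w (Suc s) x (\<lambda>a. of_bool (\<eta> < FF t h N \<theta> w (endv x a)))" using w(3) by (simp add: P_def)
      also have "\<dots> <= (1/2) ^ s * card Bd"
        using level_bad_mass[OF w(1) x, of s "\<lambda>v. \<eta> < FF t h N \<theta> w v"] w(3) \<open>At w x s = Dl\<close> by (simp add: P_def Bd_def)
      finally have "\<epsilon> * 2 ^ s < card Bd" by (simp add: field_simps)
      hence "M <= card Bd" using Me by linarith
      then obtain B where B: "B \<subseteq> Bd" "card B = M" "finite B" by (rule obtain_subset_with_card_n)
      then obtain es where es: "set es = B" "distinct es" using finite_distinct_list by blast
      have "es \<in> LS" using es B distinct_card[of es] by (auto simp: LS_def Bd_def)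
      moreover have "\<forall>e\<in>set es. \<eta> < FF t h N \<theta> w (fst (w e))" using es B by (auto simp: Bd_def)
      ultimately show "w \<in> (\<Union>es\<in>LS. {w\<in>W. Good t h N \<theta> \<eta> \<delta> cH cJ \<kappa> w \<and> (\<forall>e\<in>set es. \<eta> < FF t h N \<theta> w (fst (w e)))})"
        using w by (auto simp: P_def)
    qed
    have sw: "real (card {w\<in>W. Good t h N \<theta> \<eta> \<delta> cH cJ \<kappa> w \<and> (\<forall>e\<in>set es. \<eta> < FF t h N \<theta> w (fst (w e)))}) <= 2 * (4 * \<delta>') ^ M' * card W"
      if es: "es \<in> LS" for es
    proof -
      let ?S = "T - A - set es"
      have "card T <= card (?S \<union> (A \<union> set es))" by (rule card_mono) (use finite_subset[OF DlT(2) finT] in auto)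
      also have "\<dots> <= card ?S + (card A + card (set es))"
        by (intro order_trans[OF card_Un_le] add_left_mono card_Un_le)
      also have "\<dots> <= card ?S + (D ^ Suc s + M)"
        using card_ball_tails[OF w0(1) x, of s] card_length[of es] es by (simp add: A_def LS_def)
      finally have "m <= card ?S + (D ^ Suc s + M)" by (simp add: cardT)
      moreover have "m <= 2 * c" if "m <= c + z" "2 * z < m" for c z :: nat using that by linarith
      ultimately have "m <= 2 * card ?S" using big by blast
      hence cS: "real m / 2 <= card ?S" by linarith
      have neS: "?S \<noteq> {}" using \<open>m <= 2 * card ?S\<close> mpos by (intro notI) simp
      have n3': "real m * (\<delta> + cJ + 12 * real M ^ 2 * cH / \<kappa>) + 3 * real M + real M * real t / \<kappa> <= \<delta>' * card ?S"
        using n3 mult_left_mono[OF cS d0(1)] by linarith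
      show ?thesis unfolding W_def
        by (rule switch[OF ht k0 cH0 d0 _ _ _ M refl neS n1 n2 n3']) (use es DlT disj in \<open>auto simp: LS_def\<close>)
    qed
    have "card {w\<in>Envs. bm w = b \<and> P w} <= card (\<Union>es\<in>LS. {w\<in>W. Good t h N \<theta> \<eta> \<delta> cH cJ \<kappa> w \<and> (\<forall>e\<in>set es. \<eta> < FF t h N \<theta> w (fst (w e)))})"
      by (rule card_mono[OF _ sub]) (use finLS in \<open>auto simp: W_def\<close>)
    also have "\<dots> <= (\<Sum>es\<in>LS. card {w\<in>W. Good t h N \<theta> \<eta> \<delta> cH cJ \<kappa> w \<and> (\<forall>e\<in>set es. \<eta> < FF t h N \<theta> w (fst (w e)))})"
      by (rule card_UN_le[OF finLS])
    finally have "real (card {w\<in>Envs. bm w = b \<and> P w})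
      <= (\<Sum>es\<in>LS. real (card {w\<in>W. Good t h N \<theta> \<eta> \<delta> cH cJ \<kappa> w \<and> (\<forall>e\<in>set es. \<eta> < FF t h N \<theta> w (fst (w e)))}))"
      by (simp only: of_nat_sum[symmetric] of_nat_le_iff)
    also have "\<dots> <= (\<Sum>es\<in>LS. 2 * (4 * \<delta>') ^ M' * card W)" by (rule sum_mono[OF sw])
    also have "\<dots> = real (card LS) * (2 * (4 * \<delta>') ^ M' * card W)" by simp
    also have "\<dots> <= (real D ^ Suc s) ^ M * (2 * (4 * \<delta>') ^ M' * card W)"
      by (rule mult_right_mono[OF cLS]) (use d0 in simp)
    finally show ?thesis unfolding Wb by (simp only: C_def mult.assoc)
  qed
  have "{w\<in>Envs. P w} \<subseteq> (\<Union>b\<in>bm ` Envs. {w\<in>Envs. bm w = b \<and> P w})" by blast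
  hence "card {w\<in>Envs. P w} <= card (\<Union>b\<in>bm ` Envs. {w\<in>Envs. bm w = b \<and> P w})"
    by (rule card_mono[rotated]) auto
  also have "\<dots> <= (\<Sum>b\<in>bm ` Envs. card {w\<in>Envs. bm w = b \<and> P w})" by (rule card_UN_le) auto
  finally have "real (card {w\<in>Envs. P w}) <= (\<Sum>b\<in>bm ` Envs. real (card {w\<in>Envs. bm w = b \<and> P w}))"
    by (simp only: of_nat_sum[symmetric] of_nat_le_iff)
  also have "\<dots> <= (\<Sum>b\<in>bm ` Envs. C * card {w\<in>Envs. bm w = b})" by (rule sum_mono[OF each])
  also have "\<dots> = C * real (\<Sum>b\<in>bm ` Envs. card {w\<in>Envs. bm w = b})" by (simp add: sum_distrib_left)
  also have "(\<Sum>b\<in>bm ` Envs. card {w\<in>Envs. bm w = b}) = card (Envs)"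
    using sum.group[of "Envs" "bm ` Envs" bm "\<lambda>_. 1 :: nat"] by simp
  finally show ?thesis by (simp only: P_def C_def)
qed

end

section \<open>Uniform control over all starting vertices\<close>

context walk_config begin

text \<open>Markov's inequality for the three quantities estimated in \<open>FF_expect\<close>,
  \<open>nu2_expect\<close> and \<open>return_expect\<close>. The bound \<open>V\<close> on square
  sums also yields the columns, since it gives \<open>nu w s v <= sqrt V\<close> for each of the
  \<open>t\<close> steps.\<close>

lemma not_Good_bound:
  fixes c \<eta> \<delta> V cJ \<kappa> :: real
  assumes pos: "0 < c" "0 < \<eta>" "0 < \<delta>" "0 < V" "0 < cJ" "0 < \<kappa>"
  shows "real (card {w\<in>Envs. \<not> (Good t h N \<theta> \<eta> \<delta> (real t * sqrt V) cJ \<kappa> w \<and> (\<forall>s<t. (\<Sum>j<n. (nu w s j)^2) <= V))})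
    <= card (Envs) * (4 / (\<eta> * \<delta>) * (c * n / 2 * (\<theta> + Err) + 1 / (2 * c) + 2 * ((real t + 1) * p))
        + real t * (real (D * (t + 1)) / m + real t * p) / V + 2 * ((real t + 1) * p) / (\<kappa> * cJ))"
proof -
  let ?E = "Envs" and ?F = "FF t h N \<theta>"
  define B1 where "B1 = {w\<in>?E. \<delta> * \<eta> / 4 < avgH (?F w)}"
  define B2 where "B2 = {w\<in>?E. V < (\<Sum>s<t. \<Sum>j<n. (nu w s j)^2)}"
  define B3 where "B3 = {w\<in>?E. cJ * m * (\<kappa> / 2) < (\<Sum>e\<in>T. hit w t (fst (w e)) {e})}"
  have F0: "0 <= ?F w x" for w x unfolding FF_def by (rule sum_nonneg) simp
  have sub: "{w\<in>?E. \<not> (Good t h N \<theta> \<eta> \<delta> (real t * sqrt V) cJ \<kappa> w \<and> (\<forall>s<t. (\<Sum>j<n. (nu w s j)^2) <= V))} \<subseteq> B1 \<union> B2 \<union> B3"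
  proof
    fix w assume "w \<in> {w\<in>?E. \<not> (Good t h N \<theta> \<eta> \<delta> (real t * sqrt V) cJ \<kappa> w \<and> (\<forall>s<t. (\<Sum>j<n. (nu w s j)^2) <= V))}"
    hence w: "w \<in> ?E" and ng: "\<not> (Good t h N \<theta> \<eta> \<delta> (real t * sqrt V) cJ \<kappa> w \<and> (\<forall>s<t. (\<Sum>j<n. (nu w s j)^2) <= V))" by auto
    show "w \<in> B1 \<union> B2 \<union> B3"
    proof (rule ccontr)
      assume "w \<notin> B1 \<union> B2 \<union> B3"
      hence b: "avgH (?F w) <= \<delta> * \<eta> / 4" "(\<Sum>s<t. \<Sum>j<n. (nu w s j)^2) <= V" "(\<Sum>e\<in>T. hit w t (fst (w e)) {e}) <= cJ * m * (\<kappa> / 2)"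
        using w by (auto simp: B1_def B2_def B3_def not_less)
      have "avgH (\<lambda>x. of_bool (\<eta> / 4 < ?F w x)) <= avgH (\<lambda>x. 4 / \<eta> * ?F w x)"
      proof (rule avgH_mono)
        fix x show "of_bool (\<eta> / 4 < ?F w x) <= 4 / \<eta> * ?F w x"
          using F0[of w x] pos by (auto simp: field_simps)
      qed
      also have "\<dots> = 4 / \<eta> * avgH (?F w)" by (rule avgH_cmult)
      also have "\<dots> <= 4 / \<eta> * (\<delta> * \<eta> / 4)" using b(1) pos by (intro mult_left_mono) auto
      also have "\<dots> = \<delta>" using pos by simp
      finally have g1: "avgH (\<lambda>x. of_bool (\<eta> / 4 < ?F w x)) <= \<delta>" .
      have V: "(\<Sum>j<n. (nu w s j)^2) <= V" if "s < t" for s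
      proof -
        have "(\<Sum>j<n. (nu w s j)^2) <= (\<Sum>s<t. \<Sum>j<n. (nu w s j)^2)"
          by (rule member_le_sum[of s "{..<t}" "\<lambda>s. \<Sum>j<n. (nu w s j)^2"]) (use that in \<open>auto intro: sum_nonneg\<close>)
        thus ?thesis using b(2) by linarith
      qed
      have g2: "avgH (\<lambda>x. hit w t x {e}) <= real t * sqrt V" if e: "e \<in> T" for e
      proof -
        have "nu w s (fst e) <= sqrt V" if s: "s < t" for s
        proof (rule real_le_rsqrt)
          have "(nu w s (fst e))^2 <= (\<Sum>j<n. (nu w s j)^2)"
            by (rule member_le_sum[of "fst e" "{..<n}" "\<lambda>j. (nu w s j)^2"]) (use e in \<open>auto simp: memT\<close>)
          thus "(nu w s (fst e))^2 <= V" using V[OF s] by linarith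
        qed
        hence "(\<Sum>s<t. nu w s (fst e)) <= (\<Sum>s<t. sqrt V)" by (intro sum_mono) auto
        thus ?thesis using hit_column[OF w, of t e] by simp
      qed
      have g3: "real (card {e\<in>T. \<kappa> / 2 < hit w t (fst (w e)) {e}}) <= cJ * m"
      proof -
        have "real (card {e\<in>T. \<kappa> / 2 < hit w t (fst (w e)) {e}}) <= (\<Sum>e\<in>T. hit w t (fst (w e)) {e}) / (\<kappa> / 2)"
          by (rule card_gt_le_sum) (use pos hit_nonneg in auto)
        also have "\<dots> <= cJ * m * (\<kappa> / 2) / (\<kappa> / 2)" using b(3) pos by (intro divide_right_mono) auto
        finally show ?thesis using pos by simp
      qed
      have "Good t h N \<theta> \<eta> \<delta> (real t * sqrt V) cJ \<kappa> w" unfolding Good_def using g1 g2 g3 by blast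
      thus False using ng V by blast
    qed
  qed
  have "card {w\<in>?E. \<not> (Good t h N \<theta> \<eta> \<delta> (real t * sqrt V) cJ \<kappa> w \<and> (\<forall>s<t. (\<Sum>j<n. (nu w s j)^2) <= V))} <= card (B1 \<union> B2 \<union> B3)"
    by (rule card_mono[OF _ sub]) (auto simp: B1_def B2_def B3_def)
  also have "\<dots> <= card B1 + card B2 + card B3" by (intro order_trans[OF card_Un_le] add_mono card_Un_le order_refl)
  finally have "real (card {w\<in>?E. \<not> (Good t h N \<theta> \<eta> \<delta> (real t * sqrt V) cJ \<kappa> w \<and> (\<forall>s<t. (\<Sum>j<n. (nu w s j)^2) <= V))})
    <= real (card B1) + real (card B2) + real (card B3)" by linarith
  also have "\<dots> <= (\<Sum>w\<in>?E. avgH (?F w)) / (\<delta> * \<eta> / 4) + (\<Sum>w\<in>?E. \<Sum>s<t. \<Sum>j<n. (nu w s j)^2) / V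
     + (\<Sum>w\<in>?E. \<Sum>e\<in>T. hit w t (fst (w e)) {e}) / (cJ * m * (\<kappa> / 2))"
    unfolding B1_def B2_def B3_def
    by (intro add_mono card_gt_le_sum) (use pos mpos F0 hit_nonneg in \<open>auto intro!: avgH_nonneg sum_nonneg\<close>)
  also have "\<dots> <= (card ?E * (c * n / 2 * (\<theta> + Err) + 1 / (2 * c) + 2 * ((real t + 1) * p))) / (\<delta> * \<eta> / 4)
     + (\<Sum>s<t. card ?E * (real (D * (t + 1)) / m + real t * p)) / V
     + (card ?E * (real m * ((real t + 1) * p))) / (cJ * m * (\<kappa> / 2))"
  proof (intro add_mono divide_right_mono FF_expect return_expect)
    show "(\<Sum>w\<in>?E. \<Sum>s<t. \<Sum>j<n. (nu w s j)^2) <= (\<Sum>s<t. card ?E * (real (D * (t + 1)) / m + real t * p))"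
      by (subst sum.swap) (intro sum_mono nu2_expect, auto)
  qed (use pos in auto)
  also have "\<dots> = card ?E * (4 / (\<eta> * \<delta>) * (c * n / 2 * (\<theta> + Err) + 1 / (2 * c) + 2 * ((real t + 1) * p))
        + real t * (real (D * (t + 1)) / m + real t * p) / V + 2 * ((real t + 1) * p) / (\<kappa> * cJ))"
  proof -
    have 1: "(E * X) / (\<delta> * \<eta> / 4) = E * (4 / (\<eta> * \<delta>) * X)" for E X :: real using pos by (simp add: field_simps)
    have 2: "(\<Sum>s<t. E * Y) / V = E * (real t * Y / V)" for E Y :: real using pos by (simp add: field_simps)
    have 3: "(E * (real m * Z)) / (cJ * m * (\<kappa> / 2)) = E * (2 * Z / (\<kappa> * cJ))" for E Z :: real
      using pos mpos by (simp add: field_simps)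
    show ?thesis unfolding 1 2 3 by (simp only: ring_distribs)
  qed
  finally show ?thesis .
qed

text \<open>The preliminary walk spends \<open>s\<close> steps on reaching a tree and
  \<open>s + 1\<close> steps on passing through it.\<close>

definition Uniform :: "nat => real => real => env => bool" where
  "Uniform s \<eta> \<epsilon> w \<longleftrightarrow> (\<forall>i<n. QE w (s + Suc s) i (\<lambda>a. of_bool (\<eta> < FF t h N \<theta> w (endv i a))) <= (1/2) ^ s + \<epsilon>)"

text \<open>The last summand is the union bound over all roots, which the exponent \<open>M'\<close>
  will make affordable. At roots of trees the mass is at most \<open>\<epsilon>\<close>; the chance
  of not being at such a root is the term \<open>2^-s\<close>.\<close>

lemma not_Uniform_bound:
  fixes c \<eta> \<delta> \<delta>' V cJ \<kappa> \<epsilon> :: real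
  assumes pos: "0 < c" "0 < \<eta>" "0 < \<delta>" "0 < V" "0 < cJ" "0 < \<kappa>" "0 <= \<epsilon>" and d0: "0 <= \<delta>'" "\<delta>' <= 1"
    and M: "M = 2 * M'" "1 <= M'" and Me: "real M <= \<epsilon> * 2 ^ s" and big: "2 * (D ^ Suc s + M) < m"
    and n1: "4 * real M * \<kappa> + 4 * real M * (2 * real M + 1) * (real t * sqrt V) <= \<eta> / 2"
    and n2: "2 * \<kappa> + 4 * real M * (real t * sqrt V) <= \<eta> / 4"
    and n3: "real m * (\<delta> + cJ + 12 * real M ^ 2 * (real t * sqrt V) / \<kappa>) + 3 * real M + real M * real t / \<kappa> <= \<delta>' * (real m / 2)"
    and k: "k = 8 * s + 3" "k + 1 <= n"
  shows "real (card {w\<in>Envs. \<not> (Uniform s \<eta> \<epsilon> w \<and> (\<forall>s<t. (\<Sum>j<n. (nu w s j)^2) <= V))})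
    <= card (Envs) * (real k * real (D * k) ^ (2 * k + 2) / n
        + (4 / (\<eta> * \<delta>) * (c * n / 2 * (\<theta> + Err) + 1 / (2 * c) + 2 * ((real t + 1) * p))
            + real t * (real (D * (t + 1)) / m + real t * p) / V + 2 * ((real t + 1) * p) / (\<kappa> * cJ))
        + n * ((real D ^ Suc s) ^ M * (2 * (4 * \<delta>') ^ M')))"
proof -
  let ?E = "Envs" and ?F = "FF t h N \<theta>"
  let ?G = "Good t h N \<theta> \<eta> \<delta> (real t * sqrt V) cJ \<kappa>"
  define B1 where "B1 = {w\<in>?E. \<not> sparse k w}"
  define B2 where "B2 = {w\<in>?E. \<not> (?G w \<and> (\<forall>s<t. (\<Sum>j<n. (nu w s j)^2) <= V))}"
  define B3 where "B3 x = {w\<in>?E. TL s w x \<and> ?G w \<and> \<epsilon> < QE w (Suc s) x (\<lambda>a. of_bool (\<eta> < ?F w (endv x a)))}" for x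
  have sub: "{w\<in>?E. \<not> (Uniform s \<eta> \<epsilon> w \<and> (\<forall>s<t. (\<Sum>j<n. (nu w s j)^2) <= V))} \<subseteq> B1 \<union> B2 \<union> (\<Union>x<n. B3 x)"
  proof
    fix w assume "w \<in> {w\<in>?E. \<not> (Uniform s \<eta> \<epsilon> w \<and> (\<forall>s<t. (\<Sum>j<n. (nu w s j)^2) <= V))}"
    hence w: "w \<in> ?E" and nU: "\<not> (Uniform s \<eta> \<epsilon> w \<and> (\<forall>s<t. (\<Sum>j<n. (nu w s j)^2) <= V))" by auto
    show "w \<in> B1 \<union> B2 \<union> (\<Union>x<n. B3 x)"
    proof (rule ccontr)
      assume nb: "w \<notin> B1 \<union> B2 \<union> (\<Union>x<n. B3 x)"
      hence sp: "sparse k w" and G: "?G w" "\<forall>s<t. (\<Sum>j<n. (nu w s j)^2) <= V" using w by (auto simp: B1_def B2_def)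
      have b3: "QE w (Suc s) x (\<lambda>a. of_bool (\<eta> < ?F w (endv x a))) <= \<epsilon>" if "x < n" "TL s w x" for x
        using nb that w G by (auto simp: B3_def not_less)
      have "Uniform s \<eta> \<epsilon> w" unfolding Uniform_def
      proof (intro allI impI)
        fix i assume i: "i < n"
        have "QE w (s + Suc s) i (\<lambda>a. of_bool (\<eta> < ?F w (endv i a)))
          = QE w s i (\<lambda>a. QE w (Suc s) (endv i a) (\<lambda>b. of_bool (\<eta> < ?F w (endv (endv i a) b))))"
          by (subst QE_append[OF w i]) simp
        also have "\<dots> <= QE w s i (\<lambda>a. of_bool (\<not> TL s w (endv i a)) + \<epsilon>)"
        proof (rule QE_mono)
          fix a assume "a \<in> VL i s"
          hence v: "endv i a < n" using valid_endv i by (auto simp: VL_def)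
          have "QE w (Suc s) (endv i a) (\<lambda>b. of_bool (\<eta> < ?F w (endv (endv i a) b))) <= 1"
            by (rule QE_le_const[OF w v]) simp
          thus "QE w (Suc s) (endv i a) (\<lambda>b. of_bool (\<eta> < ?F w (endv (endv i a) b))) <= of_bool (\<not> TL s w (endv i a)) + \<epsilon>"
            using b3[OF v] pos by (cases "TL s w (endv i a)") auto
        qed
        also have "\<dots> = QE w s i (\<lambda>a. of_bool (\<not> TL s w (endv i a))) + \<epsilon>"
          by (simp only: QE_add QE_const[OF w i])
        also have "\<dots> <= (1/2) ^ s + \<epsilon>" using escape_to_TL[OF w sp _ i, of s] k by simp
        finally show "QE w (s + Suc s) i (\<lambda>a. of_bool (\<eta> < ?F w (endv i a))) <= (1/2) ^ s + \<epsilon>" .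
      qed
      thus False using nU G by blast
    qed
  qed
  have "card {w\<in>?E. \<not> (Uniform s \<eta> \<epsilon> w \<and> (\<forall>s<t. (\<Sum>j<n. (nu w s j)^2) <= V))} <= card (B1 \<union> B2 \<union> (\<Union>x<n. B3 x))"
    by (rule card_mono[OF _ sub]) (auto simp: B1_def B2_def B3_def)
  also have "\<dots> <= card B1 + card B2 + card (\<Union>x<n. B3 x)" by (intro order_trans[OF card_Un_le] add_mono card_Un_le order_refl)
  also have "\<dots> <= card B1 + card B2 + (\<Sum>x<n. card (B3 x))" by (intro add_left_mono card_UN_le) simp
  finally have "real (card {w\<in>?E. \<not> (Uniform s \<eta> \<epsilon> w \<and> (\<forall>s<t. (\<Sum>j<n. (nu w s j)^2) <= V))})
    <= real (card B1 + card B2 + (\<Sum>x<n. card (B3 x)))" by (simp only: of_nat_le_iff)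
  also have "\<dots> = real (card B1) + real (card B2) + (\<Sum>x<n. real (card (B3 x)))" by simp
  also have "\<dots> <= card ?E * (real k * real (D * k) ^ (2 * k + 2) / n)
      + card ?E * (4 / (\<eta> * \<delta>) * (c * n / 2 * (\<theta> + Err) + 1 / (2 * c) + 2 * ((real t + 1) * p))
            + real t * (real (D * (t + 1)) / m + real t * p) / V + 2 * ((real t + 1) * p) / (\<kappa> * cJ))
      + (\<Sum>x<n. (real D ^ Suc s) ^ M * (2 * (4 * \<delta>') ^ M') * card ?E)"
    unfolding B1_def B2_def B3_def
  proof (intro add_mono sum_mono)
    show "real (card {w\<in>?E. \<not> sparse k w}) <= card ?E * (real k * real (D * k) ^ (2 * k + 2) / n)"
      by (rule not_sparse_bound) (use k in auto)
    show "real (card {w\<in>?E. \<not> (?G w \<and> (\<forall>s<t. (\<Sum>j<n. (nu w s j)^2) <= V))})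
      <= card ?E * (4 / (\<eta> * \<delta>) * (c * n / 2 * (\<theta> + Err) + 1 / (2 * c) + 2 * ((real t + 1) * p))
            + real t * (real (D * (t + 1)) / m + real t * p) / V + 2 * ((real t + 1) * p) / (\<kappa> * cJ))"
      by (rule not_Good_bound[OF pos(1-6)])
    fix x assume "x \<in> {..<n}"
    thus "real (card {w\<in>?E. TL s w x \<and> ?G w \<and> \<epsilon> < QE w (Suc s) x (\<lambda>a. of_bool (\<eta> < ?F w (endv x a)))})
      <= (real D ^ Suc s) ^ M * (2 * (4 * \<delta>') ^ M') * card ?E"
      by (intro tree_vertex_bad[OF _ _ pos(6) _ d0 M Me big n1 n2 n3]) (use teq pos in auto)
  qed
  finally show ?thesis by (simp add: ring_distribs mult_ac)
qed

end

lemma tv_positive_part: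
  fixes a b :: "nat => real"
  assumes "(\<Sum>j<n. a j) = (\<Sum>j<n. b j)"
  shows "(1/2) * (\<Sum>j<n. \<bar>a j - b j\<bar>) = (\<Sum>j<n. max 0 (b j - a j))"
proof -
  have "\<bar>a j - b j\<bar> = 2 * max 0 (b j - a j) + (a j - b j)" for j by (simp add: max_def abs_if)
  hence "(\<Sum>j<n. \<bar>a j - b j\<bar>) = 2 * (\<Sum>j<n. max 0 (b j - a j)) + ((\<Sum>j<n. a j) - (\<Sum>j<n. b j))"
    by (simp add: sum.distrib sum_distrib_left sum_subtractf)
  thus ?thesis using assms by simp
qed

lemma tv_set_bound:
  fixes a b :: "nat => real"
  assumes "(\<Sum>j<n. a j) = (\<Sum>j<n. b j)" "S \<subseteq> {..<n}"
  shows "(\<Sum>j\<in>S. b j) - (\<Sum>j\<in>S. a j) <= (1/2) * (\<Sum>j<n. \<bar>a j - b j\<bar>)"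
proof -
  have "(\<Sum>j\<in>S. b j) - (\<Sum>j\<in>S. a j) = (\<Sum>j\<in>S. b j - a j)" by (simp add: sum_subtractf)
  also have "\<dots> <= (\<Sum>j\<in>S. max 0 (b j - a j))" by (rule sum_mono) simp
  also have "\<dots> <= (\<Sum>j<n. max 0 (b j - a j))" by (rule sum_mono2) (use assms in auto)
  finally show ?thesis using tv_positive_part[OF assms(1)] by simp
qed

context config begin

lemma PP_0: "PP w 0 i j = of_bool (i = j)" by (simp add: PP_def)

subsection \<open>The invariant measure\<close>

text \<open>For a vector of total mass zero, \<open>\<nu>\<close> may be subtracted from every row;
  each remaining row has \<open>L1\<close> norm at most \<open>2 * \<rho>\<close>. For
  \<open>\<rho> <= 1/4\<close> this contracts by \<open>1/2\<close>.\<close>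

lemma PP_contract:
  assumes w: "w \<in> Envs" and mix: "\<And>i. i < n ==> (1/2) * (\<Sum>j<n. \<bar>PP w S i j - \<nu> j\<bar>) <= \<rho>"
    and v: "(\<Sum>i<n. v i) = 0"
  shows "(\<Sum>j<n. \<bar>\<Sum>i<n. v i * PP w S i j\<bar>) <= 2 * \<rho> * (\<Sum>i<n. \<bar>v i\<bar>)"
proof -
  have "(\<Sum>i<n. v i * PP w S i j) = (\<Sum>i<n. v i * (PP w S i j - \<nu> j))" for j
    using v by (simp add: right_diff_distrib sum_subtractf flip: sum_distrib_right)
  hence "(\<Sum>j<n. \<bar>\<Sum>i<n. v i * PP w S i j\<bar>) <= (\<Sum>j<n. \<Sum>i<n. \<bar>v i\<bar> * \<bar>PP w S i j - \<nu> j\<bar>)"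
    by (simp only:) (intro sum_mono order_trans[OF sum_abs], simp add: abs_mult)
  also have "\<dots> = (\<Sum>i<n. \<bar>v i\<bar> * (\<Sum>j<n. \<bar>PP w S i j - \<nu> j\<bar>))"
    by (subst sum.swap) (simp only: sum_distrib_left)
  also have "\<dots> <= (\<Sum>i<n. \<bar>v i\<bar> * (2 * \<rho>))"
    by (intro sum_mono mult_left_mono) (use mix in force)+
  also have "\<dots> = 2 * \<rho> * (\<Sum>i<n. \<bar>v i\<bar>)" by (simp only: sum_distrib_right[symmetric] mult.commute)
  finally show ?thesis .
qed

text \<open>By contraction, iterating the \<open>S\<close>-step kernel from vertex \<open>0\<close>
  converges geometrically, and an \<open>S\<close>-invariant vector is determined by its total mass.
  Applying \<open>r\<close> further steps to the limit preserves both properties, so the limit is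
  invariant for every \<open>r\<close>, in particular for one step.\<close>

lemma unique_invariant:
  assumes w: "w \<in> Envs" and mix: "\<And>i. i < n ==> (1/2) * (\<Sum>j<n. \<bar>PP w S i j - \<nu> j\<bar>) <= \<rho>"
    and \<rho>: "\<rho> <= 1/4" "0 <= \<rho>"
  obtains \<pi> where "pi_star n (trans dp w) = \<pi>" "(\<Sum>j<n. \<pi> j) = 1" "\<And>j. 0 <= \<pi> j"
    "\<And>r j. j < n ==> (\<Sum>i<n. \<pi> i * PP w r i j) = \<pi> j"
proof -
  have uniq: "a j = b j"
    if "(\<Sum>i<n. a i) = (\<Sum>i<n. b i)" "\<And>j. j < n ==> (\<Sum>i<n. a i * PP w S i j) = a j"
      "\<And>j. j < n ==> (\<Sum>i<n. b i * PP w S i j) = b j" "j < n" for a b :: "nat => real" and j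
  proof -
    have "(\<Sum>j<n. \<bar>\<Sum>i<n. (a i - b i) * PP w S i j\<bar>) <= 2 * \<rho> * (\<Sum>i<n. \<bar>a i - b i\<bar>)"
      by (rule PP_contract[OF w mix]) (use that in \<open>simp_all add: sum_subtractf\<close>)
    moreover have "(\<Sum>j<n. \<bar>\<Sum>i<n. (a i - b i) * PP w S i j\<bar>) = (\<Sum>j<n. \<bar>a j - b j\<bar>)"
      by (rule sum.cong[OF refl]) (use that in \<open>simp add: left_diff_distrib sum_subtractf\<close>)
    moreover have "2 * \<rho> * (\<Sum>i<n. \<bar>a i - b i\<bar>) <= 1/2 * (\<Sum>i<n. \<bar>a i - b i\<bar>)"
      using \<rho> by (intro mult_right_mono) (auto intro: sum_nonneg)
    ultimately have "(\<Sum>j<n. \<bar>a j - b j\<bar>) <= 0" by linarith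
    moreover have "\<bar>a j - b j\<bar> <= (\<Sum>j<n. \<bar>a j - b j\<bar>)" by (rule member_le_sum) (use that in auto)
    ultimately show ?thesis by linarith
  qed
  define y where "y r j = PP w (r * S) 0 j" for r j
  have ystep: "y (Suc r) j = (\<Sum>i<n. y r i * PP w S i j)" for r j
    using PP_add[OF w npos, of "r * S" S j] by (simp add: y_def add.commute)
  have ysum: "(\<Sum>j<n. y r j) = 1" for r unfolding y_def by (rule PP_sum[OF w npos])
  define \<Delta> where "\<Delta> r = (\<Sum>j<n. \<bar>y (Suc r) j - y r j\<bar>)" for r
  have \<Delta>: "\<Delta> r <= 2 * (1/2) ^ r" for r
  proof (induction r)
    case 0
    have "\<Delta> 0 <= (\<Sum>j<n. y 1 j + y 0 j)" unfolding \<Delta>_def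
      by (rule sum_mono) (use PP_nonneg in \<open>auto simp: y_def abs_le_iff\<close>)
    thus ?case using ysum by (simp add: sum.distrib)
  next
    case (Suc r)
    have "\<Delta> (Suc r) = (\<Sum>j<n. \<bar>\<Sum>i<n. (y (Suc r) i - y r i) * PP w S i j\<bar>)"
      unfolding \<Delta>_def by (simp only: ystep[of "Suc r"] ystep[of r] left_diff_distrib sum_subtractf)
    also have "\<dots> <= 2 * \<rho> * (\<Sum>i<n. \<bar>y (Suc r) i - y r i\<bar>)"
      by (rule PP_contract[OF w mix]) (use ysum in \<open>simp_all add: sum_subtractf\<close>)
    also have "\<dots> <= 1/2 * \<Delta> r" unfolding \<Delta>_def using \<rho> by (intro mult_right_mono) (auto intro: sum_nonneg)
    finally show ?case using Suc by simp
  qed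
  have conv: "\<exists>l. (\<lambda>r. y r j) \<longlonglongrightarrow> l" if j: "j < n" for j
  proof -
    have "summable (\<lambda>r. y (Suc r) j - y r j)"
    proof (rule summable_comparison_test')
      show "summable (\<lambda>r. 2 * (1/2 :: real) ^ r)" by (intro summable_mult summable_geometric) simp
      fix r
      have "\<bar>y (Suc r) j - y r j\<bar> <= \<Delta> r" unfolding \<Delta>_def by (rule member_le_sum) (use j in auto)
      thus "norm (y (Suc r) j - y r j) <= 2 * (1/2) ^ r" using \<Delta>[of r] by simp
    qed
    hence "convergent (\<lambda>r. \<Sum>q<r. y (Suc q) j - y q j)" by (simp add: summable_iff_convergent)
    hence "convergent (\<lambda>r. y r j - y 0 j)" using sum_lessThan_telescope[of "\<lambda>q. y q j"] by (simp only:)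
    hence "convergent (\<lambda>r. (y r j - y 0 j) + y 0 j)" by (intro convergent_add convergent_const)
    thus ?thesis by (simp add: convergent_def)
  qed
  then obtain l where l: "\<And>j. j < n ==> (\<lambda>r. y r j) \<longlonglongrightarrow> l j" by metis
  define \<pi> where "\<pi> j = (if j < n then l j else 0)" for j
  have lim: "(\<lambda>r. y r j) \<longlonglongrightarrow> \<pi> j" if "j < n" for j using l that by (simp add: \<pi>_def)
  have nn: "0 <= \<pi> j" for j
  proof (cases "j < n")
    case True
    show ?thesis by (rule LIMSEQ_le_const[OF lim[OF True]]) (simp add: y_def PP_nonneg)
  qed (simp add: \<pi>_def)
  have one: "(\<Sum>j<n. \<pi> j) = 1"
  proof -
    have "(\<lambda>r. \<Sum>j<n. y r j) \<longlonglongrightarrow> (\<Sum>j<n. \<pi> j)" by (intro tendsto_sum lim) simp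
    thus ?thesis unfolding ysum using LIMSEQ_unique tendsto_const by blast
  qed
  have invS: "(\<Sum>i<n. \<pi> i * PP w S i j) = \<pi> j" if j: "j < n" for j
  proof -
    have "(\<lambda>r. \<Sum>i<n. y r i * PP w S i j) \<longlonglongrightarrow> (\<Sum>i<n. \<pi> i * PP w S i j)"
      by (intro tendsto_sum tendsto_mult lim tendsto_const) simp
    hence "(\<lambda>r. y (Suc r) j) \<longlonglongrightarrow> (\<Sum>i<n. \<pi> i * PP w S i j)" by (simp only: ystep)
    thus ?thesis using LIMSEQ_Suc[OF lim[OF j]] LIMSEQ_unique by blast
  qed
  have push: "(\<Sum>k<n. (\<Sum>i<n. c i * PP w r i k) * PP w r' k j) = (\<Sum>i<n. c i * PP w (r + r') i j)" for c r r' j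
  proof -
    have "(\<Sum>k<n. (\<Sum>i<n. c i * PP w r i k) * PP w r' k j) = (\<Sum>i<n. c i * (\<Sum>k<n. PP w r i k * PP w r' k j))"
      by (simp only: sum_distrib_left sum_distrib_right mult.assoc) (rule sum.swap)
    thus ?thesis using PP_add[OF w] by simp
  qed
  have inv: "(\<Sum>i<n. \<pi> i * PP w r i j) = \<pi> j" if j: "j < n" for r j
  proof (rule uniq[of "\<lambda>j. \<Sum>i<n. \<pi> i * PP w r i j" \<pi>, OF _ _ invS j])
    have "(\<Sum>j<n. \<Sum>i<n. \<pi> i * PP w r i j) = (\<Sum>i<n. \<pi> i * (\<Sum>j<n. PP w r i j))"
      by (subst sum.swap) (simp only: sum_distrib_left)
    thus "(\<Sum>j<n. \<Sum>i<n. \<pi> i * PP w r i j) = (\<Sum>i<n. \<pi> i)" using PP_sum[OF w] by simp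
    fix j assume "j < n"
    have "(\<Sum>k<n. (\<Sum>i<n. \<pi> i * PP w r i k) * PP w S k j) = (\<Sum>i<n. \<pi> i * PP w (S + r) i j)"
      unfolding push by (simp add: add.commute)
    also have "\<dots> = (\<Sum>k<n. (\<Sum>i<n. \<pi> i * PP w S i k) * PP w r k j)" unfolding push ..
    also have "\<dots> = (\<Sum>k<n. \<pi> k * PP w r k j)" by (intro sum.cong refl) (simp add: invS)
    finally show "(\<Sum>k<n. (\<Sum>i<n. \<pi> i * PP w r i k) * PP w S k j) = (\<Sum>i<n. \<pi> i * PP w r i j)" .
  qed
  have out: "\<forall>j\<ge>n. \<pi> j = 0" by (simp add: \<pi>_def)
  have "(\<Sum>i<n. \<pi> i * trans dp w i j) = \<pi> j" if "j < n" for j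
    using inv[OF that, of 1] PP_1[OF w] by simp
  hence inv1: "is_invariant n (trans dp w) \<pi>" unfolding is_invariant_def using nn one out by blast
  have "\<pi>' = \<pi>" if i': "is_invariant n (trans dp w) \<pi>'" for \<pi>'
  proof
    fix j
    have p1: "(\<Sum>i<n. \<pi>' i * PP w 1 i j) = \<pi>' j" if "j < n" for j
      using i' that PP_1[OF w] unfolding is_invariant_def by simp
    have pr: "(\<Sum>i<n. \<pi>' i * PP w r i j) = \<pi>' j" if "j < n" for r j
      using that
    proof (induction r arbitrary: j)
      case 0
      have "(\<Sum>i<n. \<pi>' i * PP w 0 i j) = (\<Sum>i<n. if i = j then \<pi>' i else 0)"
        by (intro sum.cong refl) (simp add: PP_0)
      thus ?case using 0 by simp
    next
      case (Suc r)
      have "(\<Sum>i<n. \<pi>' i * PP w (Suc r) i j) = (\<Sum>k<n. (\<Sum>i<n. \<pi>' i * PP w r i k) * PP w 1 k j)"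
        unfolding push by simp
      also have "\<dots> = (\<Sum>k<n. \<pi>' k * PP w 1 k j)" by (intro sum.cong refl) (simp add: Suc.IH)
      finally show ?case using p1 Suc.prems by simp
    qed
    show "\<pi>' j = \<pi> j"
    proof (cases "j < n")
      case True
      show ?thesis by (rule uniq[OF _ pr invS True]) (use i' one in \<open>simp_all add: is_invariant_def\<close>)
    next
      case False
      thus ?thesis using i' by (simp add: is_invariant_def \<pi>_def)
    qed
  qed
  hence "pi_star n (trans dp w) = \<pi>" unfolding pi_star_def using inv1 by blast
  thus ?thesis using that one nn inv by blast
qed

text \<open>An invariant measure is a mixture of the \<open>S\<close>-step rows, all within
  \<open>\<rho>\<close> of \<open>\<nu>\<close>.\<close>

lemma tv_invariant_le:
  assumes w: "w \<in> Envs" and mix: "\<And>i. i < n ==> (1/2) * (\<Sum>j<n. \<bar>PP w S i j - \<nu> j\<bar>) <= \<rho>"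
    and \<pi>: "(\<Sum>j<n. \<pi> j) = 1" "\<And>j. 0 <= \<pi> j" "\<And>j. j < n ==> (\<Sum>i<n. \<pi> i * PP w S i j) = \<pi> j"
  shows "(1/2) * (\<Sum>j<n. \<bar>\<pi> j - \<nu> j\<bar>) <= \<rho>"
proof -
  have "(\<Sum>j<n. \<bar>\<pi> j - \<nu> j\<bar>) = (\<Sum>j<n. \<bar>\<Sum>i<n. \<pi> i * (PP w S i j - \<nu> j)\<bar>)"
    by (intro sum.cong refl) (use \<pi> in \<open>simp add: right_diff_distrib sum_subtractf flip: sum_distrib_right\<close>)
  also have "\<dots> <= (\<Sum>j<n. \<Sum>i<n. \<pi> i * \<bar>PP w S i j - \<nu> j\<bar>)"
    by (intro sum_mono order_trans[OF sum_abs]) (use \<pi>(2) in \<open>simp add: abs_mult\<close>)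
  also have "\<dots> = (\<Sum>i<n. \<pi> i * (\<Sum>j<n. \<bar>PP w S i j - \<nu> j\<bar>))"
    by (subst sum.swap) (simp only: sum_distrib_left)
  also have "\<dots> <= (\<Sum>i<n. \<pi> i * (2 * \<rho>))" by (intro sum_mono mult_left_mono) (use mix \<pi>(2) in force)+
  also have "\<dots> = 2 * \<rho>" using \<pi>(1) by (simp flip: sum_distrib_right)
  finally show ?thesis by simp
qed

end

section \<open>Upper bound from light paths, lower bound from heavy paths\<close>

context walk_config begin

text \<open>After the preliminary steps the walk stands, up to mass
  \<open>2^-s + \<epsilon>\<close>, at a vertex whose light paths alone cover \<open>q \<nu>\<close>
  up to \<open>\<eta>\<close>. About \<open>1 - q\<close> of the mass of \<open>\<nu>\<close> can
  remain uncovered.\<close>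

lemma Uniform_upper:
  assumes w: "w \<in> Envs" and U: "Uniform s \<eta> \<epsilon> w" and i: "i < n" and \<eta>0: "0 <= \<eta>"
  shows "(1/2) * (\<Sum>j<n. \<bar>PP w (s + Suc s + t) i j - nu w h j\<bar>) <= 1 - qq N \<theta> + \<eta> + (1/2) ^ s + \<epsilon>"
proof -
  let ?q = "qq N \<theta>" and ?S = "s + Suc s" and ?F = "FF t h N \<theta> w" and ?X = "XX t h N \<theta> w"
  define bad where "bad x = (of_bool (\<eta> < ?F x) :: real)" for x
  have nn: "0 <= nu w h j" for j by (rule nu_nonneg)
  have pt: "max 0 (nu w h j - PP w (?S + t) i j) <= (1 - ?q) * nu w h j + QE w ?S i (\<lambda>a. bad (endv i a)) * nu w h j
     + QE w ?S i (\<lambda>a. (1 - bad (endv i a)) * \<bar>?X (endv i a) j - ?q * nu w h j\<bar>)" for j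
  proof -
    have "PP w (?S + t) i j = QE w ?S i (\<lambda>a. PP w t (endv i a) j)"
      unfolding PP_def QE_append[OF w i] by simp
    also have "\<dots> \<ge> QE w ?S i (\<lambda>a. ?q * nu w h j - bad (endv i a) * nu w h j - (1 - bad (endv i a)) * \<bar>?X (endv i a) j - ?q * nu w h j\<bar>)"
    proof (rule QE_mono)
      fix a
      have X: "?X (endv i a) j <= PP w t (endv i a) j" unfolding XX_def PP_def by (rule QE_mono) auto
      have "?q * nu w h j <= nu w h j" using nn qq_bounds(2) by (simp add: mult_left_le_one_le qq_bounds(1))
      thus "?q * nu w h j - bad (endv i a) * nu w h j - (1 - bad (endv i a)) * \<bar>?X (endv i a) j - ?q * nu w h j\<bar> <= PP w t (endv i a) j"
        using X PP_nonneg[of w t "endv i a" j] by (auto simp: bad_def)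
    qed
    also have "QE w ?S i (\<lambda>a. ?q * nu w h j - bad (endv i a) * nu w h j - (1 - bad (endv i a)) * \<bar>?X (endv i a) j - ?q * nu w h j\<bar>)
      = ?q * nu w h j - QE w ?S i (\<lambda>a. bad (endv i a)) * nu w h j - QE w ?S i (\<lambda>a. (1 - bad (endv i a)) * \<bar>?X (endv i a) j - ?q * nu w h j\<bar>)"
      by (simp only: QE_diff QE_cmult2 QE_const[OF w i])
    finally have "nu w h j - PP w (?S + t) i j <= (1 - ?q) * nu w h j + QE w ?S i (\<lambda>a. bad (endv i a)) * nu w h j
     + QE w ?S i (\<lambda>a. (1 - bad (endv i a)) * \<bar>?X (endv i a) j - ?q * nu w h j\<bar>)" by (simp add: algebra_simps)
    moreover have "0 <= (1 - ?q) * nu w h j + QE w ?S i (\<lambda>a. bad (endv i a)) * nu w h j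
     + QE w ?S i (\<lambda>a. (1 - bad (endv i a)) * \<bar>?X (endv i a) j - ?q * nu w h j\<bar>)"
      using nn qq_bounds by (intro add_nonneg_nonneg mult_nonneg_nonneg QE_nonneg) (auto simp: bad_def)
    ultimately show ?thesis by simp
  qed
  have "(\<Sum>j<n. PP w (?S + t) i j) = (\<Sum>j<n. nu w h j)" using PP_sum[OF w i] nu_sum[OF w] by simp
  from tv_positive_part[OF this]
  have "(1/2) * (\<Sum>j<n. \<bar>PP w (?S + t) i j - nu w h j\<bar>) = (\<Sum>j<n. max 0 (nu w h j - PP w (?S + t) i j))" .
  also have "\<dots> <= (\<Sum>j<n. (1 - ?q) * nu w h j + QE w ?S i (\<lambda>a. bad (endv i a)) * nu w h j
     + QE w ?S i (\<lambda>a. (1 - bad (endv i a)) * \<bar>?X (endv i a) j - ?q * nu w h j\<bar>))" by (rule sum_mono[OF pt])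
  also have "\<dots> = (1 - ?q) + QE w ?S i (\<lambda>a. bad (endv i a)) + QE w ?S i (\<lambda>a. (1 - bad (endv i a)) * ?F (endv i a))"
    unfolding sum.distrib sum_distrib_left[symmetric] nu_sum[OF w] QE_sum[symmetric] FF_def by simp
  also have "\<dots> <= (1 - ?q) + ((1/2) ^ s + \<epsilon>) + \<eta>"
  proof (intro add_mono order_refl)
    show "QE w ?S i (\<lambda>a. bad (endv i a)) <= (1/2) ^ s + \<epsilon>" using U i unfolding Uniform_def bad_def by blast
    show "QE w ?S i (\<lambda>a. (1 - bad (endv i a)) * ?F (endv i a)) <= \<eta>"
      by (rule QE_le_const[OF w i]) (use \<eta>0 in \<open>auto simp: bad_def\<close>)
  qed
  finally show ?thesis by simp
qed

lemma hw_ge: "set fs \<subseteq> H ==> (1 / real D) ^ length fs <= hw fs"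
proof (induction fs)
  case (Cons f fs)
  have "real (dp (fst f)) <= D" "0 < real (dp (fst f))" using Cons.prems degD[of "fst f"] deg2[of "fst f"] by (auto simp: memH)
  hence "(1 / real D) ^ length fs / D <= hw fs / real (dp (fst f))" using Cons by (intro frac_le) auto
  thus ?case by simp
qed simp

text \<open>Cutting off the last \<open>s1\<close> steps of a heavy trajectory removes
  \<open>s1 - h\<close> heads of its window, each contributing a factor at most \<open>1/2\<close>;
  so the window part left is heavier by \<open>2^(s1 - h)\<close>. The first tail and the first
  \<open>h\<close> heads cost at most \<open>D^(h + 1)\<close>.\<close>

lemma prefix_weight:
  assumes a: "valid x a" "length a = t" and nl: "\<not> low h N \<theta> a" and s1: "h <= s1" "s1 <= h + N"
  shows "(1 / real D) ^ (h + 1) * (\<theta> * 2 ^ (s1 - h)) <= wt (take (t - s1) a)"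
proof -
  define N' where "N' = N - (s1 - h)"
  have ts: "t - s1 = Suc (h + N')" "N' <= N" "N = N' + (s1 - h)" using teq s1 by (auto simp: N'_def)
  let ?fs = "map snd a"
  have fH: "set ?fs \<subseteq> H" by (rule heads_H[OF a(1)])
  obtain z b where zb: "a = z # b" using a(2) teq by (cases a) auto
  have tk: "take (t - s1) a = z # take (h + N') b" using ts by (simp add: zb)
  have v: "valid x (z # take (h + N') b)"
  proof -
    have "valid x ((z # take (h + N') b) @ drop (h + N') b)" using a(1) by (simp add: zb)
    thus ?thesis unfolding valid_append by blast
  qed
  have z: "real (dp (fst (fst z))) <= D" "0 < real (dp (fst (fst z)))"
    using a(1) degD[of "fst (fst z)"] deg2[of "fst (fst z)"] by (auto simp: zb memT)
  have len: "length (take (h + N') b) = h + N'" using a(2) ts teq by (simp add: zb)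
  have "butlast (map snd (z # take (h + N') b)) = take (h + N') ?fs"
    by (rule nth_equalityI) (use len a(2) zb in \<open>auto simp: nth_butlast nth_Cons' nth_append\<close>)
  hence "wt (take (h + N') b) = hw (take (h + N') ?fs)" using wt_tl[OF v] by simp
  also have "take (h + N') ?fs = take h ?fs @ take N' (drop h ?fs)" by (rule take_add)
  also have "hw \<dots> = hw (take h ?fs) * hw (take N' (drop h ?fs))" by (rule hw_append)
  finally have wb: "wt (take (h + N') b) = hw (take h ?fs) * hw (take N' (drop h ?fs))" .
  have h1: "(1 / real D) ^ h <= hw (take h ?fs)"
    using hw_ge[of "take h ?fs"] fH set_take_subset[of h ?fs] a(2) teq by (simp add: min_def)
  have mid: "\<theta> * 2 ^ (s1 - h) <= hw (take N' (drop h ?fs))"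
  proof -
    have "take N (drop h ?fs) = take N' (drop h ?fs) @ take (s1 - h) (drop N' (drop h ?fs))" unfolding ts(3) by (rule take_add)
    hence "hw (take N (drop h ?fs)) = hw (take N' (drop h ?fs)) * hw (take (s1 - h) (drop N' (drop h ?fs)))"
      by (simp only: hw_append)
    also have "hw (take (s1 - h) (drop N' (drop h ?fs))) <= (1/2) ^ (s1 - h)"
    proof -
      have "set (take (s1 - h) (drop N' (drop h ?fs))) \<subseteq> H" using fH by (meson set_drop_subset set_take_subset subset_trans)
      moreover have "length (take (s1 - h) (drop N' (drop h ?fs))) = s1 - h" using a(2) teq ts by simp
      ultimately show ?thesis using hw_le by metis
    qed
    finally have "hw (take N (drop h ?fs)) <= hw (take N' (drop h ?fs)) * (1/2) ^ (s1 - h)"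
      by (simp add: mult_left_mono)
    hence "\<theta> <= hw (take N' (drop h ?fs)) * (1/2) ^ (s1 - h)" using nl by (simp add: low_def)
    thus ?thesis by (simp add: field_simps)
  qed
  have "(1 / real D) ^ (h + 1) * (\<theta> * 2 ^ (s1 - h)) = (1 / real D) ^ h * (\<theta> * 2 ^ (s1 - h)) / D" by simp
  also have "\<dots> <= (hw (take h ?fs) * hw (take N' (drop h ?fs))) / real (dp (fst (fst z)))"
    using z h1 mid th0 by (intro frac_le mult_mono) auto
  finally show ?thesis unfolding tk using wb by simp
qed

text \<open>The walk is stopped \<open>s1\<close> steps early. With probability about
  \<open>1 - q\<close> its trajectory then weighs at least \<open>\<theta>1\<close>. At most
  \<open>1 / \<theta>1\<close> trajectories do, so this mass sits on at most
  \<open>1 / \<theta>1\<close> vertices, to which \<open>\<nu>\<close> gives at most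
  \<open>sqrt (V / \<theta>1)\<close> by Cauchy-Schwarz. Stopping early is essential in the
  application: there \<open>1 / \<theta>\<close> is of larger order than \<open>n\<close>.\<close>

lemma Uniform_lower:
  assumes w: "w \<in> Envs" and U: "Uniform s \<eta> \<epsilon> w" and i: "i < n" and \<eta>0: "0 <= \<eta>"
    and V: "(\<Sum>j<n. (nu w h j)^2) <= V" and s1: "h <= s1" "s1 <= h + N" and th: "0 < \<theta>"
    and \<pi>: "(\<Sum>j<n. \<pi> j) = 1" "(1/2) * (\<Sum>j<n. \<bar>\<pi> j - nu w h j\<bar>) <= \<rho>"
    and \<theta>1: "\<theta>1 = (1 / real D) ^ (s + Suc s + h + 1) * (\<theta> * 2 ^ (s1 - h))"
  shows "1 - qq N \<theta> - \<eta> - ((1/2) ^ s + \<epsilon>) - \<rho> - sqrt (V / \<theta>1)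
    <= (1/2) * (\<Sum>j<n. \<bar>PP w (s + Suc s + (t - s1)) i j - \<pi> j\<bar>)"
proof -
  let ?q = "qq N \<theta>" and ?S = "s + Suc s" and ?F = "FF t h N \<theta> w" and ?X = "XX t h N \<theta> w"
  let ?tt = "?S + (t - s1)"
  define bad where "bad x = (of_bool (\<eta> < ?F x) :: real)" for x
  have th1: "0 < \<theta>1" using th D2 by (simp add: \<theta>1)
  define Z where "Z = {a\<in>VL i ?tt. ext w (set a) \<and> \<theta>1 <= wt a}"
  define SS where "SS = endv i ` Z"
  have finZ: "finite Z" unfolding Z_def by (rule finite_subset[OF _ finite_VL[of i ?tt]]) auto
  have SSn: "SS \<subseteq> {..<n}" using valid_endv i by (auto simp: SS_def Z_def VL_def)
  have cS: "real (card SS) <= 1 / \<theta>1"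
  proof -
    have "real (card Z) * \<theta>1 = (\<Sum>a\<in>Z. \<theta>1)" by simp
    also have "\<dots> <= (\<Sum>a\<in>Z. wt a * of_bool (ext w (set a)) * 1)" by (rule sum_mono) (auto simp: Z_def)
    also have "\<dots> <= QE w ?tt i (\<lambda>_. 1)" unfolding QE_def by (rule sum_mono2) (auto simp: Z_def)
    also have "\<dots> = 1" by (rule QE_const[OF w i])
    finally have "real (card Z) <= 1 / \<theta>1" using th1 by (simp add: field_simps)
    moreover have "card SS <= card Z" unfolding SS_def by (rule card_image_le[OF finZ])
    ultimately show ?thesis by linarith
  qed
  have mass: "1 - ?q - \<eta> - ((1/2) ^ s + \<epsilon>) <= (\<Sum>j\<in>SS. PP w ?tt i j)"
  proof -
    have each: "1 - ?q - \<eta> - bad (endv i a) <= QE w t (endv i a) (\<lambda>b. of_bool (\<not> low h N \<theta> b))"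
      if a: "a \<in> VL i ?S" for a
    proof -
      have x: "endv i a < n" using a valid_endv i by (auto simp: VL_def)
      have "(\<Sum>j<n. ?X (endv i a) j) = QE w t (endv i a) (\<lambda>b. of_bool (low h N \<theta> b))"
        unfolding XX_def QE_sum[symmetric]
      proof (rule QE_cong)
        fix b assume "b \<in> VL (endv i a) t"
        hence "endv (endv i a) b < n" using valid_endv x by (auto simp: VL_def)
        thus "(\<Sum>j<n. of_bool (low h N \<theta> b) * of_bool (endv (endv i a) b = j)) = (of_bool (low h N \<theta> b) :: real)"
          unfolding sum_distrib_left[symmetric] by simp
      qed
      moreover have "(\<Sum>j<n. ?X (endv i a) j) - ?q = (\<Sum>j<n. ?X (endv i a) j - ?q * nu w h j)"
        using nu_sum[OF w, of h] by (simp add: sum_subtractf flip: sum_distrib_left)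
      moreover have "\<dots> <= ?F (endv i a)" unfolding FF_def by (rule sum_mono) simp
      moreover have "QE w t (endv i a) (\<lambda>b. of_bool (\<not> low h N \<theta> b)) = 1 - QE w t (endv i a) (\<lambda>b. of_bool (low h N \<theta> b))"
        by (simp only: of_bool_not_iff QE_diff QE_const[OF w x])
      ultimately have ge: "1 - ?q - ?F (endv i a) <= QE w t (endv i a) (\<lambda>b. of_bool (\<not> low h N \<theta> b))" by linarith
      moreover have "0 <= QE w t (endv i a) (\<lambda>b. of_bool (\<not> low h N \<theta> b))" by (rule QE_nonneg) simp
      ultimately show ?thesis using qq_bounds(1)[of N \<theta>] \<eta>0 by (auto simp: bad_def)
    qed
    have "QE w ?S i (\<lambda>a. bad (endv i a)) <= (1/2) ^ s + \<epsilon>"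
      using U i unfolding Uniform_def bad_def by blast
    hence "1 - ?q - \<eta> - ((1/2) ^ s + \<epsilon>) <= 1 - ?q - \<eta> - QE w ?S i (\<lambda>a. bad (endv i a))" by linarith
    also have "\<dots> = QE w ?S i (\<lambda>a. 1 - ?q - \<eta> - bad (endv i a))" by (simp only: QE_diff QE_const[OF w i])
    also have "\<dots> <= QE w ?S i (\<lambda>a. QE w t (endv i a) (\<lambda>b. of_bool (\<not> low h N \<theta> b)))" by (rule QE_mono[OF each])
    also have "\<dots> <= QE w ?S i (\<lambda>a. QE w t (endv i a) (\<lambda>b. of_bool (\<theta>1 <= wt (a @ take (t - s1) b))))"
    proof (intro QE_mono)
      fix a b assume a: "a \<in> VL i ?S" and b: "b \<in> VL (endv i a) t"
      have "\<theta>1 <= wt (a @ take (t - s1) b)" if "\<not> low h N \<theta> b"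
      proof -
        have "(1 / real D) ^ (h + 1) * (\<theta> * 2 ^ (s1 - h)) <= wt (take (t - s1) b)"
          by (rule prefix_weight[OF _ _ that s1]) (use b in \<open>auto simp: VL_def\<close>)
        moreover have "(1 / real D) ^ ?S <= wt a" using wt_ge[of i a] a by (simp add: VL_def)
        ultimately have "(1 / real D) ^ ?S * ((1 / real D) ^ (h + 1) * (\<theta> * 2 ^ (s1 - h))) <= wt a * wt (take (t - s1) b)"
          using th by (intro mult_mono) auto
        moreover have "\<theta>1 = (1 / real D) ^ ?S * ((1 / real D) ^ (h + 1) * (\<theta> * 2 ^ (s1 - h)))"
          unfolding \<theta>1 mult.assoc[symmetric] power_add[symmetric] by (simp add: add.assoc)
        ultimately show ?thesis by (simp add: wt_append)
      qed
      thus "of_bool (\<not> low h N \<theta> b) <= (of_bool (\<theta>1 <= wt (a @ take (t - s1) b)) :: real)" by auto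
    qed
    also have "\<dots> = QE w ?S i (\<lambda>a. QE w (t - s1) (endv i a) (\<lambda>b. of_bool (\<theta>1 <= wt (a @ b))))"
    proof (rule QE_cong)
      fix a assume a: "a \<in> VL i ?S"
      have x: "endv i a < n" using a valid_endv i by (auto simp: VL_def)
      have tts: "t = (t - s1) + s1" using s1 teq by simp
      have "QE w t (endv i a) (\<lambda>b. of_bool (\<theta>1 <= wt (a @ take (t - s1) b)))
        = QE w (t - s1) (endv i a) (\<lambda>b. QE w s1 (endv (endv i a) b) (\<lambda>b'. of_bool (\<theta>1 <= wt (a @ take (t - s1) (b @ b')))))"
        using QE_append[OF w x, of "t - s1" s1 "\<lambda>b. of_bool (\<theta>1 <= wt (a @ take (t - s1) b))"]
        unfolding tts[symmetric] .
      also have "\<dots> = QE w (t - s1) (endv i a) (\<lambda>b. of_bool (\<theta>1 <= wt (a @ b)))"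
      proof (rule QE_cong)
        fix b assume "b \<in> VL (endv i a) (t - s1)"
        hence "length b = t - s1" "endv (endv i a) b < n" using valid_endv x by (auto simp: VL_def)
        thus "QE w s1 (endv (endv i a) b) (\<lambda>b'. of_bool (\<theta>1 <= wt (a @ take (t - s1) (b @ b')))) = of_bool (\<theta>1 <= wt (a @ b))"
          using QE_const[OF w] by simp
      qed
      finally show "QE w t (endv i a) (\<lambda>b. of_bool (\<theta>1 <= wt (a @ take (t - s1) b))) = QE w (t - s1) (endv i a) (\<lambda>b. of_bool (\<theta>1 <= wt (a @ b)))" .
    qed
    also have "\<dots> = QE w ?tt i (\<lambda>a. of_bool (\<theta>1 <= wt a))" by (rule QE_append[OF w i, symmetric])
    also have "\<dots> <= QE w ?tt i (\<lambda>a. \<Sum>j\<in>SS. of_bool (endv i a = j))"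
    proof (rule QE_mono)
      fix a assume a: "a \<in> VL i ?tt" "ext w (set a)"
      have "endv i a \<in> SS" if "\<theta>1 <= wt a" using a that by (auto simp: SS_def Z_def)
      moreover have "(1::real) <= (\<Sum>j\<in>SS. of_bool (endv i a = j))" if "endv i a \<in> SS"
        using member_le_sum[OF that, of "\<lambda>j. of_bool (endv i a = j) :: real"] finite_subset[OF SSn] by simp
      moreover have "(0::real) <= (\<Sum>j\<in>SS. of_bool (endv i a = j))" by (rule sum_nonneg) simp
      ultimately show "of_bool (\<theta>1 <= wt a) <= (\<Sum>j\<in>SS. of_bool (endv i a = j) :: real)"
        by (cases "\<theta>1 <= wt a") (simp_all only: of_bool_eq)
    qed
    also have "\<dots> = (\<Sum>j\<in>SS. PP w ?tt i j)" by (simp add: QE_sum PP_def)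
    finally show ?thesis .
  qed
  have "(\<Sum>j\<in>SS. nu w h j) <= sqrt (V / \<theta>1)"
  proof (rule real_le_rsqrt)
    have "(\<Sum>j\<in>SS. nu w h j * 1)^2 <= (\<Sum>j\<in>SS. (nu w h j)^2) * (\<Sum>j\<in>SS. 1^2)"
      by (rule Cauchy_Schwarz_ineq_sum)
    also have "\<dots> <= V * (1 / \<theta>1)"
    proof (rule mult_mono)
      show "(\<Sum>j\<in>SS. (nu w h j)^2) <= V" using sum_mono2[of "{..<n}" SS "\<lambda>j. (nu w h j)^2"] SSn V by force
      show "(\<Sum>j\<in>SS. 1^2) <= 1 / \<theta>1" using cS by simp
      show "0 <= V" by (rule order_trans[OF _ V]) (simp add: sum_nonneg)
    qed simp
    finally show "(\<Sum>j\<in>SS. nu w h j)^2 <= V / \<theta>1" by simp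
  qed
  moreover have "(\<Sum>j\<in>SS. \<pi> j) - (\<Sum>j\<in>SS. nu w h j) <= \<rho>"
    using tv_set_bound[of "nu w h" n \<pi> SS] \<pi> nu_sum[OF w, of h] SSn by (simp add: abs_minus_commute)
  moreover have "(\<Sum>j\<in>SS. PP w ?tt i j) - (\<Sum>j\<in>SS. \<pi> j) <= (1/2) * (\<Sum>j<n. \<bar>PP w ?tt i j - \<pi> j\<bar>)"
    using tv_set_bound[of \<pi> n "PP w ?tt i" SS] \<pi>(1) PP_sum[OF w i] SSn by (simp add: abs_minus_commute)
  ultimately show ?thesis using mass by linarith
qed

end

section \<open>A central limit theorem for uniformly chosen lists\<close>

definition LL :: "'a set => nat => 'a list set" where
  "LL A N = {xs. set xs \<subseteq> A \<and> length xs = N}"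

lemma finite_LL [simp]: "finite A ==> finite (LL A N)"
  unfolding LL_def by (rule finite_lists_length_eq)

lemma card_LL: "finite A ==> card (LL A N) = card A ^ N"
  unfolding LL_def by (rule card_lists_length_eq)

lemma sum_prod_list_LL:
  fixes g :: "'a => complex"
  assumes "finite A"
  shows "(\<Sum>xs\<in>LL A N. \<Prod>x\<leftarrow>xs. g x) = (\<Sum>x\<in>A. g x) ^ N"
proof (induction N)
  case 0
  have "LL A 0 = {[]}" by (auto simp: LL_def)
  thus ?case by simp
next
  case (Suc N)
  have inj: "inj_on (\<lambda>(xs, x). x # xs) (LL A N \<times> A)" by (auto simp: inj_on_def)
  have "LL A (Suc N) = (\<lambda>(xs, x). x # xs) ` (LL A N \<times> A)" unfolding LL_def by (rule lists_length_Suc_eq)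
  hence "(\<Sum>xs\<in>LL A (Suc N). \<Prod>x\<leftarrow>xs. g x) = (\<Sum>(xs, x)\<in>LL A N \<times> A. g x * (\<Prod>x\<leftarrow>xs. g x))"
    by (simp only: sum.reindex[OF inj[unfolded case_prod_unfold]] comp_def case_prod_unfold list.map prod_list.Cons)
  also have "\<dots> = (\<Sum>xs\<in>LL A N. \<Sum>x\<in>A. g x * (\<Prod>x\<leftarrow>xs. g x))" by (rule sum.cartesian_product[symmetric])
  also have "\<dots> = (\<Sum>x\<in>A. g x) * (\<Sum>xs\<in>LL A N. \<Prod>x\<leftarrow>xs. g x)"
    by (simp only: sum_distrib_left sum_distrib_right)
  finally show ?case using Suc by simp
qed

definition lists_law :: "'a set => ('a => real) => nat => real => real measure" where
  "lists_law A X N s = distr (measure_pmf (pmf_of_set (LL A N))) borel (\<lambda>xs. (\<Sum>x\<leftarrow>xs. X x) / s)"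

lemma real_distribution_lists_law: "real_distribution (lists_law A X N s)"
  unfolding lists_law_def by (intro prob_space.real_distribution_distr measure_pmf.prob_space_axioms) simp

lemma LL_nonempty: "A \<noteq> {} ==> LL A N \<noteq> {}"
proof -
  assume "A \<noteq> {}"
  then obtain a where "a \<in> A" by blast
  hence "replicate N a \<in> LL A N" by (auto simp: LL_def)
  thus ?thesis by blast
qed

lemma char_lists_law:
  assumes A: "finite A" "A \<noteq> {}"
  shows "char (lists_law A X N s) t = ((\<Sum>x\<in>A. iexp (t / s * X x)) / card A) ^ N"
proof -
  have "char (lists_law A X N s) t = (LINT xs|measure_pmf (pmf_of_set (LL A N)). iexp (t * ((\<Sum>x\<leftarrow>xs. X x) / s)))"
    unfolding lists_law_def char_def by (subst integral_distr) auto
  also have "\<dots> = (\<Sum>xs\<in>LL A N. pmf (pmf_of_set (LL A N)) xs *\<^sub>R iexp (t * ((\<Sum>x\<leftarrow>xs. X x) / s)))"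
    by (rule integral_measure_pmf) (use A LL_nonempty[OF A(2)] in auto)
  also have "\<dots> = (\<Sum>xs\<in>LL A N. (\<Prod>x\<leftarrow>xs. iexp (t / s * X x)) / of_nat (card A ^ N))"
  proof (rule sum.cong[OF refl])
    fix xs assume xs: "xs \<in> LL A N"
    have "iexp (t * ((\<Sum>x\<leftarrow>xs. X x) / s)) = (\<Prod>x\<leftarrow>xs. iexp (t / s * X x))"
      by (induction xs) (simp_all add: field_simps add_divide_distrib exp_add)
    moreover have "pmf (pmf_of_set (LL A N)) xs = 1 / real (card A ^ N)"
      using A LL_nonempty[OF A(2)] xs by (simp add: card_LL)
    ultimately show "pmf (pmf_of_set (LL A N)) xs *\<^sub>R iexp (t * ((\<Sum>x\<leftarrow>xs. X x) / s))
        = (\<Prod>x\<leftarrow>xs. iexp (t / s * X x)) / of_nat (card A ^ N)"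
      by (simp add: scaleR_conv_of_real)
  qed
  also have "\<dots> = ((\<Sum>x\<in>A. iexp (t / s * X x)) / card A) ^ N"
    by (simp add: sum_prod_list_LL[OF A(1)] power_divide flip: sum_divide_distrib)
  finally show ?thesis .
qed

text \<open>A Taylor expansion of one factor with a cubic remainder, then \<open>N\<close> factors
  by \<open>norm_power_diff\<close>, which asks both bases to have modulus at most \<open>1\<close>;
  for \<open>1 - t^2 / (2 N)\<close> this is the assumption on \<open>t\<close>. The bound
  \<open>|X|^3 <= B * X^2\<close> trades the third moment for the variance.\<close>

lemma char_lists_law_approx:
  fixes X :: "'a => real" and s t B :: real and N :: nat
  assumes A: "finite A" "A \<noteq> {}" and mean: "(\<Sum>x\<in>A. X x) = 0" and bd: "\<And>x. x \<in> A ==> \<bar>X x\<bar> <= B"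
    and s: "0 < s" "s\<^sup>2 * card A = N * (\<Sum>x\<in>A. (X x)\<^sup>2)" and N: "t\<^sup>2 <= 4 * real N" "0 < N"
  shows "cmod (char (lists_law A X N s) t - complex_of_real ((1 + (- (t\<^sup>2) / 2) / N) ^ N)) <= \<bar>t\<bar> ^ 3 * B / (6 * s)"
proof -
  define u where "u = t / s"
  define c where "c = real (card A)"
  define v where "v = (\<Sum>x\<in>A. (X x)\<^sup>2) / c"
  define \<phi> where "\<phi> = (\<Sum>x\<in>A. iexp (u * X x)) / of_real c"
  have c: "0 < c" using A by (simp add: c_def card_gt_0_iff)
  have vN: "N * v = s\<^sup>2" using s c by (simp add: v_def c_def field_simps)
  have v0: "0 <= v" using c by (simp add: v_def sum_nonneg)
  have uv: "u\<^sup>2 * v = t\<^sup>2 / N" using vN s N by (simp add: u_def field_simps)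
  have eq: "\<phi> - complex_of_real (1 - u\<^sup>2 * v / 2)
    = (\<Sum>x\<in>A. iexp (u * X x) - (\<Sum>k\<le>2. (\<i> * (u * X x)) ^ k / fact k)) / of_real c"
  proof -
    have e: "(\<Sum>k\<le>2. (\<i> * complex_of_real (u * X x)) ^ k / fact k) = 1 + \<i> * u * X x - of_real (u\<^sup>2 * (X x)\<^sup>2 / 2)" for x
      by (simp add: numeral_2_eq_2 power2_eq_square algebra_simps)
    have "(\<Sum>x\<in>A. u\<^sup>2 * (X x)\<^sup>2 / 2) = u\<^sup>2 * (v * c) / 2"
      using c by (simp add: v_def flip: sum_distrib_left sum_divide_distrib)
    hence r: "(\<Sum>x\<in>A. complex_of_real (u\<^sup>2 * (X x)\<^sup>2 / 2)) = of_real (u\<^sup>2 * (v * c) / 2)"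
      by (simp only: of_real_sum[symmetric])
    have "(\<Sum>x\<in>A. complex_of_real (X x)) = 0" using mean by (simp only: of_real_sum[symmetric] of_real_0)
    hence "(\<Sum>x\<in>A. 1 + \<i> * u * X x - of_real (u\<^sup>2 * (X x)\<^sup>2 / 2)) = of_real c - of_real (u\<^sup>2 * (v * c) / 2)"
      unfolding sum_subtractf sum.distrib r sum_distrib_left[symmetric] by (simp add: c_def)
    hence "(\<Sum>x\<in>A. 1 + \<i> * u * X x - of_real (u\<^sup>2 * (X x)\<^sup>2 / 2)) = of_real c * of_real (1 - u\<^sup>2 * v / 2)"
      by (simp add: algebra_simps)
    hence "(\<Sum>x\<in>A. 1 + \<i> * u * X x - of_real (u\<^sup>2 * (X x)\<^sup>2 / 2)) / of_real c = of_real (1 - u\<^sup>2 * v / 2)"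
      using c by simp
    thus ?thesis unfolding \<phi>_def sum_subtractf e diff_divide_distrib by simp
  qed
  have "cmod (\<phi> - complex_of_real (1 - u\<^sup>2 * v / 2)) <= (\<Sum>x\<in>A. \<bar>u * X x\<bar> ^ 3 / 6) / c"
  proof -
    have "cmod (iexp (u * X x) - (\<Sum>k\<le>2. (\<i> * (u * X x)) ^ k / fact k)) <= \<bar>u * X x\<bar> ^ 3 / 6" for x
    proof -
      have e: "Suc 2 = 3" "fact 3 = (6::real)" by (simp_all add: fact_numeral)
      show ?thesis using iexp_approx1[of "u * X x" 2] unfolding e .
    qed
    hence "cmod (\<Sum>x\<in>A. iexp (u * X x) - (\<Sum>k\<le>2. (\<i> * (u * X x)) ^ k / fact k)) <= (\<Sum>x\<in>A. \<bar>u * X x\<bar> ^ 3 / 6)"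
      by (intro order_trans[OF norm_sum] sum_mono)
    thus ?thesis unfolding eq norm_divide using c by (simp only: norm_of_real abs_of_pos divide_right_mono less_imp_le)
  qed
  also have "\<dots> <= (\<Sum>x\<in>A. \<bar>u\<bar> ^ 3 * B * (X x)\<^sup>2 / 6) / c"
  proof (intro divide_right_mono sum_mono)
    fix x assume "x \<in> A"
    have "\<bar>u * X x\<bar> ^ 3 = \<bar>u\<bar> ^ 3 * (\<bar>X x\<bar> * (X x)\<^sup>2)" unfolding abs_mult power_mult_distrib
      by (simp add: power3_eq_cube) (simp flip: power2_eq_square)
    also have "\<dots> <= \<bar>u\<bar> ^ 3 * (B * (X x)\<^sup>2)" using bd[OF \<open>x \<in> A\<close>] by (intro mult_left_mono mult_right_mono) auto
    finally show "\<bar>u * X x\<bar> ^ 3 <= \<bar>u\<bar> ^ 3 * B * (X x)\<^sup>2" by (simp add: mult.assoc)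
  qed (use c in auto)
  also have "\<dots> = \<bar>u\<bar> ^ 3 * B * v / 6" by (simp add: v_def mult.commute[of c] sum_distrib_left sum_divide_distrib)
  finally have close: "cmod (\<phi> - complex_of_real (1 - u\<^sup>2 * v / 2)) <= \<bar>u\<bar> ^ 3 * B * v / 6" .
  have n1: "cmod \<phi> <= 1"
  proof -
    have "cmod (\<Sum>x\<in>A. iexp (u * X x)) <= (\<Sum>x\<in>A. cmod (iexp (u * X x)))" by (rule norm_sum)
    also have "\<dots> = c" by (simp add: c_def)
    finally show ?thesis using c by (simp add: \<phi>_def norm_divide)
  qed
  have r: "1 - u\<^sup>2 * v / 2 = 1 + (- (t\<^sup>2) / 2) / N" by (simp add: uv)
  have "t\<^sup>2 / N <= 4" using N by (simp add: field_simps)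
  hence n2: "cmod (complex_of_real (1 - u\<^sup>2 * v / 2)) <= 1" unfolding norm_of_real uv by (simp add: abs_le_iff)
  have "cmod (\<phi> ^ N - complex_of_real (1 - u\<^sup>2 * v / 2) ^ N) <= N * (\<bar>u\<bar> ^ 3 * B * v / 6)"
    by (rule order_trans[OF norm_power_diff[OF n1 n2] mult_left_mono[OF close]]) simp
  also have "\<dots> = \<bar>u\<bar> ^ 3 * B * s\<^sup>2 / 6" using vN by (simp add: mult_ac)
  also have "\<dots> = \<bar>t\<bar> ^ 3 * B / (6 * s)"
    using s(1) by (simp add: u_def power_divide abs_divide power3_eq_cube power2_eq_square)
  finally have fin: "cmod (\<phi> ^ N - complex_of_real (1 - u\<^sup>2 * v / 2) ^ N) <= \<bar>t\<bar> ^ 3 * B / (6 * s)" .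
  have "char (lists_law A X N s) t = \<phi> ^ N" by (simp add: char_lists_law[OF A] \<phi>_def u_def c_def)
  thus ?thesis using fin by (simp only: r of_real_power)
qed

lemma std_normal_point: "measure std_normal_distribution {x} = 0"
proof -
  have "emeasure std_normal_distribution {x} = 0"
    by (simp add: emeasure_density nn_integral_cmult_indicator emeasure_lborel_singleton
        flip: nn_integral_null_set)
  thus ?thesis by (simp add: measure_def)
qed

lemma isCont_std_normal_cdf: "isCont (cdf std_normal_distribution) x"
proof -
  interpret real_distribution std_normal_distribution by (rule real_dist_normal_dist)
  show ?thesis unfolding isCont_cdf by (rule std_normal_point)
qed

text \<open>Characteristic functions give weak convergence of the normalised sums. The threshold
  \<open>y n / s n\<close> moves with \<open>n\<close> and the inequality is strict, so the
  proportion is squeezed between distribution functions at fixed points on both sides of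
  \<open>x\<close>, and continuity of the limit closes the gap.\<close>

theorem triangular_clt:
  fixes A :: "nat => 'a set" and X :: "nat => 'a => real" and s y :: "nat => real" and N :: "nat => nat"
  assumes A: "\<And>n. finite (A n)" "\<And>n. A n \<noteq> {}" and mean: "\<And>n. (\<Sum>x\<in>A n. X n x) = 0"
    and bd: "\<And>n x. x \<in> A n ==> \<bar>X n x\<bar> <= B"
    and s: "\<And>n. (s n)\<^sup>2 * card (A n) = N n * (\<Sum>x\<in>A n. (X n x)\<^sup>2)" "filterlim s at_top sequentially"
    and y: "(\<lambda>n. y n / s n) \<longlonglongrightarrow> x"
  shows "(\<lambda>n. card {xs\<in>LL (A n) (N n). (\<Sum>x\<leftarrow>xs. X n x) < y n} / real (card (A n)) ^ N n)
    \<longlonglongrightarrow> cdf std_normal_distribution x"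
proof -
  let ?M = "\<lambda>n. lists_law (A n) (X n) (N n) (s n)"
  have spos: "\<forall>\<^sub>F n in sequentially. 0 < s n" using s(2) by (simp add: filterlim_at_top_dense)
  have B0: "0 <= B" using bd A(2) by (meson abs_ge_zero ex_in_conv order_trans)
  \<comment> \<open>Bounded summands force \<open>N n\<close> to grow at least like the square of
    \<open>s n\<close>; no separate assumption on \<open>N\<close> is made.\<close>
  have Nlb: "(s n)\<^sup>2 <= N n * B\<^sup>2" for n
  proof -
    have "(\<Sum>x\<in>A n. (X n x)\<^sup>2) <= (\<Sum>x\<in>A n. B\<^sup>2)" by (intro sum_mono) (metis bd abs_ge_zero power2_abs power_mono)
    hence "N n * (\<Sum>x\<in>A n. (X n x)\<^sup>2) <= N n * (card (A n) * B\<^sup>2)" by (intro mult_left_mono) auto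
    hence "(s n)\<^sup>2 * card (A n) <= (N n * B\<^sup>2) * card (A n)" using s(1)[of n] by (simp add: mult_ac)
    thus ?thesis using A by (simp add: card_gt_0_iff)
  qed
  have Ninf: "filterlim N at_top sequentially"
  proof -
    have "filterlim (\<lambda>n. (s n)\<^sup>2) at_top sequentially" by (rule filterlim_pow_at_top[OF _ s(2)]) simp
    hence "filterlim (\<lambda>n. real (N n) * B\<^sup>2) at_top sequentially"
      by (rule filterlim_at_top_mono) (use Nlb in auto)
    hence *: "filterlim (\<lambda>n. 1 / (B\<^sup>2 + 1) * (real (N n) * B\<^sup>2)) at_top sequentially"
      by (intro filterlim_tendsto_pos_mult_at_top[OF tendsto_const]) (auto simp: add_nonneg_pos)
    have "filterlim (\<lambda>n. real (N n)) at_top sequentially"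
    proof (rule filterlim_at_top_mono[OF *], intro always_eventually allI)
      fix n
      have "B\<^sup>2 / (B\<^sup>2 + 1) <= 1" by (simp add: divide_le_eq add_nonneg_pos)
      thus "1 / (B\<^sup>2 + 1) * (real (N n) * B\<^sup>2) <= real (N n)"
        using mult_left_mono[of "B\<^sup>2 / (B\<^sup>2 + 1)" 1 "real (N n)"] by (simp add: mult.commute)
    qed
    thus ?thesis by (simp add: filterlim_real_sequentially filterlim_sequentially_iff_filterlim_real)
  qed
  have "weak_conv_m ?M std_normal_distribution"
  proof (rule levy_continuity[OF real_distribution_lists_law real_dist_normal_dist])
    fix t :: real
    have lim: "(\<lambda>n. complex_of_real ((1 + (- (t\<^sup>2) / 2) / N n) ^ N n)) \<longlonglongrightarrow> complex_of_real (exp (- (t\<^sup>2) / 2))"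
      by (intro tendsto_of_real filterlim_compose[OF tendsto_exp_limit_sequentially Ninf])
    have "\<forall>\<^sub>F n in sequentially. max 1 (t\<^sup>2) <= real (N n)"
      using filterlim_compose[OF filterlim_real_sequentially Ninf] unfolding filterlim_at_top by blast
    hence main: "\<forall>\<^sub>F n in sequentially. cmod (char (?M n) t - complex_of_real ((1 + (- (t\<^sup>2) / 2) / N n) ^ N n)) <= \<bar>t\<bar> ^ 3 * B / (6 * s n)"
      using spos
    proof eventually_elim
      case (elim n)
      have "0 < N n" "t\<^sup>2 <= 4 * real (N n)" using elim(1) by (auto intro: gr0I)
      thus ?case by (intro char_lists_law_approx[OF A mean _ elim(2) s(1)]) (auto intro: bd)
    qed
    have "(\<lambda>n. \<bar>t\<bar> ^ 3 * B / (6 * s n)) \<longlonglongrightarrow> 0"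
      by (rule real_tendsto_divide_at_top[OF tendsto_const]) (intro filterlim_tendsto_pos_mult_at_top[OF tendsto_const _ s(2)], simp)
    from Lim_null_comparison[OF main this]
    have "(\<lambda>n. char (?M n) t) \<longlonglongrightarrow> complex_of_real (exp (- (t\<^sup>2) / 2))" by (rule Lim_transform[OF lim])
    thus "(\<lambda>n. char (?M n) t) \<longlonglongrightarrow> char std_normal_distribution t" by (simp add: char_std_normal_distribution)
  qed
  hence conv: "(\<lambda>n. cdf (?M n) z) \<longlonglongrightarrow> cdf std_normal_distribution z" for z
    using isCont_std_normal_cdf unfolding weak_conv_m_def weak_conv_def by blast
  define g where "g n = card {xs\<in>LL (A n) (N n). (\<Sum>x\<leftarrow>xs. X n x) < y n} / real (card (A n)) ^ N n" for n
  have cdfM: "cdf (?M n) z = card {xs\<in>LL (A n) (N n). (\<Sum>x\<leftarrow>xs. X n x) / s n <= z} / real (card (A n)) ^ N n" for n z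
  proof -
    have "cdf (?M n) z = measure (measure_pmf (pmf_of_set (LL (A n) (N n)))) {xs. (\<Sum>x\<leftarrow>xs. X n x) / s n <= z}"
      unfolding lists_law_def cdf_def by (subst measure_distr) (auto simp: vimage_def)
    also have "\<dots> = card (LL (A n) (N n) \<inter> {xs. (\<Sum>x\<leftarrow>xs. X n x) / s n <= z}) / card (LL (A n) (N n))"
      by (rule measure_pmf_of_set[OF LL_nonempty[OF A(2)] finite_LL[OF A(1)]])
    also have "LL (A n) (N n) \<inter> {xs. (\<Sum>x\<leftarrow>xs. X n x) / s n <= z} = {xs\<in>LL (A n) (N n). (\<Sum>x\<leftarrow>xs. X n x) / s n <= z}" by blast
    finally show ?thesis using A by (simp add: card_LL)
  qed
  have mono: "card S / real (card (A n)) ^ N n <= card S' / real (card (A n)) ^ N n" if "S \<subseteq> S'" "S' \<subseteq> LL (A n) (N n)" for S S' n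
  proof -
    have "card S <= card S'" by (rule card_mono[OF finite_subset[OF that(2) finite_LL[OF A(1)]] that(1)])
    thus ?thesis by (intro divide_right_mono) auto
  qed
  have up: "\<forall>\<^sub>F n in sequentially. g n <= cdf (?M n) z" if "x < z" for z
  proof -
    have "\<forall>\<^sub>F n in sequentially. y n / s n < z" by (rule order_tendstoD(2)[OF y that])
    thus ?thesis using spos
    proof eventually_elim
      case (elim n)
      have "{xs\<in>LL (A n) (N n). (\<Sum>x\<leftarrow>xs. X n x) < y n} \<subseteq> {xs\<in>LL (A n) (N n). (\<Sum>x\<leftarrow>xs. X n x) / s n <= z}"
        using elim by (auto simp: field_simps)
      thus ?case unfolding g_def cdfM by (rule mono) auto
    qed
  qed
  have dn: "\<forall>\<^sub>F n in sequentially. cdf (?M n) z <= g n" if "z < x" for z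
  proof -
    have "\<forall>\<^sub>F n in sequentially. z < y n / s n" by (rule order_tendstoD(1)[OF y that])
    thus ?thesis using spos
    proof eventually_elim
      case (elim n)
      have "{xs\<in>LL (A n) (N n). (\<Sum>x\<leftarrow>xs. X n x) / s n <= z} \<subseteq> {xs\<in>LL (A n) (N n). (\<Sum>x\<leftarrow>xs. X n x) < y n}"
        using elim by (auto simp: field_simps)
      thus ?case unfolding g_def cdfM by (rule mono) auto
    qed
  qed
  have "g \<longlonglongrightarrow> cdf std_normal_distribution x"
  proof (rule order_tendstoI)
    fix a assume a: "a < cdf std_normal_distribution x"
    have "(cdf std_normal_distribution \<longlongrightarrow> cdf std_normal_distribution x) (at_left x)"
      using isCont_std_normal_cdf[of x] by (simp add: isCont_def filterlim_at_split)
    hence "\<forall>\<^sub>F z in at_left x. a < cdf std_normal_distribution z" using a by (rule order_tendstoD(1))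
    moreover have "\<forall>\<^sub>F z in at_left x. z < x" by (simp add: eventually_at_filter)
    ultimately have "\<forall>\<^sub>F z in at_left x. a < cdf std_normal_distribution z \<and> z < x" by (rule eventually_conj)
    then obtain z where z: "a < cdf std_normal_distribution z" "z < x"
      using eventually_happens'[OF trivial_limit_at_left_real] by blast
    show "\<forall>\<^sub>F n in sequentially. a < g n" using order_tendstoD(1)[OF conv z(1)] dn[OF z(2)] by eventually_elim simp
  next
    fix a assume a: "cdf std_normal_distribution x < a"
    have "(cdf std_normal_distribution \<longlongrightarrow> cdf std_normal_distribution x) (at_right x)"
      using isCont_std_normal_cdf[of x] by (simp add: isCont_def filterlim_at_split)
    hence "\<forall>\<^sub>F z in at_right x. cdf std_normal_distribution z < a" using a by (rule order_tendstoD(2))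
    moreover have "\<forall>\<^sub>F z in at_right x. x < z" by (simp add: eventually_at_filter)
    ultimately have "\<forall>\<^sub>F z in at_right x. cdf std_normal_distribution z < a \<and> x < z" by (rule eventually_conj)
    then obtain z where z: "cdf std_normal_distribution z < a" "x < z"
      using eventually_happens'[OF trivial_limit_at_right_real] by blast
    show "\<forall>\<^sub>F n in sequentially. g n < a" using order_tendstoD(2)[OF conv z(1)] up[OF z(2)] by eventually_elim simp
  qed
  thus ?thesis unfolding g_def .
qed

lemma gauss_tail_cdf: "gauss_tail x = cdf std_normal_distribution (- x)"
proof -
  have "cdf std_normal_distribution (- x) = (LINT u|std_normal_distribution. indicator {.. - x} u)"
    by (simp add: cdf_def)
  also have "\<dots> = (LINT u|lborel. std_normal_density u * indicator {.. - x} u)"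
    by (subst integral_density) auto
  also have "\<dots> = (LINT u|lborel. std_normal_density (0 + (-1) * u) * indicator {.. - x} (0 + (-1) * u))"
    by (subst lborel_integral_real_affine[of "-1" _ 0]) auto
  also have "\<dots> = (LINT u|lborel. (indicator {x..} u * exp (- (u\<^sup>2) / 2)) / sqrt (2 * pi))"
    by (intro Bochner_Integration.integral_cong refl) (auto simp: std_normal_density_def indicator_def)
  also have "\<dots> = (LINT u|lborel. indicator {x..} u * exp (- (u\<^sup>2) / 2)) / sqrt (2 * pi)" by simp
  finally show ?thesis by (simp add: gauss_tail_def set_lebesgue_integral_def)
qed

lemma gauss_tail_tendsto_0: "(gauss_tail \<longlongrightarrow> 0) at_top"
proof -
  interpret real_distribution std_normal_distribution by (rule real_dist_normal_dist)
  have "((\<lambda>x. cdf std_normal_distribution (- x)) \<longlongrightarrow> 0) at_top"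
    by (rule filterlim_compose[OF cdf_lim_at_bot filterlim_uminus_at_bot_at_top])
  thus ?thesis by (simp add: gauss_tail_cdf[abs_def])
qed

section \<open>Scales\<close>

text \<open>Rounding so that \<open>EE n\<close> is a power of two close to \<open>ln n\<close>:
  geometric factors over multiples of \<open>kap n\<close> steps become exact powers of
  \<open>EE n\<close>.\<close>

definition kap :: "nat => nat" where "kap n = nat \<lceil>log 2 (ln (real n))\<rceil>"
definition EE :: "nat => real" where "EE n = 2 ^ kap n"

lemma EE_ge1: "1 <= EE n" by (simp add: EE_def)
lemma EE_pos: "0 < EE n" by (simp add: EE_def)

lemma ln_gt_1: "\<forall>\<^sub>F n in sequentially. 1 < ln (real n)" by real_asymp

lemma EE_bounds: "\<forall>\<^sub>F n in sequentially. ln (real n) <= EE n \<and> EE n <= 2 * ln (real n)"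
  using ln_gt_1
proof eventually_elim
  case (elim n)
  define x where "x = log 2 (ln (real n))"
  have x: "0 < x" using elim by (simp add: x_def)
  have k: "x <= kap n" "kap n <= x + 1" using x unfolding kap_def x_def[symmetric] by linarith+
  have e: "EE n = 2 powr kap n" by (simp add: EE_def powr_realpow)
  have l: "2 powr x = ln (real n)" using elim by (simp add: x_def)
  have "2 powr x <= 2 powr kap n" using k by simp
  moreover have "2 powr kap n <= 2 powr (x + 1)" using k(2) by (intro powr_mono) auto
  ultimately show ?case unfolding e using l by (simp add: powr_add)
qed

lemma kap_le: "\<forall>\<^sub>F n in sequentially. real (kap n) <= 2 * ln (ln (real n)) + 1"
  using ln_gt_1
proof eventually_elim
  case (elim n)
  have l: "0 < ln (ln (real n))" using elim by simp
  have "ln (exp 1) <= ln (2 ^ 2 :: real)" using exp_le by (subst ln_le_cancel_iff) auto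
  moreover have "ln (2 ^ 2 :: real) = 2 * ln 2" by (subst ln_realpow) auto
  ultimately have "1/2 <= ln (2::real)" unfolding ln_exp by linarith
  hence "log 2 (ln (real n)) <= 2 * ln (ln (real n))"
    using mult_left_mono[of "1/2" "ln 2" "ln (ln (real n))"] l by (simp add: log_def field_simps)
  moreover have "0 < log 2 (ln (real n))" using elim by simp
  ultimately show ?case unfolding kap_def by linarith
qed

lemma EE_at_top: "filterlim EE at_top sequentially"
proof (rule filterlim_at_top_mono)
  show "filterlim (\<lambda>n. ln (real n)) at_top sequentially" by real_asymp
  show "\<forall>\<^sub>F n in sequentially. ln (real n) <= EE n" using EE_bounds by eventually_elim simp
qed

lemma const_div_EE: "(\<lambda>n. c / EE n) \<longlonglongrightarrow> 0"
  by (rule real_tendsto_divide_at_top[OF tendsto_const EE_at_top])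

definition polylog :: "(nat => real) => bool" where
  "polylog f \<longleftrightarrow> (\<exists>c k. \<forall>\<^sub>F n in sequentially. \<bar>f n\<bar> <= c * EE n ^ k)"

text \<open>Negligible against every power of \<open>ln n\<close>. By \<open>tiny_mult\<close> and
  \<open>tiny_add\<close> such functions are stable under polylogarithmic factors, so error terms
  can be discarded by their shape alone.\<close>

definition tiny :: "(nat => real) => bool" where
  "tiny f \<longleftrightarrow> (\<forall>k. (\<lambda>n. f n * EE n ^ k) \<longlonglongrightarrow> 0)"

lemma polylogI: "\<forall>\<^sub>F n in sequentially. \<bar>f n\<bar> <= c * EE n ^ k ==> polylog f" unfolding polylog_def by blast

lemma polylog_const: "polylog (\<lambda>_. c)" by (rule polylogI[of _ "\<bar>c\<bar>" 0]) simp

lemma polylog_EE: "polylog EE" by (rule polylogI[of _ 1 1]) (simp add: EE_def)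

lemma polylog_add: assumes "polylog f" "polylog g" shows "polylog (\<lambda>n. f n + g n)"
proof -
  obtain c k where f: "\<forall>\<^sub>F n in sequentially. \<bar>f n\<bar> <= c * EE n ^ k" using assms unfolding polylog_def by blast
  obtain d l where g: "\<forall>\<^sub>F n in sequentially. \<bar>g n\<bar> <= d * EE n ^ l" using assms unfolding polylog_def by blast
  have "\<forall>\<^sub>F n in sequentially. \<bar>f n + g n\<bar> <= (\<bar>c\<bar> + \<bar>d\<bar>) * EE n ^ (k + l)"
    using f g
  proof eventually_elim
    case (elim n)
    have "c * EE n ^ k <= \<bar>c\<bar> * EE n ^ (k + l)" using EE_ge1[of n] by (intro mult_mono power_increasing) auto
    moreover have "d * EE n ^ l <= \<bar>d\<bar> * EE n ^ (k + l)" using EE_ge1[of n] by (intro mult_mono power_increasing) auto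
    ultimately show ?case using elim by (simp add: distrib_right)
  qed
  thus ?thesis by (rule polylogI)
qed

lemma polylog_mult: assumes "polylog f" "polylog g" shows "polylog (\<lambda>n. f n * g n)"
proof -
  obtain c k where f: "\<forall>\<^sub>F n in sequentially. \<bar>f n\<bar> <= c * EE n ^ k" using assms unfolding polylog_def by blast
  obtain d l where g: "\<forall>\<^sub>F n in sequentially. \<bar>g n\<bar> <= d * EE n ^ l" using assms unfolding polylog_def by blast
  have "\<forall>\<^sub>F n in sequentially. \<bar>f n * g n\<bar> <= (c * d) * EE n ^ (k + l)"
    using f g
  proof eventually_elim
    case (elim n)
    have "\<bar>f n\<bar> * \<bar>g n\<bar> <= (c * EE n ^ k) * (d * EE n ^ l)" using elim by (intro mult_mono) auto
    thus ?case by (simp add: abs_mult power_add mult_ac)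
  qed
  thus ?thesis by (rule polylogI)
qed

lemma polylog_power: "polylog f ==> polylog (\<lambda>n. f n ^ r)"
  by (induction r) (auto intro: polylog_mult polylog_const)

lemma tiny_mult: assumes "polylog g" "tiny f" shows "tiny (\<lambda>n. g n * f n)"
  unfolding tiny_def
proof
  fix j
  obtain c k where g: "\<forall>\<^sub>F n in sequentially. \<bar>g n\<bar> <= c * EE n ^ k" using assms unfolding polylog_def by blast
  have "(\<lambda>n. c * \<bar>f n * EE n ^ (k + j)\<bar>) \<longlonglongrightarrow> c * \<bar>0\<bar>"
    using assms(2) unfolding tiny_def by (intro tendsto_intros) auto
  hence lim: "(\<lambda>n. c * \<bar>f n * EE n ^ (k + j)\<bar>) \<longlonglongrightarrow> 0" by simp
  show "(\<lambda>n. g n * f n * EE n ^ j) \<longlonglongrightarrow> 0"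
  proof (rule Lim_null_comparison[OF _ lim])
    show "\<forall>\<^sub>F n in sequentially. norm (g n * f n * EE n ^ j) <= c * \<bar>f n * EE n ^ (k + j)\<bar>"
      using g
    proof eventually_elim
      case (elim n)
      have "\<bar>g n\<bar> * \<bar>f n * EE n ^ j\<bar> <= (c * EE n ^ k) * \<bar>f n * EE n ^ j\<bar>" using elim by (intro mult_right_mono) auto
      thus ?case using EE_pos[of n] by (simp add: abs_mult power_add mult_ac)
    qed
  qed
qed

lemma tiny_add: assumes "tiny f" "tiny g" shows "tiny (\<lambda>n. f n + g n)"
  using assms unfolding tiny_def distrib_right by (auto intro: tendsto_add_zero)

lemma tiny_tendsto: "tiny f ==> f \<longlonglongrightarrow> 0"
  unfolding tiny_def by (drule spec[of _ 0]) simp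

lemma tiny_le: assumes "tiny g" "\<forall>\<^sub>F n in sequentially. \<bar>f n\<bar> <= g n" shows "tiny f"
  unfolding tiny_def
proof
  fix k
  show "(\<lambda>n. f n * EE n ^ k) \<longlonglongrightarrow> 0"
  proof (rule Lim_null_comparison)
    show "(\<lambda>n. g n * EE n ^ k) \<longlonglongrightarrow> 0" using assms(1) unfolding tiny_def by blast
    show "\<forall>\<^sub>F n in sequentially. norm (f n * EE n ^ k) <= g n * EE n ^ k"
      using assms(2) by eventually_elim (use EE_pos in \<open>simp add: abs_mult mult_right_mono less_imp_le\<close>)
  qed
qed

lemma tiny_inv_sqrt: "tiny (\<lambda>n. 1 / sqrt (real n))"
  unfolding tiny_def
proof
  fix k :: nat
  have l: "(\<lambda>n. 2 ^ k * (ln (real n) ^ k / sqrt (real n))) \<longlonglongrightarrow> 2 ^ k * 0"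
    by (intro tendsto_mult tendsto_const) real_asymp
  show "(\<lambda>n. 1 / sqrt (real n) * EE n ^ k) \<longlonglongrightarrow> 0"
  proof (rule Lim_null_comparison)
    show "(\<lambda>n. 2 ^ k * (ln (real n) ^ k / sqrt (real n))) \<longlonglongrightarrow> 0" using l by simp
    show "\<forall>\<^sub>F n in sequentially. norm (1 / sqrt (real n) * EE n ^ k) <= 2 ^ k * (ln (real n) ^ k / sqrt (real n))"
      using EE_bounds
    proof eventually_elim
      case (elim n)
      have "EE n ^ k <= (2 * ln (real n)) ^ k" using elim EE_pos[of n] by (intro power_mono) auto
      thus ?case using EE_pos[of n] by (simp add: power_mult_distrib divide_right_mono)
    qed
  qed
qed

lemma tiny_inv: "tiny (\<lambda>n. 1 / real n)"
proof (rule tiny_le[OF tiny_inv_sqrt])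
  show "\<forall>\<^sub>F n in sequentially. \<bar>1 / real n\<bar> <= 1 / sqrt (real n)" by real_asymp
qed

lemmas polylog_intros = polylog_const polylog_EE polylog_add polylog_mult polylog_power

text \<open>The number \<open>16 * kap n + 3\<close> is \<open>8 * s + 3\<close> for
  \<open>s = 2 * kap n\<close>, the radius needed in \<open>escape_to_TL\<close>. It is of order
  \<open>ln ln n\<close>, so even raised to a power of its own order it stays far below
  \<open>n\<close>.\<close>

lemma sparse_term:
  assumes "2 <= D"
  shows "(\<lambda>n. real (16 * kap n + 3) * real (D * (16 * kap n + 3)) ^ (2 * (16 * kap n + 3) + 2) / n) \<longlonglongrightarrow> 0"
proof (rule Lim_null_comparison)
  let ?y = "\<lambda>n. 32 * ln (ln (real n)) + 19"
  have "0 < real D" using assms by simp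
  thus "(\<lambda>n. exp ((2 * ?y n + 3) * ln (real D * ?y n) - ln (real n))) \<longlonglongrightarrow> 0" by real_asymp
  show "\<forall>\<^sub>F n in sequentially. norm (real (16 * kap n + 3) * real (D * (16 * kap n + 3)) ^ (2 * (16 * kap n + 3) + 2) / n)
    <= exp ((2 * ?y n + 3) * ln (real D * ?y n) - ln (real n))"
    using kap_le ln_gt_1 eventually_gt_at_top[of 0]
  proof eventually_elim
    case (elim n)
    define k where "k = 16 * kap n + 3"
    have k: "real k <= ?y n" "3 <= k" using elim by (auto simp: k_def)
    have "real k * real (D * k) ^ (2 * k + 2) <= real (D * k) * real (D * k) ^ (2 * k + 2)"
    proof (rule mult_right_mono)
      have "1 * k <= D * k" using assms by (intro mult_right_mono) auto
      thus "real k <= real (D * k)" by (simp only: of_nat_le_iff mult_1)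
    qed simp
    also have "\<dots> = real (D * k) ^ (2 * k + 3)" by (simp add: eval_nat_numeral)
    also have "\<dots> = real (D * k) powr (2 * real k + 3)"
    proof -
      have e: "2 * real k + 3 = real (2 * k + 3)" by simp
      have "0 < real (D * k)" using k assms by (simp only: of_nat_0_less_iff) simp
      thus ?thesis unfolding e by (rule powr_realpow[symmetric])
    qed
    also have "\<dots> <= (real D * ?y n) powr (2 * real k + 3)" using k by (intro powr_mono2) (auto intro!: mult_left_mono)
    also have "\<dots> <= (real D * ?y n) powr (2 * ?y n + 3)"
    proof (rule powr_mono)
      show "1 <= real D * ?y n" using k assms mult_mono[of 1 "real D" 1 "?y n"] by simp
    qed (use k in auto)
    also have "\<dots> = exp ((2 * ?y n + 3) * ln (real D * ?y n))" using k assms by (simp add: powr_def)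
    finally show ?case unfolding k_def[symmetric] using elim(3) by (simp add: exp_diff divide_right_mono)
  qed
qed

lemma tiny_ev: "tiny f ==> 0 < c ==> \<forall>\<^sub>F n in sequentially. f n < c"
  by (rule order_tendstoD(2)[OF tiny_tendsto])

lemma EE_ev: "0 < c ==> \<forall>\<^sub>F n in sequentially. a / EE n < c"
  by (rule order_tendstoD(2)[OF const_div_EE])

lemma kap_le_EE: "real (kap n) <= EE n"
  using of_nat_less_two_power[of "kap n", where ?'a = real] by (simp add: EE_def)

section \<open>Sequences of models and the choice of parameters\<close>

locale degree_seq =
  fixes dp dm :: "nat => nat => nat" and Dmax :: nat
  assumes sums_eq: "\<And>n. (\<Sum>i<n. dm n i) = (\<Sum>i<n. dp n i)"
    and min_deg: "\<And>n i. i < n ==> 2 <= dp n i \<and> 2 <= dm n i"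
    and max_deg: "\<And>n i. i < n ==> dp n i <= Dmax \<and> dm n i <= Dmax"
begin

lemma Dmax2: "2 <= Dmax" using min_deg[of 0 1] max_deg[of 0 1] by simp

lemma cfg: "0 < n ==> config n (dp n) (dm n) Dmax"
  using sums_eq min_deg max_deg by unfold_locales auto

abbreviation mm :: "nat => nat" where "mm n \<equiv> config.m n (dm n)"
abbreviation EV :: "nat => ((nat \<times> nat) => (nat \<times> nat)) set" where "EV n \<equiv> envs n (dp n) (dm n)"

text \<open>Chosen for \<open>fibre_term\<close>. The choice of tails costs
  \<open>Dmax ^ (2 * ss n)\<close>, at most \<open>EE n ^ (4 * Dmax)\<close>, per factor, against a
  gain of \<open>EE n ^ (aa - 2)\<close>; one power of \<open>EE n\<close> is left over.\<close>

definition aa :: nat where "aa = 4 * Dmax + 3"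
definition hh :: "nat => nat" where "hh n = 2 * aa * kap n"
definition ss :: "nat => nat" where "ss n = 2 * kap n"
text \<open>The logarithmic factor equals \<open>2 ^ hh n\<close>, which puts the diagonal term
  \<open>\<theta>\<close> and the late-merging error, of order \<open>1 / n\<close> times
  \<open>2^-hh\<close>, on the same scale.\<close>

definition th :: "nat => real" where "th n = 1 / (real n * EE n ^ (2 * aa))"

definition regular :: "(nat => nat) => real => real => nat => ((nat \<times> nat) => (nat \<times> nat)) => bool" where
  "regular \<tau> \<eta> \<epsilon> n w \<longleftrightarrow>
     walk_config.Uniform n (dp n) (dm n) (\<tau> n) (hh n) (\<tau> n - 2 * hh n - 1) (th n) (ss n) \<eta> \<epsilon> w
     \<and> (\<Sum>j<n. (config.nu n (dp n) (dm n) w (hh n) j)^2) <= EE n ^ 4 / n"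

lemma mm_bounds: "0 < n ==> 2 * real n <= real (mm n) \<and> real (mm n) <= Dmax * real n"
proof -
  assume n: "0 < n"
  have "real (2 * n) <= real (mm n)" by (simp only: of_nat_le_iff config.m_ge[OF cfg[OF n]])
  moreover have "real (mm n) <= real (Dmax * n)" by (simp only: of_nat_le_iff config.m_le[OF cfg[OF n]])
  ultimately show ?thesis by simp
qed

lemma hh_le: "real (hh n) <= 2 * aa * EE n" using kap_le_EE[of n] by (simp add: hh_def mult_left_mono)

lemma two_hh: "2 ^ hh n = EE n ^ (2 * aa)" by (simp add: hh_def EE_def mult.commute flip: power_mult)

text \<open>The collision probability \<open>p\<close>: \<open>2 * \<tau> + 2 <= 4 * \<tau>\<close>
  vertices with \<open>\<tau> <= C * EE n\<close> carry at most \<open>4 * Dmax * C * EE n\<close>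
  heads, while at least \<open>n\<close> heads are still free.\<close>

definition PR :: "real => nat => real" where "PR C n = 4 * real Dmax * C * EE n / n"

context
  fixes \<tau> :: "nat => nat" and C :: real
  assumes lo: "\<forall>\<^sub>F n in sequentially. 2 * hh n + 2 <= \<tau> n"
    and hi: "\<forall>\<^sub>F n in sequentially. real (\<tau> n) <= C * ln (real n)" and C1: "1 <= C"
begin

lemma tau_le: "\<forall>\<^sub>F n in sequentially. real (\<tau> n) <= C * EE n"
  using hi EE_bounds
proof eventually_elim
  case (elim n)
  have "C * ln (real n) <= C * EE n" using elim C1 by (intro mult_left_mono) auto
  thus ?case using elim by linarith
qed

lemma poly_tau: "polylog (\<lambda>n. real (\<tau> n))"
  by (rule polylogI[of _ C 1]) (use tau_le in simp)

lemma poly_hh: "polylog (\<lambda>n. real (hh n))"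
  by (rule polylogI[of _ "2 * real aa" 1]) (use hh_le in simp)

lemma poly_ratio: "polylog (\<lambda>n. real n / mm n)"
proof (rule polylogI[of _ 1 0])
  show "\<forall>\<^sub>F n in sequentially. \<bar>real n / mm n\<bar> <= 1 * EE n ^ 0"
    using eventually_gt_at_top[of 0]
  proof eventually_elim
    case (elim n)
    hence "real n <= mm n" "0 < real n" using mm_bounds[of n] by linarith+
    thus ?case by (simp add: divide_le_eq_1)
  qed
qed

lemma tiny_mm: "tiny (\<lambda>n. 1 / real (mm n))"
proof (rule tiny_le[OF tiny_inv])
  show "\<forall>\<^sub>F n in sequentially. \<bar>1 / real (mm n)\<bar> <= 1 / real n"
    using eventually_gt_at_top[of 0]
  proof eventually_elim
    case (elim n)
    hence "real n <= mm n" "0 < real n" using mm_bounds[of n] by linarith+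
    thus ?case by (simp add: frac_le)
  qed
qed

lemma tiny_PR: "tiny (PR C)"
proof -
  have "tiny (\<lambda>n. (4 * real Dmax * C * EE n) * (1 / real n))" by (intro tiny_mult polylog_intros tiny_inv)
  thus ?thesis by (simp add: PR_def[abs_def])
qed

lemma poly_nPR: "polylog (\<lambda>n. real n * PR C n)"
proof (rule polylogI[of _ "4 * real Dmax * C" 1])
  show "\<forall>\<^sub>F n in sequentially. \<bar>real n * PR C n\<bar> <= 4 * real Dmax * C * EE n ^ 1"
    using eventually_gt_at_top[of 0] by eventually_elim (use C1 EE_pos in \<open>simp add: PR_def abs_mult less_imp_le\<close>)
qed

lemma two_tau: "\<forall>\<^sub>F n in sequentially. 2 * real (\<tau> n) <= n"
proof -
  have "tiny (\<lambda>n. (2 * real (\<tau> n)) * (1 / real n))" by (intro tiny_mult polylog_intros tiny_inv poly_tau)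
  from tiny_ev[OF this zero_less_one] show ?thesis using eventually_gt_at_top[of 0]
  proof eventually_elim
    case (elim n)
    thus ?case by (simp add: field_simps)
  qed
qed

lemma wcfg: "\<forall>\<^sub>F n in sequentially. walk_config n (dp n) (dm n) Dmax (\<tau> n) (hh n) (\<tau> n - 2 * hh n - 1) (2 * \<tau> n) (PR C n) (th n)"
  using lo two_tau tau_le EE_ev[of 1 1, simplified] eventually_gt_at_top[of 0]
proof eventually_elim
  case (elim n)
  have m: "2 * real n <= mm n" using mm_bounds elim by simp
  have k: "kap n \<noteq> 0" using elim(4) by (cases "kap n") (auto simp: EE_def)
  have t1: "1 <= real (\<tau> n)" using elim(1) by simp
  have "real (Dmax * (2 * \<tau> n + 2)) <= Dmax * (4 * real (\<tau> n))"
    unfolding of_nat_mult by (rule mult_left_mono) (use t1 in auto)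
  also have "\<dots> <= Dmax * (4 * (C * EE n))" using elim(3) by (intro mult_left_mono) auto
  also have "\<dots> = PR C n * n" using elim(5) by (simp add: PR_def)
  also have "\<dots> <= PR C n * (real (mm n) - real (2 * \<tau> n))"
    using m elim(2) C1 EE_pos[of n] by (intro mult_left_mono) (auto simp: PR_def)
  finally have pD: "real (Dmax * (2 * \<tau> n + 2)) <= PR C n * (real (mm n) - real (2 * \<tau> n))" .
  have "real (2 * \<tau> n) < real (mm n)" using m elim(2,5) by simp
  hence km: "2 * \<tau> n < mm n" by (simp only: of_nat_less_iff)
  have "walk_config_axioms n (dm n) Dmax (\<tau> n) (hh n) (\<tau> n - 2 * hh n - 1) (2 * \<tau> n) (PR C n) (th n)"
    unfolding walk_config_axioms_def
    using elim(1) k pD km EE_pos[of n] by (auto simp: hh_def aa_def th_def)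
  thus ?case unfolding walk_config_def using cfg elim(5) by blast
qed

definition rr :: "nat => real" where "rr n = (real (mm n) / (real (mm n) - real (2 * \<tau> n))) ^ \<tau> n"

text \<open>The base is at most \<open>1 + 2 \<tau> / n\<close>, so the power is at most the
  exponential of \<open>2 \<tau>^2 / n\<close>, which is \<open>tiny\<close>.\<close>

lemma rr_bounds: "tiny (\<lambda>n. rr n - 1)" "\<forall>\<^sub>F n in sequentially. 1 <= rr n \<and> rr n <= 2"
proof -
  let ?x = "\<lambda>n. (2 * real (\<tau> n) ^ 2) * (1 / real n)"
  have tx: "tiny ?x" by (intro tiny_mult polylog_intros tiny_inv poly_tau)
  have b: "\<forall>\<^sub>F n in sequentially. 1 <= rr n \<and> rr n <= 1 + 2 * ?x n \<and> ?x n <= 1/2"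
    using two_tau eventually_gt_at_top[of 0] tiny_ev[OF tx half_gt_zero[OF zero_less_one]]
  proof eventually_elim
    case (elim n)
    let ?d = "real (mm n) - real (2 * \<tau> n)"
    have m: "real n <= ?d" "0 < ?d" using mm_bounds[of n] elim by auto
    have x01: "0 <= ?x n" "?x n <= 1" using elim(3) by (simp, linarith)
    have base: "real (mm n) / ?d = 1 + 2 * real (\<tau> n) / ?d" using m by (simp add: field_simps)
    have "1 + 2 * real (\<tau> n) / ?d <= 1 + 2 * real (\<tau> n) / n" using m elim by (simp add: frac_le)
    also have "\<dots> <= exp (2 * real (\<tau> n) / n)" by (rule exp_ge_add_one_self)
    finally have "rr n <= exp (2 * real (\<tau> n) / n) ^ \<tau> n" unfolding rr_def base using m by (intro power_mono) auto
    also have "\<dots> = exp (?x n)" by (simp add: power2_eq_square mult_ac flip: exp_of_nat_mult)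
    also have "\<dots> <= 1 + ?x n + ?x n ^ 2" using x01 by (rule exp_bound)
    also have "?x n ^ 2 <= ?x n * 1" unfolding power2_eq_square[of "?x n"] using x01 by (intro mult_left_mono)
    finally have "rr n <= 1 + 2 * ?x n" by linarith
    moreover have "1 <= rr n" unfolding rr_def base using m by (intro one_le_power) simp
    ultimately show ?case using elim(3) by linarith
  qed
  show "tiny (\<lambda>n. rr n - 1)"
    by (rule tiny_le[OF tiny_mult[OF polylog_const[of 2] tx]]) (use b in eventually_elim, auto)
  show "\<forall>\<^sub>F n in sequentially. 1 <= rr n \<and> rr n <= 2" using b by eventually_elim auto
qed

lemma poly_rr: "polylog rr"
  by (rule polylogI[of _ 2 0]) (use rr_bounds(2) in eventually_elim, simp)

definition ee :: "nat => real" where "ee n = 3 * (real (\<tau> n) * PR C n)\<^sup>2 + 7 * rr n * (real Dmax / real (mm n)) * (1 / 2) ^ hh n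
  + 2 * (rr n * rr n - 1) * (2 * real Dmax / real (mm n)) + real (Dmax * (hh n + 1)) / real (mm n) * (real (\<tau> n) * PR C n)
  + 4 * (real Dmax / real (mm n))\<^sup>2 * (real (\<tau> n + hh n + 2))\<^sup>2"

text \<open>Here \<open>c = EE^aa\<close> and \<open>\<delta> = EE^-(aa - 1)\<close>. Both
  \<open>c * n * th n\<close> and \<open>1 / c\<close> equal \<open>EE^-aa\<close>, so dividing by
  \<open>\<delta>\<close> leaves one factor \<open>1 / EE\<close>. The term with
  \<open>2^-hh\<close> behaves alike, and \<open>R\<close> gathers the parts of
  \<open>n * ee n\<close> that are \<open>tiny\<close>.\<close>

lemma second_moment_term:
  assumes \<eta>: "0 < \<eta>"
  shows "(\<lambda>n. 4 / (\<eta> * (1 / EE n ^ (aa - 1))) * (EE n ^ aa * n / 2 * (th n + ee n) + 1 / (2 * EE n ^ aa)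
     + 2 * ((real (\<tau> n) + 1) * PR C n))) \<longlonglongrightarrow> 0" (is "?F \<longlonglongrightarrow> 0")
proof -
  define R where "R n = (3 * real (\<tau> n) ^ 2 * (real n * PR C n)) * PR C n + (4 * real Dmax * (real n / mm n) * (rr n + 1)) * (rr n - 1)
     + (real Dmax * (real (hh n) + 1) * (real n / mm n) * real (\<tau> n)) * PR C n
     + (4 * real Dmax ^ 2 * (real n / mm n) * (real (\<tau> n) + real (hh n) + 2) ^ 2) * (1 / real (mm n))" for n
  have tR: "tiny R" unfolding R_def[abs_def]
    by (intro tiny_add tiny_mult polylog_intros poly_tau poly_hh poly_nPR poly_ratio poly_rr tiny_PR tiny_mm rr_bounds(1))
  let ?G = "\<lambda>n. 2 / \<eta> * (2 + 7 * rr n * Dmax * (real n / mm n)) / EE n + (((2 / \<eta>) * (EE n ^ (aa - 1) * EE n ^ aa)) * R n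
     + ((8 / \<eta>) * EE n ^ (aa - 1) * (real (\<tau> n) + 1)) * PR C n)"
  have t2: "tiny (\<lambda>n. ((2 / \<eta>) * (EE n ^ (aa - 1) * EE n ^ aa)) * R n + ((8 / \<eta>) * EE n ^ (aa - 1) * (real (\<tau> n) + 1)) * PR C n)"
    by (intro tiny_add tiny_mult polylog_intros poly_tau tR tiny_PR)
  have t1: "(\<lambda>n. 2 / \<eta> * (2 + 7 * rr n * Dmax * (real n / mm n)) / EE n) \<longlonglongrightarrow> 0"
  proof (rule Lim_null_comparison[OF _ const_div_EE[of "2 / \<eta> * (2 + 14 * Dmax)"]])
    show "\<forall>\<^sub>F n in sequentially. norm (2 / \<eta> * (2 + 7 * rr n * Dmax * (real n / mm n)) / EE n) <= 2 / \<eta> * (2 + 14 * Dmax) / EE n"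
      using rr_bounds(2) eventually_gt_at_top[of 0]
    proof eventually_elim
      case (elim n)
      have r: "0 <= real n / mm n" "real n / mm n <= 1" using mm_bounds[of n] elim by (auto simp: divide_le_eq_1)
      have "rr n * Dmax * (real n / mm n) <= 2 * real Dmax * 1" using r elim by (intro mult_mono) auto
      moreover have "0 <= rr n * Dmax * (real n / mm n)" using r elim by simp
      ultimately have "2 + 7 * rr n * Dmax * (real n / mm n) <= 2 + 14 * Dmax" "0 <= 2 + 7 * rr n * Dmax * (real n / mm n)" by linarith+
      thus ?case using \<eta> EE_pos[of n] by (simp add: abs_mult divide_right_mono mult_left_mono)
    qed
  qed
  have g0: "?G \<longlonglongrightarrow> 0" using tendsto_add[OF t1 tiny_tendsto[OF t2]] by simp
  have ev: "\<forall>\<^sub>F n in sequentially. ?F n = ?G n"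
    using eventually_gt_at_top[of 0]
  proof eventually_elim
    case (elim n)
    define e1 where "e1 = EE n ^ (aa - 1)"
    define e where "e = EE n"
    define r where "r = real n / mm n"
    have ep: "0 < e" "0 < e1" using EE_pos[of n] by (simp_all add: e_def e1_def)
    have eA: "EE n ^ aa = e * e1" by (simp add: e_def e1_def aa_def eval_nat_numeral)
    have eAA: "EE n ^ (2 * aa) = (e * e1) * (e * e1)" using eA by (simp add: power_mult power2_eq_square mult.commute[of 2])
    have mp: "0 < real (mm n)" using mm_bounds[of n] elim by linarith
    have nth: "n * th n = 1 / ((e * e1) * (e * e1))" using elim by (simp add: th_def eAA)
    have half: "(1 / 2 :: real) ^ hh n = 1 / ((e * e1) * (e * e1))"
      using two_hh[of n] by (simp add: power_one_over eAA)
    have nee: "n * ee n = 7 * rr n * Dmax * r * (1 / ((e * e1) * (e * e1))) + R n"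
    proof -
      have alg: "N * (3 * (T * P)^2 + 7 * q * (D / M) * X + 2 * (q * q - 1) * (2 * D / M) + (D * H) / M * (T * P) + 4 * (D / M)^2 * Y^2)
        = 7 * q * D * (N / M) * X + ((3 * T^2 * (N * P)) * P + (4 * D * (N / M) * (q + 1)) * (q - 1) + (D * H * (N / M) * T) * P + (4 * D^2 * (N / M) * Y^2) * (1 / M))"
        if "0 < M" for N T P q D M X H Y :: real
        using that by (simp add: field_simps power2_eq_square)
      have c: "real (Dmax * (hh n + 1)) = real Dmax * (real (hh n) + 1)" "real (\<tau> n + hh n + 2) = real (\<tau> n) + real (hh n) + 2"
        by (simp_all add: algebra_simps)
      show ?thesis unfolding ee_def R_def half r_def c by (rule alg[OF mp])
    qed
    have "e * e1 * n / 2 * (th n + ee n) = (e * e1) / 2 * (n * th n + n * ee n)" by (simp add: algebra_simps)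
    also have "\<dots> = (1 + 7 * rr n * Dmax * r) / (2 * (e * e1)) + (e * e1) / 2 * R n"
      unfolding nth nee using ep by (simp add: field_simps)
    finally have s: "e * e1 * n / 2 * (th n + ee n) = (1 + 7 * rr n * Dmax * r) / (2 * (e * e1)) + (e * e1) / 2 * R n" .
    have fin: "4 / (\<eta> * (1 / e1)) * (((1 + Z) / (2 * (e * e1)) + (e * e1) / 2 * R') + 1 / (2 * (e * e1)) + 2 * Q)
      = 2 / \<eta> * (2 + Z) / e + (((2 / \<eta>) * (e1 * (e * e1))) * R' + (8 / \<eta>) * e1 * Q)" for Z R' Q
      using ep \<eta> by (simp add: field_simps)
    show ?case unfolding eA e1_def[symmetric] s fin unfolding e_def[symmetric] r_def[symmetric] by (simp add: mult_ac)
  qed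
  show ?thesis by (rule iffD2[OF filterlim_cong[OF refl refl ev] g0])
qed


text \<open>The square sums have order \<open>EE^2 / n\<close>, and \<open>\<tau>\<close>, of order
  \<open>EE\<close>, of them are added; \<open>V = EE^4 / n\<close> exceeds this by one factor
  \<open>EE\<close>.\<close>

lemma nu2_term:
  "(\<lambda>n. real (\<tau> n) * (real (Dmax * (\<tau> n + 1)) / real (mm n) + real (\<tau> n) * PR C n) / (EE n ^ 4 / n)) \<longlonglongrightarrow> 0"
proof (rule Lim_null_comparison[OF _ const_div_EE[of "C * (2 * real Dmax * C + 4 * real Dmax * C^2)"]])
  show "\<forall>\<^sub>F n in sequentially. norm (real (\<tau> n) * (real (Dmax * (\<tau> n + 1)) / real (mm n) + real (\<tau> n) * PR C n) / (EE n ^ 4 / n))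
      <= C * (2 * real Dmax * C + 4 * real Dmax * C^2) / EE n"
    using tau_le eventually_gt_at_top[of 0]
  proof eventually_elim
    case (elim n)
    let ?e = "EE n" and ?T = "real (\<tau> n)"
    have e: "1 <= ?e" by (rule EE_ge1)
    have m: "real n <= mm n" "0 < real n" using mm_bounds[of n] elim by linarith+
    have Ce: "1 <= C * ?e" using mult_mono[OF C1 e] C1 by simp
    have "real (Dmax * (\<tau> n + 1)) / real (mm n) <= real Dmax * (2 * (C * ?e)) / n"
      unfolding of_nat_mult using elim(1) Ce m by (intro frac_le mult_left_mono) auto
    also have "\<dots> = (2 * real Dmax * C) * ?e / n" by simp
    also have "\<dots> <= (2 * real Dmax * C) * ?e^2 / n"
      using e C1 by (intro divide_right_mono mult_left_mono) (auto simp: power2_eq_square)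
    finally have a: "real (Dmax * (\<tau> n + 1)) / real (mm n) <= (2 * real Dmax * C) * ?e^2 / n" .
    have P0: "0 <= PR C n" using C1 e by (simp add: PR_def)
    have "?T * PR C n <= (C * ?e) * PR C n" using elim(1) P0 by (rule mult_right_mono)
    also have "\<dots> = (4 * real Dmax * C^2) * ?e^2 / n" by (simp add: PR_def power2_eq_square)
    finally have b: "?T * PR C n <= (4 * real Dmax * C^2) * ?e^2 / n" .
    have "real (Dmax * (\<tau> n + 1)) / real (mm n) + ?T * PR C n <= (2 * real Dmax * C + 4 * real Dmax * C^2) * ?e^2 / n"
      using a b by (simp add: add_divide_distrib distrib_right)
    hence "?T * (real (Dmax * (\<tau> n + 1)) / real (mm n) + ?T * PR C n) <= (C * ?e) * ((2 * real Dmax * C + 4 * real Dmax * C^2) * ?e^2 / n)"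
      using elim(1) P0 C1 e by (intro mult_mono) auto
    hence "?T * (real (Dmax * (\<tau> n + 1)) / real (mm n) + ?T * PR C n) / (?e ^ 4 / n)
      <= (C * ?e) * ((2 * real Dmax * C + 4 * real Dmax * C^2) * ?e^2 / n) / (?e ^ 4 / n)"
      using e m by (intro divide_right_mono) auto
    also have "\<dots> = C * (2 * real Dmax * C + 4 * real Dmax * C^2) / ?e"
    proof -
      have alg: "(C * x) * (Y * x^2 / N) / (x ^ 4 / N) = C * Y / x" if "0 < x" "0 < N" for x N Y :: real
        using that by (simp add: field_simps eval_nat_numeral)
      show ?thesis by (rule alg) (use e m in linarith)+
    qed
    finally have "?T * (real (Dmax * (\<tau> n + 1)) / real (mm n) + ?T * PR C n) / (?e ^ 4 / n) <= C * (2 * real Dmax * C + 4 * real Dmax * C^2) / ?e" .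
    moreover have "0 <= ?T * (real (Dmax * (\<tau> n + 1)) / real (mm n) + ?T * PR C n) / (?e ^ 4 / n)" using P0 e by simp
    ultimately show ?case by (simp only: real_norm_def abs_of_nonneg)
  qed
qed

lemma jump_term: "(\<lambda>n. 2 * ((real (\<tau> n) + 1) * PR C n) / ((1 / EE n ^ 2) * (1 / EE n ^ (aa - 1)))) \<longlonglongrightarrow> 0"
proof -
  have "tiny (\<lambda>n. (2 * (real (\<tau> n) + 1) * (EE n ^ 2 * EE n ^ (aa - 1))) * PR C n)"
    by (intro tiny_mult polylog_intros poly_tau tiny_PR)
  moreover have "(\<lambda>n. 2 * ((real (\<tau> n) + 1) * PR C n) / ((1 / EE n ^ 2) * (1 / EE n ^ (aa - 1))))
    = (\<lambda>n. (2 * (real (\<tau> n) + 1) * (EE n ^ 2 * EE n ^ (aa - 1))) * PR C n)" by (intro ext) (simp add: mult_ac)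
  ultimately show ?thesis using tiny_tendsto by simp
qed

lemma Dmax_pow: "real Dmax ^ ss n <= EE n ^ (2 * Dmax)"
proof -
  have "real Dmax <= 2 ^ Dmax" using of_nat_less_two_power[of Dmax, where ?'a = real] by simp
  hence "real Dmax ^ ss n <= (2 ^ Dmax) ^ ss n" by (rule power_mono) simp
  also have "\<dots> = EE n ^ (2 * Dmax)" by (simp add: EE_def ss_def mult_ac flip: power_mult)
  finally show ?thesis .
qed

text \<open>The base of the power is at most \<open>4 * Dmax^2 / EE\<close>, eventually below
  \<open>exp (- 2)\<close>. The exponent \<open>2 ^ kap n = EE n\<close> is at least
  \<open>ln n\<close>, so the power beats the union over \<open>n\<close> roots.\<close>

lemma fibre_term:
  "(\<lambda>n. real n * ((real Dmax ^ Suc (ss n)) ^ (2 * 2 ^ kap n) * (2 * (4 * (1 / EE n ^ (aa - 2))) ^ (2 ^ kap n)))) \<longlonglongrightarrow> 0"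
proof (rule Lim_null_comparison)
  show "(\<lambda>n. 2 * real n * exp (- (2 * ln (real n)))) \<longlonglongrightarrow> 0" by real_asymp
  have "0 < (1::real) / 9" by simp
  from EE_ev[OF this, of "4 * (real Dmax)^2"]
  show "\<forall>\<^sub>F n in sequentially. norm (real n * ((real Dmax ^ Suc (ss n)) ^ (2 * 2 ^ kap n) * (2 * (4 * (1 / EE n ^ (aa - 2))) ^ (2 ^ kap n))))
      <= 2 * real n * exp (- (2 * ln (real n)))"
    using EE_bounds
  proof eventually_elim
    case (elim n)
    let ?e = "EE n"
    have e: "0 < ?e" by (rule EE_pos)
    have "real Dmax ^ Suc (ss n) <= real Dmax * ?e ^ (2 * Dmax)" using Dmax_pow[of n] by (simp add: mult_left_mono)
    hence "(real Dmax ^ Suc (ss n))^2 <= (real Dmax * ?e ^ (2 * Dmax))^2" by (rule power_mono) simp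
    also have "\<dots> = (real Dmax)^2 * ?e ^ (4 * Dmax)" by (simp add: power_mult_distrib flip: power_mult)
    finally have "(real Dmax ^ Suc (ss n))^2 * (4 * (1 / ?e ^ (aa - 2))) <= ((real Dmax)^2 * ?e ^ (4 * Dmax)) * (4 * (1 / ?e ^ (aa - 2)))"
      using e by (intro mult_right_mono) auto
    also have "\<dots> = 4 * (real Dmax)^2 / ?e"
      using e by (simp add: aa_def field_simps)
    also have "\<dots> <= exp (- 2)"
    proof -
      have "exp (2::real) = exp 1 ^ 2" by (simp flip: exp_of_nat_mult)
      also have "\<dots> <= 3 ^ 2" using exp_le by (intro power_mono) auto
      finally have "1 / 9 <= exp (- 2 :: real)" by (simp add: exp_minus field_simps)
      thus ?thesis using elim(1) by linarith
    qed
    finally have "((real Dmax ^ Suc (ss n))^2 * (4 * (1 / ?e ^ (aa - 2)))) ^ (2 ^ kap n) <= exp (- 2) ^ (2 ^ kap n)"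
      using e by (intro power_mono) auto
    also have "\<dots> = exp (- (2 * ?e))" by (simp add: EE_def mult.commute flip: exp_of_nat_mult)
    also have "\<dots> <= exp (- (2 * ln (real n)))" using elim(2) by simp
    finally have "((real Dmax ^ Suc (ss n))^2 * (4 * (1 / ?e ^ (aa - 2)))) ^ (2 ^ kap n) <= exp (- (2 * ln (real n)))" .
    hence "2 * real n * ((real Dmax ^ Suc (ss n))^2 * (4 * (1 / ?e ^ (aa - 2)))) ^ (2 ^ kap n) <= 2 * real n * exp (- (2 * ln (real n)))"
      by (rule mult_left_mono) simp
    moreover have "real n * ((real Dmax ^ Suc (ss n)) ^ (2 * 2 ^ kap n) * (2 * (4 * (1 / ?e ^ (aa - 2))) ^ (2 ^ kap n)))
      = 2 * real n * ((real Dmax ^ Suc (ss n))^2 * (4 * (1 / ?e ^ (aa - 2)))) ^ (2 ^ kap n)"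
      unfolding power_mult by (simp only: power_mult_distrib mult_ac)
    moreover have "0 <= real n * ((real Dmax ^ Suc (ss n)) ^ (2 * 2 ^ kap n) * (2 * (4 * (1 / ?e ^ (aa - 2))) ^ (2 ^ kap n)))"
      using e by simp
    ultimately show ?case by (simp only: real_norm_def abs_of_nonneg)
  qed
qed

text \<open>Parameters: \<open>M = 2 * 2 ^ kap n\<close>, \<open>\<kappa> = EE^-2\<close>,
  \<open>\<delta> = cJ = EE^-(aa - 1)\<close>, \<open>\<delta>' = EE^-(aa - 2)\<close>,
  \<open>V = EE^4 / n\<close>. The column bound \<open>\<tau> * sqrt V\<close> is
  \<open>tiny\<close> and drops out of all numerical conditions. What remains there is
  \<open>M * \<kappa>\<close>, of order \<open>1 / EE\<close>, and
  \<open>\<delta> / \<delta>' = 1 / EE\<close>.\<close>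

lemma regular_whp:
  assumes \<eta>: "0 < \<eta>" and \<epsilon>: "0 < \<epsilon>"
  shows "(\<lambda>n. card {w\<in>EV n. \<not> regular \<tau> \<eta> \<epsilon> n w} / real (card (EV n))) \<longlonglongrightarrow> 0"
proof -
  define V where "V n = EE n ^ 4 / n" for n
  define W where "W n = real (\<tau> n) * sqrt (V n)" for n
  have sV: "sqrt (V n) = EE n ^ 2 * (1 / sqrt n)" for n
  proof -
    have "sqrt (EE n ^ 4) = EE n ^ 2" using real_sqrt_abs[of "EE n ^ 2"] by (simp flip: power_mult)
    thus ?thesis unfolding V_def by (simp add: real_sqrt_divide)
  qed
  have tW: "tiny W" unfolding W_def[abs_def] sV
    by (intro tiny_mult poly_tau polylog_intros tiny_inv_sqrt)
  let ?M = "\<lambda>n. 2 * EE n"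
  have "tiny (\<lambda>n. (4 * ?M n * (2 * ?M n + 1)) * W n)" by (intro tiny_mult polylog_intros tW)
  from tiny_ev[OF this, of "\<eta> / 4"] \<eta> have w1: "\<forall>\<^sub>F n in sequentially. (4 * ?M n * (2 * ?M n + 1)) * W n < \<eta> / 4" by simp
  have "tiny (\<lambda>n. (4 * ?M n) * W n)" by (intro tiny_mult polylog_intros tW)
  from tiny_ev[OF this, of "\<eta> / 8"] \<eta> have w2: "\<forall>\<^sub>F n in sequentially. (4 * ?M n) * W n < \<eta> / 8" by simp
  have "tiny (\<lambda>n. (12 * ?M n ^ 2 * EE n ^ 2 * EE n ^ (aa - 2)) * W n + ((3 * ?M n + ?M n * real (\<tau> n) * EE n ^ 2) * EE n ^ (aa - 2)) * (1 / real (mm n)))"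
    by (intro tiny_add tiny_mult polylog_intros tW poly_tau tiny_mm)
  from tiny_ev[OF this, of "1 / 4"]
  have w3: "\<forall>\<^sub>F n in sequentially. (12 * ?M n ^ 2 * EE n ^ 2 * EE n ^ (aa - 2)) * W n + ((3 * ?M n + ?M n * real (\<tau> n) * EE n ^ 2) * EE n ^ (aa - 2)) * (1 / real (mm n)) < 1 / 4"
    by simp
  have "tiny (\<lambda>n. (2 * (real Dmax * EE n ^ (2 * Dmax) + ?M n)) * (1 / real n))" by (intro tiny_mult polylog_intros tiny_inv)
  from tiny_ev[OF this zero_less_one]
  have w4: "\<forall>\<^sub>F n in sequentially. (2 * (real Dmax * EE n ^ (2 * Dmax) + ?M n)) * (1 / real n) < 1" .
  have "tiny (\<lambda>n. (16 * EE n + 4) * (1 / real n))" by (intro tiny_mult polylog_intros tiny_inv)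
  from tiny_ev[OF this zero_less_one] have w5: "\<forall>\<^sub>F n in sequentially. (16 * EE n + 4) * (1 / real n) < 1" .
  have w6: "\<forall>\<^sub>F n in sequentially. 8 / EE n < \<eta> / 16" "\<forall>\<^sub>F n in sequentially. 2 / EE n < \<epsilon>" "\<forall>\<^sub>F n in sequentially. 2 / EE n < 1 / 4"
    using \<eta> \<epsilon> by (intro EE_ev; simp)+
  define \<beta> where "\<beta> n = real (16 * kap n + 3) * real (Dmax * (16 * kap n + 3)) ^ (2 * (16 * kap n + 3) + 2) / n
    + (4 / (\<eta> * (1 / EE n ^ (aa - 1))) * (EE n ^ aa * n / 2 * (th n + ee n) + 1 / (2 * EE n ^ aa) + 2 * ((real (\<tau> n) + 1) * PR C n))
      + real (\<tau> n) * (real (Dmax * (\<tau> n + 1)) / real (mm n) + real (\<tau> n) * PR C n) / V n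
      + 2 * ((real (\<tau> n) + 1) * PR C n) / ((1 / EE n ^ 2) * (1 / EE n ^ (aa - 1))))
    + real n * ((real Dmax ^ Suc (ss n)) ^ (2 * 2 ^ kap n) * (2 * (4 * (1 / EE n ^ (aa - 2))) ^ (2 ^ kap n)))" for n
  have "\<beta> \<longlonglongrightarrow> 0 + (0 + 0 + 0) + 0" unfolding \<beta>_def[abs_def] V_def
    by (intro tendsto_add sparse_term[OF Dmax2] second_moment_term[OF \<eta>] nu2_term jump_term fibre_term)
  hence b0: "\<beta> \<longlonglongrightarrow> 0" by simp
  show ?thesis
  proof (rule Lim_null_comparison[OF _ b0])
    show "\<forall>\<^sub>F n in sequentially. norm (card {w\<in>EV n. \<not> regular \<tau> \<eta> \<epsilon> n w} / real (card (EV n))) <= \<beta> n"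
      using wcfg w1 w2 w3 w4 w5 w6 eventually_gt_at_top[of 0] lo
    proof eventually_elim
      case (elim n)
      interpret walk_config n "dp n" "dm n" Dmax "\<tau> n" "hh n" "\<tau> n - 2 * hh n - 1" "2 * \<tau> n" "PR C n" "th n" by (rule elim(1))
      let ?e = "EE n" and ?m = "real (mm n)"
      have e: "1 <= ?e" "0 < ?e" by (rule EE_ge1, rule EE_pos)
      have n: "0 < real n" using elim(10) by simp
      have mp: "2 * real n <= ?m" "0 < ?m" using mm_bounds[of n] elim(10) by linarith+
      have rM: "real (2 * 2 ^ kap n) = 2 * ?e" by (simp add: EE_def)
      have Err: "Err = ee n" unfolding Err_def ee_def RR_def rr_def by simp
      have inv2: "1 / ?e ^ 2 <= 1 / ?e" using e by (simp add: field_simps power2_eq_square)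
      have c1: "real (2 * 2 ^ kap n) <= \<epsilon> * 2 ^ ss n"
      proof -
        have s2: "2 ^ ss n = ?e * ?e" by (simp add: ss_def EE_def mult_2 power_add)
        have "2 <= \<epsilon> * ?e" using elim(8) e by (simp add: field_simps)
        thus ?thesis unfolding rM s2 mult.assoc[symmetric] using e by (intro mult_right_mono) auto
      qed
      have c2: "2 * (Dmax ^ Suc (ss n) + 2 * 2 ^ kap n) < mm n"
      proof -
        define X Y where "X = real Dmax ^ Suc (ss n)" and "Y = real Dmax * ?e ^ (2 * Dmax)"
        have "X <= Y" using Dmax_pow[of n] by (simp add: X_def Y_def mult_left_mono)
        hence "2 * (X + 2 * ?e) <= 2 * (Y + 2 * ?e)" by simp
        also have "\<dots> < n" using elim(5) n by (simp add: field_simps Y_def)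
        also have "real n <= ?m" by (rule order_trans[OF _ mp(1)]) (use n in simp)
        finally have "2 * (X + 2 * ?e) < ?m" .
        moreover have "real (2 * (Dmax ^ Suc (ss n) + 2 * 2 ^ kap n)) = 2 * (X + 2 * ?e)" using rM by (simp add: X_def)
        ultimately have "real (2 * (Dmax ^ Suc (ss n) + 2 * 2 ^ kap n)) < ?m" by (simp only:)
        thus ?thesis by (simp only: of_nat_less_iff)
      qed
      have c3: "4 * (2 * ?e) * (1 / ?e ^ 2) + 4 * (2 * ?e) * (2 * (2 * ?e) + 1) * W n <= \<eta> / 2"
      proof -
        have "4 * (2 * ?e) * (1 / ?e ^ 2) = 8 / ?e" using e by (simp add: field_simps power2_eq_square)
        thus ?thesis using elim(2,7) \<eta> by linarith
      qed
      have c4: "2 * (1 / ?e ^ 2) + 4 * (2 * ?e) * W n <= \<eta> / 4"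
      proof -
        have alg: "2 * a + w <= E / 4" if "w < E / 8" "8 * b < E / 16" "a <= b" "0 < E" for a b w E :: real
          using that by linarith
        show ?thesis by (rule alg[OF elim(3) _ inv2 \<eta>]) (use elim(7) in simp)
      qed
      have c5: "?m * (1 / ?e ^ (aa - 1) + 1 / ?e ^ (aa - 1) + 12 * (2 * ?e) ^ 2 * W n / (1 / ?e ^ 2)) + 3 * (2 * ?e) + 2 * ?e * real (\<tau> n) / (1 / ?e ^ 2)
        <= 1 / ?e ^ (aa - 2) * (?m / 2)"
      proof -
        define f where "f = ?e ^ (aa - 2)"
        have f: "0 < f" "?e ^ (aa - 1) = ?e * f" using e by (simp_all add: f_def aa_def eval_nat_numeral)
        have alg: "M * (1 / (x * f) + 1 / (x * f) + 12 * y ^ 2 * w / (1 / x ^ 2)) + 3 * y + y * T / (1 / x ^ 2)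
          = 1 / f * M * (2 / x + ((12 * y ^ 2 * x ^ 2 * f) * w + ((3 * y + y * T * x ^ 2) * f) * (1 / M)))"
          if "0 < x" "0 < M" for x M y T w :: real
          using that f(1) by (simp add: field_simps power2_eq_square)
        have "2 / ?e + ((12 * (2 * ?e) ^ 2 * ?e ^ 2 * f) * W n + ((3 * (2 * ?e) + 2 * ?e * real (\<tau> n) * ?e ^ 2) * f) * (1 / ?m)) <= 1 / 2"
          using elim(4,9) unfolding f_def by linarith
        hence "1 / f * ?m * (2 / ?e + ((12 * (2 * ?e) ^ 2 * ?e ^ 2 * f) * W n + ((3 * (2 * ?e) + 2 * ?e * real (\<tau> n) * ?e ^ 2) * f) * (1 / ?m))) <= 1 / f * ?m * (1 / 2)"
          using f mp by (intro mult_left_mono) auto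
        thus ?thesis unfolding f(2) alg[OF e(2) mp(2)] f_def[symmetric] by simp
      qed
      have c6: "16 * kap n + 3 + 1 <= n"
      proof -
        have "16 * ?e + 4 < n" using elim(6) n by (simp add: field_simps)
        hence "real (16 * kap n + 3 + 1) <= real n" using kap_le_EE[of n] by simp
        thus ?thesis by (simp only: of_nat_le_iff)
      qed
      have "real (card {w\<in>EV n. \<not> (Uniform (ss n) \<eta> \<epsilon> w \<and> (\<forall>s<\<tau> n. (\<Sum>j<n. (nu w s j)^2) <= V n))}) <= card (EV n) * \<beta> n"
        unfolding \<beta>_def Err[symmetric]
        by (rule not_Uniform_bound[where M' = "2 ^ kap n" and \<kappa> = "1 / EE n ^ 2"])
           (use \<eta> \<epsilon> e n c1 c2 c3 c4 c5 c6 in \<open>simp_all only: rM W_def[symmetric]\<close>, simp_all add: V_def ss_def divide_le_eq_1)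
      moreover have "card {w\<in>EV n. \<not> regular \<tau> \<eta> \<epsilon> n w} <= card {w\<in>EV n. \<not> (Uniform (ss n) \<eta> \<epsilon> w \<and> (\<forall>s<\<tau> n. (\<Sum>j<n. (nu w s j)^2) <= V n))}"
      proof (rule card_mono)
        have "hh n < \<tau> n" using elim(11) by linarith
        thus "{w\<in>EV n. \<not> regular \<tau> \<eta> \<epsilon> n w} \<subseteq> {w\<in>EV n. \<not> (Uniform (ss n) \<eta> \<epsilon> w \<and> (\<forall>s<\<tau> n. (\<Sum>j<n. (nu w s j)^2) <= V n))}"
          unfolding regular_def V_def by blast
        show "finite {w\<in>EV n. \<not> (Uniform (ss n) \<eta> \<epsilon> w \<and> (\<forall>s<\<tau> n. (\<Sum>j<n. (nu w s j)^2) <= V n))}"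
          by (rule finite_subset[OF _ finite_envs]) blast
      qed
      ultimately have "real (card {w\<in>EV n. \<not> regular \<tau> \<eta> \<epsilon> n w}) <= card (EV n) * \<beta> n" by linarith
      moreover have "0 < real (card (EV n))" using card_envs_pos by simp
      ultimately show ?case by (simp add: field_simps)
    qed
  qed
qed

end

end

section \<open>The mass of light paths\<close>

context config begin

lemma real_card_filter: "finite A ==> real (card {x\<in>A. P x}) = (\<Sum>x\<in>A. of_bool (P x))"
  unfolding of_bool_def by (simp only: sum.inter_filter[symmetric]) simp

lemma ln_hw: "set fs \<subseteq> H ==> 0 < hw fs \<and> ln (hw fs) = - (\<Sum>f\<leftarrow>fs. ln (real (dp (fst f))))"
proof (induction fs)
  case (Cons f fs)
  have "0 < real (dp (fst f))" using Cons.prems deg2[of "fst f"] by (auto simp: memH)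
  thus ?case using Cons by (simp add: ln_div)
qed simp

text \<open>Logarithms turn heaviness of a head list into a bound on a sum of centred variables, the
  form treated by \<open>triangular_clt\<close>. The inequality is strict because lightness includes
  equality.\<close>

lemma qq_compl:
  assumes "0 < \<theta>"
  shows "1 - qq N \<theta> = card {xs\<in>LL H N. (\<Sum>f\<leftarrow>xs. ln (real (dp (fst f))) - \<mu>) < - ln \<theta> - N * \<mu>} / real (card H) ^ N"
proof -
  have HL: "HL N = LL H N" unfolding HL_def LL_def ..
  have eq: "(\<theta> < hw fs) = ((\<Sum>f\<leftarrow>fs. ln (real (dp (fst f))) - \<mu>) < - ln \<theta> - N * \<mu>)" if "fs \<in> LL H N" for fs
  proof -
    have fs: "set fs \<subseteq> H" "length fs = N" using that by (auto simp: LL_def)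
    have s: "(\<Sum>f\<leftarrow>gs. ln (real (dp (fst f))) - \<mu>) = (\<Sum>f\<leftarrow>gs. ln (real (dp (fst f)))) - length gs * \<mu>" for gs :: "(nat \<times> nat) list"
      by (induction gs) (simp_all add: algebra_simps)
    have "(\<theta> < hw fs) = (ln \<theta> < ln (hw fs))"
      using ln_less_cancel_iff[OF assms conjunct1[OF ln_hw[OF fs(1)]]] by (simp only:)
    thus ?thesis unfolding s fs(2) using ln_hw[OF fs(1)] by auto
  qed
  have "1 - qq N \<theta> = iE N (\<lambda>fs. 1 + (-1) * of_bool (hw fs <= \<theta>))" unfolding iE_plus iE_cmult qq_def by simp
  also have "\<dots> = iE N (\<lambda>fs. of_bool (\<theta> < hw fs))" by (rule iE_cong) auto
  also have "\<dots> = (\<Sum>fs\<in>LL H N. of_bool ((\<Sum>f\<leftarrow>fs. ln (real (dp (fst f))) - \<mu>) < - ln \<theta> - N * \<mu>)) / real m ^ N"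
    unfolding iE_def HL by (intro arg_cong2[of _ _ _ _ "(/)"] sum.cong refl) (simp only: eq)
  also have "\<dots> = card {xs\<in>LL H N. (\<Sum>f\<leftarrow>xs. ln (real (dp (fst f))) - \<mu>) < - ln \<theta> - N * \<mu>} / real m ^ N"
    by (subst real_card_filter) (simp_all add: H_def heads_def)
  finally show ?thesis unfolding m_def .
qed

lemma sum_H_fst: "(\<Sum>f\<in>H. \<phi> (fst f)) = (\<Sum>v<n. real (dm v) * \<phi> v)" unfolding sum_H by simp

lemma mu_H: "(\<Sum>f\<in>H. ln (real (dp (fst f)))) = m * mu n dp dm"
  unfolding sum_H_fst[of "\<lambda>v. ln (real (dp v))"] mu_def m_num[symmetric] using mpos by simp

lemma mu_bounds: "ln 2 <= mu n dp dm" "mu n dp dm <= ln D"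
proof -
  have f: "ln 2 <= ln (real (dp (fst f)))" "ln (real (dp (fst f))) <= ln D" if "f \<in> H" for f
    using that deg2[of "fst f"] degD[of "fst f"] by (auto simp: memH)
  have "m * ln 2 <= (\<Sum>f\<in>H. ln (real (dp (fst f))))" using sum_mono[of H "\<lambda>_. ln 2", OF f(1)] by (simp add: m_def)
  thus "ln 2 <= mu n dp dm" unfolding mu_H using mpos by simp
  have "(\<Sum>f\<in>H. ln (real (dp (fst f)))) <= m * ln D" using sum_mono[of H _ "\<lambda>_. ln D", OF f(2)] by (simp add: m_def)
  thus "mu n dp dm <= ln D" unfolding mu_H using mpos by simp
qed

lemma dev_bound: "f \<in> H ==> \<bar>ln (real (dp (fst f))) - mu n dp dm\<bar> <= ln D"
proof -
  assume "f \<in> H"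
  hence "ln 2 <= ln (real (dp (fst f)))" "ln (real (dp (fst f))) <= ln D"
    using deg2[of "fst f"] degD[of "fst f"] by (auto simp: memH)
  moreover have "0 < ln (2::real)" by simp
  ultimately show ?thesis using mu_bounds by linarith
qed

lemma sigma2_H: "(\<Sum>f\<in>H. (ln (real (dp (fst f))) - mu n dp dm)^2) = m * sigma2 n dp dm"
  unfolding sum_H_fst[of "\<lambda>v. (ln (real (dp v)) - mu n dp dm)^2"] sigma2_def m_num[symmetric] using mpos by simp

lemma sigma2_bounds: "0 <= sigma2 n dp dm" "sigma2 n dp dm <= (ln D)^2"
proof -
  show "0 <= sigma2 n dp dm" unfolding sigma2_def by (intro divide_nonneg_nonneg sum_nonneg) auto
  have "(\<Sum>f\<in>H. (ln (real (dp (fst f))) - mu n dp dm)^2) <= (\<Sum>f\<in>H. (ln D)^2)"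
    by (rule sum_mono) (metis abs_ge_zero dev_bound power2_abs power_mono)
  hence "m * sigma2 n dp dm <= m * (ln D)^2" unfolding sigma2_H by (simp add: m_def)
  thus "sigma2 n dp dm <= (ln D)^2" using mpos by simp
qed

end

section \<open>The critical window\<close>

context degree_seq begin

abbreviation mu' :: "nat => real" where "mu' n \<equiv> mu n (dp n) (dm n)"
abbreviation s2 :: "nat => real" where "s2 n \<equiv> sigma2 n (dp n) (dm n)"
abbreviation ts :: "nat => real" where "ts n \<equiv> t_star n (dp n) (dm n)"
abbreviation ws :: "nat => real" where "ws n \<equiv> w_star n (dp n) (dm n)"
abbreviation qN :: "(nat => nat) => nat => real" where
  "qN \<tau> n \<equiv> config.qq n (dp n) (dm n) (\<tau> n - 2 * hh n - 1) (th n)"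

lemma mu'_bounds: assumes "0 < n" shows "0 < mu' n" "ln 2 <= mu' n" "mu' n <= ln Dmax"
  using config.mu_bounds[OF cfg[OF assms]] ln_2_less_1 by (auto intro: less_le_trans[of 0 "ln 2"])

lemma lnD: "0 < ln (real Dmax)" using Dmax2 by simp

context
  assumes var_hyp: "filterlim (\<lambda>n. s2 n * ln (real n) / (ln (ln (real n)))^2) at_top sequentially"
begin

text \<open>The variance hypothesis in usable form: the window is much wider than
  \<open>ln ln n\<close>, so shifting a time by multiples of \<open>kap n\<close> does not change
  its position in the window. The power of \<open>mu\<close> in the denominator is at most a
  constant, since \<open>mu\<close> is at most \<open>ln Dmax\<close>.\<close>

lemma ws_lnln: "filterlim (\<lambda>n. ws n / ln (ln (real n))) at_top sequentially"
proof (rule filterlim_at_top_mono)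
  let ?c = "ln (real Dmax) powr (3/2)"
  show "filterlim (\<lambda>n. (1 / ?c) * sqrt (s2 n * ln (real n) / (ln (ln (real n)))^2)) at_top sequentially"
    by (intro filterlim_tendsto_pos_mult_at_top[OF tendsto_const] filterlim_compose[OF sqrt_at_top var_hyp]) (use lnD in simp)
  show "\<forall>\<^sub>F n in sequentially. (1 / ?c) * sqrt (s2 n * ln (real n) / (ln (ln (real n)))^2) <= ws n / ln (ln (real n))"
    using ln_gt_1 eventually_gt_at_top[of 0]
  proof eventually_elim
    case (elim n)
    have l: "0 < ln (ln (real n))" by (rule ln_gt_zero[OF elim(1)])
    have "sqrt (s2 n * ln (real n) / (ln (ln (real n)))^2) = sqrt (s2 n) * sqrt (ln (real n)) / ln (ln (real n))"
      using l by (simp add: real_sqrt_divide real_sqrt_mult)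
    moreover have "(sqrt (s2 n) * sqrt (ln (real n))) / ?c <= ws n" unfolding w_star_def
      using mu'_bounds[OF elim(2)] config.sigma2_bounds[OF cfg[OF elim(2)]] elim
      by (intro divide_left_mono powr_mono2 mult_nonneg_nonneg mult_pos_pos) (auto simp: lnD)
    ultimately show ?case using l divide_right_mono[of "(sqrt (s2 n) * sqrt (ln (real n))) / ?c" "ws n" "ln (ln (real n))"]
      by (simp add: mult_ac)
  qed
qed

lemma ws_at_top: "filterlim ws at_top sequentially"
proof -
  have "filterlim (\<lambda>n. ln (ln (real n))) at_top sequentially" by real_asymp
  from filterlim_at_top_mult_at_top[OF ws_lnln this] show ?thesis
  proof (rule filterlim_at_top_mono)
    show "\<forall>\<^sub>F n in sequentially. ws n / ln (ln (real n)) * ln (ln (real n)) <= ws n"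
      using ln_gt_1 by eventually_elim simp
  qed
qed

lemma ws_pos: "\<forall>\<^sub>F n in sequentially. 0 < ws n"
  using ws_at_top unfolding filterlim_at_top_dense by blast

lemma kap_ws: "(\<lambda>n. (c * real (kap n) + d) / ws n) \<longlonglongrightarrow> 0"
proof -
  have k: "(\<lambda>n. real (kap n) / ws n) \<longlonglongrightarrow> 0"
  proof (rule Lim_null_comparison)
    show "(\<lambda>n. 3 / (ws n / ln (ln (real n)))) \<longlonglongrightarrow> 0" by (rule real_tendsto_divide_at_top[OF tendsto_const ws_lnln])
    have "\<forall>\<^sub>F n in sequentially. 1 < ln (ln (real n))" by real_asymp
    thus "\<forall>\<^sub>F n in sequentially. norm (real (kap n) / ws n) <= 3 / (ws n / ln (ln (real n)))"
      using ws_pos kap_le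
    proof eventually_elim
      case (elim n)
      have "real (kap n) <= 3 * ln (ln (real n))" using elim by linarith
      hence "real (kap n) / ws n <= 3 * ln (ln (real n)) / ws n" using elim by (intro divide_right_mono) auto
      thus ?case using elim by simp
    qed
  qed
  have "(\<lambda>n. c * (real (kap n) / ws n) + d / ws n) \<longlonglongrightarrow> c * 0 + 0"
    by (intro tendsto_intros k real_tendsto_divide_at_top[OF tendsto_const ws_at_top])
  thus ?thesis by (simp add: add_divide_distrib)
qed

text \<open>Identifies \<open>mu * w_star\<close> with the standard deviation of a sum of
  \<open>t_star\<close> independent logarithmic degrees.\<close>

lemma mu_ws: "1 < n ==> mu' n * ws n = sqrt (s2 n) * sqrt (ts n)"
proof -
  assume n: "1 < n"
  hence mp: "0 < mu' n" using mu'_bounds[of n] by simp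
  have "mu' n powr (3/2) = mu' n powr (1 + 1/2)" by simp
  also have "\<dots> = mu' n * sqrt (mu' n)" unfolding powr_add using mp by (simp add: powr_half_sqrt)
  finally have p: "mu' n powr (3/2) = mu' n * sqrt (mu' n)" .
  show ?thesis unfolding w_star_def t_star_def p real_sqrt_divide using mp by simp
qed

lemma ws_ts: "(\<lambda>n. ws n / ts n) \<longlonglongrightarrow> 0"
proof (rule Lim_null_comparison)
  show "(\<lambda>n. (ln Dmax / sqrt (ln 2)) / sqrt (ln (real n))) \<longlonglongrightarrow> 0" by real_asymp
  show "\<forall>\<^sub>F n in sequentially. norm (ws n / ts n) <= (ln Dmax / sqrt (ln 2)) / sqrt (ln (real n))"
    using eventually_gt_at_top[of 1]
  proof eventually_elim
    case (elim n)
    hence n0: "0 < n" by simp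
    note mb = mu'_bounds[OF n0]
    have l: "0 < ln (real n)" using elim by simp
    have tp: "0 < ts n" using l mb by (simp add: t_star_def)
    have "ws n = sqrt (s2 n) * sqrt (ts n) / mu' n" using mu_ws[OF elim] mb by (simp add: field_simps)
    hence "ws n / ts n = sqrt (s2 n) / (mu' n * (ts n / sqrt (ts n)))" using tp by simp
    also have "ts n / sqrt (ts n) = sqrt (ts n)" using tp by (simp add: real_div_sqrt)
    also have "mu' n * sqrt (ts n) = sqrt (mu' n) * sqrt (ln (real n))"
    proof -
      have "mu' n * sqrt (ts n) = (sqrt (mu' n) * sqrt (mu' n)) * (sqrt (ln (real n)) / sqrt (mu' n))"
        using mb by (simp add: t_star_def real_sqrt_divide)
      also have "\<dots> = sqrt (mu' n) * sqrt (ln (real n))"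
      proof -
        have "(x * x) * (z / x) = x * z" if "x \<noteq> 0" for x z :: real using that by simp
        thus ?thesis using mb(1) by (metis less_irrefl real_sqrt_gt_zero)
      qed
      finally show ?thesis .
    qed
    finally have e: "ws n / ts n = sqrt (s2 n) / (sqrt (mu' n) * sqrt (ln (real n)))" .
    have "sqrt (s2 n) <= ln Dmax"
      using config.sigma2_bounds(2)[OF cfg[OF n0]] lnD by (intro real_le_lsqrt) auto
    hence "ws n / ts n <= ln Dmax / (sqrt (ln 2) * sqrt (ln (real n)))" unfolding e
      using mb l lnD by (intro frac_le mult_right_mono mult_pos_pos) auto
    moreover have "0 <= ws n / ts n" unfolding e using config.sigma2_bounds(1)[OF cfg[OF n0]] mb l by simp
    ultimately show ?case by simp
  qed
qed

definition window :: "real => (nat => nat) => bool" where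
  "window lm \<tau> \<longleftrightarrow> (\<lambda>n. (real (\<tau> n) - ts n) / ws n) \<longlonglongrightarrow> lm"

lemma window_ratio: assumes "window lm \<tau>" shows "(\<lambda>n. real (\<tau> n) / ts n) \<longlonglongrightarrow> 1"
proof -
  have "(\<lambda>n. 1 + (real (\<tau> n) - ts n) / ws n * (ws n / ts n)) \<longlonglongrightarrow> 1 + lm * 0"
    using assms unfolding window_def by (intro tendsto_intros ws_ts)
  hence l: "(\<lambda>n. 1 + (real (\<tau> n) - ts n) / ws n * (ws n / ts n)) \<longlonglongrightarrow> 1" by simp
  have ev: "\<forall>\<^sub>F n in sequentially. 1 + (real (\<tau> n) - ts n) / ws n * (ws n / ts n) = real (\<tau> n) / ts n"
    using ws_pos eventually_gt_at_top[of 1]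
  proof eventually_elim
    case (elim n)
    have "0 < ts n" using elim mu'_bounds[of n] by (simp add: t_star_def)
    thus ?case using elim by (simp add: field_simps)
  qed
  show ?thesis by (rule Lim_transform_eventually[OF l ev])
qed

lemma window_hi: assumes "window lm \<tau>" shows "\<forall>\<^sub>F n in sequentially. real (\<tau> n) <= 4 * ln (real n)"
proof -
  have "\<forall>\<^sub>F n in sequentially. real (\<tau> n) / ts n < 2" by (rule order_tendstoD(2)[OF window_ratio[OF assms]]) simp
  thus ?thesis using eventually_gt_at_top[of 1]
  proof eventually_elim
    case (elim n)
    have mb: "0 < mu' n" "ln 2 <= mu' n" using mu'_bounds[of n] elim by auto
    have l: "0 < ln (real n)" using elim by simp
    have tp: "0 < ts n" using l mb by (simp add: t_star_def)
    have "1 / 2 <= mu' n" using ln2_ge_two_thirds mb(2) by linarith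
    hence "2 * ts n <= 2 * (ln (real n) / (1/2))" unfolding t_star_def using l by (intro mult_left_mono frac_le) auto
    moreover have "real (\<tau> n) < 2 * ts n" using elim(1) tp by (simp add: field_simps)
    ultimately show ?case by simp
  qed
qed

lemma window_lo: assumes "window lm \<tau>" shows "\<forall>\<^sub>F n in sequentially. c * kap n + 2 <= \<tau> n"
proof -
  have "\<forall>\<^sub>F n in sequentially. 1/2 < real (\<tau> n) / ts n" by (rule order_tendstoD(1)[OF window_ratio[OF assms]]) simp
  moreover have "\<forall>\<^sub>F n in sequentially. real c * (2 * ln (ln (real n)) + 1) + 2 <= (1 / (2 * ln Dmax)) * ln (real n)"
  proof -
    have "0 < 1 / (2 * ln (real Dmax))" using lnD by simp
    thus ?thesis by real_asymp
  qed
  ultimately show ?thesis using eventually_gt_at_top[of 1] kap_le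
  proof eventually_elim
    case (elim n)
    have mb: "0 < mu' n" "mu' n <= ln Dmax" using mu'_bounds[of n] elim by auto
    have l: "0 < ln (real n)" using elim by simp
    have tp: "0 < ts n" using l mb by (simp add: t_star_def)
    have "ln (real n) / ln Dmax <= ts n" unfolding t_star_def using l mb by (intro frac_le) auto
    moreover have "ts n / 2 < real (\<tau> n)" using elim(1) tp by (simp add: field_simps)
    moreover have "real c * kap n <= real c * (2 * ln (ln (real n)) + 1)" using elim(4) by (intro mult_left_mono) auto
    moreover have "real c * (2 * ln (ln (real n)) + 1) + 2 <= (ln (real n) / ln Dmax) / 2" using elim(2) by simp
    moreover have "x + 2 <= S" if "L <= T" "T / 2 < S" "x <= B" "B + 2 <= L / 2" for x S L T B :: real
      using that by linarith
    ultimately have "real c * kap n + 2 <= real (\<tau> n)" by blast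
    hence "real (c * kap n + 2) <= real (\<tau> n)" by simp
    thus ?case by (simp only: of_nat_le_iff)
  qed
qed

lemma window_shift:
  assumes "window lm \<tau>" "\<forall>\<^sub>F n in sequentially. \<bar>real (\<tau>' n) - real (\<tau> n)\<bar> <= c * real (kap n) + d"
  shows "window lm \<tau>'"
proof -
  have "(\<lambda>n. (real (\<tau>' n) - real (\<tau> n)) / ws n) \<longlonglongrightarrow> 0"
  proof (rule Lim_null_comparison[OF _ kap_ws[of c d]])
    show "\<forall>\<^sub>F n in sequentially. norm ((real (\<tau>' n) - real (\<tau> n)) / ws n) <= (c * real (kap n) + d) / ws n"
      using assms(2) ws_pos by eventually_elim (simp add: divide_right_mono)
  qed
  from tendsto_add[OF assms(1)[unfolded window_def] this] show ?thesis
    unfolding window_def by (simp add: diff_divide_distrib)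
qed

text \<open>The window length \<open>N\<close> differs from \<open>\<tau>\<close> by a multiple of
  \<open>kap n\<close> plus one, so it has the same position. As \<open>- ln (th n)\<close> is
  \<open>mu * t_star\<close> up to a multiple of \<open>kap n\<close>, the centred threshold is
  about \<open>mu * (t_star - N)\<close>, that is \<open>- lm\<close> standard deviations.\<close>

lemma qN_tendsto:
  assumes W: "window lm \<tau>"
  shows "(\<lambda>n. 1 - qN \<tau> n) \<longlonglongrightarrow> gauss_tail lm"
proof -
  define N where "N n = \<tau> n - 2 * hh n - 1" for n
  define s where "s n = sqrt (N n * s2 n)" for n
  define y where "y n = - ln (th n) - N n * mu' n" for n
  have WN: "window lm N"
  proof (rule window_shift[OF W])
    show "\<forall>\<^sub>F n in sequentially. \<bar>real (N n) - real (\<tau> n)\<bar> <= real (4 * aa) * real (kap n) + 1"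
      using window_lo[OF W, of "4 * aa"]
    proof eventually_elim
      case (elim n)
      have "\<tau> n = N n + (4 * aa * kap n + 1)" using elim by (simp add: N_def hh_def)
      hence "real (\<tau> n) = real (N n) + (real (4 * aa) * real (kap n) + 1)" by simp
      moreover have "0 <= real (4 * aa) * real (kap n)" by simp
      moreover have "\<bar>x - z\<bar> <= g + 1" if "z = x + (g + 1)" "0 <= g" for x z g :: real using that by simp
      ultimately show ?case by blast
    qed
  qed
  have r1: "(\<lambda>n. sqrt (N n / ts n)) \<longlonglongrightarrow> 1" using tendsto_real_sqrt[OF window_ratio[OF WN]] by simp
  have s_eq: "s n = sqrt (N n / ts n) * (mu' n * ws n)" if "1 < n" for n
  proof -
    have "0 < ts n" using that mu'_bounds[of n] by (simp add: t_star_def)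
    thus ?thesis unfolding mu_ws[OF that] s_def by (simp add: real_sqrt_divide real_sqrt_mult)
  qed
  have muws: "filterlim (\<lambda>n. mu' n * ws n) at_top sequentially"
  proof (rule filterlim_at_top_mono)
    show "filterlim (\<lambda>n. ln 2 * ws n) at_top sequentially"
      by (rule filterlim_tendsto_pos_mult_at_top[OF tendsto_const _ ws_at_top]) simp
    show "\<forall>\<^sub>F n in sequentially. ln 2 * ws n <= mu' n * ws n"
      using ws_pos eventually_gt_at_top[of 0] by eventually_elim (use mu'_bounds(2) in \<open>simp add: mult_right_mono\<close>)
  qed
  have s_top: "filterlim s at_top sequentially"
  proof (rule filterlim_at_top_mono[OF filterlim_tendsto_pos_mult_at_top[OF r1 zero_less_one muws]])
    show "\<forall>\<^sub>F n in sequentially. sqrt (N n / ts n) * (mu' n * ws n) <= s n"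
      using eventually_gt_at_top[of 1] by eventually_elim (simp add: s_eq)
  qed
  have y_lim: "(\<lambda>n. y n / s n) \<longlonglongrightarrow> - lm"
  proof -
    have k0: "(\<lambda>n. 2 * aa * ln (EE n) / (mu' n * ws n)) \<longlonglongrightarrow> 0"
    proof (rule Lim_null_comparison[OF _ kap_ws[of "2 * aa" 0]])
      show "\<forall>\<^sub>F n in sequentially. norm (2 * aa * ln (EE n) / (mu' n * ws n)) <= (real (2 * aa) * real (kap n) + 0) / ws n"
        using ws_pos eventually_gt_at_top[of 0]
      proof eventually_elim
        case (elim n)
        note mb = mu'_bounds[OF elim(2)]
        have "ln (EE n) = kap n * ln 2" by (simp add: EE_def ln_realpow)
        hence "2 * aa * ln (EE n) / (mu' n * ws n) = (real (2 * aa) * kap n / ws n) * (ln 2 / mu' n)" by (simp add: mult_ac)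
        also have "\<dots> <= (real (2 * aa) * kap n / ws n) * 1"
          using mb elim by (intro mult_left_mono) (auto simp: divide_le_eq_1)
        finally have "2 * aa * ln (EE n) / (mu' n * ws n) <= (real (2 * aa) * real (kap n) + 0) / ws n" by simp
        moreover have "0 <= 2 * aa * ln (EE n) / (mu' n * ws n)" using mb elim EE_ge1[of n] by simp
        ultimately show ?case by (simp only: real_norm_def abs_of_nonneg)
      qed
    qed
    have "(\<lambda>n. (- ((real (N n) - ts n) / ws n) + 2 * aa * ln (EE n) / (mu' n * ws n)) / sqrt (N n / ts n)) \<longlonglongrightarrow> (- lm + 0) / 1"
      using WN unfolding window_def by (intro tendsto_intros k0 r1) auto
    hence l: "(\<lambda>n. (- ((real (N n) - ts n) / ws n) + 2 * aa * ln (EE n) / (mu' n * ws n)) / sqrt (N n / ts n)) \<longlonglongrightarrow> - lm" by simp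
    have ev: "\<forall>\<^sub>F n in sequentially. (- ((real (N n) - ts n) / ws n) + 2 * aa * ln (EE n) / (mu' n * ws n)) / sqrt (N n / ts n) = y n / s n"
      using ws_pos eventually_gt_at_top[of 1]
    proof eventually_elim
      case (elim n)
      have mp: "0 < mu' n" using mu'_bounds[of n] elim by simp
      have "ln (th n) = - (ln (real n) + 2 * aa * ln (EE n))"
        using elim EE_pos[of n] by (simp add: th_def ln_div ln_mult ln_realpow)
      moreover have "ln (real n) = mu' n * ts n" using mp by (simp add: t_star_def)
      ultimately have yn: "y n = mu' n * (ts n - N n) + 2 * aa * ln (EE n)" unfolding y_def by (simp add: algebra_simps)
      have "- ((real (N n) - ts n) / ws n) + 2 * aa * ln (EE n) / (mu' n * ws n) = y n / (mu' n * ws n)"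
        unfolding yn using mp elim(1) by (simp add: field_simps)
      thus ?case unfolding s_eq[OF elim(2)] by (simp add: mult.commute)
    qed
    show ?thesis by (rule Lim_transform_eventually[OF l ev])
  qed
  \<comment> \<open>The index is shifted by one because \<open>triangular_clt\<close> asks for a
    nonempty set of heads at every index.\<close>
  let ?A = "\<lambda>n. config.H (Suc n) (dm (Suc n))" and ?X = "\<lambda>n f. ln (real (dp (Suc n) (fst f))) - mu' (Suc n)"
  have C: "config (Suc n) (dp (Suc n)) (dm (Suc n)) Dmax" for n by (rule cfg) simp
  have cardA: "real (card (?A n)) = mm (Suc n)" for n unfolding config.m_def[OF C] ..
  have "(\<lambda>n. card {xs\<in>LL (?A n) (N (Suc n)). (\<Sum>x\<leftarrow>xs. ?X n x) < y (Suc n)} / real (card (?A n)) ^ N (Suc n)) \<longlonglongrightarrow> cdf std_normal_distribution (- lm)"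
  proof (rule triangular_clt[where B = "ln Dmax" and s = "\<lambda>n. s (Suc n)"])
    fix n
    show "finite (?A n)" by (simp add: config.H_def[OF C] heads_def)
    show "?A n \<noteq> {}" using config.mpos[OF C, of n] unfolding config.m_def[OF C] by auto
    show "(\<Sum>x\<in>?A n. ?X n x) = 0"
      unfolding sum_subtractf config.mu_H[OF C] by (simp add: cardA)
    show "\<bar>?X n x\<bar> <= ln Dmax" if "x \<in> ?A n" for x by (rule config.dev_bound[OF C that])
    show "(s (Suc n))\<^sup>2 * card (?A n) = N (Suc n) * (\<Sum>x\<in>?A n. (?X n x)\<^sup>2)"
      unfolding config.sigma2_H[OF C] s_def using config.sigma2_bounds(1)[OF C] by (simp add: cardA)
    show "filterlim (\<lambda>n. s (Suc n)) at_top sequentially" using s_top by (simp add: filterlim_sequentially_Suc)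
    show "(\<lambda>n. y (Suc n) / s (Suc n)) \<longlonglongrightarrow> - lm" by (rule LIMSEQ_Suc[OF y_lim])
  qed
  moreover have "1 - qN \<tau> (Suc n) = card {xs\<in>LL (?A n) (N (Suc n)). (\<Sum>x\<leftarrow>xs. ?X n x) < y (Suc n)} / real (card (?A n)) ^ N (Suc n)" for n
    unfolding N_def[symmetric] y_def by (rule config.qq_compl[OF C]) (simp add: th_def EE_pos)
  ultimately have "(\<lambda>n. 1 - qN \<tau> (Suc n)) \<longlonglongrightarrow> gauss_tail lm" unfolding gauss_tail_cdf by simp
  thus ?thesis by (rule LIMSEQ_imp_Suc)
qed

text \<open>The summand \<open>2 * aa\<close> offsets \<open>hh n\<close> in
  \<open>s1 n - hh n\<close>. The rest lets \<open>2 ^ (s1 n - hh n)\<close> pay for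
  \<open>Dmax ^ (2 * ss n + hh n)\<close>, for the \<open>EE^4\<close> in \<open>V\<close> and for
  the \<open>EE^(2 * aa)\<close> in \<open>1 / th n\<close>, with one factor \<open>EE\<close> to
  spare.\<close>

definition bb :: nat where "bb = 2 * aa + (Dmax * (4 + 2 * aa) + 5 + 2 * aa)"
definition s1 :: "nat => nat" where "s1 n = bb * kap n"

lemma loss_small:
  assumes \<gamma>: "0 < \<gamma>"
  shows "\<forall>\<^sub>F n in sequentially. sqrt ((EE n ^ 4 / n) / ((1 / real Dmax) ^ (ss n + Suc (ss n) + hh n + 1) * (th n * 2 ^ (s1 n - hh n)))) <= \<gamma>"
proof -
  have "0 < \<gamma>\<^sup>2" using \<gamma> by simp
  from EE_ev[OF this, of "(real Dmax)\<^sup>2"] show ?thesis using eventually_gt_at_top[of 0]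
  proof eventually_elim
    case (elim n)
    let ?e = "EE n" and ?D = "real Dmax"
    have e: "0 < ?e" by (rule EE_pos)
    have n: "0 < real n" using elim by simp
    have D0: "0 < ?D" using Dmax2 by simp
    define x where "x = ?D ^ (2 * ss n + hh n)"
    have "?D <= 2 ^ Dmax" using of_nat_less_two_power[of Dmax, where ?'a = real] by simp
    hence "x <= (2 ^ Dmax) ^ (2 * ss n + hh n)" unfolding x_def by (rule power_mono) simp
    also have "(2 ^ Dmax :: real) ^ (2 * ss n + hh n) = ?e ^ (Dmax * (4 + 2 * aa))"
      unfolding EE_def ss_def hh_def power_mult[symmetric] by (rule arg_cong[of _ _ "\<lambda>k. 2 ^ k"]) (simp add: algebra_simps)
    finally have x: "x <= ?e ^ (Dmax * (4 + 2 * aa))" .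
    have p1: "(1 / ?D) ^ (ss n + Suc (ss n) + hh n + 1) = 1 / (?D\<^sup>2 * x)"
    proof -
      have "ss n + Suc (ss n) + hh n + 1 = 2 + (2 * ss n + hh n)" by simp
      thus ?thesis unfolding x_def by (simp only: power_add power_one_over) simp
    qed
    have "s1 n - hh n = (Dmax * (4 + 2 * aa) + 5 + 2 * aa) * kap n"
      unfolding s1_def hh_def bb_def by (simp add: algebra_simps)
    hence p2: "2 ^ (s1 n - hh n) = ?e ^ (Dmax * (4 + 2 * aa)) * (?e * ?e ^ 4 * ?e ^ (2 * aa))"
    proof -
      assume a: "s1 n - hh n = (Dmax * (4 + 2 * aa) + 5 + 2 * aa) * kap n"
      have "(2::real) ^ (s1 n - hh n) = ?e ^ (Dmax * (4 + 2 * aa) + 5 + 2 * aa)"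
        unfolding a EE_def power_mult[symmetric] by (simp only: mult.commute)
      also have "\<dots> = ?e ^ (Dmax * (4 + 2 * aa)) * (?e ^ 5 * ?e ^ (2 * aa))" by (simp only: power_add mult.assoc)
      also have "?e ^ 5 = ?e * ?e ^ 4" by (simp flip: power_Suc)
      finally show ?thesis .
    qed
    have alg: "(f / N) / (1 / (d * x) * (1 / (N * h) * (g * (E * f * h)))) = d * (x / g) / E"
      if "0 < f" "0 < N" "0 < d" "0 < x" "0 < h" "0 < g" "0 < E" for f N d x h g E :: real
      using that by (simp add: field_simps)
    have "(?e ^ 4 / n) / ((1 / ?D) ^ (ss n + Suc (ss n) + hh n + 1) * (th n * 2 ^ (s1 n - hh n))) = ?D\<^sup>2 * (x / ?e ^ (Dmax * (4 + 2 * aa))) / ?e"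
      unfolding p1 p2 th_def by (rule alg) (use e n D0 in \<open>simp_all add: x_def\<close>)
    also have "\<dots> <= ?D\<^sup>2 * 1 / ?e"
      using x e by (intro divide_right_mono mult_left_mono) (auto simp: divide_le_eq_1)
    also have "\<dots> <= \<gamma>\<^sup>2" using elim(1) by simp
    finally show ?case by (rule real_le_lsqrt[OF less_imp_le[OF \<gamma>]])
  qed
qed

lemma window_regular_whp:
  assumes W: "window l \<tau>" and \<gamma>: "0 < \<gamma>"
  shows "(\<lambda>n. card {w\<in>EV n. \<not> regular \<tau> \<gamma> \<gamma> n w} / real (card (EV n))) \<longlonglongrightarrow> 0"
    "\<exists>p. \<forall>\<^sub>F n in sequentially. walk_config n (dp n) (dm n) Dmax (\<tau> n) (hh n) (\<tau> n - 2 * hh n - 1) (2 * \<tau> n) (p n) (th n)"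
proof -
  have lo: "\<forall>\<^sub>F n in sequentially. 2 * hh n + 2 <= \<tau> n"
    using window_lo[OF W, of "4 * aa"] by eventually_elim (simp add: hh_def)
  have c: "(1::real) <= 4" by simp
  show "(\<lambda>n. card {w\<in>EV n. \<not> regular \<tau> \<gamma> \<gamma> n w} / real (card (EV n))) \<longlonglongrightarrow> 0"
    by (rule regular_whp[OF lo window_hi[OF W] c \<gamma> \<gamma>])
  show "\<exists>p. \<forall>\<^sub>F n in sequentially. walk_config n (dp n) (dm n) Dmax (\<tau> n) (hh n) (\<tau> n - 2 * hh n - 1) (2 * \<tau> n) (p n) (th n)"
    using wcfg[OF lo window_hi[OF W] c] by blast
qed

lemma window_floor: "window \<Lambda> (\<lambda>n. nat \<lfloor>ts n + \<Lambda> * ws n\<rfloor>)"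
proof -
  have "(\<lambda>n. 1 + \<Lambda> * (ws n / ts n)) \<longlonglongrightarrow> 1 + \<Lambda> * 0" by (intro tendsto_intros ws_ts)
  hence "\<forall>\<^sub>F n in sequentially. 0 < 1 + \<Lambda> * (ws n / ts n)" by (rule order_tendstoD(1)) simp
  hence ev: "\<forall>\<^sub>F n in sequentially. norm ((real (nat \<lfloor>ts n + \<Lambda> * ws n\<rfloor>) - ts n) / ws n - \<Lambda>) <= (0 * real (kap n) + 1) / ws n"
    using ws_pos eventually_gt_at_top[of 1]
  proof eventually_elim
    case (elim n)
    have tp: "0 < ts n" using elim mu'_bounds[of n] by (simp add: t_star_def)
    define z where "z = ts n + \<Lambda> * ws n"
    have "z = ts n * (1 + \<Lambda> * (ws n / ts n))" using tp by (simp add: z_def field_simps)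
    hence z0: "0 < z" using tp elim(1) by simp
    hence b: "\<bar>real (nat \<lfloor>z\<rfloor>) - z\<bar> <= 1" by linarith
    have "(real (nat \<lfloor>z\<rfloor>) - ts n) / ws n - \<Lambda> = (real (nat \<lfloor>z\<rfloor>) - z) / ws n" using elim(2) by (simp add: z_def field_simps)
    thus ?case using b elim(2) unfolding z_def[symmetric] by (simp add: divide_right_mono)
  qed
  have "(\<lambda>n. (real (nat \<lfloor>ts n + \<Lambda> * ws n\<rfloor>) - ts n) / ws n - \<Lambda>) \<longlonglongrightarrow> 0"
    by (rule Lim_null_comparison[OF ev kap_ws])
  thus ?thesis unfolding window_def by (rule LIM_zero_cancel)
qed

text \<open>Three times are used. \<open>\<tau>1\<close> lies so far to the right in the window that
  the walk is close to \<open>\<nu>\<close>, which identifies \<open>pi_star\<close> approximately.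
  \<open>\<tau>2\<close> plus the preliminary steps is \<open>t\<close>, for the upper bound.
  \<open>\<tau>3\<close> is later by \<open>s1\<close>, so that stopping \<open>s1\<close> steps
  early ends at \<open>t\<close> again, for the lower bound. The same \<open>\<nu>\<close> serves
  all three, since it depends on \<open>hh n\<close> and not on the time.\<close>

lemma tv_whp:
  assumes Wt: "window lm t" and \<gamma>: "0 < \<gamma>" "\<gamma> <= 1 / 40"
  shows "(\<lambda>n. card {w\<in>EV n. \<not> (\<forall>i<n. \<bar>tv_dist n (dp n) w i (t n) - gauss_tail lm\<bar> <= 10 * \<gamma>)} / real (card (EV n))) \<longlonglongrightarrow> 0"
proof -
  have "\<forall>\<^sub>F x in at_top. gauss_tail x < \<gamma>" by (rule order_tendstoD(2)[OF gauss_tail_tendsto_0 \<gamma>(1)])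
  then obtain \<Lambda> where \<Lambda>: "gauss_tail \<Lambda> < \<gamma>" using eventually_happens'[OF trivial_limit_at_top_linorder] by blast
  define \<tau>1 where "\<tau>1 n = nat \<lfloor>ts n + \<Lambda> * ws n\<rfloor>" for n
  define \<tau>2 where "\<tau>2 n = t n - (2 * ss n + 1)" for n
  define \<tau>3 where "\<tau>3 n = t n + s1 n - (2 * ss n + 1)" for n
  have lot: "\<forall>\<^sub>F n in sequentially. 4 * kap n + 2 <= t n" by (rule window_lo[OF Wt])
  have W1: "window \<Lambda> \<tau>1" unfolding \<tau>1_def by (rule window_floor)
  have sh: "\<bar>z - x\<bar> <= g + 1" if "x = z + (g + 1)" "0 <= g" for x z g :: real using that by simp
  have W2: "window lm \<tau>2"
  proof (rule window_shift[OF Wt])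
    show "\<forall>\<^sub>F n in sequentially. \<bar>real (\<tau>2 n) - real (t n)\<bar> <= 4 * real (kap n) + 1" using lot
    proof eventually_elim
      case (elim n)
      have "t n = \<tau>2 n + (4 * kap n + 1)" using elim by (simp add: \<tau>2_def ss_def)
      hence "real (t n) = real (\<tau>2 n) + (4 * real (kap n) + 1)" by simp
      thus ?case by (rule sh) simp
    qed
  qed
  have W3: "window lm \<tau>3"
  proof (rule window_shift[OF W2])
    show "\<forall>\<^sub>F n in sequentially. \<bar>real (\<tau>3 n) - real (\<tau>2 n)\<bar> <= real bb * real (kap n) + 0" using lot
    proof eventually_elim
      case (elim n)
      have "\<tau>3 n = \<tau>2 n + bb * kap n" using elim by (simp add: \<tau>2_def \<tau>3_def ss_def s1_def)
      thus ?case by simp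
    qed
  qed
  note R1 = window_regular_whp[OF W1 \<gamma>(1)] and R2 = window_regular_whp[OF W2 \<gamma>(1)] and R3 = window_regular_whp[OF W3 \<gamma>(1)]
  obtain p1 where wc1: "\<forall>\<^sub>F n in sequentially. walk_config n (dp n) (dm n) Dmax (\<tau>1 n) (hh n) (\<tau>1 n - 2 * hh n - 1) (2 * \<tau>1 n) (p1 n) (th n)" using R1(2) by blast
  obtain p2 where wc2: "\<forall>\<^sub>F n in sequentially. walk_config n (dp n) (dm n) Dmax (\<tau>2 n) (hh n) (\<tau>2 n - 2 * hh n - 1) (2 * \<tau>2 n) (p2 n) (th n)" using R2(2) by blast
  obtain p3 where wc3: "\<forall>\<^sub>F n in sequentially. walk_config n (dp n) (dm n) Dmax (\<tau>3 n) (hh n) (\<tau>3 n - 2 * hh n - 1) (2 * \<tau>3 n) (p3 n) (th n)" using R3(2) by blast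
  have q1: "\<forall>\<^sub>F n in sequentially. 1 - qN \<tau>1 n < \<gamma>" by (rule order_tendstoD(2)[OF qN_tendsto[OF W1] \<Lambda>])
  have q2: "\<forall>\<^sub>F n in sequentially. 1 - qN \<tau>2 n < gauss_tail lm + \<gamma>"
    by (rule order_tendstoD(2)[OF qN_tendsto[OF W2]]) (use \<gamma> in simp)
  have q3: "\<forall>\<^sub>F n in sequentially. gauss_tail lm - \<gamma> < 1 - qN \<tau>3 n"
    by (rule order_tendstoD(1)[OF qN_tendsto[OF W3]]) (use \<gamma> in simp)
  have sub: "\<forall>\<^sub>F n in sequentially. \<forall>w\<in>EV n. regular \<tau>1 \<gamma> \<gamma> n w \<longrightarrow> regular \<tau>2 \<gamma> \<gamma> n w \<longrightarrow> regular \<tau>3 \<gamma> \<gamma> n w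
      \<longrightarrow> (\<forall>i<n. \<bar>tv_dist n (dp n) w i (t n) - gauss_tail lm\<bar> <= 10 * \<gamma>)"
    using wc1 wc2 wc3 q1 q2 q3 loss_small[OF \<gamma>(1)] lot window_lo[OF W3, of "bb + 4 * aa"] EE_ev[OF \<gamma>(1), of 1] eventually_gt_at_top[of 0]
  proof eventually_elim
    case (elim n)
    note wc = elim(1-3)
    interpret config n "dp n" "dm n" Dmax by (rule cfg[OF elim(11)])
    show ?case
    proof (intro ballI impI allI)
      fix w i assume w: "w \<in> EV n" and r1: "regular \<tau>1 \<gamma> \<gamma> n w" and r2: "regular \<tau>2 \<gamma> \<gamma> n w" and r3: "regular \<tau>3 \<gamma> \<gamma> n w" and i: "i < n"
      note u1 = conjunct1[OF r1[unfolded regular_def]] and u2 = conjunct1[OF r2[unfolded regular_def]] and u3 = r3[unfolded regular_def]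
      let ?S = "ss n + Suc (ss n)" and ?\<nu> = "nu w (hh n)" and ?h = "(1/2 :: real) ^ ss n"
      have g0: "0 <= \<gamma>" using \<gamma> by simp
      have hs: "?h <= \<gamma>"
      proof -
        have "2 ^ ss n = EE n * EE n" by (simp add: ss_def EE_def mult_2 power_add)
        hence "?h = 1 / (EE n * EE n)" by (simp add: power_one_over)
        also have "\<dots> <= 1 / EE n" using EE_ge1[of n] by (simp add: field_simps)
        finally show ?thesis using elim(10) by linarith
      qed
      \<comment> \<open>Four errors of at most \<open>\<gamma>\<close>: \<open>1 - q\<close>,
        \<open>\<eta>\<close>, \<open>2^-s\<close> and \<open>\<epsilon>\<close>.\<close>
      have m1: "(1/2) * (\<Sum>j<n. \<bar>PP w (?S + \<tau>1 n) k j - ?\<nu> j\<bar>) <= 5 * \<gamma>" if "k < n" for k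
        using walk_config.Uniform_upper[OF wc(1) w u1 that g0] elim(4) hs g0 by linarith
      have r: "5 * \<gamma> <= 1 / 4" "0 <= 5 * \<gamma>" using \<gamma> by simp_all
      obtain \<pi> where \<pi>: "pi_star n (trans (dp n) w) = \<pi>" "(\<Sum>j<n. \<pi> j) = 1" "\<And>j. 0 <= \<pi> j"
        "\<And>r j. j < n ==> (\<Sum>i<n. \<pi> i * PP w r i j) = \<pi> j"
        by (rule unique_invariant[OF w m1 r]) auto
      have pn: "(1/2) * (\<Sum>j<n. \<bar>\<pi> j - ?\<nu> j\<bar>) <= 5 * \<gamma>" by (rule tv_invariant_le[OF w m1 \<pi>(2,3,4)])
      have t2: "t n = ?S + \<tau>2 n" using elim(8) by (simp add: \<tau>2_def ss_def)
      have t3: "t n = ?S + (\<tau>3 n - s1 n)" using elim(8) by (simp add: \<tau>3_def ss_def)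
      have tv: "tv_dist n (dp n) w i (t n) = (1/2) * (\<Sum>j<n. \<bar>PP w (t n) i j - \<pi> j\<bar>)"
        unfolding tv_dist_def \<pi>(1) matpow_PP[OF w i] ..
      have "(\<Sum>j<n. \<bar>PP w (t n) i j - \<pi> j\<bar>) <= (\<Sum>j<n. \<bar>PP w (t n) i j - ?\<nu> j\<bar> + \<bar>\<pi> j - ?\<nu> j\<bar>)"
        by (rule sum_mono) linarith
      hence "tv_dist n (dp n) w i (t n) <= (1/2) * (\<Sum>j<n. \<bar>PP w (t n) i j - ?\<nu> j\<bar>) + (1/2) * (\<Sum>j<n. \<bar>\<pi> j - ?\<nu> j\<bar>)"
        unfolding tv by (simp add: sum.distrib)
      hence up: "tv_dist n (dp n) w i (t n) <= gauss_tail lm + 10 * \<gamma>"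
        using walk_config.Uniform_upper[OF wc(2) w u2 i g0] elim(5) hs pn g0 unfolding t2[symmetric] by linarith
      have k: "(bb + 4 * aa) * kap n + 2 <= \<tau>3 n" by (rule elim(9))
      have h1: "hh n <= s1 n" by (simp add: hh_def s1_def bb_def mult_right_mono)
      have h2: "s1 n <= hh n + (\<tau>3 n - 2 * hh n - 1)" using k by (simp add: hh_def s1_def algebra_simps)
      have th0: "0 < th n" using elim(11) EE_pos[of n] by (simp add: th_def)
      have "1 - qN \<tau>3 n - \<gamma> - (?h + \<gamma>) - 5 * \<gamma> - sqrt ((EE n ^ 4 / n) / ((1 / real Dmax) ^ (?S + hh n + 1) * (th n * 2 ^ (s1 n - hh n)))) <= tv_dist n (dp n) w i (t n)"
        unfolding tv unfolding t3 by (rule walk_config.Uniform_lower[OF wc(3) w conjunct1[OF u3] i g0 conjunct2[OF u3] h1 h2 th0 \<pi>(2) pn refl])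
      \<comment> \<open>The budget is met exactly on this side: \<open>5 * \<gamma>\<close> from
        replacing \<open>\<nu>\<close> by \<open>\<pi>\<close>, and \<open>\<gamma>\<close> each for
        the limit of \<open>1 - q\<close>, \<open>\<eta>\<close>, \<open>2^-s\<close>,
        \<open>\<epsilon>\<close> and the square root.\<close>
      hence "gauss_tail lm - 10 * \<gamma> <= tv_dist n (dp n) w i (t n)" using elim(6,7) hs g0 by linarith
      thus "\<bar>tv_dist n (dp n) w i (t n) - gauss_tail lm\<bar> <= 10 * \<gamma>" using up by (simp add: abs_le_iff)
    qed
  qed
  let ?R = "\<lambda>\<tau> n. {w\<in>EV n. \<not> regular \<tau> \<gamma> \<gamma> n w}"
  have lim: "(\<lambda>n. card (?R \<tau>1 n) / real (card (EV n)) + card (?R \<tau>2 n) / real (card (EV n)) + card (?R \<tau>3 n) / real (card (EV n))) \<longlonglongrightarrow> 0"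
    using tendsto_add[OF tendsto_add[OF R1(1) R2(1)] R3(1)] by simp
  show ?thesis
  proof (rule Lim_null_comparison[OF _ lim])
    show "\<forall>\<^sub>F n in sequentially. norm (card {w\<in>EV n. \<not> (\<forall>i<n. \<bar>tv_dist n (dp n) w i (t n) - gauss_tail lm\<bar> <= 10 * \<gamma>)} / real (card (EV n)))
      <= card (?R \<tau>1 n) / real (card (EV n)) + card (?R \<tau>2 n) / real (card (EV n)) + card (?R \<tau>3 n) / real (card (EV n))"
      using sub eventually_gt_at_top[of 0]
    proof eventually_elim
      case (elim n)
      let ?B = "{w\<in>EV n. \<not> (\<forall>i<n. \<bar>tv_dist n (dp n) w i (t n) - gauss_tail lm\<bar> <= 10 * \<gamma>)}"
      have fin: "finite (EV n)" by (rule config.finite_envs[OF cfg[OF elim(2)]])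
      have "card ?B <= card (?R \<tau>1 n \<union> ?R \<tau>2 n \<union> ?R \<tau>3 n)"
      proof (rule card_mono)
        show "?B \<subseteq> ?R \<tau>1 n \<union> ?R \<tau>2 n \<union> ?R \<tau>3 n" using elim(1) by blast
        show "finite (?R \<tau>1 n \<union> ?R \<tau>2 n \<union> ?R \<tau>3 n)" by (rule finite_subset[OF _ fin]) blast
      qed
      also have "\<dots> <= card (?R \<tau>1 n) + card (?R \<tau>2 n) + card (?R \<tau>3 n)"
        by (rule order_trans[OF card_Un_le add_right_mono[OF card_Un_le]])
      finally have "real (card ?B) <= real (card (?R \<tau>1 n) + card (?R \<tau>2 n) + card (?R \<tau>3 n))" by (simp only: of_nat_le_iff)
      hence "real (card ?B) / card (EV n) <= real (card (?R \<tau>1 n) + card (?R \<tau>2 n) + card (?R \<tau>3 n)) / card (EV n)"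
        by (rule divide_right_mono) simp
      thus ?case by (simp add: add_divide_distrib)
    qed
  qed
qed

end

end

theorem theorem2:
  fixes dp dm :: "nat \<Rightarrow> nat \<Rightarrow> nat"
    and Dmax :: nat
    and lam :: real
    and t :: "nat \<Rightarrow> nat"
  assumes sums_eq: "\<And>n. (\<Sum>i<n. dm n i) = (\<Sum>i<n. dp n i)"
    and min_deg: "\<And>n i. i < n \<Longrightarrow> 2 \<le> dp n i \<and> 2 \<le> dm n i"
    and max_deg: "\<And>n i. i < n \<Longrightarrow> dp n i \<le> Dmax \<and> dm n i \<le> Dmax"
    and var_hyp: "filterlim (\<lambda>n. sigma2 n (dp n) (dm n) * ln (real n) / (ln (ln (real n)))^2)
                     at_top sequentially"
    and t_seq: "(\<lambda>n. (real (t n) - t_star n (dp n) (dm n) - lam * w_star n (dp n) (dm n))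
                     / w_star n (dp n) (dm n)) \<longlonglongrightarrow> 0"
  shows "\<forall>\<epsilon>>0. (\<lambda>n. measure_pmf.prob (env_pmf n (dp n) (dm n))
             {\<omega>. Max ((\<lambda>i. \<bar>tv_dist n (dp n) \<omega> i (t n) - gauss_tail lam\<bar>) ` {..<n}) > \<epsilon>})
           \<longlonglongrightarrow> 0"
proof (intro allI impI)
  fix \<epsilon> :: real assume \<epsilon>: "0 < \<epsilon>"
  interpret degree_seq dp dm Dmax using sums_eq min_deg max_deg by unfold_locales auto
  have ev: "\<forall>\<^sub>F n in sequentially. (real (t n) - ts n - lam * ws n) / ws n + lam = (real (t n) - ts n) / ws n"
    using ws_pos[OF var_hyp] by eventually_elim (simp add: field_simps)
  have "(\<lambda>n. (real (t n) - ts n) / ws n) \<longlonglongrightarrow> lam"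
    by (rule Lim_transform_eventually[OF _ ev]) (use tendsto_add[OF t_seq tendsto_const[of lam]] in simp)
  hence W: "window lam t" by (simp only: window_def[OF var_hyp])
  \<comment> \<open>\<open>\<epsilon> / 10\<close> matches the error \<open>10 * \<gamma>\<close> of
    \<open>tv_whp\<close>; the cap \<open>1 / 40\<close> keeps \<open>5 * \<gamma>\<close> below the
    contraction threshold \<open>1 / 4\<close> there.\<close>
  define \<gamma> where "\<gamma> = min (\<epsilon> / 10) (1 / 40)"
  have \<gamma>: "0 < \<gamma>" "\<gamma> <= 1 / 40" "10 * \<gamma> <= \<epsilon>" using \<epsilon> by (auto simp: \<gamma>_def min_def)
  let ?B = "\<lambda>n. {w\<in>EV n. \<not> (\<forall>i<n. \<bar>tv_dist n (dp n) w i (t n) - gauss_tail lam\<bar> <= 10 * \<gamma>)}"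
  let ?P = "\<lambda>n. {\<omega>. Max ((\<lambda>i. \<bar>tv_dist n (dp n) \<omega> i (t n) - gauss_tail lam\<bar>) ` {..<n}) > \<epsilon>}"
  show "(\<lambda>n. measure_pmf.prob (env_pmf n (dp n) (dm n)) (?P n)) \<longlonglongrightarrow> 0"
  proof (rule Lim_null_comparison[OF _ tv_whp[OF var_hyp W \<gamma>(1,2)]])
    show "\<forall>\<^sub>F n in sequentially. norm (measure_pmf.prob (env_pmf n (dp n) (dm n)) (?P n)) <= card (?B n) / real (card (EV n))"
      using eventually_gt_at_top[of 0]
    proof eventually_elim
      case (elim n)
      note C = cfg[OF elim]
      have fin: "finite (EV n)" by (rule config.finite_envs[OF C])
      have eq: "measure_pmf.prob (env_pmf n (dp n) (dm n)) (?P n) = card (EV n \<inter> ?P n) / card (EV n)"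
        unfolding env_pmf_def by (rule measure_pmf_of_set[OF config.envs_ne[OF C] fin])
      have "card (EV n \<inter> ?P n) <= card (?B n)"
      proof (rule card_mono)
        show "finite (?B n)" by (rule finite_subset[OF _ fin]) blast
        show "EV n \<inter> ?P n \<subseteq> ?B n"
        proof
          fix w assume w: "w \<in> EV n \<inter> ?P n"
          have "\<not> (\<forall>i<n. \<bar>tv_dist n (dp n) w i (t n) - gauss_tail lam\<bar> <= 10 * \<gamma>)"
          proof
            assume a: "\<forall>i<n. \<bar>tv_dist n (dp n) w i (t n) - gauss_tail lam\<bar> <= 10 * \<gamma>"
            have "Max ((\<lambda>i. \<bar>tv_dist n (dp n) w i (t n) - gauss_tail lam\<bar>) ` {..<n}) <= \<epsilon>"
              by (rule Max.boundedI) (use a \<gamma>(3) elim in \<open>auto intro: order_trans\<close>)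
            thus False using w by simp
          qed
          thus "w \<in> ?B n" using w by blast
        qed
      qed
      hence "real (card (EV n \<inter> ?P n)) / card (EV n) <= card (?B n) / real (card (EV n))"
        by (intro divide_right_mono) simp_all
      thus ?case unfolding eq by simp
    qed
  qed
qed

end
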